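(* Let $\mathbf{H}_n=(x_{jk})_{1\le j,k\le n}$, $n\ge 1$, be random quaternion self-dual Hermitian matrices, where $x_{jk}=a_{jk}\mathbf{e}+b_{jk}\mathbf{i}+c_{jk}\mathbf{j}+d_{jk}\mathbf{k}$ with $x_{kj}=\bar{x}_{jk}$ and $x_{jj}=a_{jj}\mathbf{e}$, and where the entries on the diagonal are iid, the entries above the diagonal are iid quaternion random variables, and all entries on and above the diagonal are independent. Regard $\mathbf{H}_n$ as a $2n\times 2n$ complex Hermitian matrix and put $\mathbf{Q}_n=\frac{1}{\sqrt n}\mathbf{H}_n$. Let $\xi\in\mathbb{R}$. Then the largest eigenvalue of $\mathbf{Q}_n$ tends to $\xi$ almost surely as $n\to\infty$ if and only if all of the following conditions hold: (i) $\mathrm{E}\|x_{11}^+\|^2<\infty$, i.e. $\mathrm{E}\big[(a_{11}^+)^2\big]<\infty$, where $x^+=\max(x,0)$; (ii) $\mathrm{E}a_{12}\le 0$ and $\mathrm{E}b_{12}=\mathrm{E}c_{12}=\mathrm{E}d_{12}=0$; (iii) $\mathrm{E}\|x_{12}-\mathrm{E}x_{12}\|^2=\sigma^2$ and $\xi=2\sigma$, where $\sigma\ge 0$; (iv) $\mathrm{E}\|x_{12}\|^4<\infty$.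
   Context: Quaternions are represented as $2\times2$ complex matrices: with $i=\sqrt{-1}$, $\mathbf{e}=\begin{pmatrix}1&0\\0&1\end{pmatrix}$, $\mathbf{i}=\begin{pmatrix}i&0\\0&-i\end{pmatrix}$, $\mathbf{j}=\begin{pmatrix}0&1\\-1&0\end{pmatrix}$, $\mathbf{k}=\begin{pmatrix}0&i\\i&0\end{pmatrix}$. A quaternion is $q=a\mathbf{e}+b\mathbf{i}+c\mathbf{j}+d\mathbf{k}$ with $a,b,c,d\in\mathbb{R}$; its conjugate is $\bar q=a\mathbf{e}-b\mathbf{i}-c\mathbf{j}-d\mathbf{k}$ (the conjugate transpose of the $2\times 2$ matrix) and its norm is $\|q\|=\sqrt{a^2+b^2+c^2+d^2}$. Expectation of a quaternion random variable is taken componentwise. An $n\times n$ quaternion self-dual Hermitian matrix $\mathbf{H}_n=(x_{jk})$ has quaternion entries with $x_{jk}=\bar x_{kj}$; in particular $x_{jj}=a_{jj}\mathbf{e}$ with $a_{jj}$ real. Replacing each entry by its $2\times2$ complex matrix makes $\mathbf{H}_n$ a $2n\times2n$ complex Hermitian matrix, and eigenvalues are taken in the ordinary sense for this matrix. For all $n$ the matrices are formed from one infinite array $(x_{jk})_{j,k\ge1}$ on a common probability space: $\mathbf{H}_n$ is its upper-left $n\times n$ corner. The law of the diagonal entries $x_{jj}$ may differ from that of the off-diagonal entries $x_{jk}$, $j<k$. *)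

theory Defs
  imports "HOL-Probability.Probability" "Jordan_Normal_Form.Char_Poly"
begin

text \<open>
  A quaternion is given by its real coordinates with respect to the four \<open>2 \<times> 2\<close> complex
  matrices below. The product type carries the Borel sigma-algebra in which
  quaternion random variables take their values.
\<close>

type_synonym quaternion = "real \<times> real \<times> real \<times> real"

fun re_part :: "quaternion \<Rightarrow> real" where "re_part (a, b, c, d) = a"
fun i_part :: "quaternion \<Rightarrow> real" where "i_part (a, b, c, d) = b"
fun j_part :: "quaternion \<Rightarrow> real" where "j_part (a, b, c, d) = c"
fun k_part :: "quaternion \<Rightarrow> real" where "k_part (a, b, c, d) = d"

definition e_mat :: "complex mat" where "e_mat = mat_of_rows_list 2 [[1, 0], [0, 1]]"
definition i_mat :: "complex mat" where "i_mat = mat_of_rows_list 2 [[\<i>, 0], [0, - \<i>]]"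
definition j_mat :: "complex mat" where "j_mat = mat_of_rows_list 2 [[0, 1], [- 1, 0]]"
definition k_mat :: "complex mat" where "k_mat = mat_of_rows_list 2 [[0, \<i>], [\<i>, 0]]"

fun quat_mat :: "quaternion \<Rightarrow> complex mat" where
  "quat_mat (a, b, c, d) =
     complex_of_real a \<cdot>\<^sub>m e_mat + complex_of_real b \<cdot>\<^sub>m i_mat
     + complex_of_real c \<cdot>\<^sub>m j_mat + complex_of_real d \<cdot>\<^sub>m k_mat"

fun quat_conj :: "quaternion \<Rightarrow> quaternion" where
  "quat_conj (a, b, c, d) = (a, - b, - c, - d)"

fun quat_norm :: "quaternion \<Rightarrow> real" where
  "quat_norm (a, b, c, d) = sqrt (a\<^sup>2 + b\<^sup>2 + c\<^sup>2 + d\<^sup>2)"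

definition quat_expectation :: "'w measure \<Rightarrow> ('w \<Rightarrow> quaternion) \<Rightarrow> quaternion" where
  "quat_expectation M X =
     (integral\<^sup>L M (\<lambda>\<omega>. re_part (X \<omega>)), integral\<^sup>L M (\<lambda>\<omega>. i_part (X \<omega>)),
      integral\<^sup>L M (\<lambda>\<omega>. j_part (X \<omega>)), integral\<^sup>L M (\<lambda>\<omega>. k_part (X \<omega>)))"

text \<open>
  The array \<open>x\<close> is indexed from 1, whereas matrix rows and columns are indexed from 0: row \<open>r\<close>
  of the \<open>2n \<times> 2n\<close> matrix is row \<open>r mod 2\<close> of the blocks with first index \<open>r div 2 + 1\<close>.
\<close>

definition quat_block_mat :: "(nat \<Rightarrow> nat \<Rightarrow> quaternion) \<Rightarrow> nat \<Rightarrow> complex mat" where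
  "quat_block_mat x n =
     mat (2 * n) (2 * n)
       (\<lambda>(r, s). quat_mat (x (r div 2 + 1) (s div 2 + 1)) $$ (r mod 2, s mod 2))"

text \<open>
  Intended for Hermitian matrices of positive dimension: all their eigenvalues are real, so the
  set below is finite, nonempty, and consists of all the eigenvalues.
\<close>

definition largest_eigenvalue :: "complex mat \<Rightarrow> real" where
  "largest_eigenvalue A = Max {t :: real. eigenvalue A (complex_of_real t)}"

lemma quat_mat_index:
  "dim_row (quat_mat q) = 2" "dim_col (quat_mat q) = 2"
  "quat_mat q $$ (0, 0) = Complex (re_part q) (i_part q)"
  "quat_mat q $$ (0, 1) = Complex (j_part q) (k_part q)"
  "quat_mat q $$ (1, 0) = Complex (- j_part q) (k_part q)"
  "quat_mat q $$ (1, 1) = Complex (re_part q) (- i_part q)"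
  by (cases q; simp add: e_mat_def i_mat_def j_mat_def k_mat_def mat_of_rows_list_def
      complex_eq_iff)+

lemma quat_mat_conj:
  assumes "r < 2" "s < 2"
  shows "quat_mat (quat_conj q) $$ (r, s) = cnj (quat_mat q $$ (s, r))"
proof -
  have "r = 0 \<or> r = 1" "s = 0 \<or> s = 1" using assms by auto
  moreover have "re_part (quat_conj q) = re_part q" "i_part (quat_conj q) = - i_part q"
    "j_part (quat_conj q) = - j_part q" "k_part (quat_conj q) = - k_part q"
    by (cases q; simp)+
  ultimately show ?thesis
    by (elim disjE) (simp_all only: quat_mat_index complex_cnj minus_minus)
qed

lemma quat_block_mat_hermitian:
  assumes "\<And>j k. 1 \<le> j \<Longrightarrow> 1 \<le> k \<Longrightarrow> x k j = quat_conj (x j k)"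
    and "r < 2 * n" "s < 2 * n"
  shows "quat_block_mat x n $$ (s, r) = cnj (quat_block_mat x n $$ (r, s))"
proof -
  have "x (s div 2 + 1) (r div 2 + 1) = quat_conj (x (r div 2 + 1) (s div 2 + 1))"
    by (rule assms(1)) auto
  then show ?thesis
    using assms(2,3) by (simp add: quat_block_mat_def quat_mat_conj)
qed

end

theory Submission
  imports Defs "HOL-Real_Asymp.Real_Asymp"
begin

text \<open>
  The largest eigenvalue is \<open>1 / \<sqrt>n\<close> times the maximum of the Rayleigh quotients of the quaternion matrix.

  For the upper bound, the entries above the diagonal are centred and truncated at \<open>k powr (7/16)\<close>, where \<open>k\<close> is
  the larger index; the few larger entries and the shift of the mean are negligible in operator norm. The expected
  trace of the power of order about \<open>n powr (1/64)\<close> is a sum over closed walks, bounded by a product of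
  weights over the steps of the walk. A nonpositive mean and the negative part of the diagonal can only
  decrease the largest eigenvalue.

  For the lower bound, the normalised traces of the powers converge along \<open>n = k\<^sup>2\<close> to the numbers of Dyck paths.
  Hence the vectors \<open>\<Sum>i<m. U i (A) e\<close>, for \<open>e\<close> in the standard basis and \<open>U i\<close> the Chebyshev polynomials
  of the second kind, have on average Rayleigh quotients close to \<open>2 \<sigma> \<sqrt>n\<close>. Setting them to zero at the few indices
  with a very negative diagonal entry shows that the diagonal does not matter; the rank one mean is negligible as well.

  Conversely, vectors with one or two nonzero components show that almost surely only finitely many
  diagonal entries exceed a multiple of \<open>\<sqrt>n\<close>, and likewise off-diagonal entries with not too negative
  diagonal neighbours. The converse of the Borel-Cantelli lemma for almost pairwise independent events turns this
  into the moment conditions. A mean that is not a nonpositive real number is excluded by vectors that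
  are constant on blocks, whose Rayleigh quotients are of order \<open>n\<close> instead of \<open>\<sqrt>n\<close>.
\<close>

section \<open>Quaternionic vectors and matrices\<close>

text \<open>All moment arguments use the real inner product of quaternionic vectors, which contains
  the noncommutativity: real scalars are central, the powers of a Hermitian matrix have real
  diagonal entries, and an edge traversed back and forth contributes the real factor |A i j|^2, so
  that tree walks collapse as for complex matrices. The real dimension shows up only as a factor 4.
  The negative part of the diagonal need not have any moments, so the diagonal is not small in norm.
  It is kept out of the trace method and enters only through quadratic forms. The variance of a
  normalised trace is shown to be O(1/n), which is summable along squares but not along all n; the
  gaps are filled because the supremum of a quadratic form over unit vectors grows with the size of
  the corner. The Chebyshev polynomials are the orthonormal polynomials of the semicircle law, for
  which multiplication by the variable is the adjacency matrix of the half-line. The sum of the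
  first m of them has Rayleigh quotient 2(m - 1)/m there, which tends to 2, the right end of the
  spectrum.\<close>

fun qmul :: "quaternion \<Rightarrow> quaternion \<Rightarrow> quaternion" where
  "qmul (a, b, c, d) (a', b', c', d') =
     (a * a' - b * b' - c * c' - d * d', a * b' + b * a' + c * d' - d * c',
      a * c' - b * d' + c * a' + d * b', a * d' + b * c' - c * b' + d * a')"

definition qone :: quaternion where "qone = (1, 0, 0, 0)"

lemma quat_inner: "inner (a, b, c, d) (a', b', c', d' :: real) = a * a' + b * b' + c * c' + d * (d' :: real)"
  for a b c a' b' c' d :: real
  by (simp add: inner_Pair)

lemma quat_norm_eq: "quat_norm q = norm q"
  by (cases q) (simp add: norm_Pair)

lemma zero_quat: "(0 :: quaternion) = (0, 0, 0, 0)"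
  by (simp add: zero_prod_def)

lemma norm_sq_quat: "(norm (a, b, c, d :: real))\<^sup>2 = a\<^sup>2 + b\<^sup>2 + c\<^sup>2 + d\<^sup>2" for a b c :: real
  by (simp add: norm_Pair)

lemma norm_qmul: "norm (qmul p q) = norm p * norm q"
proof -
  have "(norm (qmul p q))\<^sup>2 = (norm p * norm q)\<^sup>2"
    by (cases p; cases q) (simp add: norm_sq_quat power_mult_distrib, simp add: power2_eq_square algebra_simps)
  then show ?thesis
    by (simp add: power2_eq_iff_nonneg)
qed

interpretation qmul: bounded_bilinear qmul
proof
  show "\<exists>K. \<forall>a b. norm (qmul a b) \<le> norm a * norm b * K"
    by (rule exI[of _ 1]) (simp add: norm_qmul)
qed (auto simp: algebra_simps)

lemma qmul_assoc: "qmul (qmul p q) r = qmul p (qmul q r)"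
  by (cases p; cases q; cases r) (simp add: algebra_simps)

lemma qmul_one [simp]: "qmul qone q = q" "qmul q qone = q"
  by (cases q; simp add: qone_def)+

lemma norm_qone [simp]: "norm qone = 1"
  by (simp add: qone_def norm_Pair)

lemma quat_conj_conj [simp]: "quat_conj (quat_conj q) = q"
  by (cases q) simp

lemma norm_quat_conj [simp]: "norm (quat_conj q) = norm q"
  by (cases q) (simp add: norm_Pair)

lemma quat_conj_zero [simp]: "quat_conj 0 = 0"
  by (simp add: zero_quat)

lemma linear_quat_conj: "linear quat_conj"
  by (rule linearI) auto

lemma quat_conj_add: "quat_conj (p + q) = quat_conj p + quat_conj q"
  by (rule linear_add[OF linear_quat_conj])

lemma quat_conj_diff: "quat_conj (p - q) = quat_conj p - quat_conj q"
  by (rule linear_diff[OF linear_quat_conj])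

lemma quat_conj_scaleR: "quat_conj (r *\<^sub>R q) = r *\<^sub>R quat_conj q"
  by (rule linear_scale[OF linear_quat_conj])

lemma inner_qmul_left: "inner (qmul p u) v = inner u (qmul (quat_conj p) v)"
  by (cases p; cases u; cases v) (simp add: quat_inner algebra_simps)

lemma inner_qmul_right: "inner (qmul u p) v = inner u (qmul v (quat_conj p))"
  by (cases p; cases u; cases v) (simp add: quat_inner algebra_simps)

lemma qmul_conj_self: "qmul q (quat_conj q) = (norm q)\<^sup>2 *\<^sub>R qone"
  by (cases q) (simp add: norm_sq_quat qone_def, simp add: power2_eq_square algebra_simps)

lemma re_part_inner: "re_part q = inner qone q"
  by (cases q) (simp add: qone_def quat_inner)

lemma borel_measurable_quat_conj [measurable]: "quat_conj \<in> borel_measurable borel"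
  by (intro borel_measurable_continuous_onI linear_continuous_on linear_quat_conj[unfolded linear_conv_bounded_linear])

lemma borel_measurable_qmul [measurable]:
  assumes "f \<in> borel_measurable M" "g \<in> borel_measurable M"
  shows "(\<lambda>x. qmul (f x) (g x)) \<in> borel_measurable M"
proof -
  have "continuous_on UNIV (\<lambda>p. qmul (fst p) (snd p))"
    by (intro qmul.continuous_on continuous_intros)
  then show ?thesis
    using assms borel_measurable_continuous_Pair[of f M g qmul] by simp
qed

text \<open>Matrix entries act from the left, so that \<open>mv n A\<close> commutes with right
  multiplication by quaternions.\<close>

definition mv :: "nat \<Rightarrow> (nat \<Rightarrow> nat \<Rightarrow> quaternion) \<Rightarrow> (nat \<Rightarrow> quaternion) \<Rightarrow> nat \<Rightarrow> quaternion" where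
  "mv n A v i = (\<Sum>j<n. qmul (A i j) (v j))"

text \<open>This is the real part of the quaternionic Hermitian form. It is enough for Rayleigh
  quotients, since the quadratic form of a Hermitian matrix is real.\<close>

definition ip :: "nat \<Rightarrow> (nat \<Rightarrow> quaternion) \<Rightarrow> (nat \<Rightarrow> quaternion) \<Rightarrow> real" where
  "ip n u v = (\<Sum>i<n. inner (u i) (v i))"

definition hermitian :: "nat \<Rightarrow> (nat \<Rightarrow> nat \<Rightarrow> quaternion) \<Rightarrow> bool" where
  "hermitian n A \<longleftrightarrow> (\<forall>i<n. \<forall>j<n. A j i = quat_conj (A i j))"

text \<open>The condition \<open>0 \<le> c\<close> makes the inequality between squares equivalent
  to the bound \<open>c\<close> on norms.\<close>

definition op_bound :: "nat \<Rightarrow> (nat \<Rightarrow> nat \<Rightarrow> quaternion) \<Rightarrow> real \<Rightarrow> bool" where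
  "op_bound n A c \<longleftrightarrow> 0 \<le> c \<and> (\<forall>v. ip n (mv n A v) (mv n A v) \<le> c\<^sup>2 * ip n v v)"

lemma ip_commute: "ip n u v = ip n v u"
  by (simp add: ip_def inner_commute)

lemma ip_nonneg [simp]: "0 \<le> ip n v v"
  by (simp add: ip_def sum_nonneg)

lemma ip_self: "ip n v v = (\<Sum>i<n. (norm (v i))\<^sup>2)"
  by (simp add: ip_def power2_norm_eq_inner)

lemma ip_zero_iff: "ip n v v = 0 \<longleftrightarrow> (\<forall>i<n. v i = 0)"
  by (auto simp: ip_self sum_nonneg_eq_0_iff)

lemma ip_cong: "(\<And>i. i < n \<Longrightarrow> u i = u' i) \<Longrightarrow> (\<And>i. i < n \<Longrightarrow> v i = v' i) \<Longrightarrow> ip n u v = ip n u' v'"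
  by (simp add: ip_def)

lemma ip_add_left: "ip n (\<lambda>i. u i + w i) v = ip n u v + ip n w v"
  by (simp add: ip_def inner_add_left sum.distrib)

lemma ip_add_right: "ip n v (\<lambda>i. u i + w i) = ip n v u + ip n v w"
  by (simp add: ip_def inner_add_right sum.distrib)

lemma ip_diff_left: "ip n (\<lambda>i. u i - w i) v = ip n u v - ip n w v"
  by (simp add: ip_def inner_diff_left sum_subtractf)

lemma ip_diff_right: "ip n v (\<lambda>i. u i - w i) = ip n v u - ip n v w"
  by (simp add: ip_def inner_diff_right sum_subtractf)

lemma ip_scale_left: "ip n (\<lambda>i. r *\<^sub>R u i) v = r * ip n u v"
  by (simp add: ip_def sum_distrib_left)

lemma ip_scale_right: "ip n v (\<lambda>i. r *\<^sub>R u i) = r * ip n v u"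
  by (simp add: ip_def sum_distrib_left)

lemma ip_sum_left: "ip n (\<lambda>i. \<Sum>a\<in>S. u a i) v = (\<Sum>a\<in>S. ip n (u a) v)"
  by (simp add: ip_def inner_sum_left sum.swap[of _ S])

lemma ip_sum_right: "ip n v (\<lambda>i. \<Sum>a\<in>S. u a i) = (\<Sum>a\<in>S. ip n v (u a))"
  by (simp add: ip_def inner_sum_right sum.swap[of _ S])

lemma ip_am_gm:
  assumes "t > 0"
  shows "2 * \<bar>ip n u v\<bar> \<le> t * ip n u u + ip n v v / t"
proof -
  have *: "0 \<le> t * ip n u u + ip n v v / t + 2 * s * ip n u v" if "s\<^sup>2 = 1" for s :: real
  proof -
    define w where "w i = sqrt t *\<^sub>R u i + (s / sqrt t) *\<^sub>R v i" for i
    have "ip n w w = (sqrt t)\<^sup>2 * ip n u u + (s / sqrt t)\<^sup>2 * ip n v v + 2 * (sqrt t * (s / sqrt t)) * ip n u v"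
      unfolding w_def ip_add_left ip_add_right ip_scale_left ip_scale_right
      by (simp add: ip_commute[of n v u] power2_eq_square algebra_simps)
    also have "\<dots> = t * ip n u u + ip n v v / t + 2 * s * ip n u v"
      using assms that by (simp add: power_divide)
    finally show ?thesis
      by (metis ip_nonneg)
  qed
  show ?thesis
    using *[of 1] *[of "-1"] by (simp add: abs_if)
qed

lemma ip_cauchy_schwarz: "(ip n u v)\<^sup>2 \<le> ip n u u * ip n v v"
proof -
  have *: "0 \<le> a\<^sup>2 * ip n u u + b\<^sup>2 * ip n v v + 2 * a * b * ip n u v" for a b
    using ip_nonneg[of n "\<lambda>i. a *\<^sub>R u i + b *\<^sub>R v i"]
    unfolding ip_add_left ip_add_right ip_scale_left ip_scale_right
    by (simp add: ip_commute[of n v u] power2_eq_square algebra_simps)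
  show ?thesis
  proof (cases "ip n v v = 0")
    case True
    then have "\<forall>i<n. v i = 0" by (simp add: ip_zero_iff)
    then have "ip n u v = 0" by (simp add: ip_def)
    then show ?thesis using True by simp
  next
    case False
    then have pos: "ip n v v > 0" using ip_nonneg[of n v] by linarith
    have "0 \<le> ip n v v * (ip n u u * ip n v v - (ip n u v)\<^sup>2)"
      using *[of "ip n v v" "- ip n u v"] by (simp add: power2_eq_square algebra_simps)
    then show ?thesis
      using pos by (simp add: zero_le_mult_iff)
  qed
qed

lemma mv_cong: "(\<And>j. j < n \<Longrightarrow> v j = w j) \<Longrightarrow> mv n A v = mv n A w"
  by (simp add: mv_def fun_eq_iff)

lemma mv_add: "mv n A (\<lambda>j. u j + v j) i = mv n A u i + mv n A v i"
  by (simp add: mv_def qmul.add_right sum.distrib)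

lemma mv_diff: "mv n A (\<lambda>j. u j - v j) i = mv n A u i - mv n A v i"
  by (simp add: mv_def qmul.diff_right sum_subtractf)

lemma mv_scale: "mv n A (\<lambda>j. r *\<^sub>R u j) i = r *\<^sub>R mv n A u i"
  by (simp add: mv_def qmul.scaleR_right scaleR_sum_right)

lemma mv_sum: "mv n A (\<lambda>j. \<Sum>a\<in>S. u a j) i = (\<Sum>a\<in>S. mv n A (u a) i)"
  by (simp add: mv_def qmul.sum_right sum.swap[of _ S])

lemma mv_add_mat: "mv n (\<lambda>i j. A i j + B i j) v i = mv n A v i + mv n B v i"
  by (simp add: mv_def qmul.add_left sum.distrib)

lemma mv_right_mult: "mv n A (\<lambda>j. qmul (v j) q) i = qmul (mv n A v i) q"
  by (simp add: mv_def qmul.sum_left qmul_assoc)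

lemma hermitianD: "hermitian n A \<Longrightarrow> i < n \<Longrightarrow> j < n \<Longrightarrow> A j i = quat_conj (A i j)"
  unfolding hermitian_def by blast

lemma ip_mv_hermitian:
  assumes "hermitian n A"
  shows "ip n (mv n A u) v = ip n u (mv n A v)"
proof -
  have "ip n (mv n A u) v = (\<Sum>i<n. \<Sum>j<n. inner (qmul (A i j) (u j)) (v i))"
    by (simp add: ip_def mv_def inner_sum_left)
  also have "\<dots> = (\<Sum>i<n. \<Sum>j<n. inner (u j) (qmul (A j i) (v i)))"
    by (intro sum.cong refl) (metis assms hermitianD inner_qmul_left lessThan_iff)
  also have "\<dots> = (\<Sum>j<n. \<Sum>i<n. inner (u j) (qmul (A j i) (v i)))"
    by (rule sum.swap)
  also have "\<dots> = ip n u (mv n A v)"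
    by (simp add: ip_def mv_def inner_sum_right)
  finally show ?thesis .
qed

lemma op_bound_ip:
  assumes "op_bound n A c"
  shows "\<bar>ip n u (mv n A u)\<bar> \<le> c * ip n u u"
proof -
  have c: "0 \<le> c" "ip n (mv n A u) (mv n A u) \<le> c\<^sup>2 * ip n u u"
    using assms by (auto simp: op_bound_def)
  have "(ip n u (mv n A u))\<^sup>2 \<le> ip n u u * ip n (mv n A u) (mv n A u)"
    by (rule ip_cauchy_schwarz)
  also have "\<dots> \<le> ip n u u * (c\<^sup>2 * ip n u u)"
    by (intro mult_left_mono c ip_nonneg)
  also have "\<dots> = (c * ip n u u)\<^sup>2"
    by (simp add: power2_eq_square)
  finally show ?thesis
    by (metis abs_le_square_iff abs_of_nonneg c(1) ip_nonneg mult_nonneg_nonneg)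
qed

lemma op_bound_mono:
  assumes "op_bound n A c" "c \<le> d"
  shows "op_bound n A d"
  unfolding op_bound_def
proof (intro conjI allI)
  show "0 \<le> d" using assms by (simp add: op_bound_def)
  fix v
  have "ip n (mv n A v) (mv n A v) \<le> c\<^sup>2 * ip n v v"
    using assms by (simp add: op_bound_def)
  also have "\<dots> \<le> d\<^sup>2 * ip n v v"
    using assms by (intro mult_right_mono power_mono) (auto simp: op_bound_def)
  finally show "ip n (mv n A v) (mv n A v) \<le> d\<^sup>2 * ip n v v" .
qed

definition nrm :: "nat \<Rightarrow> (nat \<Rightarrow> quaternion) \<Rightarrow> real" where
  "nrm n v = sqrt (ip n v v)"

lemma nrm_nonneg [simp]: "0 \<le> nrm n v"
  by (simp add: nrm_def)

lemma nrm_square: "(nrm n v)\<^sup>2 = ip n v v"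
  by (simp add: nrm_def)

lemma ip_le_nrm: "\<bar>ip n u v\<bar> \<le> nrm n u * nrm n v"
  using real_sqrt_le_mono[OF ip_cauchy_schwarz[of n u v]] by (simp add: nrm_def real_sqrt_mult)

lemma nrm_triangle: "nrm n (\<lambda>i. u i + v i) \<le> nrm n u + nrm n v"
proof (rule power2_le_imp_le)
  have "(nrm n (\<lambda>i. u i + v i))\<^sup>2 = ip n u u + ip n v v + 2 * ip n u v"
    unfolding nrm_square by (simp add: ip_add_left ip_add_right ip_commute[of n v u])
  also have "\<dots> \<le> (nrm n u)\<^sup>2 + (nrm n v)\<^sup>2 + 2 * (nrm n u * nrm n v)"
    using ip_le_nrm[of n u v] by (simp add: nrm_square)
  finally show "(nrm n (\<lambda>i. u i + v i))\<^sup>2 \<le> (nrm n u + nrm n v)\<^sup>2"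
    by (simp add: power2_sum)
qed simp

lemma nrm_scale: "nrm n (\<lambda>i. r *\<^sub>R v i) = \<bar>r\<bar> * nrm n v"
  by (simp add: nrm_def ip_scale_left ip_scale_right real_sqrt_mult flip: mult.assoc)

lemma nrm_diff: "nrm n (\<lambda>i. u i - v i) \<le> nrm n u + nrm n v"
  using nrm_triangle[of n u "\<lambda>i. (-1) *\<^sub>R v i"] by (simp only: nrm_scale) simp

lemma op_bound_nrm: "op_bound n A c \<longleftrightarrow> 0 \<le> c \<and> (\<forall>v. nrm n (mv n A v) \<le> c * nrm n v)"
proof -
  have "ip n (mv n A v) (mv n A v) \<le> c\<^sup>2 * ip n v v \<longleftrightarrow> nrm n (mv n A v) \<le> c * nrm n v" if "0 \<le> c" for v
  proof -
    have "nrm n (mv n A v) \<le> c * nrm n v \<longleftrightarrow> sqrt (ip n (mv n A v) (mv n A v)) \<le> sqrt (c\<^sup>2 * ip n v v)"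
      using that by (simp add: nrm_def real_sqrt_mult)
    then show ?thesis by simp
  qed
  then show ?thesis by (auto simp: op_bound_def)
qed

lemma op_bound_add:
  assumes "op_bound n A c" "op_bound n B d"
  shows "op_bound n (\<lambda>i j. A i j + B i j) (c + d)"
  unfolding op_bound_nrm
proof (intro conjI allI)
  show "0 \<le> c + d" using assms by (simp add: op_bound_def)
  fix v
  have "nrm n (mv n (\<lambda>i j. A i j + B i j) v) \<le> nrm n (mv n A v) + nrm n (mv n B v)"
    using nrm_triangle[of n "mv n A v" "mv n B v"] by (simp add: mv_add_mat[abs_def])
  also have "\<dots> \<le> c * nrm n v + d * nrm n v"
    using assms by (intro add_mono) (auto simp: op_bound_nrm)
  finally show "nrm n (mv n (\<lambda>i j. A i j + B i j) v) \<le> (c + d) * nrm n v"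
    by (simp add: algebra_simps)
qed

text \<open>Schur's test: Cauchy-Schwarz with the weight \<open>norm (A i j)\<close> split evenly
  between the two factors. Hermitian symmetry turns the row sums into column sums for the second
  summation.\<close>

lemma op_bound_schur:
  assumes A: "hermitian n A" and c: "0 \<le> c" and row: "\<And>i. i < n \<Longrightarrow> (\<Sum>j<n. norm (A i j)) \<le> c"
  shows "op_bound n A c"
  unfolding op_bound_def
proof (intro conjI allI c)
  fix v
  have sym: "norm (A j i) = norm (A i j)" if "i < n" "j < n" for i j
    by (metis A that hermitianD norm_quat_conj)
  have "(norm (mv n A v i))\<^sup>2 \<le> c * (\<Sum>j<n. norm (A i j) * (norm (v j))\<^sup>2)" if i: "i < n" for i
  proof -
    have "norm (mv n A v i) \<le> (\<Sum>j<n. norm (A i j) * norm (v j))"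
      unfolding mv_def by (rule order_trans[OF norm_sum]) (simp add: norm_qmul)
    also have "\<dots> = (\<Sum>j<n. sqrt (norm (A i j)) * (sqrt (norm (A i j)) * norm (v j)))"
      by (intro sum.cong) (auto simp flip: mult.assoc)
    finally have "(norm (mv n A v i))\<^sup>2 \<le> (\<Sum>j<n. sqrt (norm (A i j)) * (sqrt (norm (A i j)) * norm (v j)))\<^sup>2"
      by (rule power_mono) simp
    also have "\<dots> \<le> (\<Sum>j<n. (sqrt (norm (A i j)))\<^sup>2) * (\<Sum>j<n. (sqrt (norm (A i j)) * norm (v j))\<^sup>2)"
      by (rule Cauchy_Schwarz_ineq_sum)
    also have "\<dots> \<le> c * (\<Sum>j<n. norm (A i j) * (norm (v j))\<^sup>2)"
      by (intro mult_mono) (auto simp: power_mult_distrib row i sum_nonneg c)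
    finally show ?thesis .
  qed
  then have "ip n (mv n A v) (mv n A v) \<le> (\<Sum>i<n. c * (\<Sum>j<n. norm (A i j) * (norm (v j))\<^sup>2))"
    unfolding ip_self by (intro sum_mono) auto
  also have "\<dots> = c * (\<Sum>j<n. \<Sum>i<n. norm (A i j) * (norm (v j))\<^sup>2)"
    by (subst sum.swap) (simp add: sum_distrib_left)
  also have "\<dots> = c * (\<Sum>j<n. (\<Sum>i<n. norm (A j i)) * (norm (v j))\<^sup>2)"
    by (intro arg_cong2[of _ _ _ _ times] refl sum.cong) (simp add: sum_distrib_right sym)
  also have "\<dots> \<le> c * (\<Sum>j<n. c * (norm (v j))\<^sup>2)"
    by (intro mult_left_mono sum_mono mult_right_mono row c) auto
  also have "\<dots> = c\<^sup>2 * ip n v v"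
    by (simp add: ip_self power2_eq_square sum_distrib_left mult.assoc)
  finally show "ip n (mv n A v) (mv n A v) \<le> c\<^sup>2 * ip n v v" .
qed

section \<open>Traces of powers and closed walks\<close>

text \<open>For \<open>s < n\<close> and \<open>b \<in> Basis\<close> these vectors form an
  orthonormal basis over the reals; summing over it gives traces.\<close>

definition bv :: "nat \<Rightarrow> quaternion \<Rightarrow> nat \<Rightarrow> quaternion" where
  "bv s b i = (if i = s then b else 0)"

text \<open>The diagonal entry at \<open>s\<close> of the \<open>l\<close>-th power of
  \<open>A\<close>, read off from the image of a basis vector, so that no matrix product has to be
  defined.\<close>

definition pw :: "nat \<Rightarrow> (nat \<Rightarrow> nat \<Rightarrow> quaternion) \<Rightarrow> nat \<Rightarrow> nat \<Rightarrow> quaternion" where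
  "pw n A l s = ((mv n A) ^^ l) (bv s qone) s"

lemma ip_bv: "s < n \<Longrightarrow> ip n (bv s b) v = inner b (v s)"
proof -
  assume s: "s < n"
  have "ip n (bv s b) v = (\<Sum>i<n. if i = s then inner b (v s) else 0)"
    unfolding ip_def by (intro sum.cong) (auto simp: bv_def)
  then show ?thesis using s by simp
qed

lemma ip_bv_sum:
  "(\<Sum>s<n. \<Sum>b\<in>Basis. (ip n (bv s b) v)\<^sup>2) = ip n v v"
proof -
  have "(\<Sum>s<n. \<Sum>b\<in>Basis. (ip n (bv s b) v)\<^sup>2) = (\<Sum>s<n. \<Sum>b\<in>Basis. inner (v s) b * inner (v s) b)"
    by (intro sum.cong refl) (simp add: ip_bv power2_eq_square inner_commute)
  also have "\<dots> = ip n v v"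
    by (simp add: ip_def euclidean_inner[of "v _" "v _"])
  finally show ?thesis .
qed

lemma mv_pow_sum: "((mv n A) ^^ l) (\<lambda>j. \<Sum>a\<in>S. u a j) = (\<lambda>i. \<Sum>a\<in>S. ((mv n A) ^^ l) (u a) i)"
  by (induction l) (simp_all add: mv_sum[abs_def])

lemma mv_pow_right_mult: "((mv n A) ^^ l) (\<lambda>j. qmul (v j) q) = (\<lambda>i. qmul (((mv n A) ^^ l) v i) q)"
  by (induction l) (simp_all add: mv_right_mult[abs_def])

lemma mv_pow_bv: "((mv n A) ^^ l) (bv s b) i = qmul (((mv n A) ^^ l) (bv s qone) i) b"
proof -
  have "bv s b = (\<lambda>j. qmul (bv s qone j) b)"
    by (auto simp: bv_def fun_eq_iff qmul.zero_left)
  then show ?thesis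
    by (simp add: mv_pow_right_mult)
qed

lemma ip_mv_pow:
  assumes "hermitian n A"
  shows "ip n (((mv n A) ^^ a) u) v = ip n u (((mv n A) ^^ a) v)"
  by (induction a arbitrary: u v) (simp_all add: ip_mv_hermitian[OF assms] funpow_swap1)

lemma ip_mv_pow_add:
  assumes "hermitian n A"
  shows "ip n (((mv n A) ^^ a) u) (((mv n A) ^^ b) v) = ip n u (((mv n A) ^^ (a + b)) v)"
  by (simp add: ip_mv_pow[OF assms] funpow_add)

text \<open>The real part is invariant under conjugation by a unit. Hence the four basis quaternions
  at a vertex contribute equally to a trace, which is where the factors 4 come from.\<close>

lemma inner_qmul_unit: "norm b = 1 \<Longrightarrow> inner b (qmul q b) = inner qone q"
  using inner_qmul_right[of q b b] by (simp add: inner_commute qmul_conj_self)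

lemma pw_trace:
  assumes "s < n" "norm b = 1"
  shows "ip n (bv s b) (((mv n A) ^^ l) (bv s b)) = inner qone (pw n A l s)"
  using assms by (simp add: ip_bv pw_def inner_qmul_unit mv_pow_bv[of _ _ _ _ b])

lemma pw_trace_even:
  assumes "s < n" "norm b = 1" "hermitian n A"
  shows "ip n (((mv n A) ^^ l) (bv s b)) (((mv n A) ^^ l) (bv s b)) = inner qone (pw n A (2 * l) s)"
  using assms by (simp add: ip_mv_pow_add pw_trace flip: mult_2)

lemma pw_even_nonneg: "s < n \<Longrightarrow> hermitian n A \<Longrightarrow> 0 \<le> inner qone (pw n A (2 * l) s)"
  by (subst pw_trace_even[symmetric, of _ _ qone]) auto

text \<open>An element of a quaternion algebra that is self-adjoint is real.\<close>

lemma pw_real: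
  assumes "s < n" "hermitian n A"
  shows "pw n A l s = inner qone (pw n A l s) *\<^sub>R qone"
proof -
  let ?q = "pw n A l s"
  have *: "inner b ?q = inner (quat_conj b) ?q" for b
  proof -
    have "inner b ?q = ip n (bv s b) (((mv n A) ^^ l) (bv s qone))"
      using assms by (simp add: ip_bv pw_def)
    also have "\<dots> = ip n (bv s qone) (((mv n A) ^^ l) (bv s b))"
      by (metis assms(2) ip_commute ip_mv_pow)
    also have "\<dots> = inner qone (qmul ?q b)"
      using assms by (simp add: ip_bv pw_def mv_pow_bv[of _ _ _ _ b])
    also have "\<dots> = inner (quat_conj b) ?q"
      using inner_qmul_right[of ?q b qone] by (simp add: inner_commute)
    finally show ?thesis .
  qed
  obtain a b c d where q: "?q = (a, b, c, d)" by (cases ?q)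
  have "b = 0" "c = 0" "d = 0"
    using *[of "(0, 1, 0, 0)"] *[of "(0, 0, 1, 0)"] *[of "(0, 0, 0, 1)"] by (simp_all add: q)
  then show ?thesis by (simp add: q qone_def)
qed

text \<open>Log-convexity makes the ratios of consecutive terms nondecreasing, so the first ratio is
  at most the geometric mean of the first \<open>Suc k\<close> ratios. The inner induction avoids
  division, as terms may vanish.\<close>

lemma log_convex_power:
  fixes a :: "nat \<Rightarrow> real"
  assumes nn: "\<And>j. 0 \<le> a j" and lc: "\<And>j. (a (Suc j))\<^sup>2 \<le> a j * a (Suc (Suc j))"
  shows "a 1 ^ Suc k \<le> a 0 ^ k * a (Suc k)"
proof -
  have step: "a 1 * a k \<le> a 0 * a (Suc k)" for k
  proof (induction k)
    case (Suc k)
    show ?case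
    proof (cases "a k = 0")
      case True
      then have "a (Suc k) = 0" using lc[of k] by simp
      then show ?thesis using nn by simp
    next
      case False
      then have pos: "a k > 0" using nn[of k] by linarith
      have "a k * (a 1 * a (Suc k)) = (a 1 * a k) * a (Suc k)" by simp
      also have "\<dots> \<le> (a 0 * a (Suc k)) * a (Suc k)"
        by (intro mult_right_mono Suc nn)
      also have "\<dots> = a 0 * (a (Suc k))\<^sup>2" by (simp add: power2_eq_square)
      also have "\<dots> \<le> a 0 * (a k * a (Suc (Suc k)))"
        by (intro mult_left_mono lc nn)
      also have "\<dots> = a k * (a 0 * a (Suc (Suc k)))" by simp
      finally show ?thesis using pos by simp
    qed
  qed simp
  show ?thesis
  proof (induction k)
    case (Suc k)
    have "a 1 ^ Suc (Suc k) = a 1 * a 1 ^ Suc k" by simp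
    also have "\<dots> \<le> a 1 * (a 0 ^ k * a (Suc k))"
      by (intro mult_left_mono Suc nn)
    also have "\<dots> = a 0 ^ k * (a 1 * a (Suc k))" by simp
    also have "\<dots> \<le> a 0 ^ k * (a 0 * a (Suc (Suc k)))"
      by (intro mult_left_mono step zero_le_power nn)
    finally show ?case by (simp add: mult_ac)
  qed simp
qed

text \<open>The operator norm is bounded by the trace of a power without diagonalisation: Parseval
  and Cauchy-Schwarz bound the squared length of \<open>A^k v\<close> by the trace over the real
  basis times that of \<open>v\<close>, and log-convexity of the squared lengths of
  \<open>A^j v\<close> in \<open>j\<close> brings this down to \<open>j = 1\<close>.\<close>

lemma op_bound_trace:
  assumes A: "hermitian n A" and c: "0 \<le> c" and k: "0 < k"
    and tr: "4 * (\<Sum>s<n. inner qone (pw n A (2 * k) s)) \<le> c ^ (2 * k)"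
  shows "op_bound n A c"
  unfolding op_bound_def
proof (intro conjI allI c)
  fix v
  define a where "a j = ip n (((mv n A) ^^ j) v) (((mv n A) ^^ j) v)" for j
  have nn: "0 \<le> a j" for j by (simp add: a_def)
  have lc: "(a (Suc j))\<^sup>2 \<le> a j * a (Suc (Suc j))" for j
  proof -
    have "a (Suc j) = ip n (((mv n A) ^^ j) v) (((mv n A) ^^ Suc (Suc j)) v)"
      unfolding a_def ip_mv_pow_add[OF A] by simp
    then show ?thesis
      unfolding a_def using ip_cauchy_schwarz by metis
  qed
  have "a k = (\<Sum>s<n. \<Sum>b\<in>Basis. (ip n (bv s b) (((mv n A) ^^ k) v))\<^sup>2)"
    by (simp add: a_def ip_bv_sum)
  also have "\<dots> \<le> (\<Sum>s<n. \<Sum>b\<in>(Basis :: quaternion set). inner qone (pw n A (2 * k) s) * a 0)"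
  proof (intro sum_mono)
    fix s and b :: quaternion assume s: "s \<in> {..<n}" and b: "b \<in> Basis"
    have "(ip n (bv s b) (((mv n A) ^^ k) v))\<^sup>2 = (ip n (((mv n A) ^^ k) (bv s b)) v)\<^sup>2"
      by (simp add: ip_mv_pow[OF A])
    also have "\<dots> \<le> ip n (((mv n A) ^^ k) (bv s b)) (((mv n A) ^^ k) (bv s b)) * ip n v v"
      by (rule ip_cauchy_schwarz)
    also have "\<dots> = inner qone (pw n A (2 * k) s) * a 0"
      using s b by (simp add: pw_trace_even[OF _ _ A] a_def)
    finally show "(ip n (bv s b) (((mv n A) ^^ k) v))\<^sup>2 \<le> inner qone (pw n A (2 * k) s) * a 0" .
  qed
  also have "\<dots> = 4 * (\<Sum>s<n. inner qone (pw n A (2 * k) s)) * a 0"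
    by (simp add: sum_distrib_right sum_distrib_left mult.assoc)
  also have "\<dots> \<le> c ^ (2 * k) * a 0"
    by (intro mult_right_mono tr nn)
  finally have ak: "a k \<le> c ^ (2 * k) * a 0" .
  obtain k' where k': "k = Suc k'" using k by (cases k) auto
  have "a 1 ^ k \<le> a 0 ^ k' * a k"
    using log_convex_power[of a k', OF nn lc] by (simp add: k')
  also have "\<dots> \<le> a 0 ^ k' * (c ^ (2 * k) * a 0)"
    by (intro mult_left_mono ak zero_le_power nn)
  also have "\<dots> = (c\<^sup>2 * a 0) ^ k"
    by (simp add: k' power_mult_distrib power_mult power2_eq_square mult_ac)
  finally have "a 1 \<le> c\<^sup>2 * a 0"
    by (rule power_le_imp_le_base[of _ k', folded k']) (use nn c in auto)
  then show "ip n (mv n A v) (mv n A v) \<le> c\<^sup>2 * ip n v v"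
    by (simp add: a_def)
qed

text \<open>
  Walks are lists with the most recent vertex at the head and the starting vertex last.
\<close>

definition lists_n :: "nat \<Rightarrow> nat \<Rightarrow> nat list set" where
  "lists_n n l = {ws. length ws = Suc l \<and> set ws \<subseteq> {..<n}}"

definition walks :: "nat \<Rightarrow> nat \<Rightarrow> nat \<Rightarrow> nat list set" where
  "walks n s l = {ws \<in> lists_n n l. last ws = s}"

fun wprod :: "(nat \<Rightarrow> nat \<Rightarrow> quaternion) \<Rightarrow> nat list \<Rightarrow> quaternion" where
  "wprod A (i # j # ws) = qmul (A i j) (wprod A (j # ws))"
| "wprod A ws = qone"

lemma finite_lists_n [simp]: "finite (lists_n n l)"
  unfolding lists_n_def by (rule finite_subset[OF _ finite_lists_length_eq[of "{..<n}" "Suc l"]]) auto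

lemma finite_walks [simp]: "finite (walks n s l)"
  by (simp add: walks_def)

lemma walks_0: "s < n \<Longrightarrow> walks n s 0 = {[s]}"
  by (auto simp: walks_def lists_n_def length_Suc_conv)

lemma walks_Suc: "walks n s (Suc l) = (\<lambda>(i, ws). i # ws) ` ({..<n} \<times> walks n s l)"
proof (rule subset_antisym; rule subsetI)
  fix ws assume "ws \<in> walks n s (Suc l)"
  then obtain i ws' where "ws = i # ws'" "ws' \<noteq> []" "i < n" "ws' \<in> walks n s l"
    by (cases ws; cases "tl ws") (auto simp: walks_def lists_n_def)
  then show "ws \<in> (\<lambda>(i, ws). i # ws) ` ({..<n} \<times> walks n s l)" by auto
next
  fix ws assume "ws \<in> (\<lambda>(i, ws). i # ws) ` ({..<n} \<times> walks n s l)"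
  then show "ws \<in> walks n s (Suc l)" by (auto simp: walks_def lists_n_def)
qed

lemma sum_walks_Suc: "(\<Sum>ws\<in>walks n s (Suc l). f ws) = (\<Sum>ws\<in>walks n s l. \<Sum>i<n. f (i # ws))"
proof -
  have "(\<Sum>ws\<in>walks n s (Suc l). f ws) = (\<Sum>(i, ws)\<in>{..<n} \<times> walks n s l. f (i # ws))"
    unfolding walks_Suc by (subst sum.reindex) (auto simp: inj_on_def case_prod_beta)
  also have "\<dots> = (\<Sum>i<n. \<Sum>ws\<in>walks n s l. f (i # ws))"
    by (simp add: sum.cartesian_product)
  finally show ?thesis by (simp add: sum.swap[of _ "{..<n}"])
qed

lemma walks_nonempty: "ws \<in> walks n s l \<Longrightarrow> ws \<noteq> []"
  by (auto simp: walks_def lists_n_def)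

lemma pow_walks:
  assumes "s < n" "i < n"
  shows "((mv n A) ^^ l) (bv s qone) i = (\<Sum>ws\<in>{ws \<in> walks n s l. hd ws = i}. wprod A ws)"
  using assms(2)
proof (induction l arbitrary: i)
  case 0
  have "{ws \<in> walks n s 0. hd ws = i} = (if i = s then {[s]} else {})"
    using assms by (auto simp: walks_0)
  then show ?case by (simp add: bv_def)
next
  case (Suc l)
  have "(\<Sum>ws\<in>{ws \<in> walks n s (Suc l). hd ws = i}. wprod A ws)
    = (\<Sum>ws\<in>walks n s (Suc l). if hd ws = i then wprod A ws else 0)"
    by (simp add: sum.inter_filter)
  also have "\<dots> = (\<Sum>ws\<in>walks n s l. \<Sum>i'<n. if i' = i then wprod A (i' # ws) else 0)"
    by (subst sum_walks_Suc) simp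
  also have "\<dots> = (\<Sum>ws\<in>walks n s l. wprod A (i # ws))"
    using Suc.prems by (intro sum.cong refl) (simp add: sum.delta')
  also have "\<dots> = (\<Sum>ws\<in>walks n s l. qmul (A i (hd ws)) (wprod A ws))"
  proof (intro sum.cong refl)
    fix ws assume "ws \<in> walks n s l"
    then obtain j ws' where "ws = j # ws'" by (metis list.exhaust walks_nonempty)
    then show "wprod A (i # ws) = qmul (A i (hd ws)) (wprod A ws)" by simp
  qed
  also have "\<dots> = (\<Sum>j<n. \<Sum>ws\<in>{ws \<in> walks n s l. hd ws = j}. qmul (A i (hd ws)) (wprod A ws))"
  proof (subst sum.group)
    show "hd ` walks n s l \<subseteq> {..<n}"
      by (auto simp: walks_def lists_n_def) (metis hd_in_set length_0_conv lessThan_iff nat.distinct(1) subsetD)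
  qed auto
  also have "\<dots> = (\<Sum>j<n. qmul (A i j) (\<Sum>ws\<in>{ws \<in> walks n s l. hd ws = j}. wprod A ws))"
    by (intro sum.cong refl) (simp add: qmul.sum_right)
  also have "\<dots> = (\<Sum>j<n. qmul (A i j) (((mv n A) ^^ l) (bv s qone) j))"
    using Suc.IH by (intro sum.cong refl) simp
  finally show ?case by (simp add: mv_def[of n A "((mv n A) ^^ l) _"])
qed

definition cwalks :: "nat \<Rightarrow> nat \<Rightarrow> nat \<Rightarrow> nat list set" where
  "cwalks n s l = {ws \<in> walks n s l. hd ws = s}"

lemma finite_cwalks [simp]: "finite (cwalks n s l)"
  by (simp add: cwalks_def)

lemma pw_walks: "s < n \<Longrightarrow> pw n A l s = (\<Sum>ws\<in>cwalks n s l. wprod A ws)"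
  by (simp add: pw_def pow_walks cwalks_def)

lemma wprod_append: "wprod A (us @ j # vs) = qmul (wprod A (us @ [j])) (wprod A (j # vs))"
proof (induction us)
  case (Cons u us)
  then show ?case by (cases us) (simp_all add: qmul_assoc)
qed simp

text \<open>Closed walks that are back at their start halfway: concatenations of two closed walks of
  length \<open>l\<close>. They expand the square of a diagonal entry, hence its second
  moment.\<close>

definition dwalks :: "nat \<Rightarrow> nat \<Rightarrow> nat \<Rightarrow> nat list set" where
  "dwalks n s l = {ws \<in> cwalks n s (2 * l). ws ! l = s}"

lemma pw_square_walks:
  assumes "s < n"
  shows "qmul (pw n A l s) (pw n A l s) = (\<Sum>ws\<in>dwalks n s l. wprod A ws)"
proof -
  have bij: "bij_betw (\<lambda>(u, v). u @ tl v) (cwalks n s l \<times> cwalks n s l) (dwalks n s l)"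
  proof (rule bij_betwI[where g = "\<lambda>ws. (take (Suc l) ws, drop l ws)"])
    show "(\<lambda>(u, v). u @ tl v) \<in> cwalks n s l \<times> cwalks n s l \<rightarrow> dwalks n s l"
    proof (clarsimp simp: Pi_iff)
      fix u v assume "u \<in> cwalks n s l" "v \<in> cwalks n s l"
      then have uv: "length u = Suc l" "length v = Suc l" "set u \<subseteq> {..<n}" "set v \<subseteq> {..<n}"
        "hd u = s" "hd v = s" "last u = s" "last v = s"
        by (auto simp: cwalks_def walks_def lists_n_def)
      then have "u \<noteq> []" "v \<noteq> []" by auto
      then have "set (tl v) \<subseteq> {..<n}" using uv(4) by (meson list.set_sel(2) subset_code(1))
      moreover have "last (u @ tl v) = s"
        using uv \<open>v \<noteq> []\<close> \<open>u \<noteq> []\<close> by (cases v; cases "tl v") auto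
      moreover have "(u @ tl v) ! l = s"
        using uv \<open>u \<noteq> []\<close> by (simp add: nth_append last_conv_nth)
      ultimately show "u @ tl v \<in> dwalks n s l"
        using uv \<open>u \<noteq> []\<close> by (auto simp: dwalks_def cwalks_def walks_def lists_n_def)
    qed
    show "(\<lambda>ws. (take (Suc l) ws, drop l ws)) \<in> dwalks n s l \<rightarrow> cwalks n s l \<times> cwalks n s l"
    proof (clarsimp simp: Pi_iff)
      fix ws assume "ws \<in> dwalks n s l"
      then have ws: "length ws = Suc (2 * l)" "set ws \<subseteq> {..<n}" "hd ws = s" "last ws = s" "ws ! l = s"
        by (auto simp: dwalks_def cwalks_def walks_def lists_n_def)
      have "take (Suc l) ws \<in> cwalks n s l"
        using ws set_take_subset[of "Suc l" ws]
        by (cases "l = 0") (auto simp: cwalks_def walks_def lists_n_def take_Suc_conv_app_nth hd_append hd_take)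
      moreover have "drop l ws \<in> cwalks n s l"
        using ws set_drop_subset[of l ws]
        by (auto simp: cwalks_def walks_def lists_n_def hd_drop_conv_nth)
      ultimately show "take (Suc l) ws \<in> cwalks n s l \<and> drop l ws \<in> cwalks n s l" ..
    qed
    fix p assume "p \<in> cwalks n s l \<times> cwalks n s l"
    then obtain u v where p: "p = (u, v)" and uv: "length u = Suc l" "length v = Suc l" "hd v = s" "last u = s"
      by (auto simp: cwalks_def walks_def lists_n_def)
    obtain v' where v': "v = s # v'" using uv by (cases v) auto
    have "u \<noteq> []" using uv by auto
    then have u: "u = butlast u @ [s]" using uv by (metis append_butlast_last_id)
    have "drop l (u @ v') = v"
      using uv by (subst u) (simp add: v')
    then show "(case case p of (u, v) \<Rightarrow> u @ tl v of ws \<Rightarrow> (take (Suc l) ws, drop l ws)) = p"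
      using uv by (simp add: p v')
  next
    fix ws assume "ws \<in> dwalks n s l"
    then have ws: "length ws = Suc (2 * l)"
      by (auto simp: dwalks_def cwalks_def walks_def lists_n_def)
    then show "(case (take (Suc l) ws, drop l ws) of (u, v) \<Rightarrow> u @ tl v) = ws"
      by (simp add: tl_drop flip: drop_Suc)
  qed
  have "qmul (pw n A l s) (pw n A l s) = (\<Sum>(u, v)\<in>cwalks n s l \<times> cwalks n s l. qmul (wprod A u) (wprod A v))"
    unfolding pw_walks[OF assms] qmul.sum_left by (simp add: qmul.sum_right sum.cartesian_product)
  also have "\<dots> = (\<Sum>(u, v)\<in>cwalks n s l \<times> cwalks n s l. wprod A (u @ tl v))"
  proof (intro sum.cong refl, clarify)
    fix u v assume "u \<in> cwalks n s l" "v \<in> cwalks n s l"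
    then have "u \<noteq> []" "v \<noteq> []" "last u = s" "hd v = s"
      by (auto simp: cwalks_def walks_def lists_n_def)
    then have "u = butlast u @ [s]" "v = s # tl v" by (metis append_butlast_last_id, metis list.collapse)
    then show "qmul (wprod A u) (wprod A v) = wprod A (u @ tl v)"
      using wprod_append[of A "butlast u" s "tl v"] by (metis append.assoc append_Cons append_Nil)
  qed
  also have "\<dots> = (\<Sum>ws\<in>dwalks n s l. wprod A ws)"
    using sum.reindex_bij_betw[OF bij, of "wprod A"] by (simp add: case_prod_beta)
  finally show ?thesis .
qed

section \<open>Weights of walks\<close>

text \<open>The smaller endpoint comes first, so that a proper edge is the index of the
  corresponding entry above the diagonal. Loops are possible.\<close>

definition eg :: "nat \<Rightarrow> nat \<Rightarrow> nat \<times> nat" where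
  "eg i j = (min i j, max i j)"

definition inc :: "nat \<Rightarrow> nat \<times> nat \<Rightarrow> bool" where
  "inc v e \<longleftrightarrow> v = fst e \<or> v = snd e"

fun wedges :: "nat list \<Rightarrow> (nat \<times> nat) list" where
  "wedges (i # j # ws) = eg i j # wedges (j # ws)"
| "wedges ws = []"

text \<open>
  \<open>opn ws\<close> consists of the edges that led to a new vertex and were not traversed again since.
  Every step of a walk either reaches a new vertex, or closes an open edge (counted by \<open>nmi\<close>), or
  does neither (counted by \<open>noth\<close>). The steps counted by \<open>namb\<close> close one of several open edges
  at the current vertex, so they are not determined by the past of the walk.
\<close>

fun opn :: "nat list \<Rightarrow> (nat \<times> nat) set" where
  "opn (i # j # ws) = (if i \<notin> set (j # ws) then insert (eg i j) (opn (j # ws)) else opn (j # ws) - {eg i j})"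
| "opn ws = {}"

definition deg :: "(nat \<times> nat) set \<Rightarrow> nat \<Rightarrow> nat" where
  "deg F v = card {e \<in> F. inc v e}"

fun nmi :: "nat list \<Rightarrow> nat" where
  "nmi (i # j # ws) = nmi (j # ws) + (if i \<in> set (j # ws) \<and> eg i j \<in> opn (j # ws) then 1 else 0)"
| "nmi ws = 0"

fun noth :: "nat list \<Rightarrow> nat" where
  "noth (i # j # ws) = noth (j # ws) + (if i \<in> set (j # ws) \<and> eg i j \<notin> opn (j # ws) then 1 else 0)"
| "noth ws = 0"

fun namb :: "nat list \<Rightarrow> nat" where
  "namb (i # j # ws) = namb (j # ws)
     + (if i \<in> set (j # ws) \<and> eg i j \<in> opn (j # ws) \<and> 2 \<le> deg (opn (j # ws)) j then 1 else 0)"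
| "namb ws = 0"

lemma eg_commute: "eg i j = eg j i"
  by (simp add: eg_def min.commute max.commute)

lemma inc_eg [simp]: "inc v (eg i j) \<longleftrightarrow> v = i \<or> v = j"
  by (auto simp: inc_def eg_def min_def max_def)

lemma eg_inject: "eg i j = eg i' j \<longleftrightarrow> i = i'"
  by (auto simp: eg_def min_def max_def split: if_splits)

lemma wedges_inc: "e \<in> set (wedges ws) \<Longrightarrow> inc v e \<Longrightarrow> v \<in> set ws"
  by (induction ws rule: wedges.induct) auto

lemma opn_subset: "opn ws \<subseteq> set (wedges ws)"
  by (induction ws rule: opn.induct) auto

lemma finite_opn [simp]: "finite (opn ws)"
  by (rule finite_subset[OF opn_subset]) simp

lemma opn_inc: "e \<in> opn ws \<Longrightarrow> inc v e \<Longrightarrow> v \<in> set ws"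
  using opn_subset wedges_inc by blast

lemma opn_proper: "e \<in> opn ws \<Longrightarrow> fst e < snd e"
  by (induction ws rule: opn.induct) (auto simp: eg_def min_def max_def split: if_splits)

lemma length_wedges [simp]: "length (wedges ws) = length ws - 1"
  by (induction ws rule: wedges.induct) auto

lemma card_set_Cons: "card (set (i # w)) = (if i \<in> set w then card (set w) else Suc (card (set w)))"
  by (simp add: insert_absorb)

text \<open>Every vertex but the first opens an edge when it is reached, and that edge is either
  closed by a step counted in \<open>nmi\<close> or still open.\<close>

lemma card_set_walk:
  "ws \<noteq> [] \<Longrightarrow> card (set ws) = Suc (nmi ws + card (opn ws))"
proof (induction ws rule: opn.induct)
  case (1 i j ws)
  let ?w = "j # ws"
  show ?case
  proof (cases "i \<in> set ?w")
    case False
    then have "eg i j \<notin> opn ?w" using opn_inc[of "eg i j" ?w i] by auto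
    then show ?thesis using 1 False by (simp add: card_set_Cons[of i] del: list.set)
  next
    case True
    show ?thesis
    proof (cases "eg i j \<in> opn ?w")
      case e: True
      have "Suc (card (opn ?w - {eg i j})) = card (opn ?w)"
        using e by (intro card_Suc_Diff1) auto
      then show ?thesis using 1 True e by (simp add: card_set_Cons[of i] del: list.set)
    next
      case False
      then show ?thesis using 1 True by (simp add: card_set_Cons[of i] del: list.set)
    qed
  qed
qed auto

lemma length_walk_count:
  "ws \<noteq> [] \<Longrightarrow> length ws = card (set ws) + nmi ws + noth ws"
  by (induction ws rule: opn.induct) (auto simp: insert_absorb)

text \<open>The edges of a walk form a connected graph: a step to a new vertex always uses a new
  edge.\<close>

lemma card_wedges_ge: "card (set ws) \<le> Suc (card (set (wedges ws)))"
proof (induction ws rule: wedges.induct)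
  case (1 i j ws)
  show ?case
  proof (cases "i \<in> set (j # ws)")
    case True
    then have "card (set (i # j # ws)) \<le> Suc (card (set (wedges (j # ws))))"
      using 1 by (simp add: insert_absorb)
    also have "\<dots> \<le> Suc (card (set (wedges (i # j # ws))))"
      by (intro Suc_leI le_imp_less_Suc card_mono) auto
    finally show ?thesis .
  next
    case False
    then have "eg i j \<notin> set (wedges (j # ws))" using wedges_inc[of "eg i j" "j # ws" i] by auto
    then have "card (set (wedges (i # j # ws))) = Suc (card (set (wedges (j # ws))))" by simp
    then show ?thesis using 1 False by (simp add: card_set_Cons[of i] del: list.set wedges.simps)
  qed
qed auto

text \<open>An edge leading to a new vertex cannot have occurred before, and a second traversal
  removes it from \<open>opn\<close>.\<close>

lemma opn_count: "e \<in> opn ws \<Longrightarrow> count_list (wedges ws) e = 1"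
proof (induction ws rule: opn.induct)
  case (1 i j ws)
  show ?case
  proof (cases "i \<in> set (j # ws)")
    case True
    then show ?thesis using 1 by auto
  next
    case False
    then have *: "eg i j \<notin> set (wedges (j # ws))" using wedges_inc[of "eg i j" "j # ws" i] by auto
    then have "eg i j \<notin> opn (j # ws)" using opn_subset by blast
    then show ?thesis using 1 False * by (auto simp: count_list_0_iff)
  qed
qed auto

lemma opn_empty:
  assumes "\<And>e. e \<in> set (wedges ws) \<Longrightarrow> 2 \<le> count_list (wedges ws) e"
  shows "opn ws = {}"
  using assms opn_count opn_subset by (metis all_not_in_conv numeral_le_one_iff semiring_norm(69) subsetD)

text \<open>
  The excess \<open>pot\<close> is zero as long as the open edges form a path ending at the current vertex.
  Each ambiguous return to an earlier vertex lowers it, and only the \<^emph>\<open>other\<close> steps raise it.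
\<close>

definition pot :: "nat list \<Rightarrow> nat" where
  "pot ws = (\<Sum>v\<in>set ws. deg (opn ws) v - (if v = hd ws then 1 else 2))"

lemma deg_insert:
  assumes "finite F" "eg i j \<notin> F"
  shows "deg (insert (eg i j) F) v = deg F v + (if v = i \<or> v = j then 1 else 0)"
proof -
  have "{e \<in> insert (eg i j) F. inc v e} =
      (if v = i \<or> v = j then insert (eg i j) {e \<in> F. inc v e} else {e \<in> F. inc v e})"
    by auto
  then show ?thesis using assms by (simp add: deg_def)
qed

lemma deg_remove:
  assumes "finite F" "eg i j \<in> F"
  shows "deg F v = deg (F - {eg i j}) v + (if v = i \<or> v = j then 1 else 0)"
  using deg_insert[of "F - {eg i j}" i j v] assms by (simp add: insert_absorb)

lemma namb_le: "ws \<noteq> [] \<Longrightarrow> namb ws + pot ws \<le> noth ws"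
proof (induction ws rule: opn.induct)
  case (1 i j ws)
  let ?w = "j # ws"
  let ?F = "opn ?w"
  have IH: "namb ?w + pot ?w \<le> noth ?w" using 1 by blast
  \<comment> \<open>All vertices except the two ends of the step keep their degree and their
    allowance 2, so their part \<open>R\<close> of the excess is common to both sides.\<close>
  define R where "R = (\<Sum>v\<in>set ?w - {i, j}. deg ?F v - 2)"
  show ?case
  proof (cases "i \<in> set ?w")
    case False
    then have new: "eg i j \<notin> ?F" and d0: "deg ?F i = 0"
      using opn_inc[of "eg i j" ?w i] opn_inc[of _ ?w i] by (auto simp: deg_def simp del: list.set opn.simps split_paired_All)
    have ij: "i \<noteq> j" using False by auto
    have V: "set ?w = insert j (set ?w - {i, j})" "set (i # ?w) = insert i (insert j (set ?w - {i, j}))"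
      using False by auto
    have "pot ?w = (deg ?F j - 1) + (\<Sum>v\<in>set ?w - {i, j}. deg ?F v - (if v = j then 1 else 2))"
      unfolding pot_def by (subst V(1)) (simp del: list.set)
    also have "(\<Sum>v\<in>set ?w - {i, j}. deg ?F v - (if v = j then 1 else 2)) = R"
      unfolding R_def by (intro sum.cong) auto
    finally have p1: "pot ?w = (deg ?F j - 1) + R" .
    have dF: "deg (opn (i # ?w)) v = deg ?F v + (if v = i \<or> v = j then 1 else 0)" for v
      using False new deg_insert[of ?F i j v] by (simp del: list.set)
    have "pot (i # ?w) = (deg ?F j + 1 - 2) + (\<Sum>v\<in>set ?w - {i, j}. deg (opn (i # ?w)) v - (if v = i then 1 else 2))"
      unfolding pot_def using ij by (subst V(2)) (simp add: dF d0 del: list.set opn.simps)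
    also have "(\<Sum>v\<in>set ?w - {i, j}. deg (opn (i # ?w)) v - (if v = i then 1 else 2)) = R"
      unfolding R_def by (intro sum.cong) (auto simp: dF simp del: opn.simps)
    \<comment> \<open>The new vertex has degree 1 and allowance 1; at \<open>j\<close> degree and
      allowance both grow by one.\<close>
    finally have "pot (i # ?w) = pot ?w" using p1 by simp
    then show ?thesis using IH False by (simp del: list.set)
  next
    case True
    show ?thesis
    proof (cases "i = j")
      case True
      have ne: "eg i j \<notin> ?F" using opn_proper[of "eg i j" ?w] True by (auto simp: eg_def)
      then have "opn (i # ?w) = ?F" using True by simp
      then have "pot (i # ?w) = pot ?w" using True by (simp add: pot_def del: opn.simps)
      then show ?thesis using IH ne True by simp
    next
      case False
      have V: "set ?w = insert i (insert j (set ?w - {i, j}))" "set (i # ?w) = set ?w"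
        using True by auto
      have "pot ?w = (deg ?F i - 2) + (deg ?F j - 1) + (\<Sum>v\<in>set ?w - {i, j}. deg ?F v - (if v = j then 1 else 2))"
        unfolding pot_def using False by (subst V(1)) (simp del: list.set)
      also have "(\<Sum>v\<in>set ?w - {i, j}. deg ?F v - (if v = j then 1 else 2)) = R"
        unfolding R_def by (intro sum.cong) auto
      finally have p1: "pot ?w = (deg ?F i - 2) + (deg ?F j - 1) + R" .
      let ?G = "opn (i # ?w)"
      have "pot (i # ?w) = (deg ?G i - 1) + (deg ?G j - 2) + (\<Sum>v\<in>set ?w - {i, j}. deg ?G v - (if v = i then 1 else 2))"
        unfolding pot_def V(2) using False by (subst V(1)) (simp del: list.set opn.simps)
      also have "(\<Sum>v\<in>set ?w - {i, j}. deg ?G v - (if v = i then 1 else 2)) = (\<Sum>v\<in>set ?w - {i, j}. deg ?G v - 2)"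
        by (intro sum.cong) auto
      finally have p2: "pot (i # ?w) = (deg ?G i - 1) + (deg ?G j - 2) + (\<Sum>v\<in>set ?w - {i, j}. deg ?G v - 2)" .
      show ?thesis
      proof (cases "eg i j \<in> ?F")
        case e: True
        have G: "?G = ?F - {eg i j}" using True by simp
        have d: "deg ?F v = deg ?G v + (if v = i \<or> v = j then 1 else 0)" for v
          unfolding G using e by (intro deg_remove) auto
        have "(\<Sum>v\<in>set ?w - {i, j}. deg ?G v - 2) = R"
          unfolding R_def by (intro sum.cong) (auto simp: d)
        \<comment> \<open>At \<open>i\<close> the lost edge is offset by the allowance falling from
          2 to 1. At \<open>j\<close> the degree falls while the allowance rises, so the excess
          drops as soon as \<open>j\<close> had two open edges.\<close>
        then have "pot (i # ?w) + (if 2 \<le> deg ?F j then 1 else 0) \<le> pot ?w"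
          using d[of i] d[of j] p1 p2 by auto
        then show ?thesis using IH True e by (auto simp del: list.set opn.simps simp: insert_absorb)
      next
        case e: False
        then have G: "?G = ?F" using True by simp
        \<comment> \<open>No degree changes; only the allowance at \<open>i\<close> falls, by
          one.\<close>
        have "pot (i # ?w) \<le> pot ?w + 1"
          using p1 p2 by (simp add: G R_def del: opn.simps)
        then show ?thesis using IH True e by (simp del: list.set opn.simps)
      qed
    qed
  qed
qed (auto simp: pot_def deg_def)

text \<open>
  The weights are chosen such that, for \<open>a = s / \<sqrt>n\<close>, \<open>b = s \<sqrt>n\<close> and \<open>c = L K\<close>, their product
  dominates the expectation attached to a closed walk, whereas the sum of \<open>stw a b c K i ws\<close> over
  all next vertices \<open>i\<close> is not much larger than \<open>2 s \<sqrt>n\<close>. The factor \<open>1 / K\<close> of an ambiguous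
  step is compensated by the factor \<open>K\<close> of the other steps, in view of \<open>namb_le\<close> above.
\<close>

fun stw :: "real \<Rightarrow> real \<Rightarrow> real \<Rightarrow> real \<Rightarrow> nat \<Rightarrow> nat list \<Rightarrow> real" where
  "stw a b c K i ws =
     (if i \<notin> set ws then a
      else if eg i (hd ws) \<in> opn ws then (if 2 \<le> deg (opn ws) (hd ws) then b / K else b)
      else c)"

fun wt :: "real \<Rightarrow> real \<Rightarrow> real \<Rightarrow> real \<Rightarrow> nat list \<Rightarrow> real" where
  "wt a b c K (i # j # ws) = stw a b c K i (j # ws) * wt a b c K (j # ws)"
| "wt a b c K ws = 1"

lemma wt_nonneg: "0 \<le> a \<Longrightarrow> 0 \<le> b \<Longrightarrow> 0 \<le> c \<Longrightarrow> 0 \<le> K \<Longrightarrow> 0 \<le> wt a b c K ws"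
  by (induction ws rule: wedges.induct) auto

text \<open>The product of the step weights is regrouped by kinds of steps. The additional factor
  \<open>a\<close> on the left accounts for the starting vertex, which is counted by
  \<open>card (set ws)\<close> but reached by no step.\<close>

lemma wt_eq:
  assumes "K > 0" "ws \<noteq> []"
  shows "wt a b c K ws * K ^ namb ws * a = a ^ card (set ws) * b ^ nmi ws * c ^ noth ws"
  using assms(2)
proof (induction ws rule: wedges.induct)
  case (1 i j ws)
  let ?w = "j # ws"
  have IH: "wt a b c K ?w * K ^ namb ?w * a = a ^ card (set ?w) * b ^ nmi ?w * c ^ noth ?w"
    using 1 by blast
  consider "i \<notin> set ?w" | "i \<in> set ?w" "eg i j \<in> opn ?w" "2 \<le> deg (opn ?w) j"
    | "i \<in> set ?w" "eg i j \<in> opn ?w" "\<not> 2 \<le> deg (opn ?w) j" | "i \<in> set ?w" "eg i j \<notin> opn ?w"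
    by blast
  then show ?case
  proof cases
    case 1
    have "wt a b c K (i # ?w) * K ^ namb (i # ?w) * a = a * (wt a b c K ?w * K ^ namb ?w * a)"
      using 1 by (simp del: list.set)
    then show ?thesis using 1 by (simp add: IH card_set_Cons[of i] del: list.set wt.simps)
  next
    case 2
    have "wt a b c K (i # ?w) * K ^ namb (i # ?w) * a = b * (wt a b c K ?w * K ^ namb ?w * a)"
      using 2 assms by (simp del: list.set)
    then show ?thesis using 2 by (simp add: IH card_set_Cons[of i] del: list.set wt.simps)
  next
    case 3
    have "wt a b c K (i # ?w) * K ^ namb (i # ?w) * a = b * (wt a b c K ?w * K ^ namb ?w * a)"
      using 3 assms by (simp del: list.set)
    then show ?thesis using 3 by (simp add: IH card_set_Cons[of i] del: list.set wt.simps)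
  next
    case 4
    have "wt a b c K (i # ?w) * K ^ namb (i # ?w) * a = c * (wt a b c K ?w * K ^ namb ?w * a)"
      using 4 assms by (simp del: list.set)
    then show ?thesis using 4 by (simp add: IH card_set_Cons[of i] del: list.set wt.simps)
  qed
qed auto

text \<open>When no edge stays open, steps to new vertices and closing steps are equally many, and
  each pair contributes \<open>(s / sqrt n) * (s * sqrt n) = s\<^sup>2\<close>. The powers of
  \<open>K\<close> cancel in the right direction by \<open>namb_le\<close>.\<close>

lemma wt_ge:
  assumes "K \<ge> 1" "ws \<noteq> []" "0 < s" "0 \<le> L" "0 < n" "opn ws = {}"
  shows "s ^ (2 * nmi ws) * L ^ noth ws \<le> wt (s / sqrt n) (s * sqrt n) (L * K) K ws"
proof -
  have c: "card (set ws) = Suc (nmi ws)"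
    using card_set_walk[OF assms(2)] assms(6) by simp
  have "wt (s / sqrt n) (s * sqrt n) (L * K) K ws * K ^ namb ws * (s / sqrt n) =
      (s / sqrt n) * ((s / sqrt n) * (s * sqrt n)) ^ nmi ws * (L * K) ^ noth ws"
    using wt_eq[of K ws "s / sqrt n" "s * sqrt n" "L * K"] assms(1,2) unfolding c power_Suc power_mult_distrib[of "s / sqrt n" "s * sqrt n"] by simp
  also have "(s / sqrt n) * (s * sqrt n) = s\<^sup>2"
    using assms by (simp add: power2_eq_square)
  finally have *: "wt (s / sqrt n) (s * sqrt n) (L * K) K ws * K ^ namb ws = (s\<^sup>2) ^ nmi ws * (L * K) ^ noth ws"
  proof -
    let ?W = "wt (s / sqrt n) (s * sqrt n) (L * K) K ws * K ^ namb ws"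
    assume "?W * (s / sqrt n) = s / sqrt n * (s\<^sup>2) ^ nmi ws * (L * K) ^ noth ws"
    then have "(s / sqrt n) * ?W = (s / sqrt n) * ((s\<^sup>2) ^ nmi ws * (L * K) ^ noth ws)" by simp
    then show ?thesis using assms by (subst (asm) mult_cancel_left) simp
  qed
  have "K ^ namb ws \<le> K ^ noth ws"
    using assms(1) namb_le[OF assms(2)] by (intro power_increasing) auto
  then have "s ^ (2 * nmi ws) * L ^ noth ws * K ^ namb ws \<le> s ^ (2 * nmi ws) * L ^ noth ws * K ^ noth ws"
    using assms by (intro mult_left_mono) auto
  also have "\<dots> = wt (s / sqrt n) (s * sqrt n) (L * K) K ws * K ^ namb ws"
    by (simp add: * power_mult_distrib power_mult)
  finally show ?thesis
    using assms(1) by (simp add: mult_le_cancel_right)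
qed

lemma deg_le_length: "deg (opn ws) v \<le> length ws - 1"
proof -
  have "deg (opn ws) v \<le> card (set (wedges ws))"
    unfolding deg_def using opn_subset by (intro card_mono) auto
  also have "\<dots> \<le> length ws - 1"
    using card_length[of "wedges ws"] by simp
  finally show ?thesis .
qed

text \<open>The three kinds of next vertices: at most \<open>n\<close> new ones give
  \<open>s * sqrt n\<close>; the closing steps give at most \<open>s * sqrt n\<close>; the remaining
  ones lie among the at most \<open>l + 1\<close> visited vertices. The first two make up the
  leading constant 2.\<close>

lemma stw_sum:
  assumes ws: "ws \<in> walks n r l" and K: "1 \<le> K" "real l \<le> K" and s: "0 \<le> s" and L: "0 \<le> L" and n: "0 < n"
  shows "(\<Sum>i<n. stw (s / sqrt n) (s * sqrt n) (L * K) K i ws) \<le> 2 * s * sqrt n + (real l + 1) * L * K"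
proof -
  have len: "length ws = Suc l" and sub: "set ws \<subseteq> {..<n}" and ne: "ws \<noteq> []"
    using ws by (auto simp: walks_def lists_n_def)
  define P where "P = {i \<in> {..<n}. i \<in> set ws \<and> eg i (hd ws) \<in> opn ws}"
  let ?c = "if 2 \<le> deg (opn ws) (hd ws) then s * sqrt n / K else s * sqrt n"
  have "(\<Sum>i<n. stw (s / sqrt n) (s * sqrt n) (L * K) K i ws) \<le>
      (\<Sum>i<n. s / sqrt n + (if i \<in> P then ?c else 0) + (if i \<in> set ws then L * K else 0))"
    using s L K by (intro sum_mono) (auto simp: P_def)
  also have "\<dots> = n * (s / sqrt n) + card P * ?c + card (set ws) * (L * K)"

    proof -
      have "{..<n} \<inter> P = P" "{..<n} \<inter> set ws = set ws" using sub by (auto simp: P_def)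
      then show ?thesis by (simp add: sum.distrib flip: sum.inter_restrict)
    qed
  also have "n * (s / sqrt n) = s * sqrt n"

  proof -
    have "n * (s / sqrt n) = s * (n / sqrt n)" by simp
    then show ?thesis by (simp add: real_div_sqrt)
  qed
  also have "card P * ?c \<le> s * sqrt n"
  proof -
    have "card P = card ((\<lambda>i. eg i (hd ws)) ` P)"
      by (rule card_image[symmetric]) (auto simp: inj_on_def eg_inject)
    also have "\<dots> \<le> deg (opn ws) (hd ws)"
      unfolding deg_def by (intro card_mono) (auto simp: P_def)
    finally have cP: "card P \<le> deg (opn ws) (hd ws)" .
    show ?thesis
    proof (cases "2 \<le> deg (opn ws) (hd ws)")
      \<comment> \<open>There may be up to \<open>l\<close> open edges at the current vertex, but
        each weight is divided by \<open>K \<ge> l\<close>.\<close>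
      case True
      have "real (card P) \<le> K"
        using cP deg_le_length[of ws "hd ws"] len K(2) by simp
      then have "real (card P) * (s * sqrt n / K) \<le> K * (s * sqrt n / K)"
        using s K by (intro mult_right_mono) auto
      then show ?thesis using True K by simp
    next
      case False
      then have "card P \<le> 1" using cP by simp
      then have "real (card P) * (s * sqrt n) \<le> 1 * (s * sqrt n)"
        using s by (intro mult_right_mono) auto
      then show ?thesis using False by simp
    qed
  qed
  also have "card (set ws) * (L * K) \<le> (real l + 1) * (L * K)"
    using card_length[of ws] len L K by (intro mult_right_mono) auto
  finally show ?thesis by (simp add: mult.assoc del: stw.simps)
qed

lemma wt_sum:
  assumes K: "1 \<le> K" "real N \<le> K" and s: "0 \<le> s" and L: "0 \<le> L" and n: "0 < n" and r: "r < n"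
    and l: "l \<le> N"
  shows "(\<Sum>ws\<in>walks n r l. wt (s / sqrt n) (s * sqrt n) (L * K) K ws) \<le> (2 * s * sqrt n + (real N + 1) * L * K) ^ l"
  using l
proof (induction l)
  case 0
  then show ?case using r by (simp add: walks_0)
next
  case (Suc l)
  let ?c = "2 * s * sqrt n + (real N + 1) * L * K"
  have IH: "(\<Sum>ws\<in>walks n r l. wt (s / sqrt n) (s * sqrt n) (L * K) K ws) \<le> ?c ^ l"
    using Suc by simp
  have "(\<Sum>ws\<in>walks n r (Suc l). wt (s / sqrt n) (s * sqrt n) (L * K) K ws) = (\<Sum>ws\<in>walks n r l. \<Sum>i<n. stw (s / sqrt n) (s * sqrt n) (L * K) K i ws * wt (s / sqrt n) (s * sqrt n) (L * K) K ws)"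
    unfolding sum_walks_Suc
  proof (intro sum.cong refl)
    fix ws i assume "ws \<in> walks n r l"
    then obtain j ws' where "ws = j # ws'" by (metis list.exhaust walks_nonempty)
    then show "wt (s / sqrt n) (s * sqrt n) (L * K) K (i # ws) = stw (s / sqrt n) (s * sqrt n) (L * K) K i ws * wt (s / sqrt n) (s * sqrt n) (L * K) K ws" by simp
  qed
  also have "\<dots> = (\<Sum>ws\<in>walks n r l. (\<Sum>i<n. stw (s / sqrt n) (s * sqrt n) (L * K) K i ws) * wt (s / sqrt n) (s * sqrt n) (L * K) K ws)"
    by (simp only: sum_distrib_right)
  also have "\<dots> \<le> (\<Sum>ws\<in>walks n r l. ?c * wt (s / sqrt n) (s * sqrt n) (L * K) K ws)"
  proof (intro sum_mono mult_right_mono)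
    fix ws assume "ws \<in> walks n r l"
    then have "(\<Sum>i<n. stw (s / sqrt n) (s * sqrt n) (L * K) K i ws) \<le> 2 * s * sqrt n + (real l + 1) * L * K"
      by (rule stw_sum) (use Suc.prems K s L n in auto)
    also have "\<dots> \<le> ?c"
      using Suc.prems K L by (intro add_left_mono mult_right_mono) auto
    finally show "(\<Sum>i<n. stw (s / sqrt n) (s * sqrt n) (L * K) K i ws) \<le> ?c" .
  qed (use K s L in \<open>auto intro!: wt_nonneg\<close>)
  also have "\<dots> = ?c * (\<Sum>ws\<in>walks n r l. wt (s / sqrt n) (s * sqrt n) (L * K) K ws)"
    by (simp only: sum_distrib_left)
  also have "\<dots> \<le> ?c * ?c ^ l"
    using K s L by (intro mult_left_mono IH) auto
  finally show ?case unfolding power_Suc .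
qed

lemma count_ge_two_length:
  assumes "\<And>e. e \<in> set es \<Longrightarrow> 2 \<le> count_list es e"
  shows "2 * card (set es) \<le> length es"
proof -
  have "2 * card (set es) = (\<Sum>e\<in>set es. 2)" by simp
  also have "\<dots> \<le> (\<Sum>e\<in>set es. count_list es e)" using assms by (intro sum_mono) auto
  also have "\<dots> = length es" by (simp add: sum_count_set)
  finally show ?thesis .
qed

text \<open>Expectations come with the number of distinct edges, weights with the number of closing
  steps. A walk with cycles has more distinct edges than closing steps; each surplus factor
  \<open>s\<^sup>2\<close> is enlarged to \<open>L\<^sup>2\<close> and charged to two other
  steps.\<close>

lemma edge_weight_le:
  fixes s L :: real
  assumes two: "\<And>e. e \<in> set (wedges ws) \<Longrightarrow> 2 \<le> count_list (wedges ws) e"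
    and s: "0 < s" "s \<le> L" and ne: "ws \<noteq> []"
  shows "s ^ (2 * card (set (wedges ws))) * L ^ (length ws - 1 - 2 * card (set (wedges ws)))
    \<le> s ^ (2 * nmi ws) * L ^ noth ws"
proof -
  let ?E = "card (set (wedges ws))" and ?l = "length ws - 1"
  have 1: "card (set ws) = Suc (nmi ws)"
    using card_set_walk[OF ne] opn_empty[OF two] by simp
  have 2: "nmi ws \<le> ?E" using card_wedges_ge[of ws] 1 by simp
  have 3: "2 * ?E \<le> ?l" using count_ge_two_length[OF two] by simp
  have 4: "?l = 2 * nmi ws + noth ws" using length_walk_count[OF ne] 1 by simp
  obtain d where d: "?E = nmi ws + d" using 2 le_Suc_ex by blast
  obtain q where q: "?l = 2 * ?E + q" using 3 le_Suc_ex by blast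
  have o: "noth ws = 2 * d + q" using 4 d q by simp
  have "s ^ (2 * ?E) * L ^ (?l - 2 * ?E) = s ^ (2 * nmi ws) * (s ^ (2 * d) * L ^ q)"
    unfolding q by (simp add: d power_add add_mult_distrib2 mult.assoc)
  also have "\<dots> \<le> s ^ (2 * nmi ws) * (L ^ (2 * d) * L ^ q)"
  proof -
    have "s ^ (2 * d) \<le> L ^ (2 * d)" using s by (intro power_mono) auto
    then show ?thesis using s by (intro mult_left_mono mult_right_mono) auto
  qed
  also have "\<dots> = s ^ (2 * nmi ws) * L ^ noth ws" by (simp add: o power_add mult.assoc)
  finally show ?thesis .
qed

section \<open>Tree walks\<close>

text \<open>
  A good walk explores a tree depth-first: every step reaches a new vertex or goes back along the
  path \<open>stk ws\<close> that leads from the starting vertex to the current one. The height of this path is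
  a Dyck path, and \<open>dyck r h\<close> counts the ways to descend from height \<open>h\<close> to 0 in \<open>r\<close> steps.
\<close>

fun stk :: "nat list \<Rightarrow> nat list" where
  "stk (i # j # ws) = (if i \<notin> set (j # ws) then i # stk (j # ws) else tl (stk (j # ws)))"
| "stk ws = ws"

fun good :: "nat list \<Rightarrow> bool" where
  "good (i # j # ws) \<longleftrightarrow> good (j # ws) \<and> (i \<notin> set (j # ws) \<or> (\<exists>r. stk (j # ws) = j # i # r))"
| "good ws \<longleftrightarrow> True"

text \<open>All invariants are proved in one induction. The last one is a count: with
  \<open>u\<close> steps up and \<open>p\<close> steps back, the walk has \<open>1 + u + p\<close>
  entries, the stack \<open>1 + u - p\<close>, and there are \<open>1 + u\<close> vertices.\<close>

lemma good_stk:
  assumes "good ws" "ws \<noteq> []"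
  shows "stk ws \<noteq> [] \<and> hd (stk ws) = hd ws \<and> last (stk ws) = last ws \<and> distinct (stk ws) \<and>
    set (stk ws) \<subseteq> set ws \<and> opn ws = set (wedges (stk ws)) \<and>
    length ws + length (stk ws) = 2 * card (set ws)"
  using assms
proof (induction ws rule: wedges.induct)
  case (1 i j ws)
  let ?w = "j # ws"
  have IH: "stk ?w \<noteq> []" "hd (stk ?w) = j" "last (stk ?w) = last ?w" "distinct (stk ?w)"
    "set (stk ?w) \<subseteq> set ?w" "opn ?w = set (wedges (stk ?w))" "length ?w + length (stk ?w) = 2 * card (set ?w)"
    using 1 by auto
  obtain r where r: "stk ?w = j # r" using IH(1,2) by (metis list.collapse)
  show ?case
  proof (cases "i \<in> set ?w")
    case False
    then have "stk (i # ?w) = i # j # r" using r by simp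
    moreover have "opn (i # ?w) = insert (eg i j) (set (wedges (j # r)))"
      using False IH(6) r by simp
    moreover have "length (i # ?w) + length (stk (i # ?w)) = 2 * card (set (i # ?w))"
      using False IH(7) r by (simp add: card_set_Cons[of i] del: list.set)
    ultimately show ?thesis
      using False IH r by auto
  next
    case True
    then obtain r' where r': "stk ?w = j # i # r'" using 1(2) by auto
    have s: "stk (i # ?w) = i # r'" using True r' by simp
    have "j \<notin> set (i # r')" using IH(4) r' by simp
    then have "eg i j \<notin> set (wedges (i # r'))" using wedges_inc[of "eg i j" "i # r'" j] by auto
    then have "opn (i # ?w) = set (wedges (i # r'))"
      using True IH(6) r' by (simp add: eg_commute[of j i])
    moreover have "length (i # ?w) + length (stk (i # ?w)) = 2 * card (set (i # ?w))"
      using True IH(7) r' by (simp add: card_set_Cons[of i] del: list.set)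
    ultimately show ?thesis
      using IH r' s by auto
  qed
qed auto

lemma good_closed_iff:
  assumes "good ws" "ws \<noteq> []"
  shows "hd ws = last ws \<longleftrightarrow> length (stk ws) = 1"
proof -
  note * = good_stk[OF assms]
  obtain a r where r: "stk ws = a # r" using * by (meson list.exhaust)
  show ?thesis
  proof
    assume "hd ws = last ws"
    then have "a = last (a # r)" using * r by (metis list.sel(1))
    moreover have "distinct (a # r)" using * r by metis
    ultimately have "r = []" by (cases r) (auto split: if_splits)
    then show "length (stk ws) = 1" using r by simp
  next
    assume "length (stk ws) = 1"
    then have "r = []" using r by simp
    then show "hd ws = last ws" using * r by (metis last.simps list.sel(1))
  qed
qed

text \<open>As long as the walk is good, its open edges are those of the stack, and only the topmost
  of them meets the current vertex. A closing step therefore has to go back along the stack.\<close>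

lemma noth_zero_good: "noth ws = 0 \<Longrightarrow> good ws"
proof (induction ws rule: wedges.induct)
  case (1 i j ws)
  let ?w = "j # ws"
  have z: "noth ?w = 0" "i \<in> set ?w \<Longrightarrow> eg i j \<in> opn ?w" using "1.prems" by (auto split: if_splits)
  have g: "good ?w" using 1 z(1) by blast
  show ?case
  proof (cases "i \<in> set ?w")
    case True
    note * = good_stk[OF g list.distinct(2)]
    have e: "eg i j \<in> set (wedges (stk ?w))" using z(2)[OF True] * by metis
    obtain r where r: "stk ?w = j # r" using * by (metis list.collapse list.sel(1))
    have ne: "r \<noteq> []" using e r by auto
    then obtain k r' where r': "r = k # r'" by (cases r) auto
    have "j \<notin> set (k # r')" using * r r' by (metis distinct.simps(2))
    then have "eg i j \<notin> set (wedges (k # r'))" using wedges_inc[of "eg i j" "k # r'" j] by auto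
    then have "eg i j = eg j k" using e r r' by auto
    then have "i = k" by (metis eg_commute eg_inject)
    then show ?thesis using g r r' by auto
  next
    case False
    then show ?thesis using g by simp
  qed
qed auto

text \<open>A step back uses an edge that is still open, so its multiplicity goes from one to two
  and never further.\<close>

lemma good_count:
  assumes "good ws" "e \<in> set (wedges ws)"
  shows "count_list (wedges ws) e = (if e \<in> opn ws then 1 else 2)"
  using assms
proof (induction ws rule: wedges.induct)
  case (1 i j ws)
  let ?w = "j # ws"
  have g: "good ?w" using 1(2) by simp
  show ?case
  proof (cases "i \<in> set ?w")
    case False
    have new: "eg i j \<notin> set (wedges ?w)" using wedges_inc[of "eg i j" ?w i] False by auto
    then show ?thesis using 1 g False opn_subset[of ?w] by (auto simp: count_list_0_iff)
  next
    case True
    then obtain r' where r': "stk ?w = j # i # r'" using 1(2) by auto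
    have "opn ?w = set (wedges (stk ?w))" using good_stk[OF g] by simp
    then have "eg i j \<in> opn ?w" by (simp add: r' eg_commute)
    then have "count_list (wedges ?w) (eg i j) = 1" by (rule opn_count)
    then show ?thesis using 1 g True by auto
  qed
qed auto

text \<open>Going back along an edge multiplies \<open>A i j\<close> by its conjugate, which yields
  the real number \<open>(norm (A i j))\<^sup>2\<close>. It can be pulled out of the product in
  spite of noncommutativity.\<close>

lemma good_wprod:
  assumes "good ws" "ws \<noteq> []" "set ws \<subseteq> {..<n}" "hermitian n A"
  shows "\<exists>c\<ge>0. wprod A ws = c *\<^sub>R wprod A (stk ws)"
  using assms
proof (induction ws rule: wedges.induct)
  case (1 i j ws)
  let ?w = "j # ws"
  have g: "good ?w" using 1(2) by simp
  obtain c where c: "c \<ge> 0" "wprod A ?w = c *\<^sub>R wprod A (stk ?w)"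
    using 1 by auto
  obtain r where r: "stk ?w = j # r" using good_stk[OF g] by (metis list.collapse list.discI list.sel(1))
  show ?case
  proof (cases "i \<in> set ?w")
    case False
    then have "wprod A (i # ?w) = c *\<^sub>R wprod A (stk (i # ?w))"
      using c r by (simp add: qmul.scaleR_right)
    then show ?thesis using c(1) by blast
  next
    case True
    then obtain r' where r': "stk ?w = j # i # r'" using 1(2) by auto
    have s: "stk (i # ?w) = i # r'" using True r' by simp
    have "A j i = quat_conj (A i j)" using 1 by (intro hermitianD[OF assms(4)]) auto
    then have "qmul (A i j) (qmul (A j i) (wprod A (i # r'))) = (norm (A i j))\<^sup>2 *\<^sub>R wprod A (i # r')"
      by (simp add: qmul_conj_self qmul.scaleR_left flip: qmul_assoc)
    then have "wprod A (i # ?w) = (c * (norm (A i j))\<^sup>2) *\<^sub>R wprod A (stk (i # ?w))"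
      using c(2) unfolding s r' by (simp add: qmul.scaleR_right)
    then show ?thesis using c(1) by (intro exI[of _ "c * (norm (A i j))\<^sup>2"]) auto
  qed
qed (auto intro: exI[of _ 1])

lemma good_wprod_norm:
  assumes "good ws" "ws \<noteq> []" "set ws \<subseteq> {..<n}" "hermitian n A" "hd ws = last ws"
  shows "wprod A ws = norm (wprod A ws) *\<^sub>R qone"
proof -
  obtain c where c: "c \<ge> 0" "wprod A ws = c *\<^sub>R wprod A (stk ws)"
    using good_wprod assms by blast
  obtain a where "stk ws = [a]"
    using good_closed_iff[OF assms(1,2)] assms(5) by (auto simp: length_Suc_conv)
  then have "wprod A ws = c *\<^sub>R qone" using c by simp
  then show ?thesis using c(1) by simp
qed

fun dyck :: "nat \<Rightarrow> nat \<Rightarrow> nat" where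
  "dyck 0 h = (if h = 0 then 1 else 0)"
| "dyck (Suc r) h = (if h = 0 then 0 else dyck r (h - 1)) + dyck r (Suc h)"

text \<open>Good extensions by \<open>r\<close> further steps (at the head of the list) of walks in
  \<open>S\<close>, ending at height \<open>h\<close>. Starting from a single vertex this gives good
  closed walks; starting from those it gives good walks that return halfway.\<close>

definition gext :: "nat list set \<Rightarrow> nat \<Rightarrow> nat \<Rightarrow> nat \<Rightarrow> nat list set" where
  "gext S n r h = {ws. \<exists>us v. ws = us @ v \<and> v \<in> S \<and> length us = r \<and> set us \<subseteq> {..<n} \<and>
     good ws \<and> length (stk ws) = Suc h}"

lemma good_suffix: "good (us @ v) \<Longrightarrow> v \<noteq> [] \<Longrightarrow> good v"
proof (induction us)
  case (Cons u us)
  then show ?case by (cases "us @ v") auto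
qed auto

lemma finite_gext: "finite S \<Longrightarrow> finite (gext S n r h)"
proof (rule finite_subset)
  show "gext S n r h \<subseteq> (\<lambda>(us, v). us @ v) ` ({us. set us \<subseteq> {..<n} \<and> length us = r} \<times> S)"
    by (auto simp: gext_def)
qed (auto intro: finite_lists_length_eq)

lemma gext_0:
  assumes "\<And>v. v \<in> S \<Longrightarrow> good v \<and> length (stk v) = 1"
  shows "gext S n 0 h = (if h = 0 then S else {})"
  using assms by (auto simp: gext_def)

lemma gext_Suc:
  assumes S: "\<And>v. v \<in> S \<Longrightarrow> v \<noteq> [] \<and> set v \<subseteq> {..<n}"
  shows "gext S n (Suc r) h =
    (\<Union>w\<in>(if h = 0 then {} else gext S n r (h - 1)). (\<lambda>i. i # w) ` ({..<n} - set w)) \<union>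
    (\<lambda>w. stk w ! 1 # w) ` gext S n r (Suc h)" (is "?L = ?P \<union> ?M")
proof (rule subset_antisym; rule subsetI)
  fix ws assume "ws \<in> ?L"
  then obtain us v where ws: "ws = us @ v" "v \<in> S" "length us = Suc r" "set us \<subseteq> {..<n}" "good ws"
      "length (stk ws) = Suc h"
    by (auto simp: gext_def)
  then obtain i us' where us: "us = i # us'" by (cases us) auto
  define w where "w = us' @ v"
  have wne: "w \<noteq> []" using S[OF ws(2)] by (simp add: w_def)
  then obtain j w' where w': "w = j # w'" by (cases w) auto
  have wsw: "ws = i # w" by (simp add: ws us w_def)
  have gw: "good w" using ws(5) wsw w' by simp
  have in': "w \<in> gext S n r h'" if "length (stk w) = Suc h'" for h'
    using that ws us gw unfolding gext_def w_def by auto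
  show "ws \<in> ?P \<union> ?M"
  proof (cases "i \<in> set w")
    case False
    then have "stk ws = i # stk w" using wsw w' by simp
    then have h: "length (stk w) = h" using ws(6) by simp
    have "stk w \<noteq> []" using good_stk[OF gw wne] by simp
    then have "h \<noteq> 0" using h by auto
    then have "w \<in> gext S n r (h - 1)" using in' h by simp
    then show ?thesis using \<open>h \<noteq> 0\<close> False wsw ws us by auto
  next
    case True
    then obtain q where q: "stk w = j # i # q" using ws(5) wsw w' by auto
    have "stk ws = i # q" using True wsw w' q by simp
    then have "w \<in> gext S n r (Suc h)" using ws(6) q by (intro in') simp
    then show ?thesis using q wsw by (intro UnI2 image_eqI[of _ _ w]) auto
  qed
next
  fix ws assume "ws \<in> ?P \<union> ?M"
  then consider (P) w i where "h \<noteq> 0" "w \<in> gext S n r (h - 1)" "i < n" "i \<notin> set w" "ws = i # w"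
    | (M) w where "w \<in> gext S n r (Suc h)" "ws = stk w ! 1 # w"
    by (auto split: if_splits)
  then show "ws \<in> ?L"
  proof cases
    case P
    then obtain us v where w: "w = us @ v" "v \<in> S" "length us = r" "set us \<subseteq> {..<n}" "good w" "length (stk w) = h"
      by (auto simp: gext_def)
    have "w \<noteq> []" using S w by auto
    then obtain j w' where w': "w = j # w'" by (cases w) auto
    have "good ws" "length (stk ws) = Suc h" using P(3-5) w(5,6) w' by auto
    then show ?thesis using P w unfolding gext_def by (intro CollectI exI[of _ "i # us"] exI[of _ v]) auto
  next
    case M
    then obtain us v where w: "w = us @ v" "v \<in> S" "length us = r" "set us \<subseteq> {..<n}" "good w" "length (stk w) = Suc (Suc h)"
      by (auto simp: gext_def)
    have wne: "w \<noteq> []" using S w by auto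
    then obtain j w' where w': "w = j # w'" by (cases w) auto
    note * = good_stk[OF w(5) wne]
    obtain i q where q: "stk w = j # i # q"
      using * w(6) w' by (metis length_Suc_conv list.sel(1))
    have i: "i \<in> set w" using * q by auto
    then have "i < n" using w S[OF w(2)] by auto
    have ws: "ws = i # w" using M q by simp
    then have "good ws" "length (stk ws) = Suc h" using w(5,6) w' q i by auto
    then show ?thesis using ws w \<open>i < n\<close> unfolding gext_def by (intro CollectI exI[of _ "i # us"] exI[of _ v]) auto
  qed
qed

lemma card_gext_Suc:
  assumes S: "\<And>v. v \<in> S \<Longrightarrow> v \<noteq> [] \<and> set v \<subseteq> {..<n}" and fin: "finite S"
  shows "card (gext S n (Suc r) h) =
    (if h = 0 then 0 else \<Sum>w\<in>gext S n r (h - 1). n - card (set w)) + card (gext S n r (Suc h))"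
proof -
  let ?P = "\<Union>w\<in>(if h = 0 then {} else gext S n r (h - 1)). (\<lambda>i. i # w) ` ({..<n} - set w)"
  let ?M = "(\<lambda>w. stk w ! 1 # w) ` gext S n r (Suc h)"
  have sub: "set w \<subseteq> {..<n}" if "w \<in> gext S n r h'" for w h'
    using that S by (force simp: gext_def)
  have disj: "?P \<inter> ?M = {}"
  proof -
    have "stk w ! 1 \<in> set w" if "w \<in> gext S n r (Suc h)" for w
    proof -
      have "good w" "w \<noteq> []" "length (stk w) = Suc (Suc h)" using that S by (auto simp: gext_def)
      then show ?thesis using good_stk[of w] by (metis Suc_less_eq nth_mem subsetD zero_less_Suc One_nat_def)
    qed
    then show ?thesis by (auto split: if_splits)
  qed
  have "card ?P = (if h = 0 then 0 else \<Sum>w\<in>gext S n r (h - 1). n - card (set w))"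
  proof (cases "h = 0")
    case False
    have "card ?P = (\<Sum>w\<in>gext S n r (h - 1). card ((\<lambda>i. i # w) ` ({..<n} - set w)))"
      using False by (simp, intro card_UN_disjoint) (auto simp: finite_gext fin)
    also have "\<dots> = (\<Sum>w\<in>gext S n r (h - 1). n - card (set w))"
      using sub by (intro sum.cong refl) (simp add: card_image inj_on_def card_Diff_subset)
    finally show ?thesis using False by simp
  qed simp
  moreover have "card ?M = card (gext S n r (Suc h))"
    by (rule card_image) (auto simp: inj_on_def)
  moreover have "finite ?P" "finite ?M" by (auto simp: finite_gext fin)
  ultimately show ?thesis
    using gext_Suc[OF S, where r = r and h = h] card_Un_disjoint[OF _ _ disj] by simp
qed

text \<open>The last step is a step up from height \<open>h - 1\<close> or a step back from height
  \<open>h + 1\<close>; this is the recursion of \<open>dyck\<close>. A step back is determined,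
  while each of the \<open>(r + h) / 2\<close> steps up has between \<open>n - (N + r)\<close> and
  \<open>n\<close> choices.\<close>

lemma card_gext_bounds:
  assumes S: "\<And>v. v \<in> S \<Longrightarrow> v \<noteq> [] \<and> set v \<subseteq> {..<n} \<and> good v \<and> length (stk v) = 1 \<and> length v \<le> N"
    and fin: "finite S" and n: "0 < n" and N: "N + r \<le> n"
  shows "card (gext S n r h) \<le> card S * real (dyck r h) * sqrt n ^ (r + h)"
    and "(1 - (real N + real r) / real n) ^ r * card S * real (dyck r h) * sqrt n ^ (r + h) \<le> card (gext S n r h)"
proof -
  define x where "x = sqrt (real n)"
  have x: "x > 0" "x * x = n" using n by (auto simp: x_def)
  have S': "\<And>v. v \<in> S \<Longrightarrow> v \<noteq> [] \<and> set v \<subseteq> {..<n}" using S by blast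
  have "card (gext S n r h) \<le> card S * real (dyck r h) * x ^ (r + h)" for h
  proof (induction r arbitrary: h)
    case 0
    then show ?case using gext_0[of S n h] S by auto
  next
    case (Suc r)
    have 1: "real (if h = 0 then 0 else \<Sum>w\<in>gext S n r (h - 1). n - card (set w)) \<le>
        card S * real (if h = 0 then 0 else dyck r (h - 1)) * x ^ (Suc r + h)"
    proof (cases h)
      case (Suc h')
      have "real (\<Sum>w\<in>gext S n r h'. n - card (set w)) \<le> real (\<Sum>w\<in>gext S n r h'. n)"
        by (intro of_nat_mono sum_mono) auto
      also have "\<dots> = x * x * card (gext S n r h')" by (simp add: x(2))
      also have "\<dots> \<le> x * x * (card S * real (dyck r h') * x ^ (r + h'))"
        using x by (intro mult_left_mono Suc.IH) auto
      finally show ?thesis by (simp add: \<open>h = Suc h'\<close> mult_ac)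
    qed simp
    have "real (card (gext S n r (Suc h))) \<le> card S * real (dyck r (Suc h)) * x ^ (Suc r + h)"
      using Suc.IH[of "Suc h"] by simp
    then show ?case
      using 1 by (subst card_gext_Suc[OF S' fin]) (simp_all add: algebra_simps)
  qed
  then show "card (gext S n r h) \<le> card S * real (dyck r h) * sqrt n ^ (r + h)"
    by (simp add: x_def)
  define q where "q = 1 - (real N + real r) / real n"
  have q: "0 \<le> q" "q \<le> 1" using n N by (auto simp: q_def field_simps)
  have "q ^ r' * card S * real (dyck r' h) * x ^ (r' + h) \<le> card (gext S n r' h)" if "r' \<le> r" for r' h
    using that
  proof (induction r' arbitrary: h)
    case 0
    then show ?case using gext_0[of S n h] S by auto
  next
    case (Suc r')
    have 1: "q ^ Suc r' * card S * real (if h = 0 then 0 else dyck r' (h - 1)) * x ^ (Suc r' + h) \<le>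
      real (if h = 0 then 0 else \<Sum>w\<in>gext S n r' (h - 1). n - card (set w))"
    proof (cases h)
      case (Suc h')
      have "q ^ Suc r' * card S * real (dyck r' h') * x ^ (Suc r' + h)
          = q * (x * x) * (q ^ r' * card S * real (dyck r' h') * x ^ (r' + h'))"
        by (simp add: Suc mult_ac)
      also have "\<dots> \<le> q * (x * x) * card (gext S n r' h')"
        using x q Suc.IH[of h'] \<open>Suc r' \<le> r\<close> by (intro mult_left_mono) auto
      also have "\<dots> = (\<Sum>w\<in>gext S n r' h'. real n - (real N + real r))"
        using n by (simp add: x(2) q_def field_simps)
      also have "\<dots> \<le> (\<Sum>w\<in>gext S n r' h'. real (n - card (set w)))"
      proof (intro sum_mono)
        fix w assume "w \<in> gext S n r' h'"
        then have "length w \<le> N + r" using S \<open>Suc r' \<le> r\<close> by (force simp: gext_def)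
        then have "card (set w) \<le> N + r" using card_length[of w] by linarith
        then show "real n - (real N + real r) \<le> real (n - card (set w))" using N by simp
      qed
      finally show ?thesis by (simp add: Suc)
    qed simp
    have "q ^ Suc r' * card S * real (dyck r' (Suc h)) * x ^ (Suc r' + h) \<le>
        1 * (q ^ r' * card S * real (dyck r' (Suc h)) * x ^ (r' + Suc h))"
    proof -
      have "q * (q ^ r' * card S * real (dyck r' (Suc h)) * x ^ (r' + Suc h)) \<le>
        1 * (q ^ r' * card S * real (dyck r' (Suc h)) * x ^ (r' + Suc h))"
        using q x by (intro mult_right_mono) auto
      then show ?thesis by (simp add: mult_ac)
    qed
    also have "\<dots> \<le> real (card (gext S n r' (Suc h)))"
      using Suc.IH[of "Suc h"] Suc.prems by simp
    finally show ?case
      using 1 by (subst card_gext_Suc[OF S' fin]) (simp_all add: algebra_simps)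
  qed
  then show "(1 - (real N + real r) / real n) ^ r * card S * real (dyck r h) * sqrt n ^ (r + h) \<le> card (gext S n r h)"
    by (simp add: x_def q_def)
qed

definition gcw :: "nat \<Rightarrow> nat \<Rightarrow> nat \<Rightarrow> nat list set" where
  "gcw n s l = {ws \<in> cwalks n s l. good ws}"

definition gdw :: "nat \<Rightarrow> nat \<Rightarrow> nat \<Rightarrow> nat list set" where
  "gdw n s l = {ws \<in> dwalks n s l. good ws}"

lemma gcw_gext:
  assumes "s < n"
  shows "gcw n s l = gext {[s]} n l 0"
proof (rule subset_antisym; rule subsetI)
  fix ws assume "ws \<in> gcw n s l"
  then have ws: "length ws = Suc l" "set ws \<subseteq> {..<n}" "last ws = s" "hd ws = s" "good ws"
    by (auto simp: gcw_def cwalks_def walks_def lists_n_def)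
  then have ne: "ws \<noteq> []" by auto
  have "ws = butlast ws @ [s]" using ws ne by (metis append_butlast_last_id)
  moreover have "length (stk ws) = Suc 0" using good_closed_iff[OF ws(5) ne] ws by simp
  moreover have "set (butlast ws) \<subseteq> {..<n}" using ws by (meson in_set_butlastD subset_code(1))
  ultimately show "ws \<in> gext {[s]} n l 0"
    using ws unfolding gext_def by (intro CollectI exI[of _ "butlast ws"] exI[of _ "[s]"]) auto
next
  fix ws assume "ws \<in> gext {[s]} n l 0"
  then obtain us where ws: "ws = us @ [s]" "length us = l" "set us \<subseteq> {..<n}" "good ws" "length (stk ws) = 1"
    by (auto simp: gext_def)
  then have "hd ws = last ws" using good_closed_iff[of ws] by simp
  then show "ws \<in> gcw n s l"
    using ws assms by (auto simp: gcw_def cwalks_def walks_def lists_n_def)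
qed

lemma gdw_gext:
  assumes "s < n"
  shows "gdw n s l = gext (gcw n s l) n l 0"
proof (rule subset_antisym; rule subsetI)
  fix ws assume "ws \<in> gdw n s l"
  then have ws: "length ws = Suc (2 * l)" "set ws \<subseteq> {..<n}" "last ws = s" "hd ws = s" "good ws" "ws ! l = s"
    by (auto simp: gdw_def dwalks_def cwalks_def walks_def lists_n_def)
  then have ne: "ws \<noteq> []" by auto
  have "length (stk ws) = Suc 0" using good_closed_iff[OF ws(5) ne] ws by simp
  moreover have "drop l ws \<in> gcw n s l"
    using ws set_drop_subset[of l ws] good_suffix[of "take l ws" "drop l ws"]
    by (auto simp: gcw_def cwalks_def walks_def lists_n_def hd_drop_conv_nth)
  moreover have "set (take l ws) \<subseteq> {..<n}" using ws set_take_subset[of l ws] by blast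
  ultimately show "ws \<in> gext (gcw n s l) n l 0"
    using ws unfolding gext_def by (intro CollectI exI[of _ "take l ws"] exI[of _ "drop l ws"]) auto
next
  fix ws assume "ws \<in> gext (gcw n s l) n l 0"
  then obtain us v where ws: "ws = us @ v" "v \<in> gcw n s l" "length us = l" "set us \<subseteq> {..<n}" "good ws" "length (stk ws) = 1"
    by (auto simp: gext_def)
  then have v: "length v = Suc l" "set v \<subseteq> {..<n}" "last v = s" "hd v = s" "v \<noteq> []"
    by (auto simp: gcw_def cwalks_def walks_def lists_n_def)
  then have "hd ws = last ws" using good_closed_iff[of ws] ws by simp
  moreover have "ws ! l = s" using ws(1,3) v by (auto simp: nth_append hd_conv_nth)
  ultimately show "ws \<in> gdw n s l"
    using ws v by (auto simp: gdw_def dwalks_def cwalks_def walks_def lists_n_def)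
qed

lemma gcw_card:
  assumes s: "s < n" and n: "l + 1 \<le> n"
  shows "card (gcw n s l) \<le> real (dyck l 0) * sqrt n ^ l"
    and "(1 - (real l + 1) / real n) ^ l * real (dyck l 0) * sqrt n ^ l \<le> card (gcw n s l)"
  using card_gext_bounds[of "{[s]}" n 1 l 0] s n by (auto simp: gcw_gext add_ac)

text \<open>The main term of the second moment is the square of that of the first moment, so that
  the leading parts cancel in the variance.\<close>

lemma gdw_card:
  assumes s: "s < n" and n: "2 * l + 1 \<le> n"
  shows "card (gdw n s l) \<le> (real (dyck l 0))\<^sup>2 * sqrt n ^ (2 * l)"
proof -
  have S: "v \<noteq> [] \<and> set v \<subseteq> {..<n} \<and> good v \<and> length (stk v) = 1 \<and> length v \<le> Suc l" if "v \<in> gcw n s l" for v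
  proof -
    have v: "length v = Suc l" "set v \<subseteq> {..<n}" "last v = s" "hd v = s" "good v"
      using that by (auto simp: gcw_def cwalks_def walks_def lists_n_def)
    then have "v \<noteq> []" by auto
    then show ?thesis using good_closed_iff[of v] v by auto
  qed
  have e: "x ^ (2 * l) = x ^ l * x ^ l" for x :: real by (simp add: mult_2 power_add)
  have fin: "finite (gcw n s l)" by (simp add: gcw_def)
  note b = card_gext_bounds[of "gcw n s l" n "Suc l" l 0, OF S fin]
  have "card (gdw n s l) \<le> card (gcw n s l) * real (dyck l 0) * sqrt n ^ l"
    using b(1) s n by (simp add: gdw_gext)
  also have "\<dots> \<le> (real (dyck l 0) * sqrt n ^ l) * real (dyck l 0) * sqrt n ^ l"
    using gcw_card(1)[OF s, of l] n by (intro mult_right_mono) auto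
  finally show "card (gdw n s l) \<le> (real (dyck l 0))\<^sup>2 * sqrt n ^ (2 * l)"
    unfolding e power2_eq_square by (simp add: mult_ac)
qed

section \<open>Trace moments of bounded arrays\<close>

text \<open>The diagonal is set to zero because its entries have another law and possibly no
  moments; it returns through \<open>pmat\<close>.\<close>

definition hm :: "(nat \<times> nat \<Rightarrow> quaternion) \<Rightarrow> nat \<Rightarrow> nat \<Rightarrow> quaternion" where
  "hm Y i j = (if i < j then Y (i, j) else if j < i then quat_conj (Y (j, i)) else 0)"

lemma hermitian_hm [simp]: "hermitian n (hm Y)"
  unfolding hermitian_def hm_def by auto

lemma norm_hm: "norm (hm Y i j) = (if i = j then 0 else norm (Y (eg i j)))"
  by (auto simp: hm_def eg_def)

definition proper :: "nat list \<Rightarrow> bool" where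
  "proper ws \<longleftrightarrow> (\<forall>e\<in>set (wedges ws). fst e < snd e)"

lemma fst_eg_less: "fst (eg i j) < snd (eg i j) \<longleftrightarrow> i \<noteq> j"
  by (auto simp: eg_def)

lemma proper_Cons: "proper (i # j # ws) \<longleftrightarrow> i \<noteq> j \<and> proper (j # ws)"
  by (auto simp: proper_def fst_eg_less)

lemma wprod_improper: "\<not> proper ws \<Longrightarrow> wprod (hm Y) ws = 0"
proof (induction ws rule: wedges.induct)
  case (1 i j ws)
  then show ?case
    by (cases "i = j") (auto simp: proper_Cons hm_def qmul.zero_left qmul.zero_right)
qed (auto simp: proper_def)

lemma norm_wprod_list: "proper ws \<Longrightarrow> norm (wprod (hm Y) ws) = (\<Prod>e\<leftarrow>wedges ws. norm (Y e))"
  by (induction ws rule: wedges.induct) (auto simp: proper_Cons norm_qmul norm_hm)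

lemma prod_list_map_eq_prod_count:
  fixes f :: "'a \<Rightarrow> 'b :: comm_monoid_mult"
  shows "(\<Prod>x\<leftarrow>xs. f x) = (\<Prod>x\<in>set xs. f x ^ count_list xs x)"
proof (induction xs)
  case (Cons a xs)
  show ?case
  proof (cases "a \<in> set xs")
    case True
    have "(\<Prod>x\<in>set xs. f x ^ count_list (a # xs) x) = (\<Prod>x\<in>set xs. (if x = a then f a else 1) * f x ^ count_list xs x)"
      by (intro prod.cong) auto
    then show ?thesis using True Cons by (simp add: prod.distrib insert_absorb)
  next
    case False
    have "(\<Prod>x\<in>set xs. f x ^ count_list (a # xs) x) = (\<Prod>x\<in>set xs. f x ^ count_list xs x)"
      using False by (intro prod.cong) auto
    then show ?thesis using False Cons by (simp add: count_list_0_iff)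
  qed
qed simp

lemma norm_wprod: "proper ws \<Longrightarrow>
  norm (wprod (hm Y) ws) = (\<Prod>e\<in>set (wedges ws). norm (Y e) ^ count_list (wedges ws) e)"
  by (simp add: norm_wprod_list prod_list_map_eq_prod_count)

lemma wprod_update_fresh:
  "e \<notin> set (wedges ws) \<Longrightarrow> wprod (hm (Y(e := y))) ws = wprod (hm Y) ws"
proof (induction ws rule: wedges.induct)
  case (1 i j ws)
  then have "hm (Y(e := y)) i j = hm Y i j"
    by (auto simp: hm_def eg_def split: if_splits)
  then show ?case using 1 by (simp del: fun_upd_apply)
qed auto

lemma linear_hm_update: "linear (\<lambda>y. hm (Y(eg i j := y)) i j)"
  by (cases i j rule: linorder_cases)
    (auto simp: hm_def eg_def linear_quat_conj linear_id[unfolded id_def] linear_zero min_def max_def)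

text \<open>A factor that occurs once cannot be moved out of a noncommutative product, but the
  product is still real linear in it, also when the conjugate of the entry occurs.\<close>

lemma linear_wprod_update:
  "count_list (wedges ws) e = 1 \<Longrightarrow> linear (\<lambda>y. wprod (hm (Y(e := y))) ws)"
proof (induction ws rule: wedges.induct)
  case (1 i j ws)
  show ?case
  proof (cases "eg i j = e")
    case True
    then have "e \<notin> set (wedges (j # ws))" using 1(2) by (auto simp: count_list_0_iff)
    then have "(\<lambda>y. wprod (hm (Y(e := y))) (i # j # ws)) = (\<lambda>z. qmul z (wprod (hm Y) (j # ws))) \<circ> (\<lambda>y. hm (Y(e := y)) i j)"
      by (simp add: wprod_update_fresh fun_eq_iff)
    moreover have "linear (\<lambda>y. hm (Y(e := y)) i j)"
      using linear_hm_update[of Y i j] True by simp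
    moreover have "linear (\<lambda>z. qmul z (wprod (hm Y) (j # ws)))"
      by (intro linearI) (auto simp: qmul.add_left qmul.scaleR_left)
    ultimately show ?thesis by (metis linear_compose)
  next
    case False
    then have "hm (Y(e := y)) i j = hm Y i j" for y
      by (auto simp: hm_def eg_def split: if_splits)
    then have "(\<lambda>y. wprod (hm (Y(e := y))) (i # j # ws)) = (\<lambda>z. qmul (hm Y i j) z) \<circ> (\<lambda>y. wprod (hm (Y(e := y))) (j # ws))"
      by (simp add: fun_eq_iff)
    moreover have "linear (\<lambda>y. wprod (hm (Y(e := y))) (j # ws))"
      using 1 False by (simp del: fun_upd_apply)
    moreover have "linear (\<lambda>z. qmul (hm Y i j) z)"
      by (intro linearI) (auto simp: qmul.add_right qmul.scaleR_right)
    ultimately show ?thesis by (metis linear_compose)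
  qed
qed auto

lemma measurable_hm:
  assumes "i \<noteq> j \<Longrightarrow> (\<lambda>\<omega>. Y \<omega> (eg i j)) \<in> borel_measurable N"
  shows "(\<lambda>\<omega>. hm (Y \<omega>) i j) \<in> borel_measurable N"
  using assms by (cases i j rule: linorder_cases) (auto simp: hm_def eg_def min_def max_def)

lemma measurable_wprod:
  assumes "\<And>e. e \<in> set (wedges ws) \<Longrightarrow> fst e < snd e \<Longrightarrow> (\<lambda>\<omega>. Y \<omega> e) \<in> borel_measurable N"
  shows "(\<lambda>\<omega>. wprod (hm (Y \<omega>)) ws) \<in> borel_measurable N"
  using assms
proof (induction ws rule: wedges.induct)
  case (1 i j ws)
  have "(\<lambda>\<omega>. hm (Y \<omega>) i j) \<in> borel_measurable N"
    by (intro measurable_hm 1) (auto simp: fst_eg_less)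
  then show ?case using 1 by simp
qed auto

locale quat_array = prob_space M for M :: "'w measure" +
  fixes X :: "nat \<times> nat \<Rightarrow> 'w \<Rightarrow> quaternion"
  assumes indep: "indep_vars (\<lambda>_. borel) X {(j, k). j < k}"
begin

abbreviation W :: "'w \<Rightarrow> nat \<Rightarrow> nat \<Rightarrow> quaternion" where
  "W \<omega> \<equiv> hm (\<lambda>e. X e \<omega>)"

lemma X_measurable: "j < k \<Longrightarrow> X (j, k) \<in> borel_measurable M"
  using indep unfolding indep_vars_def by auto

lemma X_measurable': "fst e < snd e \<Longrightarrow> X e \<in> borel_measurable M"
  using X_measurable[of "fst e" "snd e"] by simp

lemma wprod_measurable: "(\<lambda>\<omega>. wprod (W \<omega>) ws) \<in> borel_measurable M"
  by (intro measurable_wprod X_measurable')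

lemma pw_measurable: "(\<lambda>\<omega>. pw n (W \<omega>) l s) \<in> borel_measurable M"
proof (cases "s < n")
  case True
  then show ?thesis by (auto simp: pw_walks intro!: borel_measurable_sum wprod_measurable)
next
  case False
  have *: "(\<lambda>\<omega>. hm (\<lambda>e. X e \<omega>) i j) \<in> borel_measurable M" for i j
    by (intro measurable_hm X_measurable') (simp add: fst_eg_less)
  have "(\<lambda>\<omega>. (mv n (W \<omega>) ^^ l) (bv s qone) i) \<in> borel_measurable M" for i
    by (induction l arbitrary: i) (auto simp: mv_def intro!: borel_measurable_sum borel_measurable_qmul *)
  then show ?thesis by (simp add: pw_def)
qed

end

text \<open>Only the corner of size \<open>n\<close> is constrained, so \<open>L\<close> may grow
  with \<open>n\<close>. The second moments are merely bounded, because truncation makes them depend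
  on the column; exact values are assumed separately where limits are computed.\<close>

locale bounded_quat_array = quat_array +
  fixes n :: nat and s L :: real
  assumes bound: "\<And>j k \<omega>. j < k \<Longrightarrow> k < n \<Longrightarrow> \<omega> \<in> space M \<Longrightarrow> norm (X (j, k) \<omega>) \<le> L"
    and mean: "\<And>j k. j < k \<Longrightarrow> k < n \<Longrightarrow> expectation (X (j, k)) = 0"
    and second: "\<And>j k. j < k \<Longrightarrow> k < n \<Longrightarrow> expectation (\<lambda>\<omega>. (norm (X (j, k) \<omega>))\<^sup>2) \<le> s\<^sup>2"
    and s_pos: "0 < s" and s_le: "s \<le> L"
begin

lemma L_pos: "0 < L" using s_pos s_le by linarith

lemma edge_lt: "proper ws \<Longrightarrow> set ws \<subseteq> {..<n} \<Longrightarrow> e \<in> set (wedges ws) \<Longrightarrow> fst e < snd e \<and> snd e < n"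
  using wedges_inc[of e ws "snd e"] by (auto simp: proper_def inc_def)

lemma bound': "fst e < snd e \<Longrightarrow> snd e < n \<Longrightarrow> \<omega> \<in> space M \<Longrightarrow> norm (X e \<omega>) \<le> L"
  using bound[of "fst e" "snd e"] by simp

lemma norm_wprod_le:
  assumes "set ws \<subseteq> {..<n}" "\<omega> \<in> space M"
  shows "norm (wprod (W \<omega>) ws) \<le> L ^ (length ws - 1)"
proof (cases "proper ws")
  case True
  have "norm (wprod (W \<omega>) ws) = (\<Prod>e\<leftarrow>wedges ws. norm (X e \<omega>))"
    by (simp add: norm_wprod_list True)
  also have "\<dots> \<le> L ^ length (wedges ws)"
  proof -
    have "\<forall>e\<in>set es. norm (X e \<omega>) \<le> L \<Longrightarrow> (\<Prod>e\<leftarrow>es. norm (X e \<omega>)) \<le> L ^ length es" for es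
      using L_pos by (induction es) (auto intro!: mult_mono prod_list_nonneg)
    then show ?thesis using edge_lt[OF True assms(1)] bound' assms(2) by blast
  qed
  finally show ?thesis by simp
next
  case False
  then show ?thesis using L_pos by (simp add: wprod_improper)
qed

lemma integrable_re_wprod: "set ws \<subseteq> {..<n} \<Longrightarrow> integrable M (\<lambda>\<omega>. inner qone (wprod (W \<omega>) ws))"
proof (rule integrable_const_bound[of _ "L ^ (length ws - 1)"])
  assume ws: "set ws \<subseteq> {..<n}"
  have "\<bar>inner qone (wprod (W \<omega>) ws)\<bar> \<le> L ^ (length ws - 1)" if "\<omega> \<in> space M" for \<omega>
    using Cauchy_Schwarz_ineq2[of qone "wprod (W \<omega>) ws"] norm_wprod_le[OF ws that] by simp
  then show "AE \<omega> in M. norm (inner qone (wprod (W \<omega>) ws)) \<le> L ^ (length ws - 1)"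
    by auto
qed (auto intro!: borel_measurable_inner wprod_measurable)

text \<open>An entry used once is independent of all other factors and has mean zero.\<close>

lemma expectation_wprod_single:
  assumes ws: "set ws \<subseteq> {..<n}" and e: "count_list (wedges ws) e = 1"
  shows "expectation (\<lambda>\<omega>. inner qone (wprod (W \<omega>) ws)) = 0"
proof (cases "proper ws")
  case False
  then show ?thesis by (simp add: wprod_improper)
next
  case True
  have ein: "e \<in> set (wedges ws)" using e by (metis count_list_0_iff zero_neq_one)
  have elt: "fst e < snd e" "snd e < n" using edge_lt[OF True ws ein] by auto
  \<comment> \<open>Expanding the single entry in the real basis splits the product into real
    coordinates of that entry times functions \<open>G b\<close> of the others, to which scalar
    independence applies.\<close>
  define G where "G b Y = inner qone (wprod (hm (Y(e := b))) ws)" for b Y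
  have split: "inner qone (wprod (W \<omega>) ws) = (\<Sum>b\<in>Basis. inner (X e \<omega>) b * G b (\<lambda>f. X f \<omega>))" for \<omega>
  proof -
    have lin: "linear (\<lambda>y. wprod (hm ((\<lambda>f. X f \<omega>)(e := y))) ws)"
      using e by (rule linear_wprod_update)
    have "wprod (W \<omega>) ws = wprod (hm ((\<lambda>f. X f \<omega>)(e := X e \<omega>))) ws" by (simp add: fun_upd_idem)
    also have "X e \<omega> = (\<Sum>b\<in>Basis. inner (X e \<omega>) b *\<^sub>R b)" by (simp add: euclidean_representation)
    finally show ?thesis
      by (simp add: linear_sum[OF lin] linear_scale[OF lin] inner_sum_right G_def del: fun_upd_apply)
  qed
  define J where "J = {f \<in> set (wedges ws). fst f < snd f} - {e}"
  have indJ: "indep_var (PiM {e} (\<lambda>_. borel)) (\<lambda>\<omega>. restrict (\<lambda>i. X i \<omega>) {e})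
      (PiM J (\<lambda>_. borel)) (\<lambda>\<omega>. restrict (\<lambda>i. X i \<omega>) J)"
    using elt by (intro indep_var_restrict[OF indep]) (auto simp: J_def)
  have Gm: "G b \<in> borel_measurable (PiM J (\<lambda>_. borel))" for b
    unfolding G_def
  proof (intro borel_measurable_inner measurable_wprod borel_measurable_const)
    fix f assume f: "f \<in> set (wedges ws)" "fst f < snd f"
    show "(\<lambda>Y. (Y(e := b)) f) \<in> borel_measurable (PiM J (\<lambda>_. borel))"
      using f by (cases "f = e") (auto simp: J_def intro!: measurable_component_singleton)
  qed
  \<comment> \<open>\<open>G b\<close> reads only the edges in \<open>J\<close>, as the value at
    \<open>e\<close> is overwritten; this makes it a function of the restricted family.\<close>
  have Grestr: "G b (restrict (\<lambda>i. X i \<omega>) J) = G b (\<lambda>f. X f \<omega>)" for b \<omega>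
  proof -
    have "wprod (hm ((restrict (\<lambda>i. X i \<omega>) J)(e := b))) vs = wprod (hm ((\<lambda>f. X f \<omega>)(e := b))) vs"
      if "set (wedges vs) \<subseteq> set (wedges ws)" for vs
      using that
    proof (induction vs rule: wedges.induct)
      case (1 i j vs)
      have "eg i j \<in> set (wedges ws)" using 1(2) by simp
      then have *: "hm ((restrict (\<lambda>i. X i \<omega>) J)(e := b)) i j = hm ((\<lambda>f. X f \<omega>)(e := b)) i j"
        by (cases i j rule: linorder_cases) (auto simp: hm_def J_def eg_def min_def max_def)
      have "set (wedges (j # vs)) \<subseteq> set (wedges ws)" using 1(2) by simp
      from 1(1)[OF this] show ?case by (simp only: wprod.simps *)
    qed auto
    then show ?thesis by (simp add: G_def)
  qed
  have ind: "indep_var borel (\<lambda>\<omega>. inner (X e \<omega>) b) borel (\<lambda>\<omega>. G b (\<lambda>f. X f \<omega>))" for b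
  proof -
    have "indep_var borel ((\<lambda>Y. inner (Y e) b) \<circ> (\<lambda>\<omega>. restrict (\<lambda>i. X i \<omega>) {e}))
        borel (G b \<circ> (\<lambda>\<omega>. restrict (\<lambda>i. X i \<omega>) J))"
      by (intro indep_var_compose[OF indJ] Gm borel_measurable_inner measurable_component_singleton) auto
    then show ?thesis by (simp add: comp_def Grestr)
  qed
  have iX: "integrable M (X e)"
    using bound' elt X_measurable' by (intro integrable_const_bound[of _ L]) auto
  have iXb: "integrable M (\<lambda>\<omega>. inner (X e \<omega>) b)" for b
    using iX by simp
  have EXb: "expectation (\<lambda>\<omega>. inner (X e \<omega>) b) = 0" for b
    using mean[of "fst e" "snd e"] elt iX by simp
  have iG: "integrable M (\<lambda>\<omega>. G b (\<lambda>f. X f \<omega>))" for b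
  proof (rule integrable_const_bound[of _ "\<Prod>f\<in>set (wedges ws). (max L (norm b)) ^ count_list (wedges ws) f"])
    have "\<bar>G b (\<lambda>f. X f \<omega>)\<bar> \<le> (\<Prod>f\<in>set (wedges ws). (max L (norm b)) ^ count_list (wedges ws) f)"
      if "\<omega> \<in> space M" for \<omega>
    proof -
      have "\<bar>G b (\<lambda>f. X f \<omega>)\<bar> \<le> norm (wprod (hm ((\<lambda>f. X f \<omega>)(e := b))) ws)"
        unfolding G_def using Cauchy_Schwarz_ineq2[of qone "wprod (hm ((\<lambda>f. X f \<omega>)(e := b))) ws"] by simp
      also have "\<dots> \<le> (\<Prod>f\<in>set (wedges ws). (max L (norm b)) ^ count_list (wedges ws) f)"
        unfolding norm_wprod[OF True]
      proof (intro prod_mono conjI power_mono)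
        fix f assume f: "f \<in> set (wedges ws)"
        then have "norm (X f \<omega>) \<le> L" using edge_lt[OF True ws f] bound' that by blast
        then show "norm (((\<lambda>f. X f \<omega>)(e := b)) f) \<le> max L (norm b)" by auto
      qed auto
      finally show ?thesis .
    qed
    then show "AE \<omega> in M. norm (G b (\<lambda>f. X f \<omega>)) \<le> (\<Prod>f\<in>set (wedges ws). (max L (norm b)) ^ count_list (wedges ws) f)"
      by auto
    show "(\<lambda>\<omega>. G b (\<lambda>f. X f \<omega>)) \<in> borel_measurable M"
      using ind[of b] indep_var_rv2 by blast
  qed
  have "expectation (\<lambda>\<omega>. inner qone (wprod (W \<omega>) ws)) = (\<Sum>b\<in>Basis. expectation (\<lambda>\<omega>. inner (X e \<omega>) b * G b (\<lambda>f. X f \<omega>)))"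
    unfolding split by (intro Bochner_Integration.integral_sum indep_var_integrable ind iXb iG)
  also have "\<dots> = 0"
    by (simp add: indep_var_lebesgue_integral[OF ind iXb iG] EXb)
  finally show ?thesis .
qed

lemma expectation_norm_wprod:
  assumes ws: "set ws \<subseteq> {..<n}" and pr: "proper ws"
  shows "integrable M (\<lambda>\<omega>. norm (wprod (W \<omega>) ws))"
    "expectation (\<lambda>\<omega>. norm (wprod (W \<omega>) ws)) = (\<Prod>e\<in>set (wedges ws). expectation (\<lambda>\<omega>. norm (X e \<omega>) ^ count_list (wedges ws) e))"
proof -
  let ?E = "set (wedges ws)"
  have ind: "indep_vars (\<lambda>_. borel) (\<lambda>e \<omega>. norm (X e \<omega>) ^ count_list (wedges ws) e) ?E"
  proof (rule indep_vars_compose2[where X = X and M' = "\<lambda>_. borel"])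
    show "indep_vars (\<lambda>_. borel) X ?E"
      using pr by (intro indep_vars_subset[OF indep]) (auto simp: proper_def)
  qed auto
  have int: "integrable M (\<lambda>\<omega>. norm (X e \<omega>) ^ count_list (wedges ws) e)" if "e \<in> ?E" for e
  proof (rule integrable_const_bound[of _ "L ^ count_list (wedges ws) e"])
    show "AE \<omega> in M. norm (norm (X e \<omega>) ^ count_list (wedges ws) e) \<le> L ^ count_list (wedges ws) e"
      using edge_lt[OF pr ws that] bound'[of e] by (intro AE_I2) (auto intro!: power_mono)
    show "(\<lambda>\<omega>. norm (X e \<omega>) ^ count_list (wedges ws) e) \<in> borel_measurable M"
      using edge_lt[OF pr ws that] by (intro borel_measurable_power measurable_compose[OF _ borel_measurable_norm] X_measurable') auto
  qed
  show "integrable M (\<lambda>\<omega>. norm (wprod (W \<omega>) ws))"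
    unfolding norm_wprod[OF pr] by (intro indep_vars_integrable ind int) auto
  show "expectation (\<lambda>\<omega>. norm (wprod (W \<omega>) ws)) = (\<Prod>e\<in>set (wedges ws). expectation (\<lambda>\<omega>. norm (X e \<omega>) ^ count_list (wedges ws) e))"
    unfolding norm_wprod[OF pr] by (intro indep_vars_lebesgue_integral ind int) auto
qed

lemma expectation_power_le:
  assumes e: "fst e < snd e" "snd e < n" and c: "2 \<le> c"
  shows "expectation (\<lambda>\<omega>. norm (X e \<omega>) ^ c) \<le> s\<^sup>2 * L ^ (c - 2)"
proof -
  have m: "X e \<in> borel_measurable M" using e X_measurable' by blast
  have int: "integrable M (\<lambda>\<omega>. norm (X e \<omega>) ^ k)" for k
  proof (rule integrable_const_bound[of _ "L ^ k"])
    show "AE \<omega> in M. norm (norm (X e \<omega>) ^ k) \<le> L ^ k"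
      using e bound'[of e] by (intro AE_I2) (auto intro!: power_mono)
  qed (use m in measurable)
  have "expectation (\<lambda>\<omega>. norm (X e \<omega>) ^ c) \<le> expectation (\<lambda>\<omega>. (norm (X e \<omega>))\<^sup>2 * L ^ (c - 2))"
  proof (intro integral_mono int integrable_mult_left)
    fix \<omega> assume w: "\<omega> \<in> space M"
    have "norm (X e \<omega>) ^ c = (norm (X e \<omega>))\<^sup>2 * norm (X e \<omega>) ^ (c - 2)"
      using c by (metis le_add_diff_inverse power_add)
    also have "\<dots> \<le> (norm (X e \<omega>))\<^sup>2 * L ^ (c - 2)"
      using e w bound' by (intro mult_left_mono power_mono) auto
    finally show "norm (X e \<omega>) ^ c \<le> (norm (X e \<omega>))\<^sup>2 * L ^ (c - 2)" .
  qed
  also have "\<dots> \<le> s\<^sup>2 * L ^ (c - 2)"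
    using second[of "fst e" "snd e"] e L_pos by (simp add: mult_right_mono)
  finally show ?thesis .
qed

definition valid :: "nat list \<Rightarrow> bool" where
  "valid ws \<longleftrightarrow> proper ws \<and> (\<forall>e\<in>set (wedges ws). 2 \<le> count_list (wedges ws) e)"

lemma expectation_wprod_invalid:
  assumes "set ws \<subseteq> {..<n}" "\<not> valid ws"
  shows "expectation (\<lambda>\<omega>. inner qone (wprod (W \<omega>) ws)) = 0"
proof (cases "proper ws")
  case True
  then obtain e where e: "e \<in> set (wedges ws)" "\<not> 2 \<le> count_list (wedges ws) e" using assms by (auto simp: valid_def)
  then have "count_list (wedges ws) e \<noteq> 0" by (simp add: count_list_0_iff)
  then have "count_list (wedges ws) e = 1" using e by simp
  then show ?thesis by (rule expectation_wprod_single[OF assms(1)])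
qed (simp add: wprod_improper)

text \<open>Independence factors the norm into one moment per distinct edge; two of the factors at
  each edge give the variance, the others are bounded by \<open>L\<close>.\<close>

lemma expectation_wprod_valid:
  assumes ws: "set ws \<subseteq> {..<n}" "ws \<noteq> []" and v: "valid ws"
  shows "\<bar>expectation (\<lambda>\<omega>. inner qone (wprod (W \<omega>) ws))\<bar> \<le> s ^ (2 * nmi ws) * L ^ noth ws"
proof -
  let ?E = "set (wedges ws)" and ?c = "count_list (wedges ws)"
  have pr: "proper ws" and two: "\<And>e. e \<in> ?E \<Longrightarrow> 2 \<le> ?c e" using v by (auto simp: valid_def)
  have "\<bar>expectation (\<lambda>\<omega>. inner qone (wprod (W \<omega>) ws))\<bar> \<le> expectation (\<lambda>\<omega>. \<bar>inner qone (wprod (W \<omega>) ws)\<bar>)"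
    by (rule integral_abs_bound)
  also have "\<dots> \<le> expectation (\<lambda>\<omega>. norm (wprod (W \<omega>) ws))"
  proof (intro integral_mono integrable_abs integrable_re_wprod expectation_norm_wprod ws pr)
    fix \<omega> show "\<bar>inner qone (wprod (W \<omega>) ws)\<bar> \<le> norm (wprod (W \<omega>) ws)"
      using Cauchy_Schwarz_ineq2[of qone "wprod (W \<omega>) ws"] by simp
  qed
  also have "\<dots> = (\<Prod>e\<in>?E. expectation (\<lambda>\<omega>. norm (X e \<omega>) ^ ?c e))"
    by (rule expectation_norm_wprod[OF ws(1) pr])
  also have "\<dots> \<le> (\<Prod>e\<in>?E. s\<^sup>2 * L ^ (?c e - 2))"
    using edge_lt[OF pr ws(1)] two by (intro prod_mono conjI expectation_power_le) auto
  also have "\<dots> = s ^ (2 * card ?E) * L ^ (\<Sum>e\<in>?E. ?c e - 2)"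
    by (simp add: prod.distrib power_sum power_mult)
  also have "(\<Sum>e\<in>?E. ?c e - 2) = length ws - 1 - 2 * card ?E"
  proof -
    have "(\<Sum>e\<in>?E. ?c e - 2) = (\<Sum>e\<in>?E. ?c e) - (\<Sum>e\<in>?E. 2)"
      using two by (intro sum_subtractf_nat) auto
    then show ?thesis by (simp add: sum_count_set mult.commute)
  qed
  also have "s ^ (2 * card ?E) * L ^ (length ws - 1 - 2 * card ?E) \<le> s ^ (2 * nmi ws) * L ^ noth ws"
    by (rule edge_weight_le[OF two s_pos s_le ws(2)])
  finally show ?thesis .
qed

lemma expectation_wprod_le_wt:
  assumes ws: "set ws \<subseteq> {..<n}" "ws \<noteq> []" and K: "1 \<le> K" and n: "0 < n"
  shows "\<bar>expectation (\<lambda>\<omega>. inner qone (wprod (W \<omega>) ws))\<bar> \<le> wt (s / sqrt n) (s * sqrt n) (L * K) K ws"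
proof (cases "valid ws")
  case True
  then have "opn ws = {}" by (intro opn_empty) (auto simp: valid_def)
  then show ?thesis
    using expectation_wprod_valid[OF ws True] wt_ge[of K ws s L "real n"] K ws s_pos n L_pos by force
next
  case False
  then show ?thesis
    using expectation_wprod_invalid[OF ws(1) False] s_pos L_pos K by (simp add: wt_nonneg)
qed

lemma integrable_re_pw: "r < n \<Longrightarrow> integrable M (\<lambda>\<omega>. inner qone (pw n (W \<omega>) l r))"
  by (auto simp: pw_walks inner_sum_right cwalks_def walks_def lists_n_def intro!: Bochner_Integration.integrable_sum integrable_re_wprod)

lemma expectation_re_pw: "r < n \<Longrightarrow> expectation (\<lambda>\<omega>. inner qone (pw n (W \<omega>) l r))
    = (\<Sum>ws\<in>cwalks n r l. expectation (\<lambda>\<omega>. inner qone (wprod (W \<omega>) ws)))"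
  unfolding pw_walks inner_sum_right
  by (intro Bochner_Integration.integral_sum integrable_re_wprod)
    (auto simp: cwalks_def walks_def lists_n_def)

lemma trace_moment:
  assumes k: "0 < k"
  shows "expectation (\<lambda>\<omega>. \<Sum>r<n. inner qone (pw n (W \<omega>) (2 * k) r))
    \<le> n * (2 * s * sqrt n + (2 * real k + 1) * L * (2 * real k)) ^ (2 * k)"
proof -
  have "expectation (\<lambda>\<omega>. \<Sum>r<n. inner qone (pw n (W \<omega>) (2 * k) r))
      = (\<Sum>r<n. expectation (\<lambda>\<omega>. inner qone (pw n (W \<omega>) (2 * k) r)))"
    by (intro Bochner_Integration.integral_sum integrable_re_pw) auto
  also have "\<dots> \<le> (\<Sum>r<n. (2 * s * sqrt n + (2 * real k + 1) * L * (2 * real k)) ^ (2 * k))"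
  proof (intro sum_mono)
    fix r assume "r \<in> {..<n}"
    then have r: "r < n" "0 < n" by auto
    \<comment> \<open>The parameter \<open>K\<close> is the length \<open>2 * k\<close> of the walk,
      the smallest value that the bound on open edges at a vertex allows.\<close>
    let ?w = "wt (s / sqrt n) (s * sqrt n) (L * (2 * real k)) (2 * real k)"
    have nn: "0 \<le> ?w ws" for ws
      using s_pos L_pos by (intro wt_nonneg) auto
    have "expectation (\<lambda>\<omega>. inner qone (pw n (W \<omega>) (2 * k) r)) \<le> (\<Sum>ws\<in>cwalks n r (2 * k). ?w ws)"
      unfolding expectation_re_pw[OF r(1)]
    proof (intro sum_mono)
      fix ws assume "ws \<in> cwalks n r (2 * k)"
      then have "set ws \<subseteq> {..<n}" "ws \<noteq> []" by (auto simp: cwalks_def walks_def lists_n_def)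
      then show "expectation (\<lambda>\<omega>. inner qone (wprod (W \<omega>) ws)) \<le> ?w ws"
        using expectation_wprod_le_wt[of ws "2 * real k"] k r by force
    qed
    also have "\<dots> \<le> (\<Sum>ws\<in>walks n r (2 * k). ?w ws)"
      by (intro sum_mono2 nn) (auto simp: cwalks_def)
    also have "\<dots> \<le> (2 * s * sqrt n + (real (2 * k) + 1) * L * (2 * real k)) ^ (2 * k)"
      using k s_pos L_pos r by (intro wt_sum) auto
    finally show "expectation (\<lambda>\<omega>. inner qone (pw n (W \<omega>) (2 * k) r))
      \<le> (2 * s * sqrt n + (2 * real k + 1) * L * (2 * real k)) ^ (2 * k)" by simp
  qed
  finally show ?thesis by simp
qed

end

section \<open>Limits and variances of the trace moments\<close>

lemma good_proper: "good ws \<Longrightarrow> proper ws"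
proof (induction ws rule: wedges.induct)
  case (1 i j ws)
  have g: "good (j # ws)" using 1(2) by simp
  have "i \<noteq> j"
  proof
    assume "i = j"
    then obtain r where "stk (j # ws) = j # j # r" using 1(2) by auto
    then show False using good_stk[OF g] by auto
  qed
  then show ?case using 1 g by (simp add: proper_Cons)
qed (auto simp: proper_def)

lemma dyck_odd: "odd (r + h) \<Longrightarrow> dyck r h = 0"
  by (induction r h rule: dyck.induct) (auto simp: odd_pos split: if_splits)

context bounded_quat_array
begin

context
  assumes second_eq: "\<And>j k. j < k \<Longrightarrow> k < n \<Longrightarrow> expectation (\<lambda>\<omega>. (norm (X (j, k) \<omega>))\<^sup>2) = s\<^sup>2"
begin

lemma expectation_good:
  assumes ws: "set ws \<subseteq> {..<n}" "ws \<noteq> []" "hd ws = last ws" and g: "good ws"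
  shows "expectation (\<lambda>\<omega>. inner qone (wprod (W \<omega>) ws)) = s ^ (length ws - 1)"
proof -
  let ?E = "set (wedges ws)" and ?c = "count_list (wedges ws)"
  note pr = good_proper[OF g]
  obtain a where "stk ws = [a]"
    using good_closed_iff[OF g ws(2)] ws(3) by (auto simp: length_Suc_conv)
  then have "opn ws = {}" using good_stk[OF g ws(2)] by simp
  then have c2: "?c e = 2" if "e \<in> ?E" for e using good_count[OF g that] by simp
  have "inner qone (wprod (W \<omega>) ws) = norm (wprod (W \<omega>) ws)" for \<omega>
    by (subst good_wprod_norm[OF g ws(2,1) hermitian_hm ws(3)]) (simp add: power2_norm_eq_inner[symmetric])
  then have "expectation (\<lambda>\<omega>. inner qone (wprod (W \<omega>) ws)) = (\<Prod>e\<in>?E. expectation (\<lambda>\<omega>. norm (X e \<omega>) ^ ?c e))"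
    by (simp add: expectation_norm_wprod[OF ws(1) pr])
  also have "\<dots> = (\<Prod>e\<in>?E. s ^ ?c e)"
  proof (intro prod.cong refl)
    fix e assume "e \<in> ?E"
    then show "expectation (\<lambda>\<omega>. norm (X e \<omega>) ^ ?c e) = s ^ ?c e"
      using c2 second_eq[of "fst e" "snd e"] edge_lt[OF pr ws(1)] by simp
  qed
  also have "\<dots> = s ^ (length ws - 1)"
    by (simp add: sum_count_set flip: power_sum)
  finally show ?thesis .
qed

text \<open>Good walks are evaluated exactly. A walk that is not good has some step of the third
  kind, and for even \<open>l\<close> an even number of them, hence at least two. Paying
  \<open>sqrt n\<close> instead of \<open>L\<close> for these steps therefore gains the factor
  \<open>L\<^sup>2 / n\<close>, and the weights for \<open>sqrt n\<close> still sum to the order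
  \<open>sqrt n ^ l\<close>.\<close>

lemma moment_approx:
  assumes C: "C \<subseteq> cwalks n r l" and l: "even l" "0 < l" and r: "r < n" and Ln: "L \<le> sqrt n"
  shows "\<bar>(\<Sum>ws\<in>C. expectation (\<lambda>\<omega>. inner qone (wprod (W \<omega>) ws))) - s ^ l * card {ws \<in> C. good ws}\<bar>
    \<le> L\<^sup>2 / n * (2 * s + (real l + 1) * l) ^ l * sqrt n ^ l"
proof -
  let ?e = "\<lambda>ws. expectation (\<lambda>\<omega>. inner qone (wprod (W \<omega>) ws))"
  let ?w = "wt (s / sqrt n) (s * sqrt n) (sqrt n * l) l"
  have fin: "finite C" by (rule finite_subset[OF C]) simp
  have n: "0 < n" using r by simp
  have wsC: "set ws \<subseteq> {..<n}" "ws \<noteq> []" "hd ws = last ws" "length ws = Suc l" if "ws \<in> C" for ws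
    using that C by (auto simp: cwalks_def walks_def lists_n_def)
  have split: "C = {ws \<in> C. good ws} \<union> {ws \<in> C. \<not> good ws}" by auto
  have "sum ?e C = sum ?e {ws \<in> C. good ws} + sum ?e {ws \<in> C. \<not> good ws}"
    using fin by (subst split, subst sum.union_disjoint) auto
  moreover have "sum ?e {ws \<in> C. good ws} = s ^ l * card {ws \<in> C. good ws}"
    using wsC by (simp add: expectation_good)
  ultimately have "\<bar>sum ?e C - s ^ l * card {ws \<in> C. good ws}\<bar> = \<bar>sum ?e {ws \<in> C. \<not> good ws}\<bar>"
    by simp
  also have "\<dots> \<le> (\<Sum>ws\<in>{ws \<in> C. \<not> good ws}. L\<^sup>2 / n * ?w ws)"
  proof (rule order_trans[OF sum_abs], intro sum_mono)
    fix ws assume "ws \<in> {ws \<in> C. \<not> good ws}"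
    then have wsc: "ws \<in> C" "\<not> good ws" by auto
    note ws = wsC[OF wsc(1)]
    show "\<bar>?e ws\<bar> \<le> L\<^sup>2 / n * ?w ws"
    proof (cases "valid ws")
      case True
      then have o: "opn ws = {}" by (intro opn_empty) (auto simp: valid_def)
      have "l = 2 * nmi ws + noth ws"
        using length_walk_count[OF ws(2)] card_set_walk[OF ws(2)] ws(4) o by simp
      moreover have "noth ws \<noteq> 0" using noth_zero_good wsc(2) by blast
      ultimately have "2 \<le> noth ws" using l(1) by presburger
      then obtain q where q: "noth ws = 2 + q" using le_Suc_ex by blast
      have "\<bar>?e ws\<bar> \<le> s ^ (2 * nmi ws) * L ^ noth ws"
        by (rule expectation_wprod_valid[OF ws(1,2) True])
      also have "\<dots> = L\<^sup>2 * (s ^ (2 * nmi ws) * L ^ q)" by (simp add: q power_add power2_eq_square)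
      also have "\<dots> \<le> L\<^sup>2 * (s ^ (2 * nmi ws) * sqrt n ^ q)"
        using L_pos s_pos Ln by (intro mult_left_mono power_mono) auto
      also have "\<dots> = L\<^sup>2 / n * (s ^ (2 * nmi ws) * sqrt n ^ noth ws)"
        unfolding q power_add using n by simp
      also have "\<dots> \<le> L\<^sup>2 / n * ?w ws"
        using wt_ge[of "real l" ws s "sqrt n" "real n"] l ws(2) s_pos n o by (intro mult_left_mono) auto
      finally show ?thesis .
    next
      case False
      then show ?thesis
        using expectation_wprod_invalid[OF ws(1) False] s_pos by (simp add: wt_nonneg)
    qed
  qed
  also have "\<dots> \<le> (\<Sum>ws\<in>walks n r l. L\<^sup>2 / n * ?w ws)"
    using C s_pos by (intro sum_mono2) (auto simp: cwalks_def wt_nonneg)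
  also have "\<dots> = L\<^sup>2 / n * (\<Sum>ws\<in>walks n r l. ?w ws)"
    by (simp add: sum_distrib_left)
  also have "\<dots> \<le> L\<^sup>2 / n * (2 * s * sqrt n + (real l + 1) * sqrt n * l) ^ l"
    using l s_pos n r by (intro mult_left_mono wt_sum) auto
  also have "2 * s * sqrt n + (real l + 1) * sqrt n * l = (2 * s + (real l + 1) * l) * sqrt n"
    by (simp add: algebra_simps)
  finally show ?thesis by (simp add: power_mult_distrib mult.assoc)
qed

text \<open>Collects the errors of the second moment and of twice the mean times the first moment.
  What matters is that it does not depend on \<open>n\<close>.\<close>

definition var_const :: "nat \<Rightarrow> real" where
  "var_const l = L\<^sup>2 * (2 * s + (2 * real l + 1) * (2 * l)) ^ (2 * l)
     + 2 * s ^ l * real (dyck l 0) * (s ^ l * dyck l 0 * (real l * (real l + 1)) + L\<^sup>2 * (2 * s + (real l + 1) * l) ^ l)"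

lemma integrable_re_pw_sq: "r < n \<Longrightarrow> integrable M (\<lambda>\<omega>. (inner qone (pw n (W \<omega>) l r))\<^sup>2)"
  and expectation_re_pw_sq: "r < n \<Longrightarrow> expectation (\<lambda>\<omega>. (inner qone (pw n (W \<omega>) l r))\<^sup>2)
    = (\<Sum>ws\<in>dwalks n r l. expectation (\<lambda>\<omega>. inner qone (wprod (W \<omega>) ws)))"
proof -
  assume r: "r < n"
  have eq: "(inner qone (pw n (W \<omega>) l r))\<^sup>2 = (\<Sum>ws\<in>dwalks n r l. inner qone (wprod (W \<omega>) ws))" for \<omega>
  proof -
    let ?t = "inner qone (pw n (W \<omega>) l r)"
    have "qmul (pw n (W \<omega>) l r) (pw n (W \<omega>) l r) = ?t\<^sup>2 *\<^sub>R qone"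
      by (subst (1 2) pw_real[OF r hermitian_hm]) (simp add: qmul.scaleR_left qmul.scaleR_right power2_eq_square)
    then have "inner qone (qmul (pw n (W \<omega>) l r) (pw n (W \<omega>) l r)) = ?t\<^sup>2"
      by (simp add: power2_norm_eq_inner[symmetric])
    then show ?thesis by (simp add: pw_square_walks[OF r] inner_sum_right)
  qed
  have sub: "ws \<in> dwalks n r l \<Longrightarrow> set ws \<subseteq> {..<n}" for ws
    by (auto simp: dwalks_def cwalks_def walks_def lists_n_def)
  show "integrable M (\<lambda>\<omega>. (inner qone (pw n (W \<omega>) l r))\<^sup>2)"
    unfolding eq by (intro Bochner_Integration.integrable_sum integrable_re_wprod sub)
  show "expectation (\<lambda>\<omega>. (inner qone (pw n (W \<omega>) l r))\<^sup>2)
    = (\<Sum>ws\<in>dwalks n r l. expectation (\<lambda>\<omega>. inner qone (wprod (W \<omega>) ws)))"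
    unfolding eq by (intro Bochner_Integration.integral_sum integrable_re_wprod sub)
qed

text \<open>The square is expanded around the limit instead of the expectation, so that an upper
  bound for the second moment and a lower bound for the first one suffice.\<close>

lemma pw_variance:
  assumes l: "0 < l" "2 * l + 1 \<le> n" and r: "r < n" and Ln: "L \<le> sqrt n"
  shows "expectation (\<lambda>\<omega>. (inner qone (pw n (W \<omega>) l r) / sqrt n ^ l - s ^ l * dyck l 0)\<^sup>2) \<le> var_const l / n"
proof -
  let ?Z = "\<lambda>\<omega>. inner qone (pw n (W \<omega>) l r)"
  define x where "x = sqrt (real n) ^ l"
  define m where "m = s ^ l * real (dyck l 0)"
  define t1 where "t1 = L\<^sup>2 * (2 * s + (2 * real l + 1) * (2 * l)) ^ (2 * l)"
  define t2 where "t2 = L\<^sup>2 * (2 * s + (real l + 1) * l) ^ l"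
  define R where "R = m * (real l * (real l + 1)) + t2"
  have n: "0 < n" using r by simp
  have x: "x > 0" using n by (simp add: x_def)
  have x2: "sqrt (real n) ^ (2 * l) = x\<^sup>2" by (simp add: x_def power_even_eq)
  have m: "m \<ge> 0" using s_pos by (simp add: m_def)
  have E2: "expectation (\<lambda>\<omega>. (?Z \<omega>)\<^sup>2) / x\<^sup>2 \<le> m\<^sup>2 + t1 / n"
  proof -
    have "expectation (\<lambda>\<omega>. (?Z \<omega>)\<^sup>2) \<le> s ^ (2 * l) * card (gdw n r l) + t1 / n * x\<^sup>2"
    proof -
      have "dwalks n r l \<subseteq> cwalks n r (2 * l)" by (auto simp: dwalks_def)
      from moment_approx[OF this _ _ r Ln] l
      have "\<bar>expectation (\<lambda>\<omega>. (?Z \<omega>)\<^sup>2) - s ^ (2 * l) * card (gdw n r l)\<bar> \<le> t1 / n * x\<^sup>2"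
        by (simp add: expectation_re_pw_sq[OF r] gdw_def t1_def x2)
      then show ?thesis by linarith
    qed
    also have "\<dots> \<le> s ^ (2 * l) * ((real (dyck l 0))\<^sup>2 * x\<^sup>2) + t1 / n * x\<^sup>2"
      using gdw_card[OF r l(2)] s_pos by (simp add: x2 mult_left_mono)
    also have "\<dots> = (m\<^sup>2 + t1 / n) * x\<^sup>2"
      unfolding m_def power_even_eq by (simp add: power_mult_distrib algebra_simps)
    finally show ?thesis using x by (simp add: pos_divide_le_eq)
  qed
  \<comment> \<open>The inequality is multiplied by \<open>m\<close> in order to cover odd
    \<open>l\<close>, where \<open>moment_approx\<close> does not apply but
    \<open>m = 0\<close>.\<close>
  have E1: "m * (m - (m * (real l * (real l + 1)) + t2) / n) \<le> m * (expectation ?Z / x)"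
  proof (cases "dyck l 0 = 0")
    case False
    then have ev: "even l" using dyck_odd[of l 0] by auto
    have "\<bar>expectation ?Z - s ^ l * card (gcw n r l)\<bar> \<le> t2 / n * x"
      using moment_approx[OF order_refl ev l(1) r Ln] by (simp add: expectation_re_pw[OF r] gcw_def t2_def x_def)
    then have a: "s ^ l * card (gcw n r l) - t2 / n * x \<le> expectation ?Z" by linarith
    \<comment> \<open>Bernoulli's inequality makes the loss in the number of good walks a term of
      order \<open>1 / n\<close>.\<close>
    have "1 + real l * (- ((real l + 1) / n)) \<le> (1 + (- ((real l + 1) / n))) ^ l"
      using l n by (intro Bernoulli_inequality) (auto simp: field_simps)
    then have "(1 - real l * (real l + 1) / n) * (real (dyck l 0) * x) \<le> (1 - (real l + 1) / real n) ^ l * (real (dyck l 0) * x)"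
      using x by (intro mult_right_mono) auto
    also have "\<dots> \<le> card (gcw n r l)"
      using gcw_card(2)[OF r, of l] l by (simp add: x_def mult.assoc)
    finally have "s ^ l * ((1 - real l * (real l + 1) / n) * (real (dyck l 0) * x)) \<le> s ^ l * card (gcw n r l)"
      using s_pos by (intro mult_left_mono) auto
    then have "m * (1 - real l * (real l + 1) / n) * x - t2 / n * x \<le> expectation ?Z"
      using a by (simp add: m_def mult_ac)
    then have "m * (1 - real l * (real l + 1) / n) - t2 / n \<le> expectation ?Z / x"
      using x by (simp only: pos_le_divide_eq left_diff_distrib)
    also have "m * (1 - real l * (real l + 1) / n) - t2 / n = m - (m * (real l * (real l + 1)) + t2) / n"
      using n by (simp add: field_simps)
    finally show ?thesis using m by (rule mult_left_mono)
  qed (simp add: m_def)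
  have "expectation (\<lambda>\<omega>. (?Z \<omega> / x - m)\<^sup>2) = expectation (\<lambda>\<omega>. (?Z \<omega>)\<^sup>2 / x\<^sup>2 + (- 2 * m / x) * ?Z \<omega> + m\<^sup>2)"
    using x by (intro Bochner_Integration.integral_cong refl) (simp add: power2_diff power_divide)
  also have "\<dots> = expectation (\<lambda>\<omega>. (?Z \<omega>)\<^sup>2) / x\<^sup>2 + (- 2 * m / x) * expectation ?Z + m\<^sup>2"
    using integrable_re_pw_sq[OF r, of l] integrable_re_pw[OF r, of l]
    by (simp add: prob_space)
  also have "\<dots> \<le> m\<^sup>2 + t1 / n - 2 * (m * (m - (m * (real l * (real l + 1)) + t2) / n)) + m\<^sup>2"
  proof -
    have "(- 2 * m / x) * expectation ?Z = - 2 * (m * (expectation ?Z / x))" by simp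
    then show ?thesis using E1 E2 by linarith
  qed
  also have "\<dots> = (t1 + 2 * m * R) / n"
    unfolding R_def[symmetric] by (simp add: power2_eq_square algebra_simps add_divide_distrib)
  also have "t1 + 2 * m * R = var_const l"
    by (simp add: var_const_def m_def t1_def t2_def R_def)
  finally show ?thesis by (simp add: x_def m_def)
qed

text \<open>Each diagonal entry of the power is already concentrated up to variance
  \<open>O(1 / n)\<close>, so Cauchy-Schwarz carries this over to their average and no covariances
  are needed.\<close>

lemma trace_variance:
  assumes l: "0 < l" "2 * l + 1 \<le> n" and Ln: "L \<le> sqrt n"
  shows "expectation (\<lambda>\<omega>. ((\<Sum>r<n. inner qone (pw n (W \<omega>) l r)) / (n * sqrt n ^ l) - s ^ l * dyck l 0)\<^sup>2) \<le> var_const l / n"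
    and "integrable M (\<lambda>\<omega>. ((\<Sum>r<n. inner qone (pw n (W \<omega>) l r)) / (n * sqrt n ^ l) - s ^ l * dyck l 0)\<^sup>2)"
proof -
  define x where "x = sqrt (real n) ^ l"
  define m where "m = s ^ l * real (dyck l 0)"
  define f where "f r \<omega> = inner qone (pw n (W \<omega>) l r) / x - m" for r \<omega>
  have n: "0 < n" using l by simp
  have intf: "integrable M (\<lambda>\<omega>. (f r \<omega>)\<^sup>2)" if "r < n" for r
  proof -
    have "(f r \<omega>)\<^sup>2 = (inner qone (pw n (W \<omega>) l r))\<^sup>2 / x\<^sup>2 - 2 * m / x * inner qone (pw n (W \<omega>) l r) + m\<^sup>2" for \<omega>
      by (simp add: f_def power2_diff power_divide)
    then show ?thesis
      using integrable_re_pw_sq[OF that, of l] integrable_re_pw[OF that, of l] by simp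
  qed
  have eq: "(\<Sum>r<n. inner qone (pw n (W \<omega>) l r)) / (n * x) - m = (\<Sum>r<n. f r \<omega>) / n" for \<omega>
    using n by (simp add: f_def sum_subtractf sum_divide_distrib[symmetric] diff_divide_distrib mult.commute)
  have le: "((\<Sum>r<n. f r \<omega>) / n)\<^sup>2 \<le> (\<Sum>r<n. (f r \<omega>)\<^sup>2) / n" for \<omega>
  proof -
    have "(\<Sum>r<n. f r \<omega>)\<^sup>2 \<le> (\<Sum>r<n. (f r \<omega>)\<^sup>2) * n"
      using Cauchy_Schwarz_ineq_sum[of "\<lambda>_. 1" "\<lambda>r. f r \<omega>" "{..<n}"] by (simp add: mult.commute)
    then show ?thesis
      using n by (simp add: power_divide power2_eq_square field_simps)
  qed
  have int: "integrable M (\<lambda>\<omega>. (\<Sum>r<n. (f r \<omega>)\<^sup>2) / n)"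
    using intf by (intro integrable_divide Bochner_Integration.integrable_sum) auto
  have fm: "(\<lambda>\<omega>. f r \<omega>) \<in> borel_measurable M" for r
    unfolding f_def using pw_measurable by (intro borel_measurable_diff borel_measurable_divide borel_measurable_inner) auto
  have int2: "integrable M (\<lambda>\<omega>. ((\<Sum>r<n. f r \<omega>) / n)\<^sup>2)"
    by (rule Bochner_Integration.integrable_bound[OF int])
      (use fm le in \<open>auto intro!: borel_measurable_power borel_measurable_divide borel_measurable_sum simp: abs_of_nonneg sum_nonneg\<close>)
  then show "integrable M (\<lambda>\<omega>. ((\<Sum>r<n. inner qone (pw n (W \<omega>) l r)) / (n * sqrt n ^ l) - s ^ l * dyck l 0)\<^sup>2)"
    using eq by (simp add: x_def m_def)
  have "expectation (\<lambda>\<omega>. ((\<Sum>r<n. f r \<omega>) / n)\<^sup>2) \<le> expectation (\<lambda>\<omega>. (\<Sum>r<n. (f r \<omega>)\<^sup>2) / n)"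
    by (intro integral_mono int int2 le)
  also have "\<dots> = (\<Sum>r<n. expectation (\<lambda>\<omega>. (f r \<omega>)\<^sup>2)) / n"
    using intf by (simp add: Bochner_Integration.integral_sum)
  also have "\<dots> \<le> (\<Sum>r<n. var_const l / n) / n"
    using pw_variance[OF l _ Ln] by (intro divide_right_mono sum_mono) (auto simp: f_def x_def m_def)
  also have "\<dots> = var_const l / n" using n by simp
  finally show "expectation (\<lambda>\<omega>. ((\<Sum>r<n. inner qone (pw n (W \<omega>) l r)) / (n * sqrt n ^ l) - s ^ l * dyck l 0)\<^sup>2) \<le> var_const l / n"
    using eq by (simp add: x_def m_def)
qed

end

end

section \<open>Tail sums and Borel-Cantelli lemmas\<close>

context prob_space
begin

text \<open>The series of the squares has finite expectation, hence converges almost surely.\<close>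

lemma AE_LIMSEQ_zero_second_moment:
  fixes f :: "nat \<Rightarrow> 'a \<Rightarrow> real"
  assumes int: "\<And>k. N \<le> k \<Longrightarrow> integrable M (\<lambda>\<omega>. (f k \<omega>)\<^sup>2)"
    and le: "\<And>k. N \<le> k \<Longrightarrow> expectation (\<lambda>\<omega>. (f k \<omega>)\<^sup>2) \<le> c k" and c: "summable c"
  shows "AE \<omega> in M. (\<lambda>k. f k \<omega>) \<longlonglongrightarrow> 0"
proof -
  define g where "g k \<omega> = (f (k + N) \<omega>)\<^sup>2" for k \<omega>
  have gi: "integrable M (g k)" for k using int[of "k + N"] by (simp add: g_def[abs_def])
  have c': "summable (\<lambda>k. c (k + N))" using c by (simp add: summable_iff_shift)
  have c0: "0 \<le> c (k + N)" for k
  proof -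
    have "0 \<le> expectation (\<lambda>\<omega>. (f (k + N) \<omega>)\<^sup>2)" by (intro integral_nonneg_AE) auto
    then show ?thesis by (rule order_trans) (use le[of "k + N"] in simp)
  qed
  have "(\<integral>\<^sup>+\<omega>. (\<Sum>k. ennreal (g k \<omega>)) \<partial>M) = (\<Sum>k. \<integral>\<^sup>+\<omega>. ennreal (g k \<omega>) \<partial>M)"
    using gi by (intro nn_integral_suminf) auto
  also have "\<dots> \<le> (\<Sum>k. ennreal (c (k + N)))"
  proof (intro suminf_le)
    fix k
    have "(\<integral>\<^sup>+\<omega>. ennreal (g k \<omega>) \<partial>M) = ennreal (expectation (g k))"
      using gi[of k] by (intro nn_integral_eq_integral) (simp_all add: g_def[abs_def])
    also have "\<dots> \<le> ennreal (c (k + N))"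
      using le[of "k + N"] by (intro ennreal_leI) (simp add: g_def[abs_def])
    finally show "(\<integral>\<^sup>+\<omega>. ennreal (g k \<omega>) \<partial>M) \<le> ennreal (c (k + N))" .
  qed auto
  also have "\<dots> = ennreal (\<Sum>k. c (k + N))"
    by (rule suminf_ennreal2[OF c0 c'])
  finally have "(\<integral>\<^sup>+\<omega>. (\<Sum>k. ennreal (g k \<omega>)) \<partial>M) \<noteq> \<infinity>"
    by (auto simp: top_unique)
  then have "AE \<omega> in M. (\<Sum>k. ennreal (g k \<omega>)) \<noteq> \<infinity>"
    using gi by (intro nn_integral_noteq_infinite) auto
  then show ?thesis
  proof eventually_elim
    case (elim \<omega>)
    have "summable (\<lambda>k. g k \<omega>)"
      using elim by (intro summable_suminf_not_top) (auto simp: g_def)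
    then have "(\<lambda>k. g k \<omega>) \<longlonglongrightarrow> 0" by (rule summable_LIMSEQ_zero)
    then have "(\<lambda>k. sqrt (g k \<omega>)) \<longlonglongrightarrow> sqrt 0" by (rule tendsto_real_sqrt)
    then have "(\<lambda>k. \<bar>f (k + N) \<omega>\<bar>) \<longlonglongrightarrow> 0" by (simp add: g_def)
    then have "(\<lambda>k. f (k + N) \<omega>) \<longlonglongrightarrow> 0" by (simp add: tendsto_rabs_zero_iff)
    then show ?case by (rule LIMSEQ_offset)
  qed
qed

lemma less_real_nat_ceiling: "real k < x \<longleftrightarrow> k < nat \<lceil>x\<rceil>"
  by linarith

lemma sum_indicator_ceiling:
  fixes w :: "nat \<Rightarrow> real"
  shows "(\<Sum>k<N. w k * indicator {\<omega> \<in> space M. real k < f \<omega>} \<omega>)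
    = (if \<omega> \<in> space M then sum w {..<min N (nat \<lceil>f \<omega>\<rceil>)} else 0)"
proof (cases "\<omega> \<in> space M")
  case True
  have "(\<Sum>k<N. w k * indicator {\<omega> \<in> space M. real k < f \<omega>} \<omega>) = (\<Sum>k<N. if k \<in> {..<nat \<lceil>f \<omega>\<rceil>} then w k else 0)"
    using True by (intro sum.cong refl) (auto simp: less_real_nat_ceiling)
  also have "\<dots> = sum w ({..<N} \<inter> {..<nat \<lceil>f \<omega>\<rceil>})"
    by (subst sum.inter_restrict) auto
  also have "{..<N} \<inter> {..<nat \<lceil>f \<omega>\<rceil>} = {..<min N (nat \<lceil>f \<omega>\<rceil>)}" by auto
  finally show ?thesis using True by simp
qed auto

text \<open>A partial sum of the series is the expectation of the sum of \<open>w k\<close> over the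
  integers \<open>k\<close> below \<open>f\<close> and \<open>N\<close>. Constant weights correspond
  to the first moment of \<open>f\<close>, linear weights to the second.\<close>

lemma summable_tail:
  assumes f [measurable]: "f \<in> borel_measurable M" and g: "integrable M g"
    and w: "\<And>k. 0 \<le> w k" and le: "\<And>\<omega>. \<omega> \<in> space M \<Longrightarrow> sum w {..<nat \<lceil>f \<omega> :: real\<rceil>} \<le> g \<omega>"
  shows "summable (\<lambda>k. w k * prob {\<omega> \<in> space M. real k < f \<omega>})"
proof (rule summableI_nonneg_bounded)
  fix N
  have int: "integrable M (\<lambda>\<omega>. w k * indicator {\<omega> \<in> space M. real k < f \<omega>} \<omega>)" for k
    by (intro integrable_mult_right integrable_real_indicator) (auto simp: less_top[symmetric])
  have "(\<Sum>k<N. w k * prob {\<omega> \<in> space M. real k < f \<omega>})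
      = expectation (\<lambda>\<omega>. \<Sum>k<N. w k * indicator {\<omega> \<in> space M. real k < f \<omega>} \<omega>)"
    using int by (subst Bochner_Integration.integral_sum) auto
  also have "\<dots> \<le> expectation g"
  proof (intro integral_mono g)
    fix \<omega> assume "\<omega> \<in> space M"
    then show "(\<Sum>k<N. w k * indicator {\<omega> \<in> space M. real k < f \<omega>} \<omega>) \<le> g \<omega>"
      unfolding sum_indicator_ceiling using le[of \<omega>] w
      by (auto intro!: order_trans[OF sum_mono2 le])
  qed (intro Bochner_Integration.integrable_sum int)
  finally show "(\<Sum>k<N. w k * prob {\<omega> \<in> space M. real k < f \<omega>}) \<le> expectation g" .
qed (use w in auto)

lemma integrable_tail:
  assumes f [measurable]: "f \<in> borel_measurable M" and g [measurable]: "g \<in> borel_measurable M"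
    and w: "\<And>k. 0 \<le> w k"
    and le: "\<And>\<omega>. \<omega> \<in> space M \<Longrightarrow> 0 \<le> g \<omega> \<and> g \<omega> \<le> sum w {..<nat \<lceil>f \<omega> :: real\<rceil>}"
    and sm: "summable (\<lambda>k. w k * prob {\<omega> \<in> space M. real k < f \<omega>})"
  shows "integrable M g"
proof (rule integrableI_nonneg)
  show "AE \<omega> in M. 0 \<le> g \<omega>" using le by auto
  let ?h = "\<lambda>k \<omega>. ennreal (w k * indicator {\<omega> \<in> space M. real k < f \<omega>} \<omega>)"
  have "(\<integral>\<^sup>+\<omega>. ennreal (g \<omega>) \<partial>M) \<le> (\<integral>\<^sup>+\<omega>. (\<Sum>k. ?h k \<omega>) \<partial>M)"
  proof (intro nn_integral_mono)
    fix \<omega> assume om: "\<omega> \<in> space M"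
    have "ennreal (g \<omega>) \<le> ennreal (\<Sum>k<nat \<lceil>f \<omega>\<rceil>. w k * indicator {\<omega> \<in> space M. real k < f \<omega>} \<omega>)"
      unfolding sum_indicator_ceiling using le[OF om] om by (intro ennreal_leI) auto
    also have "\<dots> = (\<Sum>k<nat \<lceil>f \<omega>\<rceil>. ?h k \<omega>)"
      using w by (intro sum_ennreal[symmetric]) auto
    also have "\<dots> \<le> (\<Sum>k. ?h k \<omega>)" by (rule sum_le_suminf) auto
    finally show "ennreal (g \<omega>) \<le> (\<Sum>k. ?h k \<omega>)" .
  qed
  also have "\<dots> = (\<Sum>k. \<integral>\<^sup>+\<omega>. ?h k \<omega> \<partial>M)"
    by (intro nn_integral_suminf) auto
  also have "\<dots> = (\<Sum>k. ennreal (w k * prob {\<omega> \<in> space M. real k < f \<omega>}))"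
  proof (intro suminf_cong)
    fix k
    have "(\<integral>\<^sup>+\<omega>. ?h k \<omega> \<partial>M) = (\<integral>\<^sup>+\<omega>. ennreal (w k) * indicator {\<omega> \<in> space M. real k < f \<omega>} \<omega> \<partial>M)"
      using w by (intro nn_integral_cong) (auto simp: indicator_def)
    then show "(\<integral>\<^sup>+\<omega>. ?h k \<omega> \<partial>M) = ennreal (w k * prob {\<omega> \<in> space M. real k < f \<omega>})"
      using w by (simp add: nn_integral_cmult_indicator emeasure_eq_measure ennreal_mult)
  qed
  also have "\<dots> = ennreal (\<Sum>k. w k * prob {\<omega> \<in> space M. real k < f \<omega>})"
    by (rule suminf_ennreal2[OF _ sm]) (use w in auto)
  finally show "(\<integral>\<^sup>+\<omega>. ennreal (g \<omega>) \<partial>M) < \<infinity>"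
    by (auto simp: less_top[symmetric] top_unique)
qed auto

lemma summable_tail_linear:
  assumes f: "f \<in> borel_measurable M" and sq: "integrable M (\<lambda>\<omega>. (f \<omega> :: real)\<^sup>2)"
    and nn: "\<And>\<omega>. \<omega> \<in> space M \<Longrightarrow> 0 \<le> f \<omega>"
  shows "summable (\<lambda>k. real k * prob {\<omega> \<in> space M. real k < f \<omega>})"
proof (rule summable_tail[OF f])
  show "integrable M (\<lambda>\<omega>. 2 * (f \<omega>)\<^sup>2 + 1)" using sq by simp
  fix \<omega> assume om: "\<omega> \<in> space M"
  have "(\<Sum>k<nat \<lceil>f \<omega>\<rceil>. real k) \<le> (\<Sum>k<nat \<lceil>f \<omega>\<rceil>. f \<omega>)"
    by (intro sum_mono) (auto simp: less_real_nat_ceiling[symmetric])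
  also have "\<dots> = real (nat \<lceil>f \<omega>\<rceil>) * f \<omega>" by simp
  also have "\<dots> \<le> (f \<omega> + 1) * f \<omega>"
    using nn[OF om] by (intro mult_right_mono) linarith+
  also have "\<dots> \<le> 2 * (f \<omega>)\<^sup>2 + 1"
    using zero_le_power2[of "f \<omega> - 1"] nn[OF om] by (simp add: power2_eq_square algebra_simps)
  finally show "(\<Sum>k<nat \<lceil>f \<omega>\<rceil>. real k) \<le> 2 * (f \<omega>)\<^sup>2 + 1" .
qed auto

lemma integrable_square_tail:
  assumes f: "f \<in> borel_measurable M" and nn: "\<And>\<omega>. \<omega> \<in> space M \<Longrightarrow> 0 \<le> f \<omega>"
    and sm: "summable (\<lambda>k. real k * prob {\<omega> \<in> space M. real k < f \<omega>})"
  shows "integrable M (\<lambda>\<omega>. (f \<omega> :: real)\<^sup>2)"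
proof (rule integrable_tail[OF f])
  show "summable (\<lambda>k. (2 * real k + 1) * prob {\<omega> \<in> space M. real k < f \<omega>})"
  proof (rule summable_comparison_test_ev)
    show "summable (\<lambda>k. 3 * (real k * prob {\<omega> \<in> space M. real k < f \<omega>}))" using sm by simp
    show "\<forall>\<^sub>F k in sequentially. norm ((2 * real k + 1) * prob {\<omega> \<in> space M. real k < f \<omega>})
        \<le> 3 * (real k * prob {\<omega> \<in> space M. real k < f \<omega>})"
      using eventually_ge_at_top[of 1]
    proof eventually_elim
      case (elim k)
      then have "(2 * real k + 1) * prob {\<omega> \<in> space M. real k < f \<omega>} \<le> (3 * real k) * prob {\<omega> \<in> space M. real k < f \<omega>}"
        by (intro mult_right_mono) auto
      then show ?case by simp
    qed
  qed
  fix \<omega> assume om: "\<omega> \<in> space M"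
  have "(f \<omega>)\<^sup>2 \<le> (real (nat \<lceil>f \<omega>\<rceil>))\<^sup>2"
    using nn[OF om] by (intro power_mono) linarith+
  also have "\<dots> = (\<Sum>k<nat \<lceil>f \<omega>\<rceil>. 2 * real k + 1)"
  proof -
    have "(\<Sum>k<m. 2 * real k + 1) = (real m)\<^sup>2" for m
      by (induction m) (auto simp: power2_eq_square algebra_simps)
    then show ?thesis by simp
  qed
  finally show "0 \<le> (f \<omega>)\<^sup>2 \<and> (f \<omega>)\<^sup>2 \<le> (\<Sum>k<nat \<lceil>f \<omega>\<rceil>. 2 * real k + 1)" by simp
qed (use f in auto)

text \<open>
  The second moment bound behind the converse Borel-Cantelli lemma: \<open>N = \<Sum>1\<^sub>E\<close> satisfies
  \<open>(E N)\<^sup>2 \<le> P(N > 0) E N\<^sup>2\<close>.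
\<close>

lemma prob_union_second_moment:
  assumes J: "finite J" and E: "\<And>i. i \<in> J \<Longrightarrow> E i \<in> events" and c: "0 \<le> c"
    and pair: "\<And>i j. i \<in> J \<Longrightarrow> j \<in> J \<Longrightarrow> i \<noteq> j \<Longrightarrow> prob (E i \<inter> E j) \<le> c * prob (E i) * prob (E j)"
  shows "(\<Sum>i\<in>J. prob (E i)) \<le> prob (\<Union>i\<in>J. E i) * (1 + c * (\<Sum>i\<in>J. prob (E i)))"
proof -
  define S where "S = (\<Sum>i\<in>J. prob (E i))"
  define U where "U = (\<Union>i\<in>J. E i)"
  define N where "N \<omega> = (\<Sum>i\<in>J. indicator (E i) \<omega> :: real)" for \<omega>
  have U: "U \<in> events" using J E by (auto simp: U_def)
  have S0: "0 \<le> S" by (simp add: S_def sum_nonneg)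
  have N2: "(N \<omega>)\<^sup>2 = (\<Sum>i\<in>J. \<Sum>j\<in>J. indicator (E i \<inter> E j) \<omega>)" for \<omega>
    by (simp add: N_def power2_eq_square sum_product indicator_inter_arith)
  have iN: "integrable M N" unfolding N_def[abs_def] using E by (auto intro!: Bochner_Integration.integrable_sum simp: less_top[symmetric])
  have iN2: "integrable M (\<lambda>\<omega>. (N \<omega>)\<^sup>2)"
    unfolding N2 using E by (auto intro!: Bochner_Integration.integrable_sum simp: less_top[symmetric])
  have EN: "expectation N = S"
    unfolding N_def[abs_def] S_def using E by (subst Bochner_Integration.integral_sum) (auto simp: less_top[symmetric])
  have "expectation (\<lambda>\<omega>. (N \<omega>)\<^sup>2) = (\<Sum>i\<in>J. \<Sum>j\<in>J. prob (E i \<inter> E j))"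
    unfolding N2 using E
    by (subst Bochner_Integration.integral_sum) (auto simp: less_top[symmetric] intro!: sum.cong Bochner_Integration.integrable_sum Bochner_Integration.integral_sum[THEN trans])
  also have "\<dots> \<le> (\<Sum>i\<in>J. \<Sum>j\<in>J. (if i = j then prob (E i) else 0) + c * prob (E i) * prob (E j))"
    using pair c by (intro sum_mono) auto
  also have "\<dots> = S + c * S\<^sup>2"
    using J by (simp add: sum.distrib S_def power2_eq_square sum_product sum_distrib_left mult_ac)
  finally have EN2: "expectation (\<lambda>\<omega>. (N \<omega>)\<^sup>2) \<le> S + c * S\<^sup>2" .
  have iNU: "integrable M (\<lambda>\<omega>. t * N \<omega>)" "integrable M (\<lambda>\<omega>. t\<^sup>2 * indicator U \<omega> :: real)" for t :: real
    using iN U by (auto simp: less_top[symmetric])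
  \<comment> \<open>This is the expectation of the square of \<open>N - t * indicator U\<close>,
    since \<open>N\<close> vanishes outside \<open>U\<close>.\<close>
  have quad: "0 \<le> expectation (\<lambda>\<omega>. (N \<omega>)\<^sup>2) - 2 * t * S + t\<^sup>2 * prob U" for t
  proof -
    have NU: "N \<omega> = N \<omega> * indicator U \<omega>" for \<omega>
      by (cases "\<omega> \<in> U") (auto simp: N_def U_def)
    have "0 \<le> expectation (\<lambda>\<omega>. (N \<omega>)\<^sup>2 - 2 * t * N \<omega> + t\<^sup>2 * indicator U \<omega>)"
    proof (intro integral_nonneg_AE AE_I2)
      fix \<omega>
      show "0 \<le> (N \<omega>)\<^sup>2 - 2 * t * N \<omega> + t\<^sup>2 * indicator U \<omega>"
      proof (cases "\<omega> \<in> U")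
        case True
        then have "(N \<omega>)\<^sup>2 - 2 * t * N \<omega> + t\<^sup>2 * indicator U \<omega> = (N \<omega> - t)\<^sup>2" by (simp add: power2_diff)
        then show ?thesis by simp
      next
        case False
        then have "N \<omega> = 0" using NU[of \<omega>] by simp
        then show ?thesis using False by simp
      qed
    qed
    also have "\<dots> = expectation (\<lambda>\<omega>. (N \<omega>)\<^sup>2) - 2 * t * S + t\<^sup>2 * prob U"
      using iN2 iNU EN U by (simp add: mult.assoc)
    finally show ?thesis .
  qed
  show ?thesis
  proof (cases "S = 0")
    case True
    then show ?thesis unfolding S_def[symmetric] by simp
  next
    case False
    then have Sp: "S > 0" using S0 by simp
    define p where "p = prob U"
    have p: "0 \<le> p" by (simp add: p_def)
    \<comment> \<open>This bounds the ratio of the second to the first moment of \<open>N\<close>;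
      it serves as the minimising parameter without dividing by \<open>prob U\<close>.\<close>
    define t where "t = 1 + c * S"
    have t: "t > 0" using c S0 by (simp add: t_def add_pos_nonneg)
    have "2 * t * S \<le> S * t + t\<^sup>2 * p"
      using quad[of t] EN2 by (simp add: t_def p_def power2_eq_square algebra_simps)
    then have "t * S \<le> t * (t * p)" by (simp add: power2_eq_square algebra_simps)
    then have "S \<le> t * p" using t by simp
    then show ?thesis by (simp add: S_def t_def p_def U_def mult.commute)
  qed
qed

text \<open>If almost surely only finitely many events occur, the probability of the union of all
  events of rank at least \<open>m\<close> falls below \<open>1 / (2 * c)\<close>. The second moment
  inequality then bounds every finite sum over these events by 1. The rank \<open>\<rho>\<close>
  allows events indexed by edges, with finitely many below each level.\<close>

lemma bounded_prob_sums:
  fixes \<rho> :: "'i \<Rightarrow> nat"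
  assumes E: "\<And>i. i \<in> I \<Longrightarrow> E i \<in> events" and c: "1 \<le> c" and I: "countable I"
    and fin: "\<And>m. finite {i \<in> I. \<rho> i < m}"
    and pair: "\<And>i j. i \<in> I \<Longrightarrow> j \<in> I \<Longrightarrow> i \<noteq> j \<Longrightarrow> prob (E i \<inter> E j) \<le> c * prob (E i) * prob (E j)"
    and ae: "AE \<omega> in M. \<exists>N. \<forall>i\<in>I. N \<le> \<rho> i \<longrightarrow> \<omega> \<notin> E i"
  shows "\<exists>B. \<forall>J. finite J \<longrightarrow> J \<subseteq> I \<longrightarrow> (\<Sum>i\<in>J. prob (E i)) \<le> B"
proof -
  define U where "U m = (\<Union>i\<in>{i \<in> I. m \<le> \<rho> i}. E i)" for m
  have Um: "U m \<in> events" for m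
    unfolding U_def using E I by (intro sets.countable_UN'') auto
  have "(\<lambda>m. prob (U m)) \<longlonglongrightarrow> prob (\<Inter>m. U m)"
    using Um by (intro finite_Lim_measure_decseq) (auto simp: decseq_def U_def)
  moreover have "prob (\<Inter>m. U m) = 0"
  proof -
    have "AE \<omega> in M. \<omega> \<notin> (\<Inter>m. U m)"
      using ae by eventually_elim (auto simp: U_def)
    then show ?thesis
      using Um by (subst prob_eq_0) auto
  qed
  ultimately have "\<forall>\<^sub>F m in sequentially. prob (U m) < 1 / (2 * c)"
    using c by (intro order_tendstoD) auto
  then obtain m where m: "prob (U m) < 1 / (2 * c)" by (auto simp: eventually_sequentially)
  let ?F = "{i \<in> I. \<rho> i < m}"
  show ?thesis
  proof (intro exI[of _ "real (card ?F) + 1"] allI impI)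
    fix J assume J: "finite J" "J \<subseteq> I"
    define K where "K = J - ?F"
    define S where "S = (\<Sum>i\<in>K. prob (E i))"
    have K: "finite K" "K \<subseteq> {i \<in> I. m \<le> \<rho> i}" using J by (auto simp: K_def)
    have S0: "0 \<le> S" by (simp add: S_def sum_nonneg)
    have "S \<le> prob (\<Union>i\<in>K. E i) * (1 + c * S)"
      unfolding S_def using K E c by (intro prob_union_second_moment pair) auto
    also have "\<dots> \<le> prob (U m) * (1 + c * S)"
      using K c S0 Um by (intro mult_right_mono finite_measure_mono) (auto simp: U_def)
    also have "\<dots> \<le> 1 / (2 * c) * (1 + c * S)"
      using m c S0 by (intro mult_right_mono) auto
    also have "\<dots> = 1 / (2 * c) + S / 2" using c by (simp add: field_simps)
    finally have "S \<le> 1 / c" by simp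
    also have "\<dots> \<le> 1" using c by simp
    finally have S1: "S \<le> 1" .
    have "(\<Sum>i\<in>J. prob (E i)) \<le> (\<Sum>i\<in>?F \<union> K. prob (E i))"
      using J K fin[of m] by (intro sum_mono2) (auto simp: K_def)
    also have "\<dots> \<le> (\<Sum>i\<in>?F. prob (E i)) + S"
      using K fin[of m] unfolding S_def by (subst sum.union_disjoint) (auto simp: K_def)
    also have "(\<Sum>i\<in>?F. prob (E i)) \<le> card ?F"
      using sum_mono[of ?F "\<lambda>i. prob (E i)" "\<lambda>_. 1"] by simp
    finally show "(\<Sum>i\<in>J. prob (E i)) \<le> real (card ?F) + 1" using S1 by simp
  qed
qed

end

section \<open>Operator norm of centred arrays\<close>

lemma hm_add: "hm (\<lambda>e. U e + V e) i j = hm U i j + hm V i j"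
  by (simp add: hm_def quat_conj_add)

lemma (in prob_space) eventually_not_event:
  assumes A: "\<And>n :: nat. N \<le> n \<Longrightarrow> A n \<in> events" and le: "\<And>n. N \<le> n \<Longrightarrow> prob (A n) \<le> c n" and c: "summable c"
  shows "AE \<omega> in M. \<forall>\<^sub>F n in sequentially. \<omega> \<notin> A n"
proof -
  define B where "B n = (if N \<le> n then A n else {})" for n
  have "summable (\<lambda>n. prob (B n))"
    by (rule summable_comparison_test_ev[OF _ c])
      (use le in \<open>auto simp: B_def eventually_sequentially intro!: exI[of _ N]\<close>)
  then have "AE \<omega> in M. \<forall>\<^sub>F n in sequentially. \<omega> \<in> space M - B n"
    using A by (intro borel_cantelli_AE1) (auto simp: B_def less_top[symmetric])
  then show ?thesis
  proof eventually_elim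
    case (elim \<omega>)
    then show ?case
      using eventually_ge_at_top[of N] by eventually_elim (auto simp: B_def)
  qed
qed

context quat_array
begin

text \<open>Markov's inequality for a trace of growing order turns the fixed ratio
  \<open>\<rho> < 1\<close> between the two bounds into a summable probability.\<close>

lemma truncated_op_bound:
  assumes s: "0 < s" and \<epsilon>: "0 < \<epsilon>"
    and bd: "\<And>j k \<omega>. j < k \<Longrightarrow> \<omega> \<in> space M \<Longrightarrow> norm (X (j, k) \<omega>) \<le> 2 * real k powr (7/16)"
    and mean: "\<And>j k. j < k \<Longrightarrow> expectation (X (j, k)) = 0"
    and second: "\<And>j k. j < k \<Longrightarrow> expectation (\<lambda>\<omega>. (norm (X (j, k) \<omega>))\<^sup>2) \<le> s\<^sup>2"
  shows "AE \<omega> in M. \<forall>\<^sub>F n in sequentially. op_bound n (W \<omega>) ((2 * s + \<epsilon>) * sqrt n)"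
proof -
  \<comment> \<open>The order must satisfy two demands: its square times the truncation level, of
    order \<open>n powr (15/32)\<close>, is negligible against \<open>sqrt n\<close>, and
    \<open>4 * n * exp (- 2 * a * n powr (1/64))\<close> is still summable.\<close>
  define kk where "kk n = nat \<lceil>real n powr (1/64)\<rceil>" for n :: nat
  define L where "L n = 2 * real n powr (7/16)" for n :: nat
  define c where "c n = (2 * s + \<epsilon>) * sqrt (real n)" for n :: nat
  define u where "u n \<omega> = 4 * (\<Sum>r<n. inner qone (pw n (W \<omega>) (2 * kk n) r))" for n \<omega>
  define A where "A n = {\<omega> \<in> space M. c n ^ (2 * kk n) \<le> u n \<omega>}" for n
  define \<rho> where "\<rho> = (2 * s + \<epsilon> / 2) / (2 * s + \<epsilon>)"
  define a where "a = - ln \<rho>"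
  have \<rho>: "0 < \<rho>" "\<rho> < 1" using s \<epsilon> by (auto simp: \<rho>_def)
  have a: "a > 0" using \<rho> by (simp add: a_def)
  have kk: "real n powr (1/64) \<le> kk n" "kk n \<le> real n powr (1/64) + 1" for n
    unfolding kk_def using powr_ge_zero[of "real n" "1/64"] by linarith+
  have um [measurable]: "u n \<in> borel_measurable M" for n
    unfolding u_def[abs_def] using pw_measurable by (intro borel_measurable_times borel_measurable_sum borel_measurable_inner) auto
  have "\<forall>\<^sub>F x in at_top. (2 * (x powr (1/64) + 1) + 1) * (2 * x powr (7/16)) * (2 * (x powr (1/64) + 1)) \<le> \<epsilon> / 2 * sqrt x"
    using \<epsilon> by real_asymp
  then have ev1: "\<forall>\<^sub>F n in sequentially. (2 * (real n powr (1/64) + 1) + 1) * (2 * real n powr (7/16)) * (2 * (real n powr (1/64) + 1)) \<le> \<epsilon> / 2 * sqrt (real n)"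
    by (rule eventually_compose_filterlim[OF _ filterlim_real_sequentially])
  have ev2: "\<forall>\<^sub>F n in sequentially. 4 * real n * exp (- 2 * a * real n powr (1/64)) \<le> 1 / real n ^ 2"
    using a by real_asymp
  have ev3: "\<forall>\<^sub>F n in sequentially. s \<le> L n" unfolding L_def by real_asymp
  obtain N where N: "\<And>n. N \<le> n \<Longrightarrow> (2 * (real n powr (1/64) + 1) + 1) * (2 * real n powr (7/16)) * (2 * (real n powr (1/64) + 1)) \<le> \<epsilon> / 2 * sqrt (real n)
       \<and> 4 * real n * exp (- 2 * a * real n powr (1/64)) \<le> 1 / real n ^ 2 \<and> s \<le> L n \<and> 0 < n"
    using eventually_conj[OF ev1 eventually_conj[OF ev2 eventually_conj[OF ev3 eventually_gt_at_top[of 0]]]]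
    by (auto simp: eventually_sequentially)
  have PA: "prob (A n) \<le> 1 / real n ^ 2" if n: "N \<le> n" for n
  proof -
    have n0: "0 < n" and sL: "s \<le> L n" using N[OF n] by auto
    have k0: "0 < kk n"
      using kk(1)[of n] n0 by (metis gr_zeroI linorder_not_less of_nat_0 of_nat_0_less_iff powr_gt_zero)
    interpret B: bounded_quat_array M X n s "L n"
    proof
      fix j k \<omega> assume jk: "j < k" "k < n" and "\<omega> \<in> space M"
      then have "norm (X (j, k) \<omega>) \<le> 2 * real k powr (7/16)" by (intro bd)
      also have "\<dots> \<le> L n" using jk by (simp add: L_def powr_mono2)
      finally show "norm (X (j, k) \<omega>) \<le> L n" .
    qed (use s sL mean second in auto)
    have ui: "integrable M (u n)"
      unfolding u_def[abs_def] by (intro integrable_mult_right Bochner_Integration.integrable_sum B.integrable_re_pw) auto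
    have cn: "c n > 0" using s \<epsilon> n0 by (simp add: c_def)
    \<comment> \<open>The error of the walk count uses up half of the slack
      \<open>\<epsilon>\<close>; the other half produces the ratio \<open>\<rho>\<close>.\<close>
    have base: "2 * s * sqrt n + (2 * real (kk n) + 1) * L n * (2 * real (kk n)) \<le> \<rho> * c n"
    proof -
      have "(2 * real (kk n) + 1) * L n * (2 * real (kk n)) \<le> (2 * (real n powr (1/64) + 1) + 1) * (2 * real n powr (7/16)) * (2 * (real n powr (1/64) + 1))"
        unfolding L_def using kk(2)[of n] by (intro mult_mono) auto
      also have "\<dots> \<le> \<epsilon> / 2 * sqrt (real n)" using N[OF n] by blast
      finally have "2 * s * sqrt n + (2 * real (kk n) + 1) * L n * (2 * real (kk n)) \<le> (2 * s + \<epsilon> / 2) * sqrt n"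
        by (simp add: algebra_simps)
      also have "\<dots> = \<rho> * c n" using s \<epsilon> by (simp add: \<rho>_def c_def)
      finally show ?thesis .
    qed
    have "prob (A n) \<le> expectation (u n) / c n ^ (2 * kk n)"
      unfolding A_def
    proof (rule integral_Markov_inequality_measure[OF ui, of "{}"])
      show "AE \<omega> in M. 0 \<le> u n \<omega>"
        unfolding u_def by (intro AE_I2 mult_nonneg_nonneg sum_nonneg pw_even_nonneg) auto
    qed (use cn in auto)
    also have "expectation (u n) \<le> 4 * (n * (2 * s * sqrt n + (2 * real (kk n) + 1) * L n * (2 * real (kk n))) ^ (2 * kk n))"
      unfolding u_def using B.trace_moment[OF k0] by simp
    also have "\<dots> \<le> 4 * (n * (\<rho> * c n) ^ (2 * kk n))"
      using base s n0 by (intro mult_left_mono power_mono) (auto simp: L_def)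
    also have "4 * (n * (\<rho> * c n) ^ (2 * kk n)) / c n ^ (2 * kk n) = 4 * real n * \<rho> ^ (2 * kk n)"
      using cn by (simp add: power_mult_distrib)
    also have "\<rho> ^ (2 * kk n) = exp (- 2 * a * kk n)"
      using \<rho> by (simp add: a_def exp_of_nat2_mult[symmetric] exp_of_nat_mult powr_realpow[symmetric] powr_def)
    also have "4 * real n * exp (- 2 * a * kk n) \<le> 4 * real n * exp (- 2 * a * real n powr (1/64))"
      using kk(1)[of n] a by (intro mult_left_mono) auto
    also have "\<dots> \<le> 1 / real n ^ 2" using N[OF n] by blast
    finally show ?thesis using cn by (simp add: divide_right_mono)
  qed
  have "AE \<omega> in M. \<forall>\<^sub>F n in sequentially. \<omega> \<notin> A n"
    by (rule eventually_not_event[OF _ PA]) (auto simp: A_def inverse_power_summable divide_inverse)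
  then show ?thesis
    using AE_space
  proof eventually_elim
    case (elim \<omega>)
    show ?case
      using elim(1) eventually_gt_at_top[of 0]
    proof eventually_elim
      case (elim n)
      have k0: "0 < kk n"
        using kk(1)[of n] elim(2) by (metis gr_zeroI linorder_not_less of_nat_0 of_nat_0_less_iff powr_gt_zero)
      have "u n \<omega> \<le> c n ^ (2 * kk n)" using elim \<open>\<omega> \<in> space M\<close> by (auto simp: A_def)
      then have "op_bound n (W \<omega>) (c n)"
        unfolding u_def using s \<epsilon> by (intro op_bound_trace[OF _ _ k0]) (auto simp: c_def)
      then show ?case by (simp add: c_def)
    qed
  qed
qed

end

section \<open>Identically distributed entries and their truncation\<close>

locale iid_quat_array = quat_array +
  assumes ident: "j < k \<Longrightarrow> distr M borel (X (j, k)) = distr M borel (X (0, 1))"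
begin

lemma X01_measurable [measurable]: "X (0, 1) \<in> borel_measurable M"
  by (rule X_measurable) simp

lemma X01_measurable_Suc [measurable]: "X (0, Suc 0) \<in> borel_measurable M"
  by (rule X_measurable) simp

lemma expectation_transfer:
  fixes h :: "quaternion \<Rightarrow> 'b :: {banach, second_countable_topology}"
  assumes "j < k" "h \<in> borel_measurable borel"
  shows "expectation (\<lambda>\<omega>. h (X (j, k) \<omega>)) = expectation (\<lambda>\<omega>. h (X (0, 1) \<omega>))"
  using integral_distr[OF X_measurable[OF assms(1)] assms(2)] integral_distr[OF X01_measurable assms(2)]
  by (simp add: ident[OF assms(1)])

lemma prob_transfer:
  assumes "j < k" "S \<in> sets borel"
  shows "prob {\<omega> \<in> space M. X (j, k) \<omega> \<in> S} = prob {\<omega> \<in> space M. X (0, 1) \<omega> \<in> S}"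
proof -
  have "prob {\<omega> \<in> space M. X (j, k) \<omega> \<in> S} = measure (distr M borel (X (j, k))) S" if "j < k" for j k
    using that assms(2) X_measurable by (simp add: measure_distr vimage_def Int_def conj_commute)
  then show ?thesis using assms(1) ident[OF assms(1)] by simp
qed

lemma array_compose:
  assumes "\<And>e. g e \<in> borel_measurable borel"
  shows "quat_array M (\<lambda>e \<omega>. g e (X e \<omega>))"
proof
  show "indep_vars (\<lambda>_. borel) (\<lambda>e \<omega>. g e (X e \<omega>)) {(j, k). j < k}"
    by (rule indep_vars_compose2[OF indep]) (rule assms)
qed

lemma iid_compose:
  assumes "g \<in> borel_measurable borel"
  shows "iid_quat_array M (\<lambda>e \<omega>. g (X e \<omega>))"
proof -
  interpret G: quat_array M "\<lambda>e \<omega>. g (X e \<omega>)"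
    using array_compose[of "\<lambda>_. g"] assms by simp
  show ?thesis
  proof
    fix j k :: nat assume jk: "j < k"
    have "distr M borel (\<lambda>\<omega>. g (X (j, k) \<omega>)) = distr (distr M borel (X (j, k))) borel g" if "j < k" for j k
      using distr_distr[OF assms X_measurable[OF that]] by (simp add: comp_def)
    then show "distr M borel (\<lambda>\<omega>. g (X (j, k) \<omega>)) = distr M borel (\<lambda>\<omega>. g (X (0, 1) \<omega>))"
      using jk ident[OF jk] by simp
  qed
qed

lemma prob_two_edges:
  assumes e: "e \<noteq> f" "fst e < snd e" "fst f < snd f" and S: "S \<in> sets borel" "T \<in> sets borel"
  shows "prob {\<omega> \<in> space M. X e \<omega> \<in> S \<and> X f \<omega> \<in> T} = prob {\<omega> \<in> space M. X (0, 1) \<omega> \<in> S} * prob {\<omega> \<in> space M. X (0, 1) \<omega> \<in> T}"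
proof -
  have "prob (\<Inter>g\<in>{e, f}. X g -` (if g = e then S else T) \<inter> space M) = (\<Prod>g\<in>{e, f}. prob (X g -` (if g = e then S else T) \<inter> space M))"
    using e S by (intro indep_varsD[OF indep]) auto
  moreover have "(\<Inter>g\<in>{e, f}. X g -` (if g = e then S else T) \<inter> space M) = {\<omega> \<in> space M. X e \<omega> \<in> S \<and> X f \<omega> \<in> T}"
    using e(1) by auto
  moreover have "X e -` S \<inter> space M = {\<omega> \<in> space M. X e \<omega> \<in> S}" "X f -` T \<inter> space M = {\<omega> \<in> space M. X f \<omega> \<in> T}"
    by auto
  ultimately show ?thesis
    using e S prob_transfer[of "fst e" "snd e" S] prob_transfer[of "fst f" "snd f" T] by simp
qed

end

lemma sum_at_most_one:
  fixes f :: "nat \<Rightarrow> real"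
  assumes "finite S" "0 \<le> c" "\<And>i. i \<in> S \<Longrightarrow> f i \<le> c" "\<And>i j. i \<in> S \<Longrightarrow> j \<in> S \<Longrightarrow> f i \<noteq> 0 \<Longrightarrow> f j \<noteq> 0 \<Longrightarrow> i = j"
  shows "sum f S \<le> c"
proof (cases "\<exists>i\<in>S. f i \<noteq> 0")
  case True
  then obtain i where i: "i \<in> S" "f i \<noteq> 0" by blast
  have "sum f S = sum f {i}"
    using assms i by (intro sum.mono_neutral_right) auto
  then show ?thesis using assms i by simp
next
  case False
  then show ?thesis using assms by simp
qed

lemma real_summable_powr: "a < -1 \<Longrightarrow> summable (\<lambda>k. real k powr a)"
  by (simp add: summable_real_powr_iff)

context iid_quat_array
begin

context
  assumes mean: "expectation (X (0, 1)) = 0"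
    and int1: "integrable M (X (0, 1))"
    and fourth: "integrable M (\<lambda>\<omega>. norm (X (0, 1) \<omega>) ^ 4)"
begin

definition B4 :: real where "B4 = expectation (\<lambda>\<omega>. norm (X (0, 1) \<omega>) ^ 4)"

lemma B4_nonneg: "0 \<le> B4"
  unfolding B4_def by (intro integral_nonneg_AE) auto

lemma int2: "integrable M (\<lambda>\<omega>. (norm (X (0, 1) \<omega>))\<^sup>2)"
proof (rule Bochner_Integration.integrable_bound)
  show "integrable M (\<lambda>\<omega>. 1 + norm (X (0, 1) \<omega>) ^ 4)" using fourth by simp
  show "AE \<omega> in M. norm ((norm (X (0, 1) \<omega>))\<^sup>2) \<le> norm (1 + norm (X (0, 1) \<omega>) ^ 4)"
  proof (intro AE_I2)
    fix \<omega>
    define y where "y = (norm (X (0, 1) \<omega>))\<^sup>2"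
    have "norm (X (0, 1) \<omega>) ^ 4 = y\<^sup>2" by (simp add: y_def power_mult[symmetric])
    moreover have "y \<le> 1 + y\<^sup>2"
    proof -
      have "2 * y \<le> 1 + y\<^sup>2" using zero_le_power2[of "y - 1"] unfolding power2_diff by simp
      moreover have "0 \<le> y" by (simp add: y_def)
      ultimately show ?thesis by linarith
    qed
    ultimately show "norm ((norm (X (0, 1) \<omega>))\<^sup>2) \<le> norm (1 + norm (X (0, 1) \<omega>) ^ 4)"
      by (simp add: y_def)
  qed
qed simp

lemma prob_big: "0 < t \<Longrightarrow> prob {\<omega> \<in> space M. t < norm (X (0, 1) \<omega>)} \<le> B4 / t ^ 4"
proof -
  assume t: "0 < t"
  have "prob {\<omega> \<in> space M. t < norm (X (0, 1) \<omega>)} \<le> prob {\<omega> \<in> space M. t ^ 4 \<le> norm (X (0, 1) \<omega>) ^ 4}"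
    using t by (intro finite_measure_mono) (auto intro!: power_mono)
  also have "\<dots> \<le> B4 / t ^ 4"
    unfolding B4_def using t by (intro integral_Markov_inequality_measure[OF fourth, of "{}"]) auto
  finally show ?thesis .
qed

text \<open>With a finite fourth moment and threshold \<open>k powr \<gamma>\<close>, exponents
  above 3/8 make two large entries in one row or column a summable event, and exponents below 1/2
  leave room for the trace method. The value 7/16 lies in the middle; it also exceeds 1/3, which the
  shift of the mean requires.\<close>

definition thr :: "nat \<Rightarrow> real" where "thr k = real k powr (7/16)"

lemma prob_thr: "0 < k \<Longrightarrow> prob {\<omega> \<in> space M. thr k < norm (X (0, 1) \<omega>)} \<le> B4 * real k powr (-7/4)"
proof -
  assume k: "0 < k"
  have "thr k ^ 4 = real k powr (7/4)"
    using k by (simp add: thr_def powr_realpow[symmetric] powr_powr)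
  then show ?thesis
    using prob_big[of "thr k"] k powr_minus_divide[of "real k" "7/4"] by (simp add: thr_def)
qed

definition bigE :: "nat \<Rightarrow> nat \<Rightarrow> 'a set" where
  "bigE j k = {\<omega> \<in> space M. thr k < norm (X (j, k) \<omega>)}"

lemma norm_X_events: "j < k \<Longrightarrow> {\<omega> \<in> space M. t < norm (X (j, k) \<omega>)} \<in> events"
  by (intro borel_measurable_less borel_measurable_const measurable_compose[OF _ borel_measurable_norm] X_measurable)

lemma bigE_events: "j < k \<Longrightarrow> bigE j k \<in> events"
  unfolding bigE_def by (rule norm_X_events)

lemma prob_bigE_two:
  assumes "j < k" "j' < k'" "(j, k) \<noteq> (j', k')"
  shows "prob (bigE j k \<inter> bigE j' k') \<le> B4\<^sup>2 * real k powr (-7/4) * real k' powr (-7/4)"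
proof -
  have "bigE j k \<inter> bigE j' k' = {\<omega> \<in> space M. X (j, k) \<omega> \<in> {q. thr k < norm q} \<and> X (j', k') \<omega> \<in> {q. thr k' < norm q}}"
    by (auto simp: bigE_def)
  then have "prob (bigE j k \<inter> bigE j' k') = prob {\<omega> \<in> space M. thr k < norm (X (0, 1) \<omega>)} * prob {\<omega> \<in> space M. thr k' < norm (X (0, 1) \<omega>)}"
    using assms prob_two_edges[of "(j, k)" "(j', k')" "{q. thr k < norm q}" "{q. thr k' < norm q}"] by simp
  also have "\<dots> \<le> (B4 * real k powr (-7/4)) * (B4 * real k' powr (-7/4))"
    using assms B4_nonneg by (intro mult_mono prob_thr) auto
  finally show ?thesis by (simp add: power2_eq_square mult_ac)
qed

text \<open>There are at most \<open>k\<^sup>2\<close> pairs in column \<open>k\<close>, each with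
  probability of order \<open>k powr (-7/2)\<close>.\<close>

lemma AE_column: "AE \<omega> in M. \<forall>\<^sub>F k in sequentially. \<forall>i<k. \<forall>i'<k. \<omega> \<in> bigE i k \<longrightarrow> \<omega> \<in> bigE i' k \<longrightarrow> i = i'"
proof -
  define P where "P k = {p \<in> {..<k} \<times> {..<k}. fst p \<noteq> snd p}" for k :: nat
  define A where "A k = (\<Union>p\<in>P k. bigE (fst p) k \<inter> bigE (snd p) k)" for k
  have fin: "finite (P k)" for k by (simp add: P_def)
  have "AE \<omega> in M. \<forall>\<^sub>F k in sequentially. \<omega> \<notin> A k"
  proof (rule eventually_not_event)
    fix k :: nat assume k: "1 \<le> k"
    show "A k \<in> events" unfolding A_def using fin by (auto simp: P_def intro!: sets.finite_UN sets.Int bigE_events)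
    have "prob (A k) \<le> (\<Sum>p\<in>P k. prob (bigE (fst p) k \<inter> bigE (snd p) k))"
      unfolding A_def using fin by (intro finite_measure_subadditive_finite) (auto simp: P_def intro!: sets.Int bigE_events)
    also have "\<dots> \<le> (\<Sum>p\<in>P k. B4\<^sup>2 * real k powr (-7/4) * real k powr (-7/4))"
      by (intro sum_mono prob_bigE_two) (auto simp: P_def)
    also have "\<dots> \<le> (real k)\<^sup>2 * (B4\<^sup>2 * real k powr (-7/4) * real k powr (-7/4))"
    proof -
      have "card (P k) \<le> card ({..<k} \<times> {..<k})" by (intro card_mono) (auto simp: P_def)
      then have "real (card (P k)) \<le> (real k)\<^sup>2" by (simp add: power2_eq_square flip: of_nat_mult)
      then show ?thesis by (simp add: mult_right_mono)
    qed
    also have "\<dots> = B4\<^sup>2 * real k powr (-3/2)"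
    proof -
      have "(real k)\<^sup>2 = real k powr 2" using k by (simp add: powr_numeral)
      then have "(real k)\<^sup>2 * (real k powr (-7/4) * real k powr (-7/4)) = real k powr (-3/2)"
        by (simp only: powr_add[symmetric]) simp
      moreover have "(real k)\<^sup>2 * (B4\<^sup>2 * u * u) = B4\<^sup>2 * ((real k)\<^sup>2 * (u * u))" for u by simp
      ultimately show ?thesis by (simp only:)
    qed
    finally show "prob (A k) \<le> B4\<^sup>2 * real k powr (-3/2)" .
  qed (intro summable_mult real_summable_powr, simp)
  then show ?thesis
  proof eventually_elim
    case (elim \<omega>)
    then show ?case
      by (rule eventually_mono) (force simp: A_def P_def)
  qed
qed

text \<open>A pair of large entries in row \<open>i\<close> is counted at its larger column
  \<open>k\<close>, together with all smaller columns \<open>j\<close>.\<close>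

lemma AE_row: "AE \<omega> in M. \<forall>\<^sub>F k in sequentially. \<forall>j<k. \<forall>i<j. \<not> (\<omega> \<in> bigE i j \<and> \<omega> \<in> bigE i k)"
proof -
  define P where "P k = (SIGMA j:{..<k}. {..<j})" for k :: nat
  define A where "A k = (\<Union>p\<in>P k. bigE (snd p) (fst p) \<inter> bigE (snd p) k)" for k
  define S where "S = (\<Sum>j. real j powr (-5/4))"
  have fin: "finite (P k)" for k by (simp add: P_def)
  have Ssum: "summable (\<lambda>j. real j powr (-5/4))" by (intro real_summable_powr) simp
  have "AE \<omega> in M. \<forall>\<^sub>F k in sequentially. \<omega> \<notin> A k"
  proof (rule eventually_not_event)
    fix k :: nat assume k: "1 \<le> k"
    show "A k \<in> events" unfolding A_def using fin by (auto simp: P_def intro!: sets.finite_UN sets.Int bigE_events)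
    have "prob (A k) \<le> (\<Sum>p\<in>P k. prob (bigE (snd p) (fst p) \<inter> bigE (snd p) k))"
      unfolding A_def using fin by (intro finite_measure_subadditive_finite) (auto simp: P_def intro!: sets.Int bigE_events)
    also have "\<dots> \<le> (\<Sum>p\<in>P k. B4\<^sup>2 * real (fst p) powr (-7/4) * real k powr (-7/4))"
      by (intro sum_mono prob_bigE_two) (auto simp: P_def)
    also have "\<dots> = (\<Sum>j<k. \<Sum>i<j. B4\<^sup>2 * real j powr (-7/4) * real k powr (-7/4))"
      unfolding P_def by (subst sum.Sigma) (auto simp: case_prod_beta)
    also have "\<dots> \<le> (\<Sum>j<k. B4\<^sup>2 * real k powr (-5/4) * real j powr (-5/4))"
    proof (intro sum_mono)
      fix j assume "j \<in> {..<k}"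
      then have j: "j < k" by simp
      show "(\<Sum>i<j. B4\<^sup>2 * real j powr (-7/4) * real k powr (-7/4)) \<le> B4\<^sup>2 * real k powr (-5/4) * real j powr (-5/4)"
      proof (cases "j = 0")
        case False
        \<comment> \<open>A power \<open>1/2\<close> is shifted from \<open>k\<close> to
          \<open>j\<close>, which makes the bound a product of two summable sequences.\<close>
        have le: "real k powr (-1/2) \<le> real j powr (-1/2)"
          using False j by (intro powr_mono2') auto
        have e1: "real j * real j powr (-7/4) = real j powr (-3/4)"
          using False powr_add[of "real j" 1 "-7/4"] by simp
        have e2: "real k powr (-7/4) = real k powr (-5/4) * real k powr (-1/2)"
          by (simp add: powr_add[symmetric])
        have e3: "real j powr (-3/4) * real j powr (-1/2) = real j powr (-5/4)"
          by (simp add: powr_add[symmetric])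
        have "(\<Sum>i<j. B4\<^sup>2 * real j powr (-7/4) * real k powr (-7/4)) = B4\<^sup>2 * (real j * real j powr (-7/4)) * real k powr (-7/4)"
          by simp
        also have "\<dots> = B4\<^sup>2 * real j powr (-3/4) * (real k powr (-5/4) * real k powr (-1/2))"
          by (simp only: e1 e2)
        also have "\<dots> \<le> B4\<^sup>2 * real j powr (-3/4) * (real k powr (-5/4) * real j powr (-1/2))"
          by (intro mult_left_mono le) auto
        also have "\<dots> = B4\<^sup>2 * real k powr (-5/4) * (real j powr (-3/4) * real j powr (-1/2))"
          by (simp only: mult_ac)
        finally show ?thesis by (simp only: e3)
      qed simp
    qed
    also have "\<dots> = B4\<^sup>2 * real k powr (-5/4) * (\<Sum>j<k. real j powr (-5/4))"
      by (simp add: sum_distrib_left)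
    also have "\<dots> \<le> B4\<^sup>2 * real k powr (-5/4) * S"
      unfolding S_def by (intro mult_left_mono sum_le_suminf Ssum) auto
    finally show "prob (A k) \<le> B4\<^sup>2 * real k powr (-5/4) * S" .
  qed (intro summable_mult2 summable_mult Ssum)
  then show ?thesis
  proof eventually_elim
    case (elim \<omega>)
    then show ?case
      by (rule eventually_mono) (force simp: A_def P_def)
  qed
qed

text \<open>The union bound over the \<open>k\<close> entries of column \<open>k\<close> gives the
  series of \<open>k\<close> times a tail probability, which is summable because of the fourth
  moment.\<close>

lemma AE_small:
  assumes \<delta>: "0 < \<delta>"
  shows "AE \<omega> in M. \<forall>\<^sub>F k in sequentially. \<forall>j<k. norm (X (j, k) \<omega>) \<le> \<delta> * sqrt k"
proof -
  define f where "f \<omega> = (norm (X (0, 1) \<omega>) / \<delta>)\<^sup>2" for \<omega>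
  define A where "A k = (\<Union>j<k. {\<omega> \<in> space M. \<delta> * sqrt k < norm (X (j, k) \<omega>)})" for k :: nat
  have f2: "(f \<omega>)\<^sup>2 = norm (X (0, 1) \<omega>) ^ 4 / \<delta> ^ 4" for \<omega>
    by (simp add: f_def power_divide power_mult[symmetric])
  have sm: "summable (\<lambda>k. real k * prob {\<omega> \<in> space M. real k < f \<omega>})"
  proof (rule summable_tail_linear)
    show "integrable M (\<lambda>\<omega>. (f \<omega>)\<^sup>2)" unfolding f2 using fourth by simp
  qed (auto simp: f_def[abs_def])
  have m: "{\<omega> \<in> space M. \<delta> * sqrt k < norm (X (j, k) \<omega>)} \<in> events" if "j < k" for j k
    using that by (rule norm_X_events)
  have "AE \<omega> in M. \<forall>\<^sub>F k in sequentially. \<omega> \<notin> A k"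
  proof (rule eventually_not_event[OF _ _ sm])
    fix k :: nat
    show "A k \<in> events" unfolding A_def using m by auto
    have "prob (A k) \<le> (\<Sum>j<k. prob {\<omega> \<in> space M. \<delta> * sqrt k < norm (X (j, k) \<omega>)})"
      unfolding A_def using m by (intro finite_measure_subadditive_finite) auto
    also have "\<dots> = (\<Sum>j<k. prob {\<omega> \<in> space M. real k < f \<omega>})"
    proof (intro sum.cong refl)
      fix j assume "j \<in> {..<k}"
      then have "prob {\<omega> \<in> space M. \<delta> * sqrt k < norm (X (j, k) \<omega>)} = prob {\<omega> \<in> space M. \<delta> * sqrt k < norm (X (0, 1) \<omega>)}"
        using prob_transfer[of j k "{q. \<delta> * sqrt k < norm q}"] by simp
      also have "{\<omega> \<in> space M. \<delta> * sqrt k < norm (X (0, 1) \<omega>)} = {\<omega> \<in> space M. real k < f \<omega>}"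
      proof -
        have "\<delta> * sqrt k < y \<longleftrightarrow> real k < (y / \<delta>)\<^sup>2" if "0 \<le> y" for y
        proof -
          have "real k < (y / \<delta>)\<^sup>2 \<longleftrightarrow> sqrt (real k) < sqrt ((y / \<delta>)\<^sup>2)" by (simp only: real_sqrt_less_iff)
          also have "\<dots> \<longleftrightarrow> sqrt k < y / \<delta>" using that \<delta> by simp
          also have "\<dots> \<longleftrightarrow> \<delta> * sqrt k < y" using \<delta> by (simp add: pos_less_divide_eq mult.commute)
          finally show ?thesis by simp
        qed
        then show ?thesis by (simp add: f_def)
      qed
      finally show "prob {\<omega> \<in> space M. \<delta> * sqrt k < norm (X (j, k) \<omega>)} = prob {\<omega> \<in> space M. real k < f \<omega>}" .
    qed
    finally show "prob (A k) \<le> real k * prob {\<omega> \<in> space M. real k < f \<omega>}" by simp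
  qed
  then show ?thesis
    using AE_space
  proof eventually_elim
    case (elim \<omega>)
    show ?case
      by (rule eventually_mono[OF elim(1)]) (use elim(2) in \<open>force simp: A_def not_less\<close>)
  qed
qed

definition big :: "nat \<times> nat \<Rightarrow> 'a \<Rightarrow> quaternion" where
  "big e \<omega> = (if thr (snd e) < norm (X e \<omega>) then X e \<omega> else 0)"

text \<open>
  Apart from finitely many initial entries, every row has at most one large entry on either side of
  the diagonal, and it is of order \<open>o(\<sqrt>n)\<close>; so Schur's test applies.
\<close>

lemma AE_big_op_bound:
  assumes \<delta>: "0 < \<delta>"
  shows "AE \<omega> in M. \<forall>\<^sub>F n in sequentially. op_bound n (hm (\<lambda>e. big e \<omega>)) (\<delta> * sqrt n)"
proof -
  have "0 < \<delta> / 3" using \<delta> by simp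
  show ?thesis
    using AE_column AE_row AE_small[OF \<open>0 < \<delta> / 3\<close>] AE_space
  proof eventually_elim
    case (elim \<omega>)
    define Q where "Q k \<longleftrightarrow> (\<forall>i<k. \<forall>i'<k. \<omega> \<in> bigE i k \<longrightarrow> \<omega> \<in> bigE i' k \<longrightarrow> i = i') \<and>
      (\<forall>j<k. \<forall>i<j. \<not> (\<omega> \<in> bigE i j \<and> \<omega> \<in> bigE i k)) \<and> (\<forall>j<k. norm (X (j, k) \<omega>) \<le> \<delta> / 3 * sqrt k)" for k
    have "\<forall>\<^sub>F k in sequentially. Q k"
      unfolding Q_def by (intro eventually_conj elim)
    then obtain N where "\<And>k. N \<le> k \<Longrightarrow> Q k"
      by (auto simp: eventually_sequentially)
    note N = this[unfolded Q_def]
    define Y where "Y e = norm (big e \<omega>)" for e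
    have Y: "Y (i, j) \<noteq> 0 \<Longrightarrow> \<omega> \<in> bigE i j" for i j
      using elim(4) by (auto simp: Y_def big_def bigE_def split: if_splits)
    have Y0: "0 \<le> Y e" for e by (simp add: Y_def)
    have Ys: "Y (i, j) \<le> \<delta> / 3 * sqrt j" if "N \<le> j" "i < j" for i j
      using N[OF that(1)] that \<delta> by (auto simp: Y_def big_def)
    \<comment> \<open>The exceptional initial block contributes a constant that may depend on the
      outcome but not on \<open>n\<close>.\<close>
    define C where "C = (\<Sum>i<N. \<Sum>j<N. Y (eg i j))"
    have "\<forall>\<^sub>F n in sequentially. C \<le> \<delta> / 3 * sqrt n" using \<delta> by real_asymp
    then show ?case
    proof eventually_elim
      case (elim n)
      show ?case
      proof (rule op_bound_schur)
        fix r assume r: "r < n"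
        have sq: "\<delta> / 3 * sqrt m \<le> \<delta> / 3 * sqrt n" if "m < n" for m :: nat
          using that \<delta> by (intro mult_left_mono) auto
        define g where "g j = (if j = r then 0 else Y (eg r j))" for j
        have g0: "0 \<le> g j" for j by (simp add: g_def Y0)
        \<comment> \<open>Row \<open>r\<close> is split into the initial block, the part left of the
          diagonal (column \<open>r\<close> of the upper triangle) and the part right of it. Each
          gets a third of the bound.\<close>
        define I1 where "I1 = {j. j < n \<and> j < N \<and> r < N}"
        define I2 where "I2 = {j. j < r \<and> N \<le> r}"
        define I3 where "I3 = {j. r < j \<and> j < n \<and> N \<le> j}"
        have fin: "finite I1" "finite I2" "finite I3"
          by (auto simp: I1_def I2_def I3_def intro: finite_subset[of _ "{..<n}"] finite_subset[of _ "{..<r}"])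
        have "sum g I1 \<le> C"
        proof (cases "r < N")
          case True
          have "sum g I1 \<le> (\<Sum>j<N. Y (eg r j))"
            by (rule order_trans[OF sum_mono[of I1 g "\<lambda>j. Y (eg r j)"] sum_mono2])
              (auto simp: I1_def g_def Y0)
          also have "\<dots> \<le> C"
            unfolding C_def using True Y0 by (intro member_le_sum sum_nonneg) auto
          finally show ?thesis .
        next
          case False
          then show ?thesis by (simp add: I1_def C_def sum_nonneg Y0)
        qed
        moreover have "sum g I2 \<le> \<delta> / 3 * sqrt n"
        proof (rule sum_at_most_one[OF fin(2)])
          fix i assume i: "i \<in> I2"
          then have "g i = Y (i, r)" by (auto simp: g_def I2_def eg_def)
          then show "g i \<le> \<delta> / 3 * sqrt n" using Ys[of r i] i sq[OF r] by (simp add: I2_def)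
          fix j assume j: "j \<in> I2" and "g i \<noteq> 0" "g j \<noteq> 0"
          moreover have "g j = Y (j, r)" using j by (auto simp: g_def I2_def eg_def)
          ultimately have "\<omega> \<in> bigE i r" "\<omega> \<in> bigE j r" using Y \<open>g i = Y (i, r)\<close> by auto
          then show "i = j" using N[of r] i j by (simp add: I2_def)
        qed (use \<delta> in auto)
        moreover have "sum g I3 \<le> \<delta> / 3 * sqrt n"
        proof (rule sum_at_most_one[OF fin(3)])
          fix i assume i: "i \<in> I3"
          then have gi: "g i = Y (r, i)" by (auto simp: g_def I3_def eg_def)
          then show "g i \<le> \<delta> / 3 * sqrt n" using Ys[of i r] i sq[of i] by (simp add: I3_def)
          fix j assume j: "j \<in> I3" and "g i \<noteq> 0" "g j \<noteq> 0"
          moreover have "g j = Y (r, j)" using j by (auto simp: g_def I3_def eg_def)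
          ultimately have "\<omega> \<in> bigE r i" "\<omega> \<in> bigE r j" using Y gi by auto
          then show "i = j" using N[of i] N[of j] i j by (cases i j rule: linorder_cases) (auto simp: I3_def)
        qed (use \<delta> in auto)
        moreover have "(\<Sum>j<n. norm (hm (\<lambda>e. big e \<omega>) r j)) \<le> sum g I1 + sum g I2 + sum g I3"
        proof -
          have "(\<Sum>j<n. norm (hm (\<lambda>e. big e \<omega>) r j)) = (\<Sum>j<n. g j)"
            by (intro sum.cong refl) (auto simp: norm_hm g_def Y_def)
          also have "\<dots> = sum g ({..<n} - {r})"
            using r by (subst sum.remove[of _ r]) (auto simp: g_def)
          also have "\<dots> \<le> sum g (I1 \<union> (I2 \<union> I3))"
            using fin g0 by (intro sum_mono2) (auto simp: I1_def I2_def I3_def)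
          also have "\<dots> \<le> sum g I1 + sum g (I2 \<union> I3)"
            using fin g0 by (simp add: sum_Un sum_nonneg)
          also have "sum g (I2 \<union> I3) \<le> sum g I2 + sum g I3"
            using fin g0 by (simp add: sum_Un sum_nonneg)
          finally show ?thesis by simp
        qed
        ultimately show "(\<Sum>j<n. norm (hm (\<lambda>e. big e \<omega>) r j)) \<le> \<delta> * sqrt n"
          using elim by simp
      qed (use \<delta> in auto)
    qed
  qed
qed

section \<open>The truncated entries and the shift of their mean\<close>

definition tr :: "nat \<Rightarrow> quaternion \<Rightarrow> quaternion" where
  "tr k q = (if norm q \<le> thr k then q else 0)"

definition mu :: "nat \<Rightarrow> quaternion" where
  "mu k = expectation (\<lambda>\<omega>. tr k (X (0, 1) \<omega>))"

lemma tr_measurable [measurable]: "tr k \<in> borel_measurable borel"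
  unfolding tr_def[abs_def] by measurable

lemma norm_tr_le: "norm (tr k q) \<le> thr k" "norm (tr k q) \<le> norm q"
  by (auto simp: tr_def thr_def)

lemma integrable_tr: "integrable M (\<lambda>\<omega>. tr k (X (0, 1) \<omega>))"
  by (rule integrable_const_bound[of _ "thr k"]) (auto simp: norm_tr_le)

lemma norm_mu_le: "norm (mu k) \<le> thr k"
proof -
  have "norm (mu k) \<le> expectation (\<lambda>\<omega>. norm (tr k (X (0, 1) \<omega>)))"
    unfolding mu_def by (rule integral_norm_bound)
  also have "\<dots> \<le> expectation (\<lambda>\<omega>. thr k)"
    using integrable_tr by (intro integral_mono) (auto simp: norm_tr_le)
  finally show ?thesis by (simp add: prob_space)
qed

text \<open>As the full mean is zero, \<open>mu k\<close> is minus the mean of the discarded part,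
  where \<open>norm q\<close> is at most \<open>norm q ^ 4 / thr k ^ 3\<close>. The exponent is
  three times 7/16.\<close>

lemma norm_mu_decay: "0 < k \<Longrightarrow> norm (mu k) \<le> B4 * real k powr (-21/16)"
proof -
  assume k: "0 < k"
  have t: "0 < thr k" using k by (simp add: thr_def)
  let ?r = "\<lambda>\<omega>. X (0, 1) \<omega> - tr k (X (0, 1) \<omega>)"
  have "mu k = - expectation ?r"
    unfolding mu_def using mean int1 integrable_tr by simp
  then have "norm (mu k) \<le> expectation (\<lambda>\<omega>. norm (?r \<omega>))"
    using integral_norm_bound[of M ?r] by simp
  also have "\<dots> \<le> expectation (\<lambda>\<omega>. norm (X (0, 1) \<omega>) ^ 4 / thr k ^ 3)"
  proof (intro integral_mono)
    show "integrable M (\<lambda>\<omega>. norm (?r \<omega>))" using int1 integrable_tr by simp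
    show "integrable M (\<lambda>\<omega>. norm (X (0, 1) \<omega>) ^ 4 / thr k ^ 3)" using fourth by simp
    fix \<omega>
    show "norm (?r \<omega>) \<le> norm (X (0, 1) \<omega>) ^ 4 / thr k ^ 3"
    proof (cases "norm (X (0, 1) \<omega>) \<le> thr k")
      case False
      have "norm (X (0, 1) \<omega>) * thr k ^ 3 \<le> norm (X (0, 1) \<omega>) * norm (X (0, 1) \<omega>) ^ 3"
        using False t by (intro mult_left_mono power_mono) auto
      then show ?thesis using False t by (simp add: tr_def pos_le_divide_eq power_Suc[symmetric] del: power_Suc)
    qed (use t in \<open>simp add: tr_def\<close>)
  qed
  also have "\<dots> = B4 / thr k ^ 3" by (simp add: B4_def)
  also have "thr k ^ 3 = real k powr (21/16)"
    using k by (simp add: thr_def powr_power)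
  finally show ?thesis using powr_minus_divide[of "real k" "21/16"] by simp
qed

text \<open>The entries depend on the larger index only. Row \<open>r\<close> has \<open>r\<close>
  entries of order \<open>r powr (-21/16)\<close> to the left and a convergent series to the right,
  so Schur's test gives a bound free of \<open>n\<close>.\<close>

lemma mu_op_bound: "\<exists>C. \<forall>n. op_bound n (hm (\<lambda>e. mu (snd e))) C"
proof -
  have Ssum: "summable (\<lambda>j. real j powr (-21/16))" by (intro real_summable_powr) simp
  define S where "S = (\<Sum>j. real j powr (-21/16))"
  have S0: "0 \<le> S" unfolding S_def by (intro suminf_nonneg Ssum) auto
  have "op_bound n (hm (\<lambda>e. mu (snd e))) (B4 + B4 * S)" for n
  proof (rule op_bound_schur)
    fix r assume r: "r < n"
    have "(\<Sum>j<n. norm (hm (\<lambda>e. mu (snd e)) r j)) \<le> (\<Sum>j<n. (if j < r then B4 * real r powr (-21/16) else 0) + B4 * real j powr (-21/16))"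
      using norm_mu_decay[of r] norm_mu_decay B4_nonneg by (intro sum_mono) (auto simp: norm_hm eg_def min_def max_def add_increasing add_increasing2)
    also have "\<dots> = real r * (B4 * real r powr (-21/16)) + B4 * (\<Sum>j<n. real j powr (-21/16))"
    proof -
      have "{..<n} \<inter> {j. j < r} = {..<r}" using r by auto
      then show ?thesis by (simp add: sum.distrib sum.If_cases sum_distrib_left)
    qed
    also have "real r * (B4 * real r powr (-21/16)) \<le> B4"
    proof (cases "r = 0")
      case False
      have "real r * real r powr (-21/16) = real r powr (-5/16)"
        using False powr_add[of "real r" 1 "-21/16"] by simp
      also have "\<dots> \<le> real r powr 0" using False by (intro powr_mono) auto
      finally have "real r * real r powr (-21/16) \<le> 1" using False by simp
      then have "B4 * (real r * real r powr (-21/16)) \<le> B4 * 1" using B4_nonneg by (intro mult_left_mono)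
      then show ?thesis by (simp add: mult_ac)
    qed (use B4_nonneg in simp)
    also have "B4 * (\<Sum>j<n. real j powr (-21/16)) \<le> B4 * S"
      unfolding S_def using B4_nonneg by (intro mult_left_mono sum_le_suminf Ssum) auto
    finally show "(\<Sum>j<n. norm (hm (\<lambda>e. mu (snd e)) r j)) \<le> B4 + B4 * S" by simp
  qed (use S0 B4_nonneg in auto)
  then show ?thesis by blast
qed

text \<open>The array is the sum of the truncated and centred part, the large entries and the shift
  of the mean. A positive upper bound \<open>s\<close> for the standard deviation is assumed instead
  of its value, so that degenerate entries are included.\<close>

lemma AE_op_bound:
  assumes s: "expectation (\<lambda>\<omega>. (norm (X (0, 1) \<omega>))\<^sup>2) \<le> s\<^sup>2" "0 < s" and \<epsilon>: "0 < \<epsilon>"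
  shows "AE \<omega> in M. \<forall>\<^sub>F n in sequentially. op_bound n (W \<omega>) ((2 * s + \<epsilon>) * sqrt n)"
proof -
  define Y where "Y e \<omega> = tr (snd e) (X e \<omega>) - mu (snd e)" for e \<omega>
  interpret Y: quat_array M Y
  proof -
    have "quat_array M (\<lambda>e \<omega>. tr (snd e) (X e \<omega>) - mu (snd e))"
      by (rule array_compose[of "\<lambda>e q. tr (snd e) q - mu (snd e)"])
        (intro borel_measurable_diff tr_measurable borel_measurable_const)
    moreover have "Y = (\<lambda>e \<omega>. tr (snd e) (X e \<omega>) - mu (snd e))" by (intro ext) (rule Y_def)
    ultimately show "quat_array M Y" by (simp only:)
  qed
  have "AE \<omega> in M. \<forall>\<^sub>F n in sequentially. op_bound n (hm (\<lambda>e. Y e \<omega>)) ((2 * s + \<epsilon> / 3) * sqrt n)"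
  proof (rule Y.truncated_op_bound)
    fix j k :: nat assume jk: "j < k"
    show "norm (Y (j, k) \<omega>) \<le> 2 * real k powr (7/16)" for \<omega>
      using norm_triangle_ineq4[of "tr k (X (j, k) \<omega>)" "mu k"] norm_mu_le[of k] norm_tr_le(1)[of k "X (j, k) \<omega>"]
      by (simp add: Y_def thr_def)
    have "expectation (Y (j, k)) = expectation (\<lambda>\<omega>. tr k (X (0, 1) \<omega>) - mu k)"
      using expectation_transfer[OF jk, of "\<lambda>q. tr k q - mu k"] by (simp add: Y_def[abs_def])
    then show "expectation (Y (j, k)) = 0"
      using integrable_tr[of k] by (simp add: mu_def prob_space)
    let ?t = "\<lambda>\<omega>. tr k (X (0, 1) \<omega>)"
    have it2: "integrable M (\<lambda>\<omega>. (norm (?t \<omega>))\<^sup>2)"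
      by (rule integrable_const_bound[of _ "(thr k)\<^sup>2"]) (auto simp: norm_tr_le intro!: power_mono)
    have "expectation (\<lambda>\<omega>. (norm (Y (j, k) \<omega>))\<^sup>2) = expectation (\<lambda>\<omega>. (norm (?t \<omega> - mu k))\<^sup>2)"
      using expectation_transfer[OF jk, of "\<lambda>q. (norm (tr k q - mu k))\<^sup>2"] by (simp add: Y_def[abs_def])
    also have "\<dots> = expectation (\<lambda>\<omega>. (norm (?t \<omega>))\<^sup>2 - 2 * inner (?t \<omega>) (mu k) + (norm (mu k))\<^sup>2)"
      by (intro Bochner_Integration.integral_cong refl)
        (simp add: power2_norm_eq_inner inner_diff_left inner_diff_right inner_commute)
    also have "\<dots> = expectation (\<lambda>\<omega>. (norm (?t \<omega>))\<^sup>2) - 2 * inner (mu k) (mu k) + (norm (mu k))\<^sup>2"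
      using it2 integrable_tr[of k] by (simp add: prob_space mu_def)
    also have "\<dots> \<le> expectation (\<lambda>\<omega>. (norm (?t \<omega>))\<^sup>2)"
      by (simp add: power2_norm_eq_inner)
    also have "\<dots> \<le> expectation (\<lambda>\<omega>. (norm (X (0, 1) \<omega>))\<^sup>2)"
      using it2 int2 by (intro integral_mono power_mono) (auto simp: norm_tr_le)
    also have "\<dots> \<le> s\<^sup>2" by (rule s)
    finally show "expectation (\<lambda>\<omega>. (norm (Y (j, k) \<omega>))\<^sup>2) \<le> s\<^sup>2" .
  qed (use s \<epsilon> in auto)
  moreover have "AE \<omega> in M. \<forall>\<^sub>F n in sequentially. op_bound n (hm (\<lambda>e. big e \<omega>)) (\<epsilon> / 3 * sqrt n)"
    using \<epsilon> by (intro AE_big_op_bound) auto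
  ultimately show ?thesis
  proof eventually_elim
    case (elim \<omega>)
    obtain C where C: "\<And>n. op_bound n (hm (\<lambda>e. mu (snd e))) C" using mu_op_bound by blast
    have "\<forall>\<^sub>F n in sequentially. C \<le> \<epsilon> / 3 * sqrt n" using \<epsilon> by real_asymp
    with elim show ?case
    proof eventually_elim
      case (elim n)
      have eq: "W \<omega> = (\<lambda>i j. (hm (\<lambda>e. Y e \<omega>) i j + hm (\<lambda>e. big e \<omega>) i j) + hm (\<lambda>e. mu (snd e)) i j)"
      proof -
        have "X e \<omega> = (Y e \<omega> + big e \<omega>) + mu (snd e)" for e
          by (auto simp: Y_def big_def tr_def)
        then have "W \<omega> = hm (\<lambda>e. (Y e \<omega> + big e \<omega>) + mu (snd e))" by simp
        then show ?thesis by (intro ext) (simp only: hm_add)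
      qed
      have "op_bound n (W \<omega>) (((2 * s + \<epsilon> / 3) * sqrt n + \<epsilon> / 3 * sqrt n) + C)"
        unfolding eq by (intro op_bound_add elim C)
      then show ?case
      proof (rule op_bound_mono)
        have "(2 * s + \<epsilon> / 3) * sqrt n + \<epsilon> / 3 * sqrt n + C = 2 * s * sqrt n + \<epsilon> * sqrt n - \<epsilon> / 3 * sqrt n + C"
          by (simp add: algebra_simps)
        then show "(2 * s + \<epsilon> / 3) * sqrt n + \<epsilon> / 3 * sqrt n + C \<le> (2 * s + \<epsilon>) * sqrt n"
          using elim(3) by (simp only: distrib_right)
      qed
    qed
  qed
qed

end

end

section \<open>Chebyshev test vectors\<close>

text \<open>
  \<open>chebL i\<close> applies the \<open>i\<close>-th Chebyshev polynomial of the second kind (rescaled to \<open>[-2, 2]\<close>) to a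
  moment sequence, and \<open>chebV i\<close> applies it to a matrix.
\<close>

fun chebL :: "nat \<Rightarrow> (nat \<Rightarrow> real) \<Rightarrow> real" where
  "chebL 0 f = f 0"
| "chebL (Suc 0) f = f 1"
| "chebL (Suc (Suc i)) f = chebL (Suc i) (\<lambda>l. f (Suc l)) - chebL i f"

fun chebV :: "nat \<Rightarrow> (nat \<Rightarrow> nat \<Rightarrow> quaternion) \<Rightarrow> real \<Rightarrow> nat \<Rightarrow> (nat \<Rightarrow> quaternion) \<Rightarrow> nat \<Rightarrow> quaternion" where
  "chebV n A \<alpha> 0 w = w"
| "chebV n A \<alpha> (Suc 0) w = (\<lambda>x. \<alpha> *\<^sub>R mv n A w x)"
| "chebV n A \<alpha> (Suc (Suc i)) w = (\<lambda>x. \<alpha> *\<^sub>R mv n A (chebV n A \<alpha> (Suc i) w) x - chebV n A \<alpha> i w x)"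

text \<open>The Chebyshev recursion with the sign made positive: it bounds the norms of the
  polynomials by the triangle inequality. Its growth is harmless, since only finitely many degrees
  occur.\<close>

fun chebB :: "real \<Rightarrow> nat \<Rightarrow> real" where
  "chebB \<beta> 0 = 1"
| "chebB \<beta> (Suc 0) = \<beta>"
| "chebB \<beta> (Suc (Suc i)) = \<beta> * chebB \<beta> (Suc i) + chebB \<beta> i"

lemma chebL_cmult: "chebL i (\<lambda>l. c * f l) = c * chebL i f"
  by (induction i f rule: chebL.induct) (auto simp: right_diff_distrib)

lemma chebL_sum: "chebL i (\<lambda>l. \<Sum>e\<in>E. f e l) = (\<Sum>e\<in>E. chebL i (f e))"
proof (induction i "\<lambda>l. \<Sum>e\<in>E. f e l" arbitrary: f rule: chebL.induct)
  case (3 i)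
  then show ?case by (simp add: sum_subtractf)
qed auto

lemma chebL_tendsto:
  assumes "\<And>l. (\<lambda>k. f k l) \<longlonglongrightarrow> g l"
  shows "(\<lambda>k. chebL i (f k)) \<longlonglongrightarrow> chebL i g"
  using assms
proof (induction i g arbitrary: f rule: chebL.induct)
  case (3 i g)
  have "(\<lambda>k. chebL (Suc i) (\<lambda>l. f k (Suc l))) \<longlonglongrightarrow> chebL (Suc i) (\<lambda>l. g (Suc l))"
    by (rule 3(1)) (rule 3(3))
  moreover have "(\<lambda>k. chebL i (f k)) \<longlonglongrightarrow> chebL i g" by (rule 3(2)) (rule 3(3))
  ultimately show ?case by (simp add: tendsto_diff)
qed auto

text \<open>\<open>dyck r i\<close> is the entry \<open>(i, 0)\<close> of the power \<open>r\<close>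
  of the adjacency matrix T of the half-line. The Chebyshev polynomial of degree \<open>i\<close> in
  T maps the basis vector at 0 to that at \<open>i\<close>, which moves the end of the walks from 0
  to \<open>i\<close>.\<close>

lemma chebL_dyck: "chebL i (\<lambda>l. real (dyck (l + l') 0)) = real (dyck l' i)"
proof (induction i "\<lambda>l. real (dyck (l + l') 0)" arbitrary: l' rule: chebL.induct)
  case (3 i)
  have "chebL (Suc i) (\<lambda>l. real (dyck (Suc l + l') 0)) = real (dyck (Suc l') (Suc i))"
    using 3(1)[of "Suc l'"] by simp
  moreover have "chebL i (\<lambda>l. real (dyck (l + l') 0)) = real (dyck l' i)" by (rule 3(2)) simp
  ultimately show ?case by simp
qed auto

text \<open>The same fact, read as the entry \<open>(i, 0)\<close> of the polynomial of degree
  \<open>j\<close> in T; it yields orthonormality.\<close>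

lemma chebL_dyck_height:
  "chebL j (\<lambda>l. real (dyck l i)) = (if i = j then 1 else 0)"
proof (induction j arbitrary: i rule: induct_nat_012)
  case (ge2 j)
  have "chebL (Suc j) (\<lambda>l. real (dyck (Suc l) i)) = (if i = 0 then 0 else chebL (Suc j) (\<lambda>l. real (dyck l (i - 1)))) + chebL (Suc j) (\<lambda>l. real (dyck l (Suc i)))"
  proof -
    have add: "chebL (Suc j) (\<lambda>l. f l + g l) = chebL (Suc j) f + chebL (Suc j) g" for f g
      using chebL_sum[of "Suc j" "\<lambda>b. if b then f else g" "UNIV :: bool set"] by (simp add: UNIV_bool add.commute)
    show ?thesis by (cases "i = 0") (simp_all add: add)
  qed
  then show ?case using ge2 by auto
qed auto

text \<open>With one more factor T the result is the entry \<open>(i, j)\<close> of T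
  itself.\<close>

lemma chebL_dyck_shift:
  "chebL j (\<lambda>l. real (dyck (Suc l) i)) = (if i = Suc j then 1 else 0) + (if j = Suc i then 1 else 0)"
proof -
  have add: "chebL j (\<lambda>l. f l + g l) = chebL j f + chebL j g" for f g
    using chebL_sum[of j "\<lambda>b. if b then f else g" "UNIV :: bool set"] by (simp add: UNIV_bool add.commute)
  show ?thesis by (cases i) (simp_all add: add chebL_dyck_height)
qed

lemma ip_chebV:
  assumes "hermitian n A"
  shows "ip n (chebV n A \<alpha> i u) w = chebL i (\<lambda>l. \<alpha> ^ l * ip n (((mv n A) ^^ l) u) w)"
proof (induction i arbitrary: w rule: induct_nat_012)
  case (ge2 i)
  have "ip n (chebV n A \<alpha> (Suc (Suc i)) u) w
      = ip n (chebV n A \<alpha> (Suc i) u) (\<lambda>x. \<alpha> *\<^sub>R mv n A w x) - ip n (chebV n A \<alpha> i u) w"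
    by (simp add: ip_diff_left ip_scale_left ip_scale_right ip_mv_hermitian[OF assms])
  also have "ip n (chebV n A \<alpha> (Suc i) u) (\<lambda>x. \<alpha> *\<^sub>R mv n A w x)
      = chebL (Suc i) (\<lambda>l. \<alpha> ^ l * ip n (((mv n A) ^^ l) u) (\<lambda>x. \<alpha> *\<^sub>R mv n A w x))"
    by (rule ge2)
  also have "(\<lambda>l. \<alpha> ^ l * ip n (((mv n A) ^^ l) u) (\<lambda>x. \<alpha> *\<^sub>R mv n A w x))
      = (\<lambda>l. \<alpha> ^ Suc l * ip n (((mv n A) ^^ Suc l) u) w)"
    by (simp add: ip_scale_right ip_mv_hermitian[OF assms] mult_ac)
  finally show ?case using ge2(1) by simp
qed (auto simp: ip_scale_left)

lemma ip_chebV_chebV: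
  assumes "hermitian n A"
  shows "ip n (chebV n A \<alpha> i u) (((mv n A) ^^ d) (chebV n A \<alpha> j u))
    = chebL i (\<lambda>l. chebL j (\<lambda>l'. \<alpha> ^ (l + l') * ip n u (((mv n A) ^^ (l + l' + d)) u)))"
proof -
  have "ip n (((mv n A) ^^ l) u) (((mv n A) ^^ d) (chebV n A \<alpha> j u)) = chebL j (\<lambda>l'. \<alpha> ^ l' * ip n u (((mv n A) ^^ (l + l' + d)) u))" for l
  proof -
    have "ip n (((mv n A) ^^ l) u) (((mv n A) ^^ d) (chebV n A \<alpha> j u)) = ip n (chebV n A \<alpha> j u) (((mv n A) ^^ (l + d)) u)"
    proof -
      have "ip n (((mv n A) ^^ l) u) (((mv n A) ^^ d) (chebV n A \<alpha> j u)) = ip n (((mv n A) ^^ d) (chebV n A \<alpha> j u)) (((mv n A) ^^ l) u)"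
        by (rule ip_commute)
      also have "\<dots> = ip n (chebV n A \<alpha> j u) (((mv n A) ^^ d) (((mv n A) ^^ l) u))"
        by (rule ip_mv_pow[OF assms])
      finally show ?thesis by (simp add: funpow_add add.commute[of l d])
    qed
    also have "\<dots> = chebL j (\<lambda>l'. \<alpha> ^ l' * ip n u (((mv n A) ^^ (l + l' + d)) u))"
      by (simp add: ip_chebV[OF assms] ip_mv_pow_add[OF assms] add_ac)
    finally show ?thesis .
  qed
  then show ?thesis
    by (simp add: ip_chebV[OF assms] power_add mult.assoc chebL_cmult)
qed

lemma ip_chebV_commute:
  assumes "hermitian n A"
  shows "ip n (chebV n A \<alpha> i u) w = ip n u (chebV n A \<alpha> i w)"
proof -
  have "ip n (((mv n A) ^^ l) u) w = ip n (((mv n A) ^^ l) w) u" for l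
    by (metis assms ip_commute ip_mv_pow)
  then have "(\<lambda>l. \<alpha> ^ l * ip n (((mv n A) ^^ l) u) w) = (\<lambda>l. \<alpha> ^ l * ip n (((mv n A) ^^ l) w) u)"
    by metis
  then show ?thesis
    unfolding ip_commute[of n u "chebV n A \<alpha> i w"] ip_chebV[OF assms] by (simp only:)
qed

lemma nrm_chebV:
  assumes A: "op_bound n A c" and \<alpha>: "0 \<le> \<alpha>" "\<alpha> * c \<le> \<beta>"
  shows "0 \<le> chebB \<beta> i \<and> nrm n (chebV n A \<alpha> i w) \<le> chebB \<beta> i * nrm n w"
proof -
  have step: "nrm n (\<lambda>x. \<alpha> *\<^sub>R mv n A v x) \<le> \<beta> * nrm n v" for v
  proof -
    have "nrm n (\<lambda>x. \<alpha> *\<^sub>R mv n A v x) = \<alpha> * nrm n (mv n A v)" using \<alpha> by (simp add: nrm_scale)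
    also have "\<dots> \<le> \<alpha> * (c * nrm n v)" using A \<alpha> by (intro mult_left_mono) (auto simp: op_bound_nrm)
    also have "\<dots> \<le> \<beta> * nrm n v" using \<alpha> by (simp add: mult.assoc[symmetric] mult_right_mono)
    finally show ?thesis .
  qed
  have \<beta>: "0 \<le> \<beta>" using A \<alpha> by (auto simp: op_bound_def intro: order_trans[OF mult_nonneg_nonneg])
  show ?thesis
  proof (induction i rule: induct_nat_012)
    case (ge2 i)
    have "nrm n (chebV n A \<alpha> (Suc (Suc i)) w) \<le> nrm n (\<lambda>x. \<alpha> *\<^sub>R mv n A (chebV n A \<alpha> (Suc i) w) x) + nrm n (chebV n A \<alpha> i w)"
      by (simp add: nrm_diff)
    also have "\<dots> \<le> \<beta> * (chebB \<beta> (Suc i) * nrm n w) + chebB \<beta> i * nrm n w"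
      using ge2 \<beta> by (intro add_mono order_trans[OF step] mult_left_mono) auto
    finally show ?case using ge2 \<beta> by (simp add: algebra_simps)
  qed (use step \<beta> in auto)
qed

definition chebP :: "nat \<Rightarrow> (nat \<Rightarrow> nat \<Rightarrow> quaternion) \<Rightarrow> real \<Rightarrow> nat \<Rightarrow> (nat \<Rightarrow> quaternion) \<Rightarrow> nat \<Rightarrow> quaternion" where
  "chebP n A \<alpha> m w x = (\<Sum>i<m. chebV n A \<alpha> i w x)"

definition chebC :: "real \<Rightarrow> nat \<Rightarrow> real" where
  "chebC \<beta> m = (\<Sum>i<m. chebB \<beta> i)"

lemma ip_chebP_commute:
  assumes "hermitian n A"
  shows "ip n (chebP n A \<alpha> m u) w = ip n u (chebP n A \<alpha> m w)"
  unfolding chebP_def[abs_def] ip_sum_left ip_sum_right by (simp add: ip_chebV_commute[OF assms])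

lemma ip_chebP_le:
  assumes "op_bound n A c" "0 \<le> \<alpha>" "\<alpha> * c \<le> \<beta>"
  shows "ip n (chebP n A \<alpha> m w) (chebP n A \<alpha> m w) \<le> (chebC \<beta> m)\<^sup>2 * ip n w w"
proof -
  note V = nrm_chebV[OF assms]
  have "nrm n (chebP n A \<alpha> m w) \<le> chebC \<beta> m * nrm n w"
  proof (induction m)
    case 0
    have "nrm n (\<lambda>_. 0 :: quaternion) = 0" by (simp add: nrm_def ip_def)
    then show ?case by (simp add: chebP_def[abs_def] chebC_def)
  next
    case (Suc m)
    have "nrm n (chebP n A \<alpha> (Suc m) w) \<le> nrm n (chebP n A \<alpha> m w) + nrm n (chebV n A \<alpha> m w)"
      using nrm_triangle[of n "chebP n A \<alpha> m w" "chebV n A \<alpha> m w"] by (simp add: chebP_def[abs_def])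
    then show ?case using Suc V[of m w] by (simp add: chebC_def algebra_simps)
  qed
  then have "(nrm n (chebP n A \<alpha> m w))\<^sup>2 \<le> (chebC \<beta> m * nrm n w)\<^sup>2" by (intro power_mono) auto
  then show ?thesis by (simp add: power_mult_distrib nrm_square)
qed

text \<open>The normalised trace moments of \<open>A\<close>, with \<open>s \<sqrt>n\<close> as the unit of length.\<close>

definition mom :: "nat \<Rightarrow> (nat \<Rightarrow> nat \<Rightarrow> quaternion) \<Rightarrow> real \<Rightarrow> nat \<Rightarrow> real" where
  "mom n A s l = (\<Sum>r<n. inner qone (pw n A l r)) / (n * (s * sqrt n) ^ l)"

text \<open>Summing over the whole real basis turns quadratic forms of polynomials in
  \<open>A\<close> into trace moments, which are the only quantities with known limits.\<close>

lemma sum_chebP: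
  assumes A: "hermitian n A" and s: "0 < s" and n: "0 < n"
  shows "(\<Sum>r<n. \<Sum>b\<in>Basis. ip n (chebP n A (1 / (s * sqrt n)) m (bv r b)) (((mv n A) ^^ d) (chebP n A (1 / (s * sqrt n)) m (bv r b))))
    = 4 * n * (s * sqrt n) ^ d * (\<Sum>i<m. \<Sum>j<m. chebL i (\<lambda>l. chebL j (\<lambda>l'. mom n A s (l + l' + d))))"
proof -
  define \<alpha> where "\<alpha> = 1 / (s * sqrt n)"
  define F where "F r l = inner qone (pw n A l r)" for r l
  have \<alpha>: "\<alpha> > 0" using s n by (simp add: \<alpha>_def)
  have "(\<Sum>r<n. \<Sum>b\<in>Basis. ip n (chebP n A \<alpha> m (bv r b)) (((mv n A) ^^ d) (chebP n A \<alpha> m (bv r b))))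
    = (\<Sum>r<n. \<Sum>b\<in>(Basis :: quaternion set). \<Sum>i<m. \<Sum>j<m. chebL i (\<lambda>l. chebL j (\<lambda>l'. \<alpha> ^ (l + l') * F r (l + l' + d))))"
    unfolding chebP_def[abs_def] mv_pow_sum ip_sum_left ip_sum_right ip_chebV_chebV[OF A]
    by (intro sum.cong refl) (simp add: pw_trace F_def)
  also have "\<dots> = 4 * (\<Sum>r<n. \<Sum>i<m. \<Sum>j<m. chebL i (\<lambda>l. chebL j (\<lambda>l'. \<alpha> ^ (l + l') * F r (l + l' + d))))"
    by (simp add: sum_distrib_left)
  also have "(\<Sum>r<n. \<Sum>i<m. \<Sum>j<m. chebL i (\<lambda>l. chebL j (\<lambda>l'. \<alpha> ^ (l + l') * F r (l + l' + d))))
      = (\<Sum>i<m. \<Sum>j<m. \<Sum>r<n. chebL i (\<lambda>l. chebL j (\<lambda>l'. \<alpha> ^ (l + l') * F r (l + l' + d))))"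
    by (subst sum.swap) (intro sum.cong refl sum.swap)
  also have "\<dots> = (\<Sum>i<m. \<Sum>j<m. chebL i (\<lambda>l. chebL j (\<lambda>l'. (n * (s * sqrt n) ^ d) * mom n A s (l + l' + d))))"
  proof (intro sum.cong refl)
    fix i j
    have *: "(\<Sum>r<n. \<alpha> ^ (l + l') * F r (l + l' + d)) = (n * (s * sqrt n) ^ d) * mom n A s (l + l' + d)" for l l'
    proof -
      have x: "s * sqrt n > 0" using s n by simp
      have frac: "(1 / y) ^ (l + l') * S = n * y ^ d * (S / (n * y ^ (l + l' + d)))" if "y > 0" for y S :: real
        using that n by (simp add: power_divide power_add)
      have "(\<Sum>r<n. \<alpha> ^ (l + l') * F r (l + l' + d)) = \<alpha> ^ (l + l') * (\<Sum>r<n. F r (l + l' + d))"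
        by (simp add: sum_distrib_left)
      also have "\<dots> = (n * (s * sqrt n) ^ d) * ((\<Sum>r<n. F r (l + l' + d)) / (n * (s * sqrt n) ^ (l + l' + d)))"
        unfolding \<alpha>_def by (rule frac[OF x])
      finally show ?thesis by (simp add: mom_def F_def)
    qed
    show "(\<Sum>r<n. chebL i (\<lambda>l. chebL j (\<lambda>l'. \<alpha> ^ (l + l') * F r (l + l' + d))))
        = chebL i (\<lambda>l. chebL j (\<lambda>l'. (n * (s * sqrt n) ^ d) * mom n A s (l + l' + d)))"
      by (simp only: chebL_sum[symmetric] *)
  qed
  also have "\<dots> = n * (s * sqrt n) ^ d * (\<Sum>i<m. \<Sum>j<m. chebL i (\<lambda>l. chebL j (\<lambda>l'. mom n A s (l + l' + d))))"
    by (simp add: chebL_cmult sum_distrib_left)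
  finally show ?thesis by (simp add: \<alpha>_def)
qed

lemma cheb_limit_0: "(\<Sum>i<m. \<Sum>j<m. chebL i (\<lambda>l. chebL j (\<lambda>l'. real (dyck (l + l' + 0) 0)))) = m"
proof -
  have "chebL i (\<lambda>l. chebL j (\<lambda>l'. real (dyck (l + l' + 0) 0))) = (if j = i then 1 else 0)" for i j
  proof -
    have "(\<lambda>l. chebL j (\<lambda>l'. real (dyck (l + l' + 0) 0))) = (\<lambda>l. real (dyck l j))"
      using chebL_dyck[of j] by (simp add: add.commute)
    then show ?thesis by (simp add: chebL_dyck_height)
  qed
  then show ?thesis by simp
qed

text \<open>Only neighbouring degrees interact, and there are \<open>m - 1\<close> neighbouring
  pairs, each counted twice. Against \<open>m\<close> from \<open>cheb_limit_0\<close>, the limiting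
  Rayleigh quotient is \<open>2 * (m - 1) / m\<close>.\<close>

lemma cheb_limit_1: "0 < m \<Longrightarrow> (\<Sum>i<m. \<Sum>j<m. chebL i (\<lambda>l. chebL j (\<lambda>l'. real (dyck (l + l' + 1) 0)))) = 2 * (real m - 1)"
proof -
  assume m: "0 < m"
  have "chebL i (\<lambda>l. chebL j (\<lambda>l'. real (dyck (l + l' + 1) 0))) = (if j = Suc i then 1 else 0) + (if i = Suc j then 1 else 0)" for i j
  proof -
    have "(\<lambda>l. chebL j (\<lambda>l'. real (dyck (l + l' + 1) 0))) = (\<lambda>l. real (dyck (Suc l) j))"
      using chebL_dyck[of j "Suc _"] by (simp add: add.commute del: dyck.simps)
    then show ?thesis by (simp add: chebL_dyck_shift del: dyck.simps)
  qed
  moreover have "(\<Sum>i<m. \<Sum>j<m. (if j = Suc i then 1 else 0) :: real) = real m - 1"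
  proof -
    have "(\<Sum>i<m. \<Sum>j<m. (if j = Suc i then 1 else 0) :: real) = (\<Sum>i<m. if i < m - 1 then 1 else 0)"
      by (intro sum.cong refl) auto
    also have "\<dots> = real (card ({..<m} \<inter> {i. i < m - 1}))" by (simp add: sum.If_cases)
    also have "{..<m} \<inter> {i. i < m - 1} = {..<m - 1}" by auto
    finally show ?thesis using m by simp
  qed
  moreover have "(\<Sum>i<m. \<Sum>j<m. (if i = Suc j then 1 else 0) :: real) = (\<Sum>i<m. \<Sum>j<m. (if j = Suc i then 1 else 0))"
    by (subst sum.swap) simp
  ultimately show ?thesis by (simp add: sum.distrib)
qed

text \<open>The term \<open>a *\<^sub>R qone\<close> is also added on the diagonal, hence the
  correction \<open>d i - a\<close> there.\<close>

definition pmat :: "(nat \<Rightarrow> nat \<Rightarrow> quaternion) \<Rightarrow> (nat \<Rightarrow> real) \<Rightarrow> real \<Rightarrow> nat \<Rightarrow> nat \<Rightarrow> quaternion" where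
  "pmat A d a i j = A i j + (if i = j then (d i - a) *\<^sub>R qone else 0) + a *\<^sub>R qone"

lemma quat_conj_qone [simp]: "quat_conj qone = qone"
  by (simp add: qone_def)

lemma ip_pmat:
  "ip n g (mv n (pmat A d a) g) = ip n g (mv n A g) + (\<Sum>i<n. (d i - a) * (norm (g i))\<^sup>2) + a * (norm (\<Sum>i<n. g i))\<^sup>2"
proof -
  have mvp: "mv n (pmat A d a) g i = mv n A g i + (d i - a) *\<^sub>R g i + a *\<^sub>R (\<Sum>j<n. g j)" if "i < n" for i
  proof -
    have "mv n (pmat A d a) g i = (\<Sum>j<n. qmul (A i j) (g j) + (if j = i then (d i - a) *\<^sub>R g i else 0) + a *\<^sub>R g j)"
      unfolding mv_def pmat_def by (intro sum.cong refl) (auto simp: qmul.add_left qmul.scaleR_left qmul.zero_left)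
    then show ?thesis using that by (simp add: sum.distrib mv_def scaleR_sum_right)
  qed
  have "ip n g (mv n (pmat A d a) g) = (\<Sum>i<n. inner (g i) (mv n A g i) + (d i - a) * (norm (g i))\<^sup>2 + a * inner (g i) (\<Sum>j<n. g j))"
    unfolding ip_def by (intro sum.cong refl) (simp add: mvp inner_add_right power2_norm_eq_inner)
  also have "\<dots> = ip n g (mv n A g) + (\<Sum>i<n. (d i - a) * (norm (g i))\<^sup>2) + a * inner (\<Sum>i<n. g i) (\<Sum>j<n. g j)"
    by (simp add: sum.distrib ip_def inner_sum_left sum_distrib_left)
  finally show ?thesis by (simp add: power2_norm_eq_inner)
qed

lemma norm_square_ip:
  assumes "i < n"
  shows "(norm (v i))\<^sup>2 = (\<Sum>b\<in>Basis. (ip n (bv i b) v)\<^sup>2)"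
proof -
  have "(norm (v i))\<^sup>2 = (\<Sum>b\<in>Basis. inner (v i) b * inner (v i) b)"
    unfolding power2_norm_eq_inner by (rule euclidean_inner)
  then show ?thesis using assms by (simp add: ip_bv power2_eq_square inner_commute)
qed

lemma norm_sum_square_ip:
  "(norm (\<Sum>i<n. if i \<in> S then v i else 0))\<^sup>2 = (\<Sum>b\<in>Basis. (ip n (\<lambda>i. if i \<in> S then b else 0) v)\<^sup>2)"
proof -
  have "ip n (\<lambda>i. if i \<in> S then b else 0) v = inner (\<Sum>i<n. if i \<in> S then v i else 0) b" for b :: quaternion
    unfolding ip_def inner_sum_left by (intro sum.cong refl) (simp add: inner_commute)
  moreover have "(norm (\<Sum>i<n. if i \<in> S then v i else 0))\<^sup>2
      = (\<Sum>b\<in>Basis. inner (\<Sum>i<n. if i \<in> S then v i else 0) b * inner (\<Sum>i<n. if i \<in> S then v i else 0) b)"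
    unfolding power2_norm_eq_inner by (rule euclidean_inner)
  ultimately show ?thesis by (simp add: power2_eq_square)
qed

text \<open>Parseval after moving \<open>T\<close> to the fixed vector \<open>u\<close>. A sum over
  all test vectors thus becomes a single squared length.\<close>

lemma sum_ip_adjoint:
  assumes "\<And>u w. ip n (T u) w = ip n u (T w)"
  shows "(\<Sum>r<n. \<Sum>b\<in>Basis. (ip n u (T (bv r b)))\<^sup>2) = ip n (T u) (T u)"
proof -
  have "ip n u (T (bv r b)) = ip n (bv r b) (T u)" for r b
    using assms[of u "bv r b"] ip_commute[of n "T u"] by simp
  then show ?thesis by (simp add: ip_bv_sum)
qed

text \<open>Read contrapositively, it provides a vector with Rayleigh quotient above
  \<open>\<theta> * sqrt n\<close>. The hypothesis \<open>le\<close> is applied to the Chebyshev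
  vectors of all \<open>4 * n\<close> basis vectors, cut off at the bad indices, and the results are
  added. The errors thus need to be small only on average. \<open>R\<close> is the remainder of a
  truncation.\<close>

lemma rayleigh_sum_bound:
  fixes d :: "nat \<Rightarrow> real" and m :: nat
  assumes n: "0 < n" and s: "0 < s" and A: "hermitian n A" "op_bound n A (c * sqrt n)"
    and R: "op_bound n R (\<tau> * sqrt n)" and a: "a \<le> 0" and K: "0 \<le> K" and \<theta>: "0 \<le> \<theta>" and \<eta>: "0 < \<eta>"
    and le: "\<And>v. ip n v (mv n (pmat (\<lambda>i j. A i j + R i j) d a) v) \<le> \<theta> * sqrt n * ip n v v"
  defines "q \<equiv> \<lambda>e. \<Sum>i<m. \<Sum>j<m. chebL i (\<lambda>l. chebL j (\<lambda>l'. mom n A s (l + l' + e)))"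
    and "C \<equiv> chebC (c / s) m"
  shows "s * q 1 \<le> (\<theta> + \<eta> * c\<^sup>2 + \<tau> + K / sqrt n) * q 0
    + (1 / \<eta> + c) * C\<^sup>2 * (card {i. i < n \<and> d i < - K} / n) + \<bar>a\<bar> * C\<^sup>2 / sqrt n"
proof -
  define x where "x = sqrt (real n)"
  define P where "P = chebP n A (1 / (s * sqrt n)) m"
  define bad where "bad = {i. i < n \<and> d i < - K}"
  define G where "G = {i. - K \<le> d i}"
  define v where "v r b = P (bv r b)" for r b
  define g where "g r b i = (if i \<in> G then v r b i else 0)" for r b i
  define h where "h r b i = v r b i - g r b i" for r b i
  define S where "S f = (\<Sum>r<n. \<Sum>b\<in>(Basis :: quaternion set). (f r b :: real))" for f
  have x: "x > 0" "x * x = n" using n by (simp_all add: x_def)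
  have c: "0 \<le> c" "0 \<le> \<tau>" using A(2) R n by (auto simp: op_bound_def zero_le_mult_iff)
  have Padj: "ip n (P u) w = ip n u (P w)" for u w unfolding P_def by (rule ip_chebP_commute[OF A(1)])
  have Ple: "ip n (P w) (P w) \<le> C\<^sup>2 * ip n w w" for w
    unfolding P_def C_def using x s by (intro ip_chebP_le[OF A(2)]) (auto simp: x_def)
  have Smono: "(\<And>r b. r < n \<Longrightarrow> b \<in> Basis \<Longrightarrow> f r b \<le> f' r b) \<Longrightarrow> S f \<le> S f'" for f f'
    unfolding S_def by (intro sum_mono) auto
  have Sadd: "S (\<lambda>r b. f r b + f' r b) = S f + S f'" for f f' by (simp add: S_def sum.distrib)
  have Scmult: "S (\<lambda>r b. t * f r b) = t * S f" for f t by (simp add: S_def sum_distrib_left)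
  have Ssum: "S (\<lambda>r b. \<Sum>i\<in>I. f i r b) = (\<Sum>i\<in>I. S (f i))" for f and I :: "nat set"
    unfolding S_def by (simp only: sum.swap[of _ I])
  have Ssum': "S (\<lambda>r b. \<Sum>i\<in>I. f i r b) = (\<Sum>i\<in>I. S (f i))" for f and I :: "quaternion set"
    unfolding S_def by (simp only: sum.swap[of _ I])
  have T0: "S (\<lambda>r b. ip n (v r b) (v r b)) = 4 * n * q 0"
    using sum_chebP[OF A(1) s n, of m 0] by (simp add: S_def v_def P_def q_def)
  have T1: "S (\<lambda>r b. ip n (v r b) (mv n A (v r b))) = 4 * n * (s * x) * q 1"
    using sum_chebP[OF A(1) s n, of m 1] by (simp add: S_def v_def P_def q_def x_def)
  \<comment> \<open>By self-adjointness of \<open>P\<close>, the total mass of all test vectors at a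
    bad index equals the squared length of \<open>P\<close> applied to the basis vectors at that
    index, so each bad index costs a constant.\<close>
  have H: "S (\<lambda>r b. ip n (h r b) (h r b)) \<le> 4 * card bad * C\<^sup>2"
  proof -
    have hh: "ip n (h r b) (h r b) = (\<Sum>i\<in>bad. \<Sum>b'\<in>Basis. (ip n (bv i b') (v r b))\<^sup>2)" for r b
    proof -
      have "ip n (h r b) (h r b) = (\<Sum>i<n. if i \<in> bad then (norm (v r b i))\<^sup>2 else 0)"
        unfolding ip_self by (intro sum.cong refl) (auto simp: h_def g_def G_def bad_def)
      also have "\<dots> = (\<Sum>i\<in>{..<n} \<inter> bad. (norm (v r b i))\<^sup>2)"
        by (subst sum.inter_restrict) auto
      also have "{..<n} \<inter> bad = bad" by (auto simp: bad_def)
      also have "(\<Sum>i\<in>bad. (norm (v r b i))\<^sup>2) = (\<Sum>i\<in>bad. \<Sum>b'\<in>Basis. (ip n (bv i b') (v r b))\<^sup>2)"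
        by (intro sum.cong refl norm_square_ip) (auto simp: bad_def)
      finally show ?thesis .
    qed
    have "S (\<lambda>r b. ip n (h r b) (h r b)) = (\<Sum>i\<in>bad. \<Sum>b'\<in>Basis. S (\<lambda>r b. (ip n (bv i b') (v r b))\<^sup>2))"
      by (simp add: hh Ssum Ssum')
    also have "\<dots> = (\<Sum>i\<in>bad. \<Sum>b'\<in>Basis. ip n (P (bv i b')) (P (bv i b')))"
      unfolding S_def v_def by (simp add: sum_ip_adjoint[of n P, OF Padj])
    also have "\<dots> \<le> (\<Sum>i\<in>bad. \<Sum>b'\<in>(Basis :: quaternion set). C\<^sup>2)"
    proof (intro sum_mono)
      fix i and b' :: quaternion assume "i \<in> bad" "b' \<in> Basis"
      then have "ip n (bv i b') (bv i b') = 1" by (simp add: ip_bv bad_def bv_def inner_Basis)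
      then show "ip n (P (bv i b')) (P (bv i b')) \<le> C\<^sup>2" using Ple[of "bv i b'"] by simp
    qed
    also have "\<dots> = 4 * card bad * C\<^sup>2" by simp
    finally show ?thesis .
  qed
  \<comment> \<open>The same exchange with the indicator of the good indices bounds the rank one
    term by order \<open>n\<close>, against \<open>n * sqrt n\<close> for the main term.\<close>
  have J: "S (\<lambda>r b. (norm (\<Sum>i<n. g r b i))\<^sup>2) \<le> 4 * n * C\<^sup>2"
  proof -
    have "S (\<lambda>r b. (norm (\<Sum>i<n. g r b i))\<^sup>2) = (\<Sum>b'\<in>Basis. S (\<lambda>r b. (ip n (\<lambda>i. if i \<in> G then b' else 0) (v r b))\<^sup>2))"
      by (simp add: g_def norm_sum_square_ip Ssum')
    also have "\<dots> = (\<Sum>b'\<in>Basis. ip n (P (\<lambda>i. if i \<in> G then b' else 0)) (P (\<lambda>i. if i \<in> G then b' else 0)))"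
      unfolding S_def v_def by (simp add: sum_ip_adjoint[of n P, OF Padj])
    also have "\<dots> \<le> (\<Sum>b'\<in>(Basis :: quaternion set). C\<^sup>2 * n)"
    proof (intro sum_mono)
      fix b' :: quaternion assume b': "b' \<in> Basis"
      have "ip n (\<lambda>i. if i \<in> G then b' else 0) (\<lambda>i. if i \<in> G then b' else 0) \<le> (\<Sum>i<n. 1)"
        unfolding ip_self using b' by (intro sum_mono) auto
      then have "C\<^sup>2 * ip n (\<lambda>i. if i \<in> G then b' else 0) (\<lambda>i. if i \<in> G then b' else 0) \<le> C\<^sup>2 * n"
        by (intro mult_left_mono) auto
      then show "ip n (P (\<lambda>i. if i \<in> G then b' else 0)) (P (\<lambda>i. if i \<in> G then b' else 0)) \<le> C\<^sup>2 * n"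
        by (rule order_trans[OF Ple])
    qed
    also have "\<dots> = 4 * n * C\<^sup>2" by simp
    finally show ?thesis .
  qed
  have single: "ip n (v r b) (mv n A (v r b)) \<le> (\<theta> * x + \<eta> * c\<^sup>2 * x + \<tau> * x + K) * ip n (v r b) (v r b)
      + x * (1 / \<eta> + c) * ip n (h r b) (h r b) + \<bar>a\<bar> * (norm (\<Sum>i<n. g r b i))\<^sup>2" for r b
  proof -
    let ?v = "v r b" and ?g = "g r b" and ?h = "h r b"
    have gv: "ip n ?g ?g \<le> ip n ?v ?v"
      unfolding ip_self by (intro sum_mono) (auto simp: g_def)
    have "ip n ?g (mv n (\<lambda>i j. A i j + R i j) ?g) + (\<Sum>i<n. (d i - a) * (norm (?g i))\<^sup>2) + a * (norm (\<Sum>i<n. ?g i))\<^sup>2 \<le> \<theta> * x * ip n ?g ?g"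
      using le[of ?g] by (simp add: ip_pmat x_def)
    moreover have "\<theta> * x * ip n ?g ?g \<le> \<theta> * x * ip n ?v ?v" using gv \<theta> x by (intro mult_left_mono) auto
    moreover have "- K * ip n ?v ?v \<le> (\<Sum>i<n. (d i - a) * (norm (?g i))\<^sup>2)"
    proof -
      have "(\<Sum>i<n. (d i - a) * (norm (?g i))\<^sup>2) \<ge> (\<Sum>i<n. - K * (norm (?g i))\<^sup>2)"
      proof (intro sum_mono)
        fix i
        show "- K * (norm (?g i))\<^sup>2 \<le> (d i - a) * (norm (?g i))\<^sup>2"
        proof (cases "i \<in> G")
          case True
          then have "0 \<le> (d i - a + K) * (norm (?g i))\<^sup>2"
            using a by (intro mult_nonneg_nonneg) (auto simp: G_def)
          then show ?thesis by (simp add: algebra_simps)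
        qed (simp add: g_def)
      qed
      moreover have "(\<Sum>i<n. - K * (norm (?g i))\<^sup>2) = - K * ip n ?g ?g" by (simp add: ip_self sum_distrib_left)
      moreover have "K * ip n ?g ?g \<le> K * ip n ?v ?v" using gv K by (intro mult_left_mono)
      ultimately show ?thesis by simp
    qed
    moreover have "ip n ?g (mv n (\<lambda>i j. A i j + R i j) ?g) = ip n ?g (mv n A ?g) + ip n ?g (mv n R ?g)"
      unfolding mv_add_mat[abs_def] by (rule ip_add_right)
    moreover have "- (\<tau> * x) * ip n ?v ?v \<le> ip n ?g (mv n R ?g)"
    proof -
      have "\<bar>ip n ?g (mv n R ?g)\<bar> \<le> \<tau> * x * ip n ?g ?g" using op_bound_ip[OF R, of ?g] by (simp add: x_def)
      moreover have "\<tau> * x * ip n ?g ?g \<le> \<tau> * x * ip n ?v ?v" using gv c x by (intro mult_left_mono) auto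
      ultimately show ?thesis by simp
    qed
    moreover have "ip n ?g (mv n A ?g) \<ge> ip n ?v (mv n A ?v) - \<eta> * c\<^sup>2 * x * ip n ?v ?v - x * (1 / \<eta> + c) * ip n ?h ?h"
    proof -
      have geq: "?g = (\<lambda>i. ?v i - ?h i)" by (auto simp: h_def)
      have "ip n ?g (mv n A ?g) = ip n ?v (mv n A ?v) - ip n ?v (mv n A ?h) - ip n ?h (mv n A ?v) + ip n ?h (mv n A ?h)"
        unfolding geq mv_diff[abs_def] by (simp add: ip_diff_left ip_diff_right)
      also have "ip n ?v (mv n A ?h) = ip n ?h (mv n A ?v)"
        by (metis A(1) ip_commute ip_mv_hermitian)
      finally have 1: "ip n ?g (mv n A ?g) = ip n ?v (mv n A ?v) - 2 * ip n (mv n A ?v) ?h + ip n ?h (mv n A ?h)"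
        by (simp add: ip_commute[of n ?h "mv n A ?v"])
      have 2: "\<bar>ip n ?h (mv n A ?h)\<bar> \<le> c * x * ip n ?h ?h" using op_bound_ip[OF A(2), of ?h] by (simp add: x_def)
      \<comment> \<open>The cross term is balanced by \<open>\<eta> / x\<close>: a small multiple of
        the mass of \<open>v\<close>, and a large multiple of the mass of \<open>h\<close>, which is
        small in total.\<close>
      have "2 * \<bar>ip n (mv n A ?v) ?h\<bar> \<le> (\<eta> / x) * ip n (mv n A ?v) (mv n A ?v) + ip n ?h ?h / (\<eta> / x)"
        using \<eta> x by (intro ip_am_gm) auto
      also have "(\<eta> / x) * ip n (mv n A ?v) (mv n A ?v) \<le> (\<eta> / x) * ((c * x)\<^sup>2 * ip n ?v ?v)"
        using A(2) \<eta> x by (intro mult_left_mono) (auto simp: op_bound_def x_def)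
      also have "(\<eta> / x) * ((c * x)\<^sup>2 * ip n ?v ?v) = \<eta> * c\<^sup>2 * x * ip n ?v ?v"
        using x by (simp add: power2_eq_square)
      finally have 3: "2 * \<bar>ip n (mv n A ?v) ?h\<bar> \<le> \<eta> * c\<^sup>2 * x * ip n ?v ?v + ip n ?h ?h * (x / \<eta>)"
        by simp
      have "x * (1 / \<eta> + c) * ip n ?h ?h = ip n ?h ?h * (x / \<eta>) + c * x * ip n ?h ?h"
        by (simp add: algebra_simps)
      then show ?thesis using 1 2 3 by linarith
    qed
    moreover have "a * (norm (\<Sum>i<n. ?g i))\<^sup>2 = - (\<bar>a\<bar> * (norm (\<Sum>i<n. ?g i))\<^sup>2)" using a by simp
    ultimately show ?thesis by (simp add: distrib_right)
  qed
  have "4 * n * (s * x) * q 1 \<le> S (\<lambda>r b. (\<theta> * x + \<eta> * c\<^sup>2 * x + \<tau> * x + K) * ip n (v r b) (v r b)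
      + x * (1 / \<eta> + c) * ip n (h r b) (h r b) + \<bar>a\<bar> * (norm (\<Sum>i<n. g r b i))\<^sup>2)"
    unfolding T1[symmetric] by (rule Smono) (rule single)
  also have "\<dots> = (\<theta> * x + \<eta> * c\<^sup>2 * x + \<tau> * x + K) * (4 * n * q 0)
      + x * (1 / \<eta> + c) * S (\<lambda>r b. ip n (h r b) (h r b)) + \<bar>a\<bar> * S (\<lambda>r b. (norm (\<Sum>i<n. g r b i))\<^sup>2)"
    by (simp add: Sadd Scmult T0)
  also have "\<dots> \<le> (\<theta> * x + \<eta> * c\<^sup>2 * x + \<tau> * x + K) * (4 * n * q 0)
      + x * (1 / \<eta> + c) * (4 * card bad * C\<^sup>2) + \<bar>a\<bar> * (4 * n * C\<^sup>2)"
    using H J x \<eta> c by (intro add_mono mult_left_mono order_refl) auto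
  also have "\<dots> = (4 * n * x) * ((\<theta> + \<eta> * c\<^sup>2 + \<tau> + K / x) * q 0 + (1 / \<eta> + c) * C\<^sup>2 * (card bad / n) + \<bar>a\<bar> * C\<^sup>2 / x)"
    using x(1) n by (simp add: field_simps)
  finally have "(4 * n * x) * (s * q 1) \<le> (4 * n * x) * ((\<theta> + \<eta> * c\<^sup>2 + \<tau> + K / x) * q 0 + (1 / \<eta> + c) * C\<^sup>2 * (card bad / n) + \<bar>a\<bar> * C\<^sup>2 / x)"
    by (simp add: mult_ac)
  then show ?thesis
    unfolding x_def[symmetric] bad_def[symmetric] using x n by (subst (asm) mult_le_cancel_left_pos) auto
qed

section \<open>Rayleigh quotients of perturbed arrays\<close>

lemma pw_zero [simp]: "pw n A 0 r = qone"
  by (simp add: pw_def bv_def)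

lemma power4_add_le: "(x + y) ^ 4 \<le> 8 * x ^ 4 + 8 * y ^ 4" for x y :: real
proof -
  have sq: "(u + v)\<^sup>2 \<le> 2 * u\<^sup>2 + 2 * v\<^sup>2" for u v :: real
    using zero_le_power2[of "u - v"] by (simp add: power2_sum power2_diff)
  have "(x + y) ^ 4 = ((x + y)\<^sup>2)\<^sup>2" by (simp add: power_mult[symmetric])
  also have "\<dots> \<le> (2 * x\<^sup>2 + 2 * y\<^sup>2)\<^sup>2" by (intro power_mono sq) auto
  also have "\<dots> \<le> 2 * (2 * x\<^sup>2)\<^sup>2 + 2 * (2 * y\<^sup>2)\<^sup>2" by (rule sq)
  also have "\<dots> = 8 * x ^ 4 + 8 * y ^ 4" by (simp add: power_mult_distrib power_mult[symmetric])
  finally show ?thesis .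
qed

context iid_quat_array
begin

lemma AE_mom_convergence:
  assumes bd: "\<And>\<omega>. \<omega> \<in> space M \<Longrightarrow> norm (X (0, 1) \<omega>) \<le> L"
    and bd': "\<And>j k \<omega>. j < k \<Longrightarrow> \<omega> \<in> space M \<Longrightarrow> norm (X (j, k) \<omega>) \<le> L"
    and mean: "expectation (X (0, 1)) = 0"
    and second: "expectation (\<lambda>\<omega>. (norm (X (0, 1) \<omega>))\<^sup>2) = s\<^sup>2" and s: "0 < s"
  shows "AE \<omega> in M. \<forall>l. (\<lambda>k. mom (k\<^sup>2) (W \<omega>) s l) \<longlonglongrightarrow> dyck l 0"
  unfolding AE_all_countable
proof
  fix l
  \<comment> \<open>The locale for bounded arrays requires \<open>s \<le> L\<close>.\<close>
  define L' where "L' = max L s"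
  have mean': "expectation (X (j, k)) = 0" if "j < k" for j k
    using expectation_transfer[OF that, of "\<lambda>q. q"] mean by simp
  have second': "expectation (\<lambda>\<omega>. (norm (X (j, k) \<omega>))\<^sup>2) = s\<^sup>2" if "j < k" for j k
    using expectation_transfer[OF that, of "\<lambda>q. (norm q)\<^sup>2"] second by simp
  have B: "bounded_quat_array M X n s L'" for n
  proof
    show "j < k \<Longrightarrow> k < n \<Longrightarrow> \<omega> \<in> space M \<Longrightarrow> norm (X (j, k) \<omega>) \<le> L'" for j k \<omega>
      using bd'[of j k \<omega>] by (simp add: L'_def)
  qed (use s mean' second' in \<open>auto simp: L'_def\<close>)
  show "AE \<omega> in M. (\<lambda>k. mom (k\<^sup>2) (W \<omega>) s l) \<longlonglongrightarrow> dyck l 0"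
  proof (cases "l = 0")
    case True
    have "mom (k\<^sup>2) (W \<omega>) s 0 = 1" if "0 < k" for k \<omega>
      using that by (simp add: mom_def power2_norm_eq_inner[symmetric])
    then have "(\<lambda>k. mom (k\<^sup>2) (W \<omega>) s 0) \<longlonglongrightarrow> 1" for \<omega>
      by (intro tendsto_eventually) (auto simp: eventually_sequentially intro!: exI[of _ 1])
    then show ?thesis using True by simp
  next
    case False
    then have l: "0 < l" by simp
    define f where "f k \<omega> = (\<Sum>r<k\<^sup>2. inner qone (pw (k\<^sup>2) (W \<omega>) l r)) / (real (k\<^sup>2) * sqrt (real (k\<^sup>2)) ^ l) - s ^ l * dyck l 0" for k \<omega>
    define N where "N = nat \<lceil>L'\<rceil> + 2 * l + 1"
    have N: "2 * l + 1 \<le> k\<^sup>2" "L' \<le> sqrt (real (k\<^sup>2))" if "N \<le> k" for k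
    proof -
      have "2 * l + 1 \<le> k" using that by (simp add: N_def)
      also have "k \<le> k\<^sup>2" by (simp add: power2_eq_square)
      finally show "2 * l + 1 \<le> k\<^sup>2" .
      have "nat \<lceil>L'\<rceil> \<le> k" using that unfolding N_def by linarith
      then have "real (nat \<lceil>L'\<rceil>) \<le> real k" by (rule of_nat_mono)
      then have "L' \<le> real k" using real_nat_ceiling_ge[of L'] by linarith
      then show "L' \<le> sqrt (real (k\<^sup>2))" by simp
    qed
    have "AE \<omega> in M. (\<lambda>k. f k \<omega>) \<longlonglongrightarrow> 0"
    proof (rule AE_LIMSEQ_zero_second_moment)
      fix k assume k: "N \<le> k"
      interpret B: bounded_quat_array M X "k\<^sup>2" s L' by (rule B)
      show "integrable M (\<lambda>\<omega>. (f k \<omega>)\<^sup>2)"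
        unfolding f_def using second' l N[OF k] by (intro B.trace_variance) auto
      show "expectation (\<lambda>\<omega>. (f k \<omega>)\<^sup>2) \<le> bounded_quat_array.var_const s L' l / real (k\<^sup>2)"
        unfolding f_def using second' l N[OF k] by (intro B.trace_variance) auto
    next
      have "summable (\<lambda>k. bounded_quat_array.var_const s L' l * inverse (real k ^ 2))"
        by (intro summable_mult inverse_power_summable) simp
      then show "summable (\<lambda>k. bounded_quat_array.var_const s L' l / real (k\<^sup>2))"
        by (simp add: divide_inverse)
    qed
    then show ?thesis
    proof eventually_elim
      case (elim \<omega>)
      have "mom (k\<^sup>2) (W \<omega>) s l = f k \<omega> / s ^ l + dyck l 0" for k
        using s by (simp add: mom_def f_def diff_divide_distrib power_mult_distrib)
      moreover have "(\<lambda>k. f k \<omega> / s ^ l + dyck l 0) \<longlonglongrightarrow> 0 / s ^ l + dyck l 0"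
        by (intro tendsto_intros elim) (use s in simp)
      ultimately show ?case by simp
    qed
  qed
qed

text \<open>In contrast to \<open>tr\<close> the level is fixed: the convergence of moments needs a
  bound independent of \<open>n\<close>, and the discarded part is controlled in operator norm
  through its small variance.\<close>

definition cut :: "real \<Rightarrow> quaternion \<Rightarrow> quaternion" where
  "cut T q = (if norm q \<le> T then q else 0)"

lemma cut_measurable [measurable]: "cut T \<in> borel_measurable borel"
  unfolding cut_def[abs_def] by measurable

lemma norm_cut_le: "norm (cut T q) \<le> norm q" "0 \<le> T \<Longrightarrow> norm (cut T q) \<le> T"
  by (auto simp: cut_def)

context
  assumes mean: "expectation (X (0, 1)) = 0"
    and int1: "integrable M (X (0, 1))"
    and fourth: "integrable M (\<lambda>\<omega>. norm (X (0, 1) \<omega>) ^ 4)"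
begin

lemma second_sub:
  assumes Z: "integrable M Z" and Z2: "integrable M (\<lambda>\<omega>. (norm (Z \<omega> :: quaternion))\<^sup>2)"
  shows "expectation (\<lambda>\<omega>. (norm (Z \<omega> - expectation Z))\<^sup>2) = expectation (\<lambda>\<omega>. (norm (Z \<omega>))\<^sup>2) - (norm (expectation Z))\<^sup>2"
proof -
  let ?m = "expectation Z"
  have "expectation (\<lambda>\<omega>. (norm (Z \<omega> - ?m))\<^sup>2) = expectation (\<lambda>\<omega>. (norm (Z \<omega>))\<^sup>2 - 2 * inner (Z \<omega>) ?m + (norm ?m)\<^sup>2)"
    by (intro Bochner_Integration.integral_cong refl)
      (simp add: power2_norm_eq_inner inner_diff_left inner_diff_right inner_commute)
  also have "\<dots> = expectation (\<lambda>\<omega>. (norm (Z \<omega>))\<^sup>2) - 2 * inner ?m ?m + (norm ?m)\<^sup>2"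
    using Z Z2 by (simp add: prob_space)
  finally show ?thesis by (simp add: power2_norm_eq_inner)
qed

lemma cut_limits:
  "(\<lambda>N. expectation (\<lambda>\<omega>. cut (real N) (X (0, 1) \<omega>))) \<longlonglongrightarrow> 0"
  "(\<lambda>N. expectation (\<lambda>\<omega>. (norm (cut (real N) (X (0, 1) \<omega>)))\<^sup>2)) \<longlonglongrightarrow> expectation (\<lambda>\<omega>. (norm (X (0, 1) \<omega>))\<^sup>2)"
  "(\<lambda>N. expectation (\<lambda>\<omega>. (norm (X (0, 1) \<omega> - cut (real N) (X (0, 1) \<omega>)))\<^sup>2)) \<longlonglongrightarrow> 0"
proof -
  have lim: "(\<lambda>N. cut (real N) q) \<longlonglongrightarrow> q" for q
  proof (rule tendsto_eventually)
    show "\<forall>\<^sub>F N in sequentially. cut (real N) q = q"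
      using eventually_ge_at_top[of "nat \<lceil>norm q\<rceil>"] by eventually_elim (simp add: cut_def; linarith)
  qed
  note int2 = int2[OF mean int1 fourth]
  have "(\<lambda>N. expectation (\<lambda>\<omega>. cut (real N) (X (0, 1) \<omega>))) \<longlonglongrightarrow> expectation (X (0, 1))"
    by (rule integral_dominated_convergence[where w = "\<lambda>\<omega>. norm (X (0, 1) \<omega>)"])
      (use int1 lim in \<open>auto simp: norm_cut_le\<close>)
  then show "(\<lambda>N. expectation (\<lambda>\<omega>. cut (real N) (X (0, 1) \<omega>))) \<longlonglongrightarrow> 0" using mean by simp
  show "(\<lambda>N. expectation (\<lambda>\<omega>. (norm (cut (real N) (X (0, 1) \<omega>)))\<^sup>2)) \<longlonglongrightarrow> expectation (\<lambda>\<omega>. (norm (X (0, 1) \<omega>))\<^sup>2)"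
    by (rule integral_dominated_convergence[where w = "\<lambda>\<omega>. (norm (X (0, 1) \<omega>))\<^sup>2"])
      (use int2 in \<open>auto simp: norm_cut_le intro!: tendsto_intros power_mono lim AE_I2\<close>)
  have "(\<lambda>N. expectation (\<lambda>\<omega>. (norm (X (0, 1) \<omega> - cut (real N) (X (0, 1) \<omega>)))\<^sup>2)) \<longlonglongrightarrow> expectation (\<lambda>\<omega>. (norm (X (0, 1) \<omega> - X (0, 1) \<omega>))\<^sup>2)"
  proof (rule integral_dominated_convergence[where w = "\<lambda>\<omega>. (norm (X (0, 1) \<omega>))\<^sup>2"])
    show "AE \<omega> in M. (\<lambda>N. (norm (X (0, 1) \<omega> - cut (real N) (X (0, 1) \<omega>)))\<^sup>2) \<longlonglongrightarrow> (norm (X (0, 1) \<omega> - X (0, 1) \<omega>))\<^sup>2"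
      using lim by (intro AE_I2 tendsto_intros)
    show "AE \<omega> in M. norm ((norm (X (0, 1) \<omega> - cut (real N) (X (0, 1) \<omega>)))\<^sup>2) \<le> (norm (X (0, 1) \<omega>))\<^sup>2" for N
      by (auto simp: cut_def)
  qed (use int2 in auto)
  then show "(\<lambda>N. expectation (\<lambda>\<omega>. (norm (X (0, 1) \<omega> - cut (real N) (X (0, 1) \<omega>)))\<^sup>2)) \<longlonglongrightarrow> 0" by simp
qed

text \<open>Centring never increases a second moment, so the remainder keeps variance at most
  \<open>\<kappa>\<^sup>2\<close>, while the variance of the truncated part converges to
  \<open>\<sigma>\<^sup>2\<close> as the level grows.\<close>

lemma truncation_exists:
  assumes \<sigma>: "0 < \<sigma>" "expectation (\<lambda>\<omega>. (norm (X (0, 1) \<omega>))\<^sup>2) = \<sigma>\<^sup>2" and \<kappa>: "0 < \<kappa>"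
  shows "\<exists>T s. 0 \<le> T \<and> 0 < s \<and> \<sigma> - \<kappa> < s \<and>
    (let m = expectation (\<lambda>\<omega>. cut T (X (0, 1) \<omega>)) in
      expectation (\<lambda>\<omega>. (norm (cut T (X (0, 1) \<omega>) - m))\<^sup>2) = s\<^sup>2 \<and>
      expectation (\<lambda>\<omega>. (norm (X (0, 1) \<omega> - (cut T (X (0, 1) \<omega>) - m)))\<^sup>2) \<le> \<kappa>\<^sup>2)"
proof -
  note int2 = int2[OF mean int1 fourth]
  let ?c = "\<lambda>N \<omega>. cut (real N) (X (0, 1) \<omega>)"
  have ic: "integrable M (?c N)" "integrable M (\<lambda>\<omega>. (norm (?c N \<omega>))\<^sup>2)" for N
  proof -
    show "integrable M (?c N)"
      by (rule integrable_const_bound[of _ "real N"]) (auto simp: norm_cut_le)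
    show "integrable M (\<lambda>\<omega>. (norm (?c N \<omega>))\<^sup>2)"
      by (rule integrable_const_bound[of _ "(real N)\<^sup>2"]) (auto simp: norm_cut_le intro!: power_mono)
  qed
  define V where "V N = expectation (\<lambda>\<omega>. (norm (?c N \<omega> - expectation (?c N)))\<^sup>2)" for N
  have "V = (\<lambda>N. expectation (\<lambda>\<omega>. (norm (?c N \<omega>))\<^sup>2) - (norm (expectation (?c N)))\<^sup>2)"
    unfolding V_def by (intro ext second_sub ic)
  moreover have "(\<lambda>N. expectation (\<lambda>\<omega>. (norm (?c N \<omega>))\<^sup>2) - (norm (expectation (?c N)))\<^sup>2) \<longlonglongrightarrow> \<sigma>\<^sup>2 - (norm (0 :: quaternion))\<^sup>2"
    using cut_limits(1,2) unfolding \<sigma>(2) by (intro tendsto_intros)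
  ultimately have "V \<longlonglongrightarrow> \<sigma>\<^sup>2" by simp
  then have "(\<lambda>N. sqrt (V N)) \<longlonglongrightarrow> sqrt (\<sigma>\<^sup>2)" by (rule tendsto_real_sqrt)
  then have Vs: "(\<lambda>N. sqrt (V N)) \<longlonglongrightarrow> \<sigma>" using \<sigma> by simp
  have "\<forall>\<^sub>F N in sequentially. max 0 (\<sigma> - \<kappa>) < sqrt (V N)"
    using \<sigma> \<kappa> by (intro order_tendstoD[OF Vs]) auto
  moreover have "\<forall>\<^sub>F N in sequentially. expectation (\<lambda>\<omega>. (norm (X (0, 1) \<omega> - ?c N \<omega>))\<^sup>2) < \<kappa>\<^sup>2"
    using \<kappa> by (intro order_tendstoD[OF cut_limits(3)]) auto
  ultimately have "\<forall>\<^sub>F N in sequentially. max 0 (\<sigma> - \<kappa>) < sqrt (V N) \<and> expectation (\<lambda>\<omega>. (norm (X (0, 1) \<omega> - ?c N \<omega>))\<^sup>2) < \<kappa>\<^sup>2"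
    by (rule eventually_conj)
  then obtain N where N: "max 0 (\<sigma> - \<kappa>) < sqrt (V N)" "expectation (\<lambda>\<omega>. (norm (X (0, 1) \<omega> - ?c N \<omega>))\<^sup>2) < \<kappa>\<^sup>2"
    by (auto simp: eventually_sequentially)
  let ?Z = "\<lambda>\<omega>. X (0, 1) \<omega> - ?c N \<omega>"
  have iZ: "integrable M ?Z" using int1 ic by simp
  have iZ2: "integrable M (\<lambda>\<omega>. (norm (?Z \<omega>))\<^sup>2)"
    by (rule Bochner_Integration.integrable_bound[OF int2]) (auto simp: cut_def)
  have EZ: "expectation ?Z = - expectation (?c N)" using int1 ic mean by simp
  have "expectation (\<lambda>\<omega>. (norm (X (0, 1) \<omega> - (?c N \<omega> - expectation (?c N))))\<^sup>2) = expectation (\<lambda>\<omega>. (norm (?Z \<omega> - expectation ?Z))\<^sup>2)"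
    unfolding EZ by (simp add: algebra_simps)
  also have "\<dots> \<le> expectation (\<lambda>\<omega>. (norm (?Z \<omega>))\<^sup>2)"
    by (subst second_sub[OF iZ iZ2]) simp
  finally have "expectation (\<lambda>\<omega>. (norm (X (0, 1) \<omega> - (?c N \<omega> - expectation (?c N))))\<^sup>2) \<le> \<kappa>\<^sup>2"
    using N(2) by simp
  moreover have "V N = (sqrt (V N))\<^sup>2"
    unfolding V_def by (simp add: integral_nonneg_AE)
  ultimately show ?thesis
    using N(1) by (intro exI[of _ "real N"] exI[of _ "sqrt (V N)"]) (auto simp: V_def Let_def)
qed

lemma AE_rayleigh_lower:
  fixes d :: "nat \<Rightarrow> 'a \<Rightarrow> real"
  assumes \<sigma>: "expectation (\<lambda>\<omega>. (norm (X (0, 1) \<omega>))\<^sup>2) = \<sigma>\<^sup>2" and \<theta>: "0 \<le> \<theta>" "\<theta> < 2 * \<sigma>" and a: "a \<le> 0"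
    and bad: "\<And>\<delta>. 0 < \<delta> \<Longrightarrow> \<exists>K\<ge>0. AE \<omega> in M. \<forall>\<^sub>F k in sequentially. card {i. i < k\<^sup>2 \<and> d i \<omega> < - K} \<le> \<delta> * real (k\<^sup>2)"
  shows "AE \<omega> in M. \<forall>\<^sub>F k in sequentially. \<exists>v. \<theta> * real k * ip (k\<^sup>2) v v < ip (k\<^sup>2) v (mv (k\<^sup>2) (pmat (W \<omega>) (\<lambda>i. d i \<omega>) a) v)"
proof -
  \<comment> \<open>The distance from \<open>\<theta>\<close> to \<open>2 * \<sigma>\<close> is
    divided into 20 parts; the errors below consume fewer than that.\<close>
  define \<kappa> where "\<kappa> = (2 * \<sigma> - \<theta>) / 20"
  have \<kappa>: "\<kappa> > 0" and \<sigma>0: "\<sigma> > 0" using \<theta> by (auto simp: \<kappa>_def)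
  obtain T s where Ts: "0 \<le> T" "0 < s" "\<sigma> - \<kappa> < s"
      "expectation (\<lambda>\<omega>. (norm (cut T (X (0, 1) \<omega>) - expectation (\<lambda>\<omega>. cut T (X (0, 1) \<omega>))))\<^sup>2) = s\<^sup>2"
      "expectation (\<lambda>\<omega>. (norm (X (0, 1) \<omega> - (cut T (X (0, 1) \<omega>) - expectation (\<lambda>\<omega>. cut T (X (0, 1) \<omega>)))))\<^sup>2) \<le> \<kappa>\<^sup>2"
    using truncation_exists[OF \<sigma>0 \<sigma> \<kappa>] unfolding Let_def by blast
  define mT where "mT = expectation (\<lambda>\<omega>. cut T (X (0, 1) \<omega>))"
  define g where "g q = cut T q - mT" for q
  define h where "h q = q - g q" for q
  have gm: "g \<in> borel_measurable borel" "h \<in> borel_measurable borel"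
    unfolding g_def[abs_def] h_def[abs_def] by measurable
  have gb: "norm (g q) \<le> T + norm mT" for q
    unfolding g_def using norm_triangle_ineq4[of "cut T q" mT] norm_cut_le(2)[OF Ts(1), of q] by simp
  interpret Y: iid_quat_array M "\<lambda>e \<omega>. g (X e \<omega>)" by (rule iid_compose[OF gm(1)])
  interpret Z: iid_quat_array M "\<lambda>e \<omega>. h (X e \<omega>)" by (rule iid_compose[OF gm(2)])
  have igX: "integrable M (\<lambda>\<omega>. cut T (X (0, 1) \<omega>))"
    by (rule integrable_const_bound[of _ T]) (auto simp: norm_cut_le Ts)
  have iY: "integrable M (\<lambda>\<omega>. g (X (0, 1) \<omega>))" unfolding g_def using igX by simp
  have EY: "expectation (\<lambda>\<omega>. g (X (0, 1) \<omega>)) = 0"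
    unfolding g_def using igX by (simp add: prob_space mT_def)
  have iY4: "integrable M (\<lambda>\<omega>. norm (g (X (0, 1) \<omega>)) ^ 4)"
  proof (rule integrable_const_bound[of _ "(T + norm mT) ^ 4"])
    have "norm (g (X (0, 1) \<omega>)) ^ 4 \<le> (T + norm mT) ^ 4" for \<omega> by (intro power_mono gb) auto
    then show "AE \<omega> in M. norm (norm (g (X (0, 1) \<omega>)) ^ 4) \<le> (T + norm mT) ^ 4" by simp
  qed (use gm in measurable)
  have iZ: "integrable M (\<lambda>\<omega>. h (X (0, 1) \<omega>))" unfolding h_def using iY int1 by simp
  have EZ: "expectation (\<lambda>\<omega>. h (X (0, 1) \<omega>)) = 0"
    unfolding h_def using iY int1 mean EY by simp
  have iZ4: "integrable M (\<lambda>\<omega>. norm (h (X (0, 1) \<omega>)) ^ 4)"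
  proof (rule Bochner_Integration.integrable_bound)
    show "integrable M (\<lambda>\<omega>. 8 * norm (X (0, 1) \<omega>) ^ 4 + 8 * norm (g (X (0, 1) \<omega>)) ^ 4)"
      using fourth iY4 by simp
    have "norm (h q) ^ 4 \<le> 8 * norm q ^ 4 + 8 * norm (g q) ^ 4" for q
    proof -
      have "norm (h q) ^ 4 \<le> (norm q + norm (g q)) ^ 4"
        unfolding h_def by (intro power_mono norm_triangle_ineq4) auto
      then show ?thesis using power4_add_le[of "norm q" "norm (g q)"] by linarith
    qed
    then show "AE \<omega> in M. norm (norm (h (X (0, 1) \<omega>)) ^ 4) \<le> norm (8 * norm (X (0, 1) \<omega>) ^ 4 + 8 * norm (g (X (0, 1) \<omega>)) ^ 4)"
      by (simp add: abs_of_nonneg)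
  qed (use gm in measurable)
  define c where "c = 2 * s + 1"
  have c: "c > 0" using Ts by (simp add: c_def)
  \<comment> \<open>So many polynomials that the deficit \<open>2 * s / m\<close> of the Rayleigh
    quotient is at most \<open>\<kappa>\<close>.\<close>
  define m where "m = nat \<lceil>2 * s / \<kappa>\<rceil> + 1"
  have m: "0 < m" "(2 * s - \<kappa>) * m \<le> s * (2 * (real m - 1))"
  proof -
    have "2 * s / \<kappa> \<le> m" unfolding m_def by linarith
    then have "2 * s \<le> m * \<kappa>" using \<kappa> by (simp add: pos_divide_le_eq)
    then show "(2 * s - \<kappa>) * m \<le> s * (2 * (real m - 1))" by (simp add: algebra_simps)
  qed (simp add: m_def)
  define \<eta> where "\<eta> = \<kappa> / c\<^sup>2"
  have \<eta>: "\<eta> > 0" "\<eta> * c\<^sup>2 = \<kappa>" using \<kappa> c by (auto simp: \<eta>_def)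
  define C where "C = chebC (c / s) m"
  define D where "D = (1 / \<eta> + c) * C\<^sup>2"
  have D: "0 \<le> D" using \<eta> c by (auto simp: D_def)
  \<comment> \<open>The admissible fraction of bad indices is chosen after \<open>m\<close>, since
    the constant \<open>C\<close> grows with \<open>m\<close>; the level \<open>K\<close> follows
    from it.\<close>
  define \<delta> where "\<delta> = \<kappa> / (D + 1)"
  have \<delta>: "0 < \<delta>" "D * \<delta> \<le> \<kappa>"
    using \<kappa> D by (auto simp: \<delta>_def pos_divide_le_eq algebra_simps)
  obtain K where K: "0 \<le> K" "AE \<omega> in M. \<forall>\<^sub>F k in sequentially. card {i. i < k\<^sup>2 \<and> d i \<omega> < - K} \<le> \<delta> * real (k\<^sup>2)"
    using bad[OF \<delta>(1)] by blast
  have sqf: "filterlim (\<lambda>k. k\<^sup>2) sequentially sequentially"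
    by (intro filterlim_subseq) (auto simp: strict_mono_def power_strict_mono)
  have aY: "AE \<omega> in M. \<forall>\<^sub>F n in sequentially. op_bound n (hm (\<lambda>e. g (X e \<omega>))) ((2 * s + 1) * sqrt n)"
    using Ts by (intro Y.AE_op_bound EY iY iY4) (auto simp: g_def mT_def)
  have aZ: "AE \<omega> in M. \<forall>\<^sub>F n in sequentially. op_bound n (hm (\<lambda>e. h (X e \<omega>))) ((2 * \<kappa> + \<kappa>) * sqrt n)"
    using Ts \<kappa> by (intro Z.AE_op_bound EZ iZ iZ4) (auto simp: h_def g_def mT_def)
  have aM: "AE \<omega> in M. \<forall>l. (\<lambda>k. mom (k\<^sup>2) (hm (\<lambda>e. g (X e \<omega>))) s l) \<longlonglongrightarrow> dyck l 0"
    using Ts gb by (intro Y.AE_mom_convergence[of "T + norm mT"] EY) (auto simp: g_def mT_def)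
  show ?thesis
    using aY aZ aM K(2)
  proof eventually_elim
    case (elim \<omega>)
    define A where "A = hm (\<lambda>e. g (X e \<omega>))"
    define R where "R = hm (\<lambda>e. h (X e \<omega>))"
    have W: "W \<omega> = (\<lambda>i j. A i j + R i j)"
    proof -
      have "W \<omega> i j = A i j + R i j" for i j
        unfolding A_def R_def hm_add[symmetric] by (simp add: h_def)
      then show ?thesis by blast
    qed
    define q where "q k e = (\<Sum>i<m. \<Sum>j<m. chebL i (\<lambda>l. chebL j (\<lambda>l'. mom (k\<^sup>2) A s (l + l' + e))))" for k e :: nat
    have lim: "(\<lambda>k. q k e) \<longlonglongrightarrow> (\<Sum>i<m. \<Sum>j<m. chebL i (\<lambda>l. chebL j (\<lambda>l'. real (dyck (l + l' + e) 0))))" for e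
      unfolding q_def using elim(3) by (intro tendsto_sum chebL_tendsto) (auto simp: A_def)
    have l0: "(\<lambda>k. q k 0) \<longlonglongrightarrow> m" using lim[of 0] by (simp only: cheb_limit_0)
    have l1: "(\<lambda>k. q k 1) \<longlonglongrightarrow> 2 * (real m - 1)" using lim[of 1] m(1) by (simp only: cheb_limit_1)
    have lr: "(\<lambda>k. (\<theta> + \<kappa> + 3 * \<kappa> + K / real k) * q k 0 + \<kappa> + \<bar>a\<bar> * C\<^sup>2 / real k) \<longlonglongrightarrow> (\<theta> + \<kappa> + 3 * \<kappa> + 0) * m + \<kappa> + 0"
      by (intro tendsto_intros l0 tendsto_divide_0[OF tendsto_const] filterlim_at_top_imp_at_infinity filterlim_real_sequentially)
    have ll: "(\<lambda>k. s * q k 1) \<longlonglongrightarrow> s * (2 * (real m - 1))"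
      by (intro tendsto_intros l1)
    \<comment> \<open>Per unit of \<open>m\<close>, the errors are one \<open>\<kappa>\<close> from
      the cross term, three from the remainder and at most one from the bad indices; the terms with
      \<open>K\<close> and \<open>a\<close> vanish in the limit.\<close>
    have gap: "(\<theta> + \<kappa> + 3 * \<kappa> + 0) * m + \<kappa> + 0 < s * (2 * (real m - 1))"
    proof -
      have "\<theta> = 2 * \<sigma> - 20 * \<kappa>" by (simp add: \<kappa>_def field_simps)
      then have "\<theta> + 5 * \<kappa> < 2 * s - \<kappa>" using Ts(3) \<kappa> by linarith
      then have "(\<theta> + 5 * \<kappa>) * m < (2 * s - \<kappa>) * m" using m(1) by (intro mult_strict_right_mono) auto
      moreover have "(\<theta> + \<kappa> + 3 * \<kappa> + 0) * m + \<kappa> + 0 \<le> (\<theta> + 5 * \<kappa>) * m"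
        using m(1) \<kappa> by (simp add: algebra_simps)
      ultimately show ?thesis using m(2) by linarith
    qed
    have "\<forall>\<^sub>F k in sequentially. (\<theta> + \<kappa> + 3 * \<kappa> + K / real k) * q k 0 + \<kappa> + \<bar>a\<bar> * C\<^sup>2 / real k < s * q k 1"
    proof -
      obtain z where z: "(\<theta> + \<kappa> + 3 * \<kappa> + 0) * m + \<kappa> + 0 < z" "z < s * (2 * (real m - 1))"
        using gap dense by blast
      show ?thesis
        using order_tendstoD(2)[OF lr z(1)] order_tendstoD(1)[OF ll z(2)] by eventually_elim simp
    qed
    moreover have "\<forall>\<^sub>F k in sequentially. op_bound (k\<^sup>2) A (c * sqrt (k\<^sup>2))"
      using eventually_compose_filterlim[OF elim(1) sqf] by (simp add: A_def c_def)
    moreover have "\<forall>\<^sub>F k in sequentially. op_bound (k\<^sup>2) R ((3 * \<kappa>) * sqrt (k\<^sup>2))"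
      using eventually_compose_filterlim[OF elim(2) sqf] by (simp add: R_def)
    ultimately show ?case
      using elim(4) eventually_gt_at_top[of 0]
    proof eventually_elim
      case (elim k)
      show ?case
      proof (rule ccontr)
        assume "\<not> ?case"
        then have le: "ip (k\<^sup>2) v (mv (k\<^sup>2) (pmat (\<lambda>i j. A i j + R i j) (\<lambda>i. d i \<omega>) a) v) \<le> \<theta> * sqrt (real (k\<^sup>2)) * ip (k\<^sup>2) v v" for v
          unfolding W[symmetric] by (auto simp: not_less)
        have n: "0 < k\<^sup>2" using elim by simp
        have "s * q k 1 \<le> (\<theta> + \<eta> * c\<^sup>2 + 3 * \<kappa> + K / sqrt (real (k\<^sup>2))) * q k 0
            + (1 / \<eta> + c) * C\<^sup>2 * (card {i. i < k\<^sup>2 \<and> d i \<omega> < - K} / real (k\<^sup>2)) + \<bar>a\<bar> * C\<^sup>2 / sqrt (real (k\<^sup>2))"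
          unfolding q_def C_def
          by (rule rayleigh_sum_bound[OF n Ts(2) _ _ _ a K(1) \<theta>(1) \<eta>(1) le])
            (use elim in \<open>auto simp: A_def\<close>)
        also have "(1 / \<eta> + c) * C\<^sup>2 * (card {i. i < k\<^sup>2 \<and> d i \<omega> < - K} / real (k\<^sup>2)) \<le> \<kappa>"
        proof -
          have "card {i. i < k\<^sup>2 \<and> d i \<omega> < - K} / real (k\<^sup>2) \<le> \<delta>"
            using elim n by (simp add: pos_divide_le_eq)
          then have "D * (card {i. i < k\<^sup>2 \<and> d i \<omega> < - K} / real (k\<^sup>2)) \<le> D * \<delta>" using D by (intro mult_left_mono)
          then show ?thesis using \<delta>(2) by (simp add: D_def)
        qed
        finally show False using elim(1) by (simp add: \<eta>(2))
      qed
    qed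
  qed
qed

end

end

section \<open>Eigenvalues of quaternion block matrices\<close>

lemma continuous_on_coordinate [continuous_intros]: "continuous_on S (\<lambda>v :: nat \<Rightarrow> quaternion. v i)"
  by (rule continuous_on_subset[OF continuous_on_product_coordinates]) simp

lemma continuous_on_ip: "continuous_on S (\<lambda>v. ip n v v)" "continuous_on S (\<lambda>v. ip n v (mv n A v))"
  unfolding ip_def mv_def by (intro continuous_intros qmul.continuous_on)+

text \<open>Vectors are functions on all natural numbers. Requiring zeros from \<open>n\<close> on
  places the sphere in a product of compact sets, where Tychonoff's theorem applies.\<close>

lemma compact_ip_sphere: "compact {v. ip n v v = 1 \<and> (\<forall>i\<ge>n. v i = 0)}"
proof -
  let ?K = "PiE UNIV (\<lambda>i. if i < n then cball 0 1 else {0 :: quaternion})"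
  have "compactin (product_topology (\<lambda>_ :: nat. euclidean) UNIV) ?K"
    unfolding compactin_PiE by auto
  then have "compact ?K"
    by (simp add: euclidean_product_topology)
  moreover have "closed {v :: nat \<Rightarrow> quaternion. ip n v v = 1}"
    by (intro closed_Collect_eq continuous_on_ip continuous_on_const)
  ultimately have "compact (?K \<inter> {v. ip n v v = 1})" by (rule compact_Int_closed)
  moreover have "?K \<inter> {v. ip n v v = 1} = {v. ip n v v = 1 \<and> (\<forall>i\<ge>n. v i = 0)}"
  proof (intro subset_antisym subsetI)
    fix v assume v: "v \<in> {v. ip n v v = 1 \<and> (\<forall>i\<ge>n. v i = 0)}"
    have "norm (v i) \<le> 1" if "i < n" for i
    proof -
      have "(norm (v i))\<^sup>2 \<le> (\<Sum>i<n. (norm (v i))\<^sup>2)"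
        using that by (intro member_le_sum) auto
      also have "\<dots> = 1" using v by (simp add: ip_self)
      finally show ?thesis using power2_le_imp_le[of "norm (v i)" 1] by simp
    qed
    then have "v i \<in> (if i < n then cball 0 1 else {0})" for i using v by simp
    then show "v \<in> ?K \<inter> {v. ip n v v = 1}" using v by (simp only: PiE_UNIV_domain Pi_iff Int_iff) simp
  next
    fix v assume v: "v \<in> ?K \<inter> {v. ip n v v = 1}"
    have "v i = 0" if "n \<le> i" for i
    proof -
      have "v i \<in> (if i < n then cball 0 1 else {0})" using v unfolding PiE_UNIV_domain Pi_iff Int_iff by blast
      then show ?thesis using that by simp
    qed
    then show "v \<in> {v. ip n v v = 1 \<and> (\<forall>i\<ge>n. v i = 0)}" using v by simp
  qed
  ultimately show ?thesis by simp
qed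

text \<open>A small \<open>t\<close> with the sign of \<open>\<alpha>\<close> would let the linear
  term prevail.\<close>

lemma quadratic_nonpos:
  fixes \<alpha> q :: real
  assumes "\<And>t. 2 * t * \<alpha> + t\<^sup>2 * q \<le> 0"
  shows "\<alpha> = 0"
proof (rule ccontr)
  assume "\<alpha> \<noteq> 0"
  define t where "t = \<alpha> / (\<bar>q\<bar> + 1)"
  have "2 * t * \<alpha> + t\<^sup>2 * q \<ge> 2 * t * \<alpha> - t\<^sup>2 * (\<bar>q\<bar> + 1)"
  proof -
    have "- (t\<^sup>2 * (\<bar>q\<bar> + 1)) \<le> t\<^sup>2 * q"
      unfolding mult_minus_right[symmetric] by (intro mult_left_mono) auto
    then show ?thesis by simp
  qed
  also have "2 * t * \<alpha> - t\<^sup>2 * (\<bar>q\<bar> + 1) = \<alpha>\<^sup>2 / (\<bar>q\<bar> + 1)"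
  proof -
    have "2 * (\<alpha> / b) * \<alpha> - (\<alpha> / b)\<^sup>2 * b = \<alpha>\<^sup>2 / b" if "b \<noteq> 0" for b :: real
      using that by (simp add: power2_eq_square field_simps)
    moreover have "\<bar>q\<bar> + 1 \<noteq> 0" by linarith
    ultimately show ?thesis unfolding t_def by blast
  qed
  finally have "\<alpha>\<^sup>2 / (\<bar>q\<bar> + 1) \<le> 0" using assms[of t] by linarith
  moreover have "\<alpha>\<^sup>2 / (\<bar>q\<bar> + 1) > 0" using \<open>\<alpha> \<noteq> 0\<close> by (intro divide_pos_pos) auto
  ultimately show False by linarith
qed

lemma rayleigh_attained:
  assumes A: "hermitian n A" and n: "0 < n"
  shows "\<exists>v t. (\<exists>i<n. v i \<noteq> 0) \<and> (\<forall>i<n. mv n A v i = t *\<^sub>R v i) \<and> (\<forall>u. ip n u (mv n A u) \<le> t * ip n u u)"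
proof -
  let ?S = "{v. ip n v v = 1 \<and> (\<forall>i\<ge>n. v i = 0)}"
  have "bv 0 qone \<in> ?S" using n by (simp add: ip_bv) (simp add: bv_def power2_norm_eq_inner[symmetric])
  then have "?S \<noteq> {}" by blast
  then obtain v where v: "v \<in> ?S" "\<And>u. u \<in> ?S \<Longrightarrow> ip n u (mv n A u) \<le> ip n v (mv n A v)"
    using continuous_attains_sup[OF compact_ip_sphere[of n] _ continuous_on_ip(2)[of _ n A]] by auto
  define t where "t = ip n v (mv n A v)"
  have max: "ip n u (mv n A u) \<le> t * ip n u u" for u
  proof (cases "ip n u u = 0")
    case True
    then have "\<forall>i<n. u i = 0" by (simp add: ip_zero_iff)
    then have "ip n u (mv n A u) = 0" by (simp add: ip_def)
    then show ?thesis using True by simp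
  next
    case False
    then have pos: "0 < ip n u u" using ip_nonneg[of n u] by linarith
    define c where "c = 1 / sqrt (ip n u u)"
    define u' where "u' i = (if i < n then c *\<^sub>R u i else 0)" for i
    have c2: "c\<^sup>2 * ip n u u = 1" using pos by (simp add: c_def power_divide)
    have eq: "ip n u' u' = c\<^sup>2 * ip n u u" "ip n u' (mv n A u') = c\<^sup>2 * ip n u (mv n A u)"
    proof -
      have "ip n u' u' = ip n (\<lambda>i. c *\<^sub>R u i) (\<lambda>i. c *\<^sub>R u i)" by (rule ip_cong) (auto simp: u'_def)
      then show "ip n u' u' = c\<^sup>2 * ip n u u"
        by (simp add: ip_scale_left ip_scale_right power2_eq_square)
      have "mv n A u' = mv n A (\<lambda>i. c *\<^sub>R u i)" by (rule mv_cong) (simp add: u'_def)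
      then have "ip n u' (mv n A u') = ip n (\<lambda>i. c *\<^sub>R u i) (\<lambda>i. c *\<^sub>R mv n A u i)"
        by (intro ip_cong) (auto simp: u'_def mv_scale)
      then show "ip n u' (mv n A u') = c\<^sup>2 * ip n u (mv n A u)"
        by (simp add: ip_scale_left ip_scale_right power2_eq_square)
    qed
    have "u' \<in> ?S" using c2 eq by (simp add: u'_def)
    then have "c\<^sup>2 * ip n u (mv n A u) \<le> t" using v(2)[of u'] eq by (simp add: t_def)
    also have "t = c\<^sup>2 * (t * ip n u u)" using c2 by (simp add: mult_ac)
    finally show ?thesis using c2 pos by (simp add: mult_le_cancel_left) (metis mult_zero_left zero_less_power2 zero_neq_one power_zero_numeral)
  qed
  \<comment> \<open>The residual of the maximiser is zero: moving \<open>v\<close> along it changes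
    the form minus \<open>t\<close> times the squared length by \<open>2 * \<tau> * ip n r r\<close>
    to first order, yet the result stays nonpositive.\<close>
  define r where "r i = mv n A v i - t *\<^sub>R v i" for i
  have "ip n r r = 0"
  proof (rule quadratic_nonpos)
    fix \<tau>
    let ?u = "\<lambda>i. v i + \<tau> *\<^sub>R r i"
    have v1: "ip n v v = 1" using v by simp
    have "mv n A ?u = (\<lambda>i. mv n A v i + \<tau> *\<^sub>R mv n A r i)" by (simp add: fun_eq_iff mv_add mv_scale)
    then have e1: "ip n ?u (mv n A ?u) = t + 2 * \<tau> * ip n r (mv n A v) + \<tau>\<^sup>2 * ip n r (mv n A r)"
      using ip_mv_hermitian[OF A, of v r]
      by (simp add: ip_add_left ip_add_right ip_scale_left ip_scale_right t_def power2_eq_square ip_commute[of n "mv n A v" r])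
    have e2: "ip n ?u ?u = 1 + 2 * \<tau> * ip n r v + \<tau>\<^sup>2 * ip n r r"
      using v1 by (simp add: ip_add_left ip_add_right ip_scale_left ip_scale_right power2_eq_square ip_commute[of n v r])
    have e3: "ip n r r = ip n r (mv n A v) - t * ip n r v"
      by (subst (2) r_def[abs_def]) (simp add: ip_diff_right ip_scale_right)
    have "2 * \<tau> * ip n r r + \<tau>\<^sup>2 * (ip n r (mv n A r) - t * ip n r r) = ip n ?u (mv n A ?u) - t * ip n ?u ?u"
      unfolding e1 e2 by (subst e3) (simp add: algebra_simps)
    then show "2 * \<tau> * ip n r r + \<tau>\<^sup>2 * (ip n r (mv n A r) - t * ip n r r) \<le> 0"
      using max[of ?u] by simp
  qed
  then have "\<forall>i<n. mv n A v i = t *\<^sub>R v i" by (simp add: ip_zero_iff r_def)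
  moreover have "\<exists>i<n. v i \<noteq> 0"
  proof (rule ccontr)
    assume "\<not> ?thesis"
    then have "ip n v v = 0" by (simp add: ip_zero_iff)
    then show False using v by simp
  qed
  ultimately show ?thesis using max by blast
qed

text \<open>\<open>ccol q\<close> is the first column of the \<open>2 \<times> 2\<close> matrix of \<open>q\<close>, which identifies quaternions with \<open>\<complex>\<^sup>2\<close>.\<close>

definition ccol :: "quaternion \<Rightarrow> nat \<Rightarrow> complex" where
  "ccol q \<rho> = (if \<rho> = 0 then Complex (re_part q) (i_part q) else Complex (- j_part q) (k_part q))"

text \<open>The first column of a matrix product is the left factor applied to the first column of
  the right factor.\<close>

lemma ccol_qmul:
  assumes "\<rho> < 2"
  shows "quat_mat p $$ (\<rho>, 0) * ccol q 0 + quat_mat p $$ (\<rho>, 1) * ccol q 1 = ccol (qmul p q) \<rho>"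
proof -
  have "\<rho> = 0 \<or> \<rho> = 1" using assms by auto
  then show ?thesis
    by (elim disjE; cases p; cases q)
      (simp_all only: quat_mat_index, simp_all add: ccol_def complex_eq_iff algebra_simps)
qed

lemma ccol_add: "ccol (p + q) \<rho> = ccol p \<rho> + ccol q \<rho>"
  by (cases p; cases q) (simp add: ccol_def complex_eq_iff)

lemma ccol_zero: "ccol 0 \<rho> = 0"
  by (simp add: ccol_def zero_quat complex_eq_iff)

lemma ccol_sum: "ccol (sum f S) \<rho> = (\<Sum>i\<in>S. ccol (f i) \<rho>)"
  by (induction S rule: infinite_finite_induct) (auto simp: ccol_zero ccol_add)

lemma ccol_scale: "ccol (c *\<^sub>R q) \<rho> = of_real c * ccol q \<rho>"
  by (cases q) (simp add: ccol_def complex_eq_iff)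

lemma ccol_inject: "ccol p 0 = ccol q 0 \<Longrightarrow> ccol p 1 = ccol q 1 \<Longrightarrow> p = q"
  by (cases p; cases q) (simp add: ccol_def)

lemma ccol_surj: "\<exists>q. ccol q 0 = z \<and> ccol q 1 = w"
  by (rule exI[of _ "(Re z, Im z, - Re w, Im w)"]) (simp add: ccol_def complex_eq_iff)

lemma sum_double: "(\<Sum>s<2 * n. f s) = (\<Sum>j<n. f (2 * j) + f (2 * j + 1))" for f :: "nat \<Rightarrow> 'b :: comm_monoid_add"
  by (induction n) (auto simp: add.assoc)

definition cvec :: "nat \<Rightarrow> (nat \<Rightarrow> quaternion) \<Rightarrow> complex vec" where
  "cvec n v = vec (2 * n) (\<lambda>r. ccol (v (r div 2)) (r mod 2))"

lemma block_mat_mult_cvec: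
  assumes r: "r < 2 * n"
  shows "((complex_of_real c \<cdot>\<^sub>m quat_block_mat x n) *\<^sub>v cvec n v) $ r
    = ccol (c *\<^sub>R mv n (\<lambda>i j. x (i + 1) (j + 1)) v (r div 2)) (r mod 2)"
proof -
  let ?M = "complex_of_real c \<cdot>\<^sub>m quat_block_mat x n"
  let ?p = "\<lambda>j. x (r div 2 + 1) (j + 1)"
  have "(?M *\<^sub>v cvec n v) $ r = (\<Sum>s<2 * n. ?M $$ (r, s) * cvec n v $ s)"
    using r by (simp add: quat_block_mat_def scalar_prod_def cvec_def lessThan_atLeast0)
  also have "\<dots> = (\<Sum>j<n. ?M $$ (r, 2 * j) * cvec n v $ (2 * j) + ?M $$ (r, 2 * j + 1) * cvec n v $ (2 * j + 1))"
    by (rule sum_double)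
  also have "\<dots> = (\<Sum>j<n. of_real c * (quat_mat (?p j) $$ (r mod 2, 0) * ccol (v j) 0 + quat_mat (?p j) $$ (r mod 2, 1) * ccol (v j) 1))"
  proof (intro sum.cong refl)
    fix j assume "j \<in> {..<n}"
    then have j: "2 * j < 2 * n" "2 * j + 1 < 2 * n" by auto
    have d: "(2 * j + 1) div 2 = j" "(2 * j + 1) mod 2 = 1" by auto
    show "?M $$ (r, 2 * j) * cvec n v $ (2 * j) + ?M $$ (r, 2 * j + 1) * cvec n v $ (2 * j + 1)
      = of_real c * (quat_mat (?p j) $$ (r mod 2, 0) * ccol (v j) 0 + quat_mat (?p j) $$ (r mod 2, 1) * ccol (v j) 1)"
      using j r d by (simp add: quat_block_mat_def cvec_def distrib_left mult.assoc)
  qed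
  also have "\<dots> = (\<Sum>j<n. of_real c * ccol (qmul (?p j) (v j)) (r mod 2))"
    by (intro sum.cong refl arg_cong2[of _ _ _ _ times] ccol_qmul) auto
  finally show ?thesis
    by (simp add: mv_def ccol_scale ccol_sum sum_distrib_left)
qed

lemma cvec_zero_iff: "cvec n v = 0\<^sub>v (2 * n) \<longleftrightarrow> (\<forall>i<n. v i = 0)"
proof
  assume z: "cvec n v = 0\<^sub>v (2 * n)"
  show "\<forall>i<n. v i = 0"
  proof (intro allI impI)
    fix i assume i: "i < n"
    have "cvec n v $ (2 * i) = 0" "cvec n v $ (2 * i + 1) = 0" using z i by auto
    moreover have "(2 * i + 1) div 2 = i" "(2 * i + 1) mod 2 = 1" by auto
    ultimately have "ccol (v i) 0 = 0" "ccol (v i) 1 = 0" using i by (simp_all add: cvec_def)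
    then show "v i = 0" by (intro ccol_inject) (auto simp: ccol_zero)
  qed
next
  assume "\<forall>i<n. v i = 0"
  then show "cvec n v = 0\<^sub>v (2 * n)"
    by (intro eq_vecI) (auto simp: cvec_def ccol_zero less_mult_imp_div_less mult.commute)
qed

lemma cvec_surj: "z \<in> carrier_vec (2 * n) \<Longrightarrow> \<exists>v. z = cvec n v"
proof -
  assume z: "z \<in> carrier_vec (2 * n)"
  have "\<exists>v. \<forall>i. ccol (v i) 0 = z $ (2 * i) \<and> ccol (v i) 1 = z $ (2 * i + 1)"
    by (rule choice) (use ccol_surj in blast)
  then obtain v where v: "\<And>i. ccol (v i) 0 = z $ (2 * i)" "\<And>i. ccol (v i) 1 = z $ (2 * i + 1)" by blast
  have "z = cvec n v"
  proof (rule eq_vecI)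
    fix r assume r: "r < dim_vec (cvec n v)"
    show "z $ r = cvec n v $ r"
    proof (cases "even r")
      case True
      then show ?thesis using r v(1)[of "r div 2"] by (simp add: cvec_def)
    next
      case False
      then have "r = 2 * (r div 2) + 1" by presburger
      then show ?thesis using r v(2)[of "r div 2"] False by (simp add: cvec_def odd_iff_mod_2_eq_one)
    qed
  qed (use z in \<open>simp add: cvec_def\<close>)
  then show ?thesis by blast
qed

text \<open>Taking first columns identifies quaternionic vectors of length \<open>n\<close> with
  complex vectors of length \<open>2 * n\<close>, compatibly with the matrix and with real
  scalars.\<close>

lemma eigenvalue_block_mat:
  "eigenvalue (complex_of_real c \<cdot>\<^sub>m quat_block_mat x n) (complex_of_real t) \<longleftrightarrow>
    (\<exists>v. (\<exists>i<n. v i \<noteq> 0) \<and> (\<forall>i<n. c *\<^sub>R mv n (\<lambda>i j. x (i + 1) (j + 1)) v i = t *\<^sub>R v i))"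
proof -
  let ?M = "complex_of_real c \<cdot>\<^sub>m quat_block_mat x n"
  let ?A = "\<lambda>i j. x (i + 1) (j + 1)"
  have dim: "dim_row ?M = 2 * n" "dim_col ?M = 2 * n" by (simp_all add: quat_block_mat_def)
  have iff: "?M *\<^sub>v cvec n v = complex_of_real t \<cdot>\<^sub>v cvec n v \<longleftrightarrow> (\<forall>i<n. c *\<^sub>R mv n ?A v i = t *\<^sub>R v i)" for v
  proof
    assume eq: "?M *\<^sub>v cvec n v = complex_of_real t \<cdot>\<^sub>v cvec n v"
    have comp: "ccol (c *\<^sub>R mv n ?A v (r div 2)) (r mod 2) = ccol (t *\<^sub>R v (r div 2)) (r mod 2)" if "r < 2 * n" for r
    proof -
      have "(?M *\<^sub>v cvec n v) $ r = of_real t * cvec n v $ r" using eq that by (simp add: cvec_def)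
      then show ?thesis using that block_mat_mult_cvec[OF that, of c x v] by (simp add: cvec_def ccol_scale)
    qed
    show "\<forall>i<n. c *\<^sub>R mv n ?A v i = t *\<^sub>R v i"
    proof (intro allI impI)
      fix i assume i: "i < n"
      have d: "(2 * i + 1) div 2 = i" "(2 * i + 1) mod 2 = 1" by auto
      show "c *\<^sub>R mv n ?A v i = t *\<^sub>R v i"
        using comp[of "2 * i"] comp[of "2 * i + 1"] i d by (intro ccol_inject) auto
    qed
  next
    assume eq: "\<forall>i<n. c *\<^sub>R mv n ?A v i = t *\<^sub>R v i"
    show "?M *\<^sub>v cvec n v = complex_of_real t \<cdot>\<^sub>v cvec n v"
    proof (rule eq_vecI)
      fix r assume "r < dim_vec (complex_of_real t \<cdot>\<^sub>v cvec n v)"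
      then have r: "r < 2 * n" by (simp add: cvec_def)
      then have "r div 2 < n" by auto
      then show "(?M *\<^sub>v cvec n v) $ r = (complex_of_real t \<cdot>\<^sub>v cvec n v) $ r"
        using eq r block_mat_mult_cvec[OF r, of c x v] by (simp add: cvec_def ccol_scale)
    qed (simp add: quat_block_mat_def cvec_def)
  qed
  have "eigenvalue ?M (complex_of_real t) \<longleftrightarrow> (\<exists>v. cvec n v \<noteq> 0\<^sub>v (2 * n) \<and> ?M *\<^sub>v cvec n v = complex_of_real t \<cdot>\<^sub>v cvec n v)"
  proof
    assume "eigenvalue ?M (complex_of_real t)"
    then obtain z where z: "z \<in> carrier_vec (2 * n)" "z \<noteq> 0\<^sub>v (2 * n)" "?M *\<^sub>v z = complex_of_real t \<cdot>\<^sub>v z"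
      unfolding eigenvalue_def eigenvector_def dim by blast
    then show "\<exists>v. cvec n v \<noteq> 0\<^sub>v (2 * n) \<and> ?M *\<^sub>v cvec n v = complex_of_real t \<cdot>\<^sub>v cvec n v"
      using cvec_surj by metis
  next
    assume "\<exists>v. cvec n v \<noteq> 0\<^sub>v (2 * n) \<and> ?M *\<^sub>v cvec n v = complex_of_real t \<cdot>\<^sub>v cvec n v"
    moreover have "cvec n v \<in> carrier_vec (2 * n)" for v by (simp add: cvec_def)
    ultimately show "eigenvalue ?M (complex_of_real t)"
      unfolding eigenvalue_def eigenvector_def dim by blast
  qed
  then show ?thesis by (simp add: iff cvec_zero_iff)
qed

lemma largest_eigenvalue_block_mat:
  assumes A: "hermitian n (\<lambda>i j. x (i + 1) (j + 1))" and n: "0 < n" and c: "0 < c"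
  defines "\<Lambda> \<equiv> largest_eigenvalue (complex_of_real c \<cdot>\<^sub>m quat_block_mat x n)"
  shows "\<exists>v. 0 < ip n v v \<and> c * ip n v (mv n (\<lambda>i j. x (i + 1) (j + 1)) v) = \<Lambda> * ip n v v"
    and "\<And>u. c * ip n u (mv n (\<lambda>i j. x (i + 1) (j + 1)) u) \<le> \<Lambda> * ip n u u"
proof -
  let ?A = "\<lambda>i j. x (i + 1) (j + 1)"
  let ?E = "{t :: real. eigenvalue (complex_of_real c \<cdot>\<^sub>m quat_block_mat x n) (complex_of_real t)}"
  obtain v t where vt: "\<exists>i<n. v i \<noteq> 0" "\<forall>i<n. mv n ?A v i = t *\<^sub>R v i" "\<And>u. ip n u (mv n ?A u) \<le> t * ip n u u"
    using rayleigh_attained[OF A n] by blast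
  have ray: "\<exists>v. 0 < ip n v v \<and> c * ip n v (mv n ?A v) = t' * ip n v v" if t': "t' \<in> ?E" for t'
  proof -
    obtain w where w: "\<exists>i<n. w i \<noteq> 0" "\<forall>i<n. c *\<^sub>R mv n ?A w i = t' *\<^sub>R w i"
      using t' unfolding mem_Collect_eq eigenvalue_block_mat by blast
    have "c * ip n w (mv n ?A w) = ip n w (\<lambda>i. c *\<^sub>R mv n ?A w i)" by (simp add: ip_scale_right)
    also have "\<dots> = ip n w (\<lambda>i. t' *\<^sub>R w i)" using w by (intro ip_cong) auto
    also have "\<dots> = t' * ip n w w" by (simp add: ip_scale_right)
    finally have "c * ip n w (mv n ?A w) = t' * ip n w w" .
    moreover have "ip n w w \<noteq> 0" using w(1) unfolding ip_zero_iff by blast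
    then have "0 < ip n w w" using ip_nonneg[of n w] by linarith
    ultimately show ?thesis by (intro exI[of _ w] conjI)
  qed
  have "c *\<^sub>R mv n ?A v i = (c * t) *\<^sub>R v i" if "i < n" for i using vt(2) that by simp
  then have tE: "c * t \<in> ?E" unfolding mem_Collect_eq eigenvalue_block_mat using vt(1) by blast
  have le: "t' \<le> c * t" if t': "t' \<in> ?E" for t'
  proof -
    obtain w where w: "0 < ip n w w" "c * ip n w (mv n ?A w) = t' * ip n w w" using ray[OF t'] by blast
    have "t' * ip n w w \<le> c * (t * ip n w w)"
      unfolding w(2)[symmetric] using vt(3)[of w] c by (intro mult_left_mono) auto
    then show ?thesis using w(1) by (simp add: mult.assoc[symmetric])
  qed
  \<comment> \<open>\<open>Max\<close> is meaningful for finite sets only; eigenvalues are roots of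
    the characteristic polynomial, which is nonzero.\<close>
  have "finite ?E"
  proof -
    let ?M = "complex_of_real c \<cdot>\<^sub>m quat_block_mat x n"
    have M: "?M \<in> carrier_mat (2 * n) (2 * n)" by (simp add: quat_block_mat_def)
    have "char_poly ?M \<noteq> 0" using degree_monic_char_poly[OF M] n by auto
    then have "finite {z. poly (char_poly ?M) z = 0}" by (rule poly_roots_finite)
    moreover have "complex_of_real ` ?E \<subseteq> {z. poly (char_poly ?M) z = 0}"
      using eigenvalue_root_char_poly[OF M] by auto
    ultimately have "finite (complex_of_real ` ?E)" by (rule rev_finite_subset)
    then show ?thesis by (rule finite_imageD) (auto simp: inj_on_def)
  qed
  then have "\<Lambda> = c * t"
    unfolding \<Lambda>_def largest_eigenvalue_def using tE le by (intro Max_eqI) auto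
  then show "\<exists>v. 0 < ip n v v \<and> c * ip n v (mv n ?A v) = \<Lambda> * ip n v v"
    and "c * ip n u (mv n ?A u) \<le> \<Lambda> * ip n u u" for u
    using ray[OF tE] vt(3)[of u] c by (auto simp: mult.assoc)
qed

section \<open>Wigner matrices with a diagonal\<close>

lemma (in prob_space) indep_vars_reindex:
  assumes ind: "indep_vars (\<lambda>_. N) X I" and f: "inj_on f J" "f ` J \<subseteq> I"
  shows "indep_vars (\<lambda>_. N) (\<lambda>j. X (f j)) J"
  unfolding indep_vars_def2
proof (intro conjI ballI indep_setsI)
  have rv: "random_variable N (X i)" if "i \<in> I" for i using ind that by (simp add: indep_vars_def2)
  fix j assume j: "j \<in> J"
  show "random_variable N (X (f j))" using rv f j by blast
  show "{X (f j) -` A \<inter> space M |A. A \<in> sets N} \<subseteq> events"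
    using rv f j by (auto intro!: measurable_sets[of "X (f j)" M N])
next
  fix A K assume K: "K \<noteq> {}" "K \<subseteq> J" "finite K"
    and A: "\<forall>j\<in>K. A j \<in> {X (f j) -` A \<inter> space M |A. A \<in> sets N}"
  then have "\<forall>j\<in>K. \<exists>B. B \<in> sets N \<and> A j = X (f j) -` B \<inter> space M" by auto
  then obtain B where B: "\<And>j. j \<in> K \<Longrightarrow> B j \<in> sets N \<and> A j = X (f j) -` B j \<inter> space M" by metis
  have inj: "inj_on f K" using f K by (auto intro: inj_on_subset)
  define B' where "B' i = B (the_inv_into K f i)" for i
  have B': "B' (f j) = B j" if "j \<in> K" for j using inj that by (simp add: B'_def the_inv_into_f_f)
  have "prob (\<Inter>i\<in>f ` K. X i -` B' i \<inter> space M) = (\<Prod>i\<in>f ` K. prob (X i -` B' i \<inter> space M))"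
    using K f B B' by (intro indep_varsD[OF ind]) auto
  moreover have "(\<Inter>i\<in>f ` K. X i -` B' i \<inter> space M) = (\<Inter>j\<in>K. A j)"
    unfolding image_image by (rule INF_cong[OF refl]) (simp add: B B')
  moreover have "(\<Prod>i\<in>f ` K. prob (X i -` B' i \<inter> space M)) = (\<Prod>j\<in>K. prob (A j))"
    unfolding prod.reindex[OF inj] by (rule prod.cong[OF refl]) (simp add: B B')
  ultimately show "prob (\<Inter>j\<in>K. A j) = (\<Prod>j\<in>K. prob (A j))" by simp
qed

locale wigner = prob_space M for M :: "'w measure" +
  fixes x :: "nat \<Rightarrow> nat \<Rightarrow> 'w \<Rightarrow> quaternion"
  assumes self_dual: "\<And>j k \<omega>. 1 \<le> j \<Longrightarrow> 1 \<le> k \<Longrightarrow> \<omega> \<in> space M \<Longrightarrow> x k j \<omega> = quat_conj (x j k \<omega>)"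
    and diag_real: "\<And>j \<omega>. 1 \<le> j \<Longrightarrow> \<omega> \<in> space M \<Longrightarrow> x j j \<omega> = (re_part (x j j \<omega>), 0, 0, 0)"
    and indep_all: "indep_vars (\<lambda>_. borel) (\<lambda>(j, k). x j k) {(j, k). 1 \<le> j \<and> j \<le> k}"
    and diag_ident: "\<And>j. 1 \<le> j \<Longrightarrow> distr M borel (x j j) = distr M borel (x 1 1)"
    and offdiag_ident: "\<And>j k. 1 \<le> j \<Longrightarrow> j < k \<Longrightarrow> distr M borel (x j k) = distr M borel (x 1 2)"
begin

text \<open>Indices are shifted to start from 0. The diagonal is included, so that its independence
  of the other entries remains available.\<close>

definition X :: "nat \<times> nat \<Rightarrow> 'w \<Rightarrow> quaternion" where
  "X e = x (Suc (fst e)) (Suc (snd e))"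

definition d :: "nat \<Rightarrow> 'w \<Rightarrow> real" where
  "d i \<omega> = re_part (x (Suc i) (Suc i) \<omega>)"

definition H :: "'w \<Rightarrow> nat \<Rightarrow> nat \<Rightarrow> quaternion" where
  "H \<omega> i j = x (i + 1) (j + 1) \<omega>"

definition lam :: "nat \<Rightarrow> 'w \<Rightarrow> real" where
  "lam n \<omega> = largest_eigenvalue (complex_of_real (1 / sqrt (real n)) \<cdot>\<^sub>m quat_block_mat (\<lambda>j k. x j k \<omega>) n)"

lemma indep_X: "indep_vars (\<lambda>_. borel) X {(j, k). j \<le> k}"
proof -
  have "indep_vars (\<lambda>_. borel) (\<lambda>e. (\<lambda>(j, k). x j k) (Suc (fst e), Suc (snd e))) {(j, k). j \<le> k}"
    by (rule indep_vars_reindex[OF indep_all]) (auto simp: inj_on_def)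
  then show ?thesis by (simp add: X_def[abs_def])
qed

sublocale X: iid_quat_array M X
proof
  show "indep_vars (\<lambda>_. borel) X {(j, k). j < k}"
    by (rule indep_vars_subset[OF indep_X]) auto
  show "distr M borel (X (j, k)) = distr M borel (X (0, 1))" if "j < k" for j k
  proof -
    have "distr M borel (x (Suc j) (Suc k)) = distr M borel (x (Suc 0) (Suc 1))"
      using offdiag_ident[of "Suc j" "Suc k"] that unfolding One_nat_def numeral_2_eq_2 by simp
    then show ?thesis by (simp only: X_def fst_conv snd_conv)
  qed
qed

lemma X01: "X (0, 1) = x 1 2"
  by (simp add: X_def numeral_2_eq_2)

lemma d_measurable [measurable]: "d i \<in> borel_measurable M"
proof -
  have "X (i, i) \<in> borel_measurable M" using indep_X by (auto simp: indep_vars_def)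
  then have "(\<lambda>\<omega>. inner qone (X (i, i) \<omega>)) \<in> borel_measurable M" by (intro borel_measurable_inner) auto
  then show ?thesis by (simp add: d_def[abs_def] X_def re_part_inner)
qed

lemma re_part_measurable [measurable]: "re_part \<in> borel_measurable borel"
  unfolding re_part_inner[abs_def] by measurable

lemma prob_diag:
  assumes "S \<in> sets borel"
  shows "prob {\<omega> \<in> space M. d i \<omega> \<in> S} = prob {\<omega> \<in> space M. d 0 \<omega> \<in> S}"
proof -
  have m: "X (i, i) \<in> borel_measurable M" for i using indep_X by (auto simp: indep_vars_def)
  have *: "prob {\<omega> \<in> space M. d i \<omega> \<in> S} = measure (distr M borel (X (i, i))) (re_part -` S)" for i
    using m[of i] assms by (subst measure_distr) (auto simp: d_def X_def vimage_def Int_def conj_commute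
      intro!: measurable_sets_borel[OF re_part_measurable, unfolded vimage_def])
  have "distr M borel (X (i, i)) = distr M borel (X (0, 0))"
    unfolding X_def fst_conv snd_conv One_nat_def[symmetric] by (rule diag_ident) simp
  then show ?thesis unfolding *[of i] *[of 0] by (rule arg_cong)
qed

lemma indep_d: "indep_vars (\<lambda>_. borel) d UNIV"
proof -
  have "indep_vars (\<lambda>_. borel) (\<lambda>i. X (i, i)) UNIV"
    using indep_vars_reindex[OF indep_X, of "\<lambda>i. (i, i)" UNIV] by (auto simp: inj_on_def)
  then have "indep_vars (\<lambda>_. borel) (\<lambda>i \<omega>. re_part (X (i, i) \<omega>)) UNIV"
    by (rule indep_vars_compose2) measurable
  then show ?thesis by (simp add: d_def[abs_def] X_def)
qed

lemma prob_diag_two: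
  assumes "i \<noteq> j" "S \<in> sets borel" "T \<in> sets borel"
  shows "prob {\<omega> \<in> space M. d i \<omega> \<in> S \<and> d j \<omega> \<in> T} = prob {\<omega> \<in> space M. d i \<omega> \<in> S} * prob {\<omega> \<in> space M. d j \<omega> \<in> T}"
proof -
  define A where "A k = {\<omega> \<in> space M. d k \<omega> \<in> (if k = i then S else T)}" for k
  have A: "A k = d k -` (if k = i then S else T) \<inter> space M" for k by (auto simp: A_def)
  have "prob (\<Inter>k\<in>{i, j}. A k) = (\<Prod>k\<in>{i, j}. prob (A k))"
    unfolding A using assms by (intro indep_varsD[OF indep_d]) auto
  moreover have "(\<Inter>k\<in>{i, j}. A k) = {\<omega> \<in> space M. d i \<omega> \<in> S \<and> d j \<omega> \<in> T}"
    using assms(1) by (auto simp: A_def)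
  moreover have "(\<Prod>k\<in>{i, j}. prob (A k)) = prob (A i) * prob (A j)" using assms(1) by simp
  moreover have "A i = {\<omega> \<in> space M. d i \<omega> \<in> S}" "A j = {\<omega> \<in> space M. d j \<omega> \<in> T}"
    using assms(1) unfolding A_def by auto
  ultimately show ?thesis by (simp only:)
qed

lemma hermitian_H: "\<omega> \<in> space M \<Longrightarrow> hermitian n (H \<omega>)"
  unfolding hermitian_def H_def by (intro allI impI self_dual) simp_all

lemma lam_attained:
  assumes "\<omega> \<in> space M" "0 < n"
  shows "\<exists>v. 0 < ip n v v \<and> ip n v (mv n (H \<omega>) v) = lam n \<omega> * sqrt n * ip n v v"
proof -
  have "hermitian n (\<lambda>i j. x (i + 1) (j + 1) \<omega>)" using hermitian_H[OF assms(1), of n] by (simp add: H_def[abs_def])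
  then obtain v where v: "0 < ip n v v" "1 / sqrt n * ip n v (mv n (H \<omega>) v) = lam n \<omega> * ip n v v"
    using largest_eigenvalue_block_mat(1)[of n "\<lambda>j k. x j k \<omega>" "1 / sqrt n"] assms(2)
    by (auto simp: lam_def H_def[abs_def])
  then show ?thesis using assms(2) by (intro exI[of _ v]) (simp add: field_simps)
qed

lemma lam_ge:
  assumes "\<omega> \<in> space M" "0 < n"
  shows "ip n u (mv n (H \<omega>) u) \<le> lam n \<omega> * sqrt n * ip n u u"
proof -
  have "hermitian n (\<lambda>i j. x (i + 1) (j + 1) \<omega>)" using hermitian_H[OF assms(1), of n] by (simp add: H_def[abs_def])
  then have "1 / sqrt n * ip n u (mv n (H \<omega>) u) \<le> lam n \<omega> * ip n u u"
    using largest_eigenvalue_block_mat(2)[of n "\<lambda>j k. x j k \<omega>" "1 / sqrt n"] assms(2)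
    by (auto simp: lam_def H_def[abs_def])
  then show ?thesis using assms(2) by (simp add: field_simps)
qed

lemma H_diag: "\<omega> \<in> space M \<Longrightarrow> H \<omega> i i = d i \<omega> *\<^sub>R qone"
  using diag_real[of "Suc i" \<omega>] by (simp add: H_def d_def qone_def)

lemma H_upper: "i < j \<Longrightarrow> H \<omega> i j = X (i, j) \<omega>"
  by (simp add: H_def X_def)

text \<open>Valid for every real \<open>a\<close>; it is used with \<open>a\<close> the real part of
  the mean.\<close>

lemma H_eq_pmat:
  assumes "\<omega> \<in> space M"
  shows "H \<omega> i j = pmat (hm (\<lambda>e. X e \<omega> - a *\<^sub>R qone)) (\<lambda>i. d i \<omega>) a i j"
proof (cases i j rule: linorder_cases)
  case greater
  have "H \<omega> i j = quat_conj (H \<omega> j i)" unfolding H_def using self_dual[of "j + 1" "i + 1" \<omega>] assms by simp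
  then show ?thesis
    using greater by (simp add: pmat_def hm_def H_upper quat_conj_diff quat_conj_scaleR)
qed (use assms in \<open>auto simp: pmat_def hm_def H_upper H_diag scaleR_left_diff_distrib\<close>)

lemma d_le_lam:
  assumes "\<omega> \<in> space M" "i < n"
  shows "d i \<omega> \<le> lam n \<omega> * sqrt n"
proof -
  have "ip n (bv i qone) (mv n (H \<omega>) (bv i qone)) = d i \<omega>"
  proof -
    have "mv n (H \<omega>) (bv i qone) i = (\<Sum>j<n. if j = i then H \<omega> i i else 0)"
      unfolding mv_def by (intro sum.cong refl) (auto simp: bv_def qmul.zero_right)
    also have "\<dots> = d i \<omega> *\<^sub>R qone" using assms by (simp add: H_diag)
    finally show ?thesis using assms by (simp add: ip_bv power2_norm_eq_inner[symmetric])
  qed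
  moreover have "ip n (bv i qone) (bv i qone) = 1"
    using assms by (simp add: ip_bv) (simp add: bv_def power2_norm_eq_inner[symmetric])
  ultimately show ?thesis using lam_ge[OF assms(1), of n "bv i qone"] assms(2) by simp
qed

text \<open>Padding a vector with zeros preserves its quadratic form, so a large Rayleigh quotient
  of a corner persists in all larger matrices. This carries bounds from squares
  \<open>k\<^sup>2\<close> to all \<open>n\<close>.\<close>

lemma lam_mono:
  assumes "\<omega> \<in> space M" "0 < m" "m \<le> n" "0 \<le> \<theta>" and v: "\<theta> * ip m v v < ip m v (mv m (H \<omega>) v)"
  shows "\<theta> < lam n \<omega> * sqrt n"
proof -
  define u where "u i = (if i < m then v i else 0)" for i
  have sub: "(\<Sum>i<n. if i < m then f i else 0) = (\<Sum>i<m. f i)" for f :: "nat \<Rightarrow> 'b :: comm_monoid_add"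
  proof -
    have "{..<n} \<inter> {i. i < m} = {..<m}" using assms by auto
    then show ?thesis by (simp add: sum.If_cases)
  qed
  have uu: "ip n u u = ip m v v"
    unfolding ip_def using sub[of "\<lambda>i. inner (v i) (v i)"] by (simp add: u_def if_distrib cong: if_cong)
  have "mv n (H \<omega>) u i = mv m (H \<omega>) v i" for i
  proof -
    have "mv n (H \<omega>) u i = (\<Sum>j<n. if j < m then qmul (H \<omega> i j) (v j) else 0)"
      unfolding mv_def by (intro sum.cong refl) (auto simp: u_def qmul.zero_right)
    then show ?thesis by (simp add: sub mv_def)
  qed
  then have "ip n u (mv n (H \<omega>) u) = (\<Sum>i<n. if i < m then inner (v i) (mv m (H \<omega>) v i) else 0)"
    unfolding ip_def by (intro sum.cong refl) (auto simp: u_def)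
  then have "ip n u (mv n (H \<omega>) u) = ip m v (mv m (H \<omega>) v)" by (simp add: sub ip_def)
  then have "\<theta> * ip m v v < lam n \<omega> * sqrt n * ip m v v"
    using lam_ge[OF assms(1), of n u] v assms uu by simp
  then show ?thesis using ip_nonneg[of m v] by (simp add: mult_less_cancel_right)
qed

lemma prob_diag_below:
  assumes \<delta>: "0 < \<delta>"
  shows "\<exists>K\<ge>0. prob {\<omega> \<in> space M. d 0 \<omega> < - K} < \<delta>"
proof -
  have "(\<lambda>N. prob {\<omega> \<in> space M. d 0 \<omega> < - real N}) \<longlonglongrightarrow> prob (\<Inter>N. {\<omega> \<in> space M. d 0 \<omega> < - real N})"
    by (intro finite_Lim_measure_decseq) (auto simp: decseq_def)
  moreover have "(\<Inter>N. {\<omega> \<in> space M. d 0 \<omega> < - real N}) = {}"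
  proof -
    have "\<exists>N. \<not> d 0 \<omega> < - real N" for \<omega> using real_arch_simple[of "- d 0 \<omega>"] by (auto simp: minus_le_iff not_less)
    then show ?thesis by blast
  qed
  ultimately have "(\<lambda>N. prob {\<omega> \<in> space M. d 0 \<omega> < - real N}) \<longlonglongrightarrow> 0" by simp
  then have "\<forall>\<^sub>F N in sequentially. prob {\<omega> \<in> space M. d 0 \<omega> < - real N} < \<delta>"
    using \<delta> by (intro order_tendstoD) auto
  then obtain N where "prob {\<omega> \<in> space M. d 0 \<omega> < - real N} < \<delta>" by (auto simp: eventually_sequentially)
  then show ?thesis by (intro exI[of _ "real N"]) simp
qed

text \<open>A law of large numbers along squares for bounded indicators. It uses tightness of a
  single law only, hence no moment of the negative part. One half of \<open>\<delta>\<close> covers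
  the probability, the other the fluctuation.\<close>

lemma AE_bad_fraction:
  assumes \<delta>: "0 < \<delta>"
  shows "\<exists>K\<ge>0. AE \<omega> in M. \<forall>\<^sub>F k in sequentially. card {i. i < k\<^sup>2 \<and> d i \<omega> < - K} \<le> \<delta> * real (k\<^sup>2)"
proof -
  obtain K where K: "0 \<le> K" "prob {\<omega> \<in> space M. d 0 \<omega> < - K} < \<delta> / 2"
    using prob_diag_below[of "\<delta> / 2"] \<delta> by auto
  define b where "b i \<omega> = (if d i \<omega> < - K then 1 else 0 :: real)" for i \<omega>
  define p where "p = prob {\<omega> \<in> space M. d 0 \<omega> < - K}"
  define f where "f k \<omega> = (\<Sum>i<k\<^sup>2. b i \<omega> - p) / real (k\<^sup>2)" for k \<omega>
  have bm [measurable]: "b i \<in> borel_measurable M" for i unfolding b_def[abs_def] by measurable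
  have b01: "b i \<omega> \<in> {0, 1}" for i \<omega> by (simp add: b_def)
  have p: "0 \<le> p" "p \<le> 1" by (simp_all add: p_def)
  have Eb: "expectation (b i) = p" for i
  proof -
    have "expectation (b i) = expectation (indicator {\<omega> \<in> space M. d i \<omega> < - K})"
      by (intro Bochner_Integration.integral_cong refl) (auto simp: b_def indicator_def)
    also have "\<dots> = p" using prob_diag[of "{..<- K}" i] by (simp add: p_def)
    finally show ?thesis .
  qed
  have ib: "integrable M (b i)" for i
    by (rule integrable_const_bound[of _ 1]) (auto simp: b_def)
  have ibb: "integrable M (\<lambda>\<omega>. (b i \<omega> - p) * (b j \<omega> - p))" for i j
  proof (rule integrable_const_bound[of _ 1])
    have "\<bar>(b i \<omega> - p) * (b j \<omega> - p)\<bar> \<le> 1 * 1" for \<omega>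
      unfolding abs_mult using p by (intro mult_mono) (auto simp: b_def)
    then show "AE \<omega> in M. norm ((b i \<omega> - p) * (b j \<omega> - p)) \<le> 1" by simp
  qed measurable
  have Ebb: "expectation (\<lambda>\<omega>. (b i \<omega> - p) * (b j \<omega> - p)) \<le> (if i = j then 1 else 0)" for i j
  proof (cases "i = j")
    case True
    have "expectation (\<lambda>\<omega>. (b i \<omega> - p) * (b j \<omega> - p)) \<le> expectation (\<lambda>\<omega>. 1)"
    proof (intro integral_mono ibb)
      fix \<omega>
      have "\<bar>(b i \<omega> - p) * (b j \<omega> - p)\<bar> \<le> 1 * 1"
        unfolding abs_mult using p by (intro mult_mono) (auto simp: b_def)
      then show "(b i \<omega> - p) * (b j \<omega> - p) \<le> 1" by simp
    qed auto
    then show ?thesis using True by (simp add: prob_space)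
  next
    case False
    have "expectation (\<lambda>\<omega>. b i \<omega> * b j \<omega>) = p * p"
    proof -
      have "expectation (\<lambda>\<omega>. b i \<omega> * b j \<omega>) = expectation (indicator {\<omega> \<in> space M. d i \<omega> < - K \<and> d j \<omega> < - K})"
        by (intro Bochner_Integration.integral_cong refl) (auto simp: b_def indicator_def)
      also have "\<dots> = p * p"
        using prob_diag_two[OF False, of "{..<- K}" "{..<- K}"] prob_diag[of "{..<- K}" i] prob_diag[of "{..<- K}" j]
        by (simp add: p_def)
      finally show ?thesis .
    qed
    moreover have "integrable M (\<lambda>\<omega>. b i \<omega> * b j \<omega>)"
      by (rule integrable_const_bound[of _ 1]) (auto simp: b_def)
    ultimately have "expectation (\<lambda>\<omega>. (b i \<omega> - p) * (b j \<omega> - p)) = 0"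
      using ib by (simp add: algebra_simps Eb prob_space)
    then show ?thesis using False by simp
  qed
  have f2: "(f k \<omega>)\<^sup>2 = (\<Sum>i<k\<^sup>2. \<Sum>j<k\<^sup>2. (b i \<omega> - p) * (b j \<omega> - p)) / (real (k\<^sup>2))\<^sup>2" for k \<omega>
    unfolding f_def power_divide by (simp only: power2_eq_square[of "sum _ _"] sum_product)
  have "AE \<omega> in M. (\<lambda>k. f k \<omega>) \<longlonglongrightarrow> 0"
  proof (rule AE_LIMSEQ_zero_second_moment)
    fix k :: nat assume k: "1 \<le> k"
    show "integrable M (\<lambda>\<omega>. (f k \<omega>)\<^sup>2)"
      unfolding f2 by (intro integrable_divide Bochner_Integration.integrable_sum ibb)
    have "expectation (\<lambda>\<omega>. (f k \<omega>)\<^sup>2) = (\<Sum>i<k\<^sup>2. \<Sum>j<k\<^sup>2. expectation (\<lambda>\<omega>. (b i \<omega> - p) * (b j \<omega> - p))) / (real (k\<^sup>2))\<^sup>2"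
      unfolding f2 using ibb by (simp add: Bochner_Integration.integral_sum Bochner_Integration.integrable_sum)
    also have "\<dots> \<le> (\<Sum>i<k\<^sup>2. \<Sum>j<k\<^sup>2. if i = j then 1 else 0) / (real (k\<^sup>2))\<^sup>2"
      by (intro divide_right_mono sum_mono Ebb) auto
    also have "\<dots> = inverse (real k ^ 2)"
      using k by (simp add: power2_eq_square divide_simps)
    finally show "expectation (\<lambda>\<omega>. (f k \<omega>)\<^sup>2) \<le> inverse (real k ^ 2)" .
  qed (rule inverse_power_summable, simp)
  then have "AE \<omega> in M. \<forall>\<^sub>F k in sequentially. card {i. i < k\<^sup>2 \<and> d i \<omega> < - K} \<le> \<delta> * real (k\<^sup>2)"
  proof eventually_elim
    case (elim \<omega>)
    then have "\<forall>\<^sub>F k in sequentially. f k \<omega> < \<delta> / 2" using \<delta> by (intro order_tendstoD) auto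
    then show ?case
      using eventually_gt_at_top[of 0]
    proof eventually_elim
      case (elim k)
      have "(\<Sum>i<k\<^sup>2. b i \<omega>) = card {i. i < k\<^sup>2 \<and> d i \<omega> < - K}"
      proof -
        have "{..<k\<^sup>2} \<inter> {i. d i \<omega> < - K} = {i. i < k\<^sup>2 \<and> d i \<omega> < - K}" by auto
        then show ?thesis by (simp add: b_def sum.If_cases)
      qed
      then have "f k \<omega> = card {i. i < k\<^sup>2 \<and> d i \<omega> < - K} / real (k\<^sup>2) - p"
        using elim(2) by (simp add: f_def sum_subtractf diff_divide_distrib)
      moreover have "p < \<delta> / 2" using K by (simp add: p_def)
      ultimately have "card {i. i < k\<^sup>2 \<and> d i \<omega> < - K} / real (k\<^sup>2) \<le> \<delta>" using elim(1) by linarith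
      then show ?case using elim(2) by (simp add: pos_divide_le_eq)
    qed
  qed
  then show ?thesis using K by blast
qed

end

lemma (in iid_quat_array) iid_centred:
  assumes "integrable M (X (0, 1))" "integrable M (\<lambda>\<omega>. norm (X (0, 1) \<omega>) ^ 4)" "expectation (X (0, 1)) = \<mu>"
  shows "iid_quat_array M (\<lambda>e \<omega>. X e \<omega> - \<mu>)" "expectation (\<lambda>\<omega>. X (0, 1) \<omega> - \<mu>) = 0"
    "integrable M (\<lambda>\<omega>. X (0, 1) \<omega> - \<mu>)" "integrable M (\<lambda>\<omega>. norm (X (0, 1) \<omega> - \<mu>) ^ 4)"
proof -
  show "iid_quat_array M (\<lambda>e \<omega>. X e \<omega> - \<mu>)" by (rule iid_compose) measurable
  show "expectation (\<lambda>\<omega>. X (0, 1) \<omega> - \<mu>) = 0" "integrable M (\<lambda>\<omega>. X (0, 1) \<omega> - \<mu>)"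
    using assms by (simp_all add: prob_space del: One_nat_def)
  show "integrable M (\<lambda>\<omega>. norm (X (0, 1) \<omega> - \<mu>) ^ 4)"
  proof (rule Bochner_Integration.integrable_bound)
    show "integrable M (\<lambda>\<omega>. 8 * norm (X (0, 1) \<omega>) ^ 4 + 8 * norm \<mu> ^ 4)" using assms(2) by simp
    have "norm (q - \<mu>) ^ 4 \<le> 8 * norm q ^ 4 + 8 * norm \<mu> ^ 4" for q
    proof -
      have "norm (q - \<mu>) ^ 4 \<le> (norm q + norm \<mu>) ^ 4" by (intro power_mono norm_triangle_ineq4) auto
      then show ?thesis using power4_add_le[of "norm q" "norm \<mu>"] by linarith
    qed
    then show "AE \<omega> in M. norm (norm (X (0, 1) \<omega> - \<mu>) ^ 4) \<le> norm (8 * norm (X (0, 1) \<omega>) ^ 4 + 8 * norm \<mu> ^ 4)"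
      by (simp add: abs_of_nonneg)
  qed measurable
qed

section \<open>Sufficiency of the moment conditions\<close>

context wigner
begin

text \<open>For each \<open>n\<close> only the new entry \<open>d n\<close> has to be compared with
  \<open>\<epsilon> * sqrt n\<close>: later thresholds are larger, and the finitely many initial
  entries are eventually exceeded.\<close>

lemma AE_diag:
  assumes int: "integrable M (\<lambda>\<omega>. (max (d 0 \<omega>) 0)\<^sup>2)" and \<epsilon>: "0 < \<epsilon>"
  shows "AE \<omega> in M. \<forall>\<^sub>F n in sequentially. \<forall>i<n. d i \<omega> \<le> \<epsilon> * sqrt n"
proof -
  define f where "f \<omega> = (max (d 0 \<omega>) 0 / \<epsilon>)\<^sup>2" for \<omega>
  define A where "A n = {\<omega> \<in> space M. d n \<omega> \<in> {\<epsilon> * sqrt n <..}}" for n :: nat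
  have fm: "f \<in> borel_measurable M" unfolding f_def[abs_def] by measurable
  have "summable (\<lambda>k. 1 * prob {\<omega> \<in> space M. real k < f \<omega>})"
  proof (rule summable_tail[OF fm])
    show "integrable M (\<lambda>\<omega>. f \<omega> + 1)" using int by (simp add: f_def power_divide)
    show "(\<Sum>k<nat \<lceil>f \<omega>\<rceil>. 1) \<le> f \<omega> + 1" for \<omega>
    proof -
      have "0 \<le> f \<omega>" by (simp add: f_def)
      then show ?thesis by simp
    qed
  qed simp
  then have sm: "summable (\<lambda>k. prob {\<omega> \<in> space M. real k < f \<omega>})" by simp
  have "AE \<omega> in M. \<forall>\<^sub>F n in sequentially. \<omega> \<notin> A n"
  proof (rule eventually_not_event[OF _ _ sm])
    fix n :: nat
    show "A n \<in> events" unfolding A_def by measurable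
    have "prob (A n) = prob {\<omega> \<in> space M. d 0 \<omega> \<in> {\<epsilon> * sqrt n <..}}" unfolding A_def by (rule prob_diag) simp
    also have "\<dots> \<le> prob {\<omega> \<in> space M. real n < f \<omega>}"
    proof (intro finite_measure_mono)
      have "real n < f \<omega>" if "\<epsilon> * sqrt n < d 0 \<omega>" for \<omega>
      proof -
        have "0 \<le> \<epsilon> * sqrt n" using \<epsilon> by simp
        then have "max (d 0 \<omega>) 0 = d 0 \<omega>" using that by linarith
        moreover have "sqrt n < d 0 \<omega> / \<epsilon>" using that \<epsilon> by (simp add: pos_less_divide_eq mult.commute)
        then have "(sqrt n)\<^sup>2 < (d 0 \<omega> / \<epsilon>)\<^sup>2" by (intro power_strict_mono) auto
        ultimately show ?thesis by (simp add: f_def)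
      qed
      then show "{\<omega> \<in> space M. d 0 \<omega> \<in> {\<epsilon> * sqrt n <..}} \<subseteq> {\<omega> \<in> space M. real n < f \<omega>}" by auto
    qed (use fm in measurable)
    finally show "prob (A n) \<le> prob {\<omega> \<in> space M. real n < f \<omega>}" .
  qed
  then show ?thesis using AE_space
  proof eventually_elim
    case (elim \<omega>)
    then obtain N where N: "\<And>n. N \<le> n \<Longrightarrow> d n \<omega> \<le> \<epsilon> * sqrt n"
      by (auto simp: eventually_sequentially A_def not_less)
    have ev: "\<forall>\<^sub>F n in sequentially. c \<le> \<epsilon> * sqrt n" for c
      using \<epsilon> by real_asymp
    have "\<forall>\<^sub>F n in sequentially. \<forall>i\<in>{..<N}. d i \<omega> \<le> \<epsilon> * sqrt n"
      using ev by (intro eventually_ball_finite) auto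
    then show ?case
    proof eventually_elim
      case (elim n)
      show ?case
      proof (intro allI impI)
        fix i assume i: "i < n"
        show "d i \<omega> \<le> \<epsilon> * sqrt n"
        proof (cases "i < N")
          case False
          then have "d i \<omega> \<le> \<epsilon> * sqrt i" using N by simp
          also have "\<dots> \<le> \<epsilon> * sqrt n" using i \<epsilon> by simp
          finally show ?thesis .
        qed (use elim in simp)
      qed
    qed
  qed
qed

context
  fixes a \<sigma> :: real
  assumes int1: "integrable M (X (0, 1))" and fourth: "integrable M (\<lambda>\<omega>. norm (X (0, 1) \<omega>) ^ 4)"
    and mean: "expectation (X (0, 1)) = a *\<^sub>R qone" and a: "a \<le> 0"
    and var: "expectation (\<lambda>\<omega>. (norm (X (0, 1) \<omega> - a *\<^sub>R qone))\<^sup>2) = \<sigma>\<^sup>2" and \<sigma>: "0 \<le> \<sigma>"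
begin

text \<open>The decomposition \<open>pmat\<close> is evaluated at a maximising vector, where the
  rank one term has a favourable sign because of \<open>a \<le> 0\<close>.\<close>

lemma AE_lam_upper:
  assumes int: "integrable M (\<lambda>\<omega>. (max (d 0 \<omega>) 0)\<^sup>2)" and y: "2 * \<sigma> < y"
  shows "AE \<omega> in M. \<forall>\<^sub>F n in sequentially. lam n \<omega> < y"
proof -
  note c = X.iid_centred[OF int1 fourth mean]
  interpret Y: iid_quat_array M "\<lambda>e \<omega>. X e \<omega> - a *\<^sub>R qone" by (rule c(1))
  \<comment> \<open>One \<open>\<epsilon>\<close> keeps the bound
    \<open>\<sigma> + \<epsilon>\<close> positive even for \<open>\<sigma> = 0\<close> and counts
    twice, one is the slack of the operator bound, and the diagonal and \<open>a\<close> take two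
    more.\<close>
  define \<epsilon> where "\<epsilon> = (y - 2 * \<sigma>) / 6"
  have \<epsilon>: "0 < \<epsilon>" "y = 2 * \<sigma> + 6 * \<epsilon>" using y by (auto simp: \<epsilon>_def field_simps)
  have "\<sigma>\<^sup>2 \<le> (\<sigma> + \<epsilon>)\<^sup>2" using \<sigma> \<epsilon> by (intro power_mono) auto
  then have "AE \<omega> in M. \<forall>\<^sub>F n in sequentially. op_bound n (Y.W \<omega>) ((2 * (\<sigma> + \<epsilon>) + \<epsilon>) * sqrt n)"
    using \<sigma> \<epsilon> by (intro Y.AE_op_bound c(2-4)) (simp_all add: var del: One_nat_def)
  then show ?thesis using AE_diag[OF int \<epsilon>(1)] AE_space
  proof eventually_elim
    case (elim \<omega>)
    note om = elim(3)
    have "\<forall>\<^sub>F n in sequentially. \<bar>a\<bar> \<le> \<epsilon> * sqrt n" using \<epsilon>(1) by real_asymp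
    then show ?case using elim(1,2) eventually_gt_at_top[of 0]
    proof eventually_elim
      case (elim n)
      obtain v where v: "0 < ip n v v" "ip n v (mv n (H \<omega>) v) = lam n \<omega> * sqrt n * ip n v v"
        using lam_attained[OF om elim(4)] by blast
      have "H \<omega> = pmat (Y.W \<omega>) (\<lambda>i. d i \<omega>) a" using H_eq_pmat[OF om, of _ _ a] by (intro ext)
      then have "lam n \<omega> * sqrt n * ip n v v
          = ip n v (mv n (Y.W \<omega>) v) + (\<Sum>i<n. (d i \<omega> - a) * (norm (v i))\<^sup>2) + a * (norm (\<Sum>i<n. v i))\<^sup>2"
        using v(2) by (simp add: ip_pmat)
      moreover have "ip n v (mv n (Y.W \<omega>) v) \<le> (2 * (\<sigma> + \<epsilon>) + \<epsilon>) * sqrt n * ip n v v"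
        using op_bound_ip[OF elim(2), of v] by linarith
      moreover have "(\<Sum>i<n. (d i \<omega> - a) * (norm (v i))\<^sup>2) \<le> (\<Sum>i<n. (2 * \<epsilon> * sqrt n) * (norm (v i))\<^sup>2)"
      proof (intro sum_mono mult_right_mono)
        fix i assume "i \<in> {..<n}"
        then have "d i \<omega> \<le> \<epsilon> * sqrt n" using elim(3) by simp
        then show "d i \<omega> - a \<le> 2 * \<epsilon> * sqrt n" using elim(1) by linarith
      qed simp
      moreover have "(\<Sum>i<n. (2 * \<epsilon> * sqrt n) * (norm (v i))\<^sup>2) = 2 * \<epsilon> * sqrt n * ip n v v"
        by (simp add: ip_self sum_distrib_left)
      moreover have "a * (norm (\<Sum>i<n. v i))\<^sup>2 \<le> 0" using a by (simp add: mult_nonpos_nonneg)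
      ultimately have "lam n \<omega> * sqrt n * ip n v v \<le> (2 * (\<sigma> + \<epsilon>) + \<epsilon>) * sqrt n * ip n v v + 2 * \<epsilon> * sqrt n * ip n v v"
        by linarith
      also have "\<dots> = (2 * \<sigma> + 5 * \<epsilon>) * (sqrt n * ip n v v)" by (simp add: algebra_simps)
      finally have "lam n \<omega> * (sqrt n * ip n v v) \<le> (2 * \<sigma> + 5 * \<epsilon>) * (sqrt n * ip n v v)" by (simp add: algebra_simps)
      then have "lam n \<omega> \<le> 2 * \<sigma> + 5 * \<epsilon>" using v(1) elim(4) by (simp add: mult_le_cancel_right)
      then show ?case using \<epsilon> by linarith
    qed
  qed
qed

lemma AE_lam_lower:
  assumes y: "y < 2 * \<sigma>"
  shows "AE \<omega> in M. \<forall>\<^sub>F n in sequentially. y < lam n \<omega>"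
proof (cases "y < 0")
  \<comment> \<open>The first diagonal entry divided by \<open>sqrt n\<close> is a lower bound
    tending to 0. For \<open>\<sigma> = 0\<close> this is the only case.\<close>
  case True
  show ?thesis
  proof (rule AE_I2)
    fix \<omega> assume om: "\<omega> \<in> space M"
    have "\<forall>\<^sub>F n in sequentially. y * sqrt n < c" for c using True by real_asymp
    from this[of "d 0 \<omega>"] show "\<forall>\<^sub>F n in sequentially. y < lam n \<omega>" using eventually_gt_at_top[of 0]
    proof eventually_elim
      case (elim n)
      then have "y * sqrt n < lam n \<omega> * sqrt n" using d_le_lam[OF om, of 0 n] by linarith
      then show ?case using elim by (simp add: mult_less_cancel_right)
    qed
  qed
next
  case False
  note c = X.iid_centred[OF int1 fourth mean]
  interpret Y: iid_quat_array M "\<lambda>e \<omega>. X e \<omega> - a *\<^sub>R qone" by (rule c(1))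
  define \<theta> where "\<theta> = (y + 2 * \<sigma>) / 2"
  have \<theta>: "0 \<le> \<theta>" "y < \<theta>" "\<theta> < 2 * \<sigma>" using y False \<sigma> by (auto simp: \<theta>_def)
  have "AE \<omega> in M. \<forall>\<^sub>F k in sequentially. \<exists>v. \<theta> * real k * ip (k\<^sup>2) v v < ip (k\<^sup>2) v (mv (k\<^sup>2) (pmat (Y.W \<omega>) (\<lambda>i. d i \<omega>) a) v)"
    by (rule Y.AE_rayleigh_lower[OF c(2-4) var \<theta>(1,3) a AE_bad_fraction])
  then show ?thesis using AE_space
  proof eventually_elim
    case (elim \<omega>)
    note om = elim(2)
    have eq: "H \<omega> = pmat (Y.W \<omega>) (\<lambda>i. d i \<omega>) a" using H_eq_pmat[OF om, of _ _ a] by (intro ext)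
    define k where "k n = nat \<lfloor>sqrt (real n)\<rfloor>" for n
    have kl: "filterlim k sequentially sequentially" unfolding k_def by real_asymp
    \<comment> \<open>The square root of \<open>n\<close> is less than \<open>k n + 1\<close>, and
      the distance between \<open>y\<close> and \<open>\<theta>\<close> absorbs this
      rounding.\<close>
    have "\<forall>\<^sub>F m in sequentially. y * (real m + 1) \<le> \<theta> * real m" using \<theta>(2) by real_asymp
    then have "\<forall>\<^sub>F m in sequentially. 0 < m \<and> y * (real m + 1) \<le> \<theta> * real m \<and>
        (\<exists>v. \<theta> * real m * ip (m\<^sup>2) v v < ip (m\<^sup>2) v (mv (m\<^sup>2) (H \<omega>) v))"
      using elim(1) eventually_gt_at_top[of 0] unfolding eq by eventually_elim blast
    then have "\<forall>\<^sub>F n in sequentially. 0 < k n \<and> y * (real (k n) + 1) \<le> \<theta> * real (k n) \<and>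
        (\<exists>v. \<theta> * real (k n) * ip ((k n)\<^sup>2) v v < ip ((k n)\<^sup>2) v (mv ((k n)\<^sup>2) (H \<omega>) v))"
      by (rule eventually_compose_filterlim[OF _ kl])
    then show ?case
    proof eventually_elim
      case (elim n)
      have kn: "real (k n) \<le> sqrt n" "sqrt n < real (k n) + 1" unfolding k_def by (simp_all add: of_nat_nat)
      have "(real (k n))\<^sup>2 \<le> (sqrt n)\<^sup>2" using kn(1) by (intro power_mono) auto
      then have "real ((k n)\<^sup>2) \<le> real n" by simp
      then have le: "(k n)\<^sup>2 \<le> n" by (simp only: of_nat_le_iff)
      obtain v where v: "\<theta> * real (k n) * ip ((k n)\<^sup>2) v v < ip ((k n)\<^sup>2) v (mv ((k n)\<^sup>2) (H \<omega>) v)"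
        using elim by blast
      have "\<theta> * real (k n) < lam n \<omega> * sqrt n"
        using lam_mono[OF om _ le _ v] elim \<theta>(1) by simp
      moreover have "y * sqrt n \<le> y * (real (k n) + 1)" using kn False by (intro mult_left_mono) auto
      ultimately have "y * sqrt n < lam n \<omega> * sqrt n" using elim by linarith
      then show ?case by (simp add: mult_less_cancel_right)
    qed
  qed
qed

lemma AE_lam_tendsto:
  assumes int: "integrable M (\<lambda>\<omega>. (max (d 0 \<omega>) 0)\<^sup>2)"
  shows "AE \<omega> in M. (\<lambda>n. lam n \<omega>) \<longlonglongrightarrow> 2 * \<sigma>"
proof -
  have "AE \<omega> in M. \<forall>j. \<forall>\<^sub>F n in sequentially. lam n \<omega> < 2 * \<sigma> + 1 / real (Suc j)"
    unfolding AE_all_countable using AE_lam_upper[OF int] by simp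
  moreover have "AE \<omega> in M. \<forall>j. \<forall>\<^sub>F n in sequentially. 2 * \<sigma> - 1 / real (Suc j) < lam n \<omega>"
    unfolding AE_all_countable using AE_lam_lower by simp
  ultimately show ?thesis
  proof eventually_elim
    case (elim \<omega>)
    show ?case
    proof (rule order_tendstoI)
      fix y assume "2 * \<sigma> < y"
      then obtain j where "inverse (real (Suc j)) < y - 2 * \<sigma>" using reals_Archimedean[of "y - 2 * \<sigma>"] by auto
      then have "2 * \<sigma> + 1 / real (Suc j) < y" by (simp add: inverse_eq_divide)
      with elim(1)[rule_format, of j] show "\<forall>\<^sub>F n in sequentially. lam n \<omega> < y" by (auto elim!: eventually_mono)
    next
      fix y assume "y < 2 * \<sigma>"
      then obtain j where "inverse (real (Suc j)) < 2 * \<sigma> - y" using reals_Archimedean[of "2 * \<sigma> - y"] by auto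
      then have "y < 2 * \<sigma> - 1 / real (Suc j)" by (simp add: inverse_eq_divide)
      with elim(2)[rule_format, of j] show "\<forall>\<^sub>F n in sequentially. y < lam n \<omega>" by (auto elim!: eventually_mono)
    qed
  qed
qed

end

end

section \<open>Necessity of the moment conditions\<close>

text \<open>Adding the last row and column contributes two equal terms, in which the last component
  meets the sum of the earlier ones. Only partial sums of \<open>v\<close> matter.\<close>

lemma ip_hm_const:
  "ip n v (mv n (hm (\<lambda>_. u)) v) = 2 * (\<Sum>j<n. inner (\<Sum>i<j. v i) (qmul u (v j)))"
proof (induction n)
  case 0
  show ?case by (simp add: ip_def)
next
  case (Suc n)
  have "ip (Suc n) v (mv (Suc n) (hm (\<lambda>_. u)) v) =
      (\<Sum>i<n. inner (v i) (mv n (hm (\<lambda>_. u)) v i + qmul u (v n))) + inner (v n) (\<Sum>j<n. qmul (quat_conj u) (v j))"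
    by (simp add: ip_def mv_def hm_def qmul.zero_left)
  also have "(\<Sum>i<n. inner (v i) (mv n (hm (\<lambda>_. u)) v i + qmul u (v n)))
      = ip n v (mv n (hm (\<lambda>_. u)) v) + inner (\<Sum>i<n. v i) (qmul u (v n))"
    by (simp add: inner_add_right sum.distrib ip_def inner_sum_left)
  also have "inner (v n) (\<Sum>j<n. qmul (quat_conj u) (v j)) = inner (\<Sum>i<n. v i) (qmul u (v n))"
    by (simp add: inner_sum_right inner_sum_left inner_commute[of "v n"] inner_qmul_left)
  finally show ?case using Suc by simp
qed

text \<open>On a block with constant value \<open>e\<close> on \<open>G\<close>, the part of the
  partial sum built up inside the block is a multiple of \<open>e\<close> and drops out by
  \<open>inner e (qmul u e) = 0\<close>.\<close>

lemma block_sums: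
  fixes v :: "nat \<Rightarrow> quaternion"
  assumes "c \<le> c'" and v: "\<And>j. c \<le> j \<Longrightarrow> j < c' \<Longrightarrow> v j = (if j \<in> G then e else 0)" and e: "inner e (qmul u e) = 0"
  defines "N \<equiv> card (G \<inter> {c..<c'})"
  shows "(\<Sum>i<c'. v i) = (\<Sum>i<c. v i) + real N *\<^sub>R e"
    and "(\<Sum>j<c'. inner (\<Sum>i<j. v i) (qmul u (v j))) = (\<Sum>j<c. inner (\<Sum>i<j. v i) (qmul u (v j))) + N * inner (\<Sum>i<c. v i) (qmul u e)"
    and "(\<Sum>i<c'. (norm (v i))\<^sup>2) = (\<Sum>i<c. (norm (v i))\<^sup>2) + N * (norm e)\<^sup>2"
proof -
  have "(\<Sum>i<c'. v i) = (\<Sum>i<c. v i) + real (card (G \<inter> {c..<c'})) *\<^sub>R e \<and>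
    (\<Sum>j<c'. inner (\<Sum>i<j. v i) (qmul u (v j))) = (\<Sum>j<c. inner (\<Sum>i<j. v i) (qmul u (v j))) + card (G \<inter> {c..<c'}) * inner (\<Sum>i<c. v i) (qmul u e) \<and>
    (\<Sum>i<c'. (norm (v i))\<^sup>2) = (\<Sum>i<c. (norm (v i))\<^sup>2) + card (G \<inter> {c..<c'}) * (norm e)\<^sup>2"
    using assms(1) v
  proof (induction c' rule: dec_induct)
    case (step m)
    note IH = step.IH[OF step.prems]
    have vm: "v m = (if m \<in> G then e else 0)" using step.prems[of m] step.hyps by simp
    show ?case
    proof (cases "m \<in> G")
      case True
      have "G \<inter> {c..<Suc m} = insert m (G \<inter> {c..<m})" using True step.hyps by auto
      then have "card (G \<inter> {c..<Suc m}) = Suc (card (G \<inter> {c..<m}))" by simp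
      then show ?thesis using IH vm True e by (simp add: inner_add_left algebra_simps)
    next
      case False
      then have "G \<inter> {c..<Suc m} = G \<inter> {c..<m}" by (auto simp: less_Suc_eq)
      then show ?thesis using IH vm False by (simp add: qmul.zero_right)
    qed
  qed simp
  then show "(\<Sum>i<c'. v i) = (\<Sum>i<c. v i) + real N *\<^sub>R e"
    and "(\<Sum>j<c'. inner (\<Sum>i<j. v i) (qmul u (v j))) = (\<Sum>j<c. inner (\<Sum>i<j. v i) (qmul u (v j))) + N * inner (\<Sum>i<c. v i) (qmul u e)"
    and "(\<Sum>i<c'. (norm (v i))\<^sup>2) = (\<Sum>i<c. (norm (v i))\<^sup>2) + N * (norm e)\<^sup>2"
    by (simp_all add: N_def)
qed

text \<open>A discrete intermediate value argument: the number of elements of \<open>G\<close> grows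
  by at most one per step, so a block with exactly \<open>t\<close> of them can be cut off.\<close>

lemma exists_block:
  fixes G :: "nat set"
  assumes "t \<le> card (G \<inter> {c..<n})"
  shows "\<exists>c'\<ge>c. c' \<le> max c n \<and> card (G \<inter> {c..<c'}) = t \<and> card (G \<inter> {c'..<n}) = card (G \<inter> {c..<n}) - t"
proof (cases "c \<le> n")
  case True
  then show ?thesis using assms
  proof (induction n arbitrary: t rule: dec_induct)
    case base
    then show ?case by (intro exI[of _ c]) simp
  next
    case (step m)
    have split: "card (G \<inter> {c'..<Suc m}) = card (G \<inter> {c'..<m}) + (if m \<in> G then 1 else 0)" if "c' \<le> m" for c'
    proof (cases "m \<in> G")
      case True
      have "G \<inter> {c'..<Suc m} = insert m (G \<inter> {c'..<m})" using True that by auto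
      then show ?thesis using True by simp
    next
      case False
      then have "G \<inter> {c'..<Suc m} = G \<inter> {c'..<m}" by (auto simp: less_Suc_eq)
      then show ?thesis using False by simp
    qed
    show ?case
    proof (cases "t \<le> card (G \<inter> {c..<m})")
      case True
      then obtain c' where c': "c \<le> c'" "c' \<le> max c m" "card (G \<inter> {c..<c'}) = t" "card (G \<inter> {c'..<m}) = card (G \<inter> {c..<m}) - t"
        using step.IH by blast
      then have "c' \<le> m" using step.hyps by simp
      then show ?thesis using c' split[of c'] split[of c] step.hyps True by (intro exI[of _ c']) auto
    next
      case False
      then have "t = card (G \<inter> {c..<Suc m})" using split[of c] step.hyps step.prems by (simp split: if_splits)
      then show ?thesis using step.hyps by (intro exI[of _ "Suc m"]) auto
    qed
  qed
qed (use assms in \<open>auto intro!: exI[of _ c]\<close>)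

lemma qmul_imaginary_self:
  assumes "inner qone u = 0" shows "qmul u u = - (norm u)\<^sup>2 *\<^sub>R qone"
proof -
  have "quat_conj u = - u" using assms by (cases u) (simp add: qone_def quat_inner)
  then show ?thesis using qmul_conj_self[of u] by (simp add: qmul.minus_right) (metis add.inverse_inverse scaleR_minus_left)
qed

text \<open>
  The four block values are \<open>1\<close>, \<open>- u / |u|\<close>, \<open>- 1\<close>, \<open>u / |u|\<close>. They sum to zero, which removes
  the real part of the mean, and the vector turns steadily in the direction of \<open>- u\<close>, so that
  all contributions of the imaginary part to the quadratic form have the same sign.
\<close>

lemma rotating_vector:
  assumes u: "inner qone u = 0" "u \<noteq> 0" and card: "4 * t \<le> card (G \<inter> {..<n})"
  shows "\<exists>v. (\<Sum>i<n. v i) = 0 \<and> (\<forall>i<n. v i = 0 \<or> i \<in> G) \<and> ip n v v = 4 * real t \<and>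
    ip n v (mv n (hm (\<lambda>_. u)) v) = 4 * norm u * (real t)\<^sup>2"
proof -
  define w where "w = (1 / norm u) *\<^sub>R u"
  have w: "inner qone w = 0" "norm w = 1" "u = norm u *\<^sub>R w" using u by (simp_all add: w_def)
  have ww: "qmul w w = - qone" using qmul_imaginary_self[OF w(1)] w(2) by simp
  have uw: "qmul u w = - norm u *\<^sub>R qone" using w(3) ww by (metis qmul.scaleR_left scaleR_minus_left scaleR_minus_right)
  have inn: "inner qone qone = 1" "inner w w = 1" "inner w qone = 0" "inner w u = norm u" "inner u w = norm u" "inner qone u = 0" "inner u qone = 0"
    using w u(1) inner_commute[of w qone] by (simp_all add: w_def power2_norm_eq_inner[symmetric] inner_commute[of u qone] power2_eq_square)
  have le: "max c n = n" if "c \<le> n" for c using that by simp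
  have "t \<le> card (G \<inter> {0..<n})" using card by (simp add: atLeast0LessThan)
  from exists_block[OF this] obtain c1 where c1: "c1 \<le> n" "card (G \<inter> {0..<c1}) = t" "card (G \<inter> {c1..<n}) = card (G \<inter> {0..<n}) - t" by auto
  have "t \<le> card (G \<inter> {c1..<n})" using card c1 by (simp add: atLeast0LessThan)
  from exists_block[OF this] obtain c2 where c2: "c1 \<le> c2" "c2 \<le> n" "card (G \<inter> {c1..<c2}) = t" "card (G \<inter> {c2..<n}) = card (G \<inter> {c1..<n}) - t"
    using c1(1) le by auto
  have "t \<le> card (G \<inter> {c2..<n})" using card c1 c2 by (simp add: atLeast0LessThan)
  from exists_block[OF this] obtain c3 where c3: "c2 \<le> c3" "c3 \<le> n" "card (G \<inter> {c2..<c3}) = t" "card (G \<inter> {c3..<n}) = card (G \<inter> {c2..<n}) - t"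
    using c2(2) le by auto
  have "t \<le> card (G \<inter> {c3..<n})" using card c1 c2 c3 by (simp add: atLeast0LessThan)
  from exists_block[OF this] obtain c4 where c4: "c3 \<le> c4" "c4 \<le> n" "card (G \<inter> {c3..<c4}) = t"
    using c3(2) le by auto
  define v where "v j = (if j \<in> G then if j < c1 then qone else if j < c2 then - w else if j < c3 then - qone else if j < c4 then w else 0 else 0)" for j
  define S where "S c = (\<Sum>i<c. v i)" for c
  define F where "F c = (\<Sum>j<c. inner (S j) (qmul u (v j)))" for c
  define Q where "Q c = (\<Sum>j<c. (norm (v j))\<^sup>2)" for c
  have unit: "inner b (qmul u b) = 0" if "norm b = 1" for b using inner_qmul_unit[OF that] u by simp
  have "v j = (if j \<in> G then qone else 0)" if "0 \<le> j" "j < c1" for j using that by (simp add: v_def)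
  note b1 = block_sums[where c = 0 and c' = c1 and v = v and G = G and e = qone and u = u, OF le0 this unit[OF norm_qone]]
  have 1: "S c1 = S 0 + real t *\<^sub>R qone" "F c1 = F 0 + real t * inner (S 0) (qmul u qone)" "Q c1 = Q 0 + real t"
    using b1 unfolding c1(2) S_def F_def Q_def norm_qone power_one mult_1_right by blast+
  have 2: "S c2 = S c1 + real t *\<^sub>R (- w)" "F c2 = F c1 + real t * inner (S c1) (qmul u (- w))" "Q c2 = Q c1 + real t"
    using block_sums[of c1 c2 v G "- w" u] unit[of "- w"] c2 w by (simp_all add: v_def S_def F_def Q_def)
  have 3: "S c3 = S c2 + real t *\<^sub>R (- qone)" "F c3 = F c2 + real t * inner (S c2) (qmul u (- qone))" "Q c3 = Q c2 + real t"
    using block_sums[of c2 c3 v G "- qone" u] unit[of "- qone"] c2(1) c3 by (simp_all add: v_def S_def F_def Q_def)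
  have 4: "S c4 = S c3 + real t *\<^sub>R w" "F c4 = F c3 + real t * inner (S c3) (qmul u w)" "Q c4 = Q c3 + real t"
    using block_sums[of c3 c4 v G w u] unit[of w] c2(1) c3(1) c4 w by (simp_all add: v_def S_def F_def Q_def)
  have 5: "S n = S c4" "F n = F c4" "Q n = Q c4"
    using block_sums[of c4 n v "{}" 0 u] c2(1) c3(1) c4(1,2) by (simp_all add: v_def S_def F_def Q_def)
  have 0: "S 0 = 0" "F 0 = 0" "Q 0 = 0" by (simp_all add: S_def F_def Q_def)
  have "S n = 0" using 0 1 2 3 4 5 by simp
  moreover have "Q n = 4 * real t" using 0 1 2 3 4 5 by simp
  \<comment> \<open>The second and the third block contribute
    \<open>norm u * (real t)\<^sup>2\<close> each, the first and the fourth nothing.\<close>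
  moreover have "F n = 2 * norm u * (real t)\<^sup>2"
    unfolding 5 4 3 2 1 0 by (simp add: qmul.minus_right uw inner_diff_left inner_add_left inn power2_eq_square algebra_simps)
  ultimately have "(\<Sum>i<n. v i) = 0" "ip n v v = 4 * real t" "ip n v (mv n (hm (\<lambda>_. u)) v) = 4 * norm u * (real t)\<^sup>2"
    by (simp_all add: ip_hm_const ip_self S_def F_def Q_def)
  moreover have "v i = 0 \<or> i \<in> G" for i by (simp add: v_def)
  ultimately show ?thesis by blast
qed

section \<open>Moment conditions from eventual boundedness of the largest eigenvalue\<close>

context wigner
begin

lemma prob_edge_and_diag:
  assumes jk: "j < k" and S: "S \<in> sets borel" "T \<in> sets borel"
  shows "prob {\<omega> \<in> space M. d j \<omega> \<in> S \<and> d k \<omega> \<in> S \<and> X (j, k) \<omega> \<in> T}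
    = (prob {\<omega> \<in> space M. d 0 \<omega> \<in> S})\<^sup>2 * prob {\<omega> \<in> space M. X (0, 1) \<omega> \<in> T}"
proof -
  define A where "A e = {\<omega> \<in> space M. X e \<omega> \<in> (if fst e = snd e then re_part -` S else T)}" for e
  have A: "A e = X e -` (if fst e = snd e then re_part -` S else T) \<inter> space M" for e by (auto simp: A_def)
  have "re_part -` S \<in> sets borel" using measurable_sets_borel[OF re_part_measurable S(1)] .
  then have "prob (\<Inter>e\<in>{(j, j), (k, k), (j, k)}. A e) = (\<Prod>e\<in>{(j, j), (k, k), (j, k)}. prob (A e))"
    unfolding A using jk S by (intro indep_varsD[OF indep_X]) auto
  moreover have "(\<Inter>e\<in>{(j, j), (k, k), (j, k)}. A e) = {\<omega> \<in> space M. d j \<omega> \<in> S \<and> d k \<omega> \<in> S \<and> X (j, k) \<omega> \<in> T}"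
    using jk by (auto simp: A_def d_def X_def)
  moreover have "(\<Prod>e\<in>{(j, j), (k, k), (j, k)}. prob (A e)) = prob (A (j, j)) * (prob (A (k, k)) * prob (A (j, k)))" using jk by simp
  moreover have "A (i, i) = {\<omega> \<in> space M. d i \<omega> \<in> S}" for i by (auto simp: A_def d_def X_def)
  moreover have "A (j, k) = {\<omega> \<in> space M. X (j, k) \<omega> \<in> T}" using jk by (auto simp: A_def)
  ultimately have "prob {\<omega> \<in> space M. d j \<omega> \<in> S \<and> d k \<omega> \<in> S \<and> X (j, k) \<omega> \<in> T}
      = prob {\<omega> \<in> space M. d j \<omega> \<in> S} * (prob {\<omega> \<in> space M. d k \<omega> \<in> S} * prob {\<omega> \<in> space M. X (j, k) \<omega> \<in> T})"
    by (simp only:)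
  then show ?thesis
    unfolding prob_diag[OF S(1), of j] prob_diag[OF S(1), of k] X.prob_transfer[OF jk S(2)] power2_eq_square
    by (simp only: mult.assoc)
qed

text \<open>The test vector lives on \<open>j\<close> and \<open>k\<close>; the component at
  \<open>j\<close> carries the direction of the entry, so that both off-diagonal terms equal its
  norm.\<close>

lemma edge_le_lam:
  assumes om: "\<omega> \<in> space M" and jk: "j < k" "k < n"
  shows "d j \<omega> + d k \<omega> + 2 * norm (X (j, k) \<omega>) \<le> 2 * (lam n \<omega> * sqrt n)"
proof -
  define q where "q = X (j, k) \<omega>"
  define u where "u = (if q = 0 then qone else (1 / norm q) *\<^sub>R q)"
  have u: "norm u = 1" "inner u q = norm q"
    by (auto simp: u_def power2_norm_eq_inner[symmetric] power2_eq_square)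
  define v where "v i = (if i = j then u else if i = k then qone else 0)" for i
  have sub: "(\<Sum>i<n. if i = j then f i else if i = k then g i else 0) = f j + g k" for f g :: "nat \<Rightarrow> 'b :: comm_monoid_add"
  proof -
    have "(\<Sum>i<n. if i = j then f i else if i = k then g i else 0) = (\<Sum>i<n. (if i = j then f i else 0) + (if i = k then g i else 0))"
      using jk by (intro sum.cong refl) auto
    then show ?thesis using jk by (simp add: sum.distrib)
  qed
  have mv: "mv n (H \<omega>) v i = qmul (H \<omega> i j) u + H \<omega> i k" for i
  proof -
    have "mv n (H \<omega>) v i = (\<Sum>l<n. if l = j then qmul (H \<omega> i l) u else if l = k then H \<omega> i l else 0)"
      unfolding mv_def by (intro sum.cong refl) (auto simp: v_def qmul.zero_right)
    then show ?thesis by (simp add: sub)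
  qed
  have ip: "ip n v w = inner u (w j) + inner qone (w k)" for w
  proof -
    have "ip n v w = (\<Sum>l<n. if l = j then inner u (w l) else if l = k then inner qone (w l) else 0)"
      unfolding ip_def by (intro sum.cong refl) (auto simp: v_def)
    then show ?thesis by (simp add: sub)
  qed
  have "ip n v v = 2" using jk u by (simp add: ip) (simp add: v_def power2_norm_eq_inner[symmetric])
  have "H \<omega> j k = q" using jk by (simp add: H_upper q_def)
  then have kj: "H \<omega> k j = quat_conj q" using hermitianD[OF hermitian_H[OF om], of j n k] jk by simp
  have "inner qone (qmul (quat_conj q) u) = inner u q"
    using inner_qmul_left[of q qone u] by (simp add: inner_commute)
  then have "ip n v (mv n (H \<omega>) v) = d j \<omega> + d k \<omega> + 2 * norm q"
    unfolding ip mv H_diag[OF om] kj \<open>H \<omega> j k = q\<close>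
    using u by (simp add: qmul.scaleR_left inner_add_right power2_norm_eq_inner[symmetric])
  then show ?thesis using lam_ge[OF om, of n v] jk \<open>ip n v v = 2\<close> by (simp add: q_def)
qed

context
  fixes C :: real
  assumes C: "0 < C" and bdd: "AE \<omega> in M. \<forall>\<^sub>F n in sequentially. lam n \<omega> \<le> C"
begin

lemma diag_integrable: "integrable M (\<lambda>\<omega>. (max (d 0 \<omega>) 0)\<^sup>2)"
proof -
  \<comment> \<open>Entry \<open>i\<close> appears for the first time in the corner of size
    \<open>i + 1\<close>.\<close>
  define E where "E i = {\<omega> \<in> space M. d i \<omega> \<in> {C * sqrt (real i + 1) <..}}" for i
  define f where "f \<omega> = (max (d 0 \<omega>) 0 / C)\<^sup>2" for \<omega>
  have fm: "f \<in> borel_measurable M" unfolding f_def[abs_def] by measurable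
  have "\<exists>B. \<forall>J. finite J \<longrightarrow> J \<subseteq> UNIV \<longrightarrow> (\<Sum>i\<in>J. prob (E i)) \<le> B"
  proof (rule bounded_prob_sums[where \<rho> = "\<lambda>i. i" and c = 1])
    show "E i \<in> events" for i unfolding E_def by measurable
    show "prob (E i \<inter> E j) \<le> 1 * prob (E i) * prob (E j)" if "i \<noteq> j" for i j
    proof -
      have "E i \<inter> E j = {\<omega> \<in> space M. d i \<omega> \<in> {C * sqrt (real i + 1) <..} \<and> d j \<omega> \<in> {C * sqrt (real j + 1) <..}}"
        by (auto simp: E_def)
      then show ?thesis
        using prob_diag_two[OF that, of "{C * sqrt (real i + 1) <..}" "{C * sqrt (real j + 1) <..}"] unfolding E_def by simp
    qed
    show "AE \<omega> in M. \<exists>N. \<forall>i\<in>UNIV. N \<le> i \<longrightarrow> \<omega> \<notin> E i"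
      using bdd AE_space
    proof eventually_elim
      case (elim \<omega>)
      then obtain N where N: "\<And>n. N \<le> n \<Longrightarrow> lam n \<omega> \<le> C" by (auto simp: eventually_sequentially)
      have "\<omega> \<notin> E i" if "N \<le> i" for i
      proof -
        have "d i \<omega> \<le> lam (Suc i) \<omega> * sqrt (Suc i)" using elim by (intro d_le_lam) auto
        also have "\<dots> \<le> C * sqrt (Suc i)" using N[of "Suc i"] that by (intro mult_right_mono) auto
        finally show ?thesis by (simp add: E_def add.commute)
      qed
      then show ?case by blast
    qed
  qed auto
  then obtain B where B: "\<And>J. finite J \<Longrightarrow> (\<Sum>i\<in>J. prob (E i)) \<le> B" by auto
  have PE: "prob (E i) = prob {\<omega> \<in> space M. real (Suc i) < f \<omega>}" for i
  proof -
    have "C * sqrt (real i + 1) < y \<longleftrightarrow> real (Suc i) < (max y 0 / C)\<^sup>2" for y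
    proof -
      have "real (Suc i) < (max y 0 / C)\<^sup>2 \<longleftrightarrow> sqrt (real (Suc i)) < max y 0 / C"
        using C real_sqrt_less_iff[of "real (Suc i)" "(max y 0 / C)\<^sup>2"] by simp
      also have "\<dots> \<longleftrightarrow> C * sqrt (real i + 1) < max y 0" using C by (simp add: pos_less_divide_eq mult.commute add.commute)
      also have "\<dots> \<longleftrightarrow> C * sqrt (real i + 1) < y"
      proof -
        have "0 \<le> C * sqrt (real i + 1)" using C by simp
        then show ?thesis by linarith
      qed
      finally show ?thesis by simp
    qed
    then have "{\<omega> \<in> space M. d 0 \<omega> \<in> {C * sqrt (real i + 1) <..}} = {\<omega> \<in> space M. real (Suc i) < f \<omega>}" by (simp add: f_def)
    then show ?thesis using prob_diag[of "{C * sqrt (real i + 1) <..}" i] by (simp add: E_def)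
  qed
  have "summable (\<lambda>i. prob {\<omega> \<in> space M. real (Suc i) < f \<omega>})"
    unfolding PE[symmetric] by (rule summableI_nonneg_bounded[of _ B]) (auto intro: B)
  then have sm: "summable (\<lambda>k. 1 * prob {\<omega> \<in> space M. real k < f \<omega>})"
    using summable_Suc_iff[of "\<lambda>k. prob {\<omega> \<in> space M. real k < f \<omega>}"] by simp
  have "integrable M f"
  proof (rule integrable_tail[OF fm fm _ _ sm])
    show "0 \<le> f \<omega> \<and> f \<omega> \<le> (\<Sum>k<nat \<lceil>f \<omega>\<rceil>. 1)" for \<omega>
    proof -
      have "0 \<le> f \<omega>" by (simp add: f_def)
      then show ?thesis by simp
    qed
  qed simp
  then have "integrable M (\<lambda>\<omega>. C\<^sup>2 * f \<omega>)" by simp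
  then show ?thesis using C by (simp add: f_def power_divide)
qed

text \<open>
  A large entry makes the largest eigenvalue large only if both diagonal entries are not too
  negative. Restricting to this event makes the events for edges with a common vertex dependent,
  but only at the cost of a constant factor in the correlation inequality.
\<close>

lemma fourth_integrable: "integrable M (\<lambda>\<omega>. norm (X (0, 1) \<omega>) ^ 4)"
proof -
  obtain K where K: "0 \<le> K" "prob {\<omega> \<in> space M. d 0 \<omega> < - K} < 1" using prob_diag_below[of 1] by auto
  define g where "g = prob {\<omega> \<in> space M. d 0 \<omega> \<in> {- K..}}"
  have g: "0 < g" "g \<le> 1"
  proof -
    have "g = 1 - prob {\<omega> \<in> space M. d 0 \<omega> < - K}"
    proof -
      have "{\<omega> \<in> space M. d 0 \<omega> \<in> {- K..}} = space M - {\<omega> \<in> space M. d 0 \<omega> < - K}" by auto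
      then show ?thesis unfolding g_def by (simp add: prob_compl)
    qed
    then show "0 < g" using K by simp
  qed (simp add: g_def)
  \<comment> \<open>On the event below both diagonal entries are at least \<open>- K\<close>, so
    \<open>edge_le_lam\<close> bounds the entry by \<open>C * sqrt n + K\<close>, which is at most
    \<open>L * sqrt n\<close>.\<close>
  define L where "L = C + K"
  have L: "0 < L" using C K by (simp add: L_def)
  define T :: "nat \<Rightarrow> quaternion set" where "T k = {q. L * sqrt (real k + 1) < norm q}" for k
  have Tb: "T k \<in> sets borel" for k unfolding T_def by measurable
  define P where "P k = prob {\<omega> \<in> space M. X (0, 1) \<omega> \<in> T k}" for k
  define I where "I = {e :: nat \<times> nat. fst e < snd e}"
  define E where "E e = {\<omega> \<in> space M. d (fst e) \<omega> \<in> {- K..} \<and> d (snd e) \<omega> \<in> {- K..} \<and> X e \<omega> \<in> T (snd e)}" for e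
  have PE: "prob (E e) = g\<^sup>2 * P (snd e)" if "e \<in> I" for e
    using prob_edge_and_diag[of "fst e" "snd e" "{- K..}" "T (snd e)"] that Tb by (simp add: E_def I_def P_def g_def)
  have Xm: "X e \<in> borel_measurable M" if "e \<in> I" for e using that X.X_measurable' by (simp add: I_def)
  have XT: "{\<omega> \<in> space M. X e \<omega> \<in> T k} \<in> events" if "e \<in> I" for e k
    using measurable_sets[OF Xm[OF that] Tb[of k]] by (simp add: vimage_def Int_def conj_commute)
  have "\<exists>B. \<forall>J. finite J \<longrightarrow> J \<subseteq> I \<longrightarrow> (\<Sum>e\<in>J. prob (E e)) \<le> B"
  proof (rule bounded_prob_sums[where \<rho> = snd and c = "1 / g ^ 4"])
    \<comment> \<open>Each event has the probability of its large entry times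
      \<open>g\<^sup>2\<close>. Dropping the diagonal conditions from an intersection loses
      \<open>g ^ 4\<close>, after which distinct edges are independent.\<close>
    show "1 \<le> 1 / g ^ 4" using g by (simp add: power_le_one)
    show "countable I" by simp
    show "finite {e \<in> I. snd e < m}" for m
      by (rule finite_subset[of _ "{..<m} \<times> {..<m}"]) (auto simp: I_def)
    show Ee: "E e \<in> events" if "e \<in> I" for e
    proof -
      have "E e = {\<omega> \<in> space M. d (fst e) \<omega> \<in> {- K..}} \<inter> {\<omega> \<in> space M. d (snd e) \<omega> \<in> {- K..}} \<inter> {\<omega> \<in> space M. X e \<omega> \<in> T (snd e)}"
        by (auto simp: E_def)
      moreover have "{\<omega> \<in> space M. d i \<omega> \<in> {- K..}} \<in> events" for i by measurable
      ultimately show ?thesis using XT[OF that, of "snd e"] by (simp only: sets.Int)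
    qed
    show "prob (E e \<inter> E f) \<le> 1 / g ^ 4 * prob (E e) * prob (E f)" if "e \<in> I" "f \<in> I" "e \<noteq> f" for e f
    proof -
      have "prob (E e \<inter> E f) \<le> prob {\<omega> \<in> space M. X e \<omega> \<in> T (snd e) \<and> X f \<omega> \<in> T (snd f)}"
      proof (rule finite_measure_mono)
        have "{\<omega> \<in> space M. X e \<omega> \<in> T (snd e) \<and> X f \<omega> \<in> T (snd f)}
            = {\<omega> \<in> space M. X e \<omega> \<in> T (snd e)} \<inter> {\<omega> \<in> space M. X f \<omega> \<in> T (snd f)}" by auto
        then show "{\<omega> \<in> space M. X e \<omega> \<in> T (snd e) \<and> X f \<omega> \<in> T (snd f)} \<in> events"
          using XT[OF that(1)] XT[OF that(2)] by simp
      qed (auto simp: E_def)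
      also have "\<dots> = P (snd e) * P (snd f)"
        unfolding P_def using that Tb by (intro X.prob_two_edges) (simp_all add: I_def)
      also have "\<dots> = 1 / g ^ 4 * prob (E e) * prob (E f)"
        unfolding PE[OF that(1)] PE[OF that(2)] using g by (simp add: power2_eq_square power4_eq_xxxx)
      finally show ?thesis .
    qed
    show "AE \<omega> in M. \<exists>N. \<forall>e\<in>I. N \<le> snd e \<longrightarrow> \<omega> \<notin> E e"
      using bdd AE_space
    proof eventually_elim
      case (elim \<omega>)
      then obtain N where N: "\<And>n. N \<le> n \<Longrightarrow> lam n \<omega> \<le> C" by (auto simp: eventually_sequentially)
      have "\<omega> \<notin> E e" if e: "e \<in> I" "N \<le> snd e" for e
      proof
        assume "\<omega> \<in> E e"
        then have *: "- K \<le> d (fst e) \<omega>" "- K \<le> d (snd e) \<omega>" "L * sqrt (real (snd e) + 1) < norm (X e \<omega>)"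
          by (auto simp: E_def T_def)
        define n where "n = Suc (snd e)"
        have "d (fst e) \<omega> + d (snd e) \<omega> + 2 * norm (X (fst e, snd e) \<omega>) \<le> 2 * (lam n \<omega> * sqrt n)"
          using e elim(2) by (intro edge_le_lam) (auto simp: I_def n_def)
        moreover have "lam n \<omega> * sqrt n \<le> C * sqrt n" using N[of n] e by (intro mult_right_mono) (auto simp: n_def)
        moreover have "K * 1 \<le> K * sqrt n" using K by (intro mult_left_mono) (auto simp: n_def)
        moreover have "L * sqrt n < norm (X e \<omega>)" using *(3) by (simp add: n_def add.commute)
        moreover have "L * sqrt n = C * sqrt n + K * sqrt n" by (simp add: L_def algebra_simps)
        ultimately show False using *(1,2) unfolding prod.collapse by linarith
      qed
      then show ?case by blast
    qed
  qed
  then obtain B where B: "\<And>J. finite J \<Longrightarrow> J \<subseteq> I \<Longrightarrow> (\<Sum>e\<in>J. prob (E e)) \<le> B" by blast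
  define f where "f \<omega> = (norm (X (0, 1) \<omega>) / L)\<^sup>2" for \<omega>
  have fm: "f \<in> borel_measurable M" unfolding f_def[abs_def] by measurable
  have Pf: "P k = prob {\<omega> \<in> space M. real (Suc k) < f \<omega>}" for k
  proof -
    have "q \<in> T k \<longleftrightarrow> real (Suc k) < (norm q / L)\<^sup>2" for q
    proof -
      have "real (Suc k) < (norm q / L)\<^sup>2 \<longleftrightarrow> sqrt (real (Suc k)) < norm q / L"
        using L real_sqrt_less_iff[of "real (Suc k)" "(norm q / L)\<^sup>2"] by simp
      then show ?thesis using L by (simp add: T_def pos_less_divide_eq mult.commute add.commute)
    qed
    then show ?thesis by (simp only: P_def f_def)
  qed
  \<comment> \<open>There are \<open>k\<close> edges with larger endpoint \<open>k\<close>. The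
    weight \<open>k\<close> is what turns a tail series for the squared norm into a fourth
    moment.\<close>
  have "summable (\<lambda>k. real k * P k)"
  proof (rule summableI_nonneg_bounded)
    fix m :: nat
    define J where "J = (SIGMA k:{..<m}. {..<k})"
    have J: "(\<lambda>(k, j). (j, k)) ` J \<subseteq> I" "finite J" by (auto simp: J_def I_def)
    have inj: "inj_on (\<lambda>(k, j). (j, k)) J" by (auto simp: inj_on_def)
    have "(\<Sum>e\<in>(\<lambda>(k, j). (j, k)) ` J. prob (E e)) = (\<Sum>(k, j)\<in>J. g\<^sup>2 * P k)"
      unfolding sum.reindex[OF inj] by (intro sum.cong refl) (auto simp: PE J_def I_def)
    also have "\<dots> = (\<Sum>k<m. \<Sum>j<k. g\<^sup>2 * P k)" unfolding J_def by (subst sum.Sigma) auto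
    also have "\<dots> = g\<^sup>2 * (\<Sum>k<m. real k * P k)" by (simp add: sum_distrib_left mult.left_commute)
    finally have "g\<^sup>2 * (\<Sum>k<m. real k * P k) \<le> B" using B[OF _ J(1)] J(2) by simp
    then show "(\<Sum>k<m. real k * P k) \<le> B / g\<^sup>2" using g by (simp add: pos_le_divide_eq mult.commute)
  qed (simp add: P_def)
  then have "summable (\<lambda>k. 2 * (real k * P k))" by simp
  then have "summable (\<lambda>k. real (Suc k) * P k)"
  proof (rule summable_comparison_test_ev[rotated])
    show "\<forall>\<^sub>F k in sequentially. norm (real (Suc k) * P k) \<le> 2 * (real k * P k)"
      using eventually_gt_at_top[of 0]
    proof eventually_elim
      case (elim k)
      have "real (Suc k) * P k \<le> (2 * real k) * P k" using elim by (intro mult_right_mono) (auto simp: P_def)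
      then show ?case by (simp add: P_def)
    qed
  qed
  then have "summable (\<lambda>k. real k * prob {\<omega> \<in> space M. real k < f \<omega>})"
    unfolding Pf by (subst (asm) summable_Suc_iff[where f = "\<lambda>k. real k * prob {\<omega> \<in> space M. real k < f \<omega>}"])
  then have "integrable M (\<lambda>\<omega>. (f \<omega>)\<^sup>2)"
    by (intro integrable_square_tail fm) (auto simp: f_def)
  then have "integrable M (\<lambda>\<omega>. L ^ 4 * (f \<omega>)\<^sup>2)" by simp
  then show ?thesis using L by (simp add: f_def power_divide power_mult[symmetric])
qed

end

end

section \<open>Necessity of the condition on the mean\<close>

context wigner
begin

context
  fixes C :: real
  assumes C: "0 < C" and bdd: "AE \<omega> in M. \<forall>\<^sub>F n in sequentially. lam n \<omega> \<le> C"
    and int1: "integrable M (X (0, 1))" and fourth: "integrable M (\<lambda>\<omega>. norm (X (0, 1) \<omega>) ^ 4)"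
begin

text \<open>Randomness is eliminated by fixing one outcome. What remains is a deterministic
  inequality: on vectors supported in \<open>G\<close>, at least half of all indices, the form of
  the mean grows only like \<open>k\<close>, the square root of the dimension.\<close>

lemma exists_good_outcome:
  assumes mean: "expectation (X (0, 1)) = a *\<^sub>R qone + u"
  shows "\<exists>G B K. \<forall>\<^sub>F k in sequentially. real (k\<^sup>2) \<le> 2 * card (G \<inter> {..<k\<^sup>2}) \<and>
    (\<forall>v. (\<forall>i<k\<^sup>2. v i = 0 \<or> i \<in> G) \<longrightarrow>
      ip (k\<^sup>2) v (mv (k\<^sup>2) (hm (\<lambda>_. u)) v) + a * (norm (\<Sum>i<k\<^sup>2. v i))\<^sup>2 \<le> (B * real k + K + a) * ip (k\<^sup>2) v v)"
proof -
  note c = X.iid_centred[OF int1 fourth mean]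
  interpret Y: iid_quat_array M "\<lambda>e \<omega>. X e \<omega> - (a *\<^sub>R qone + u)" by (rule c(1))
  define s where "s = sqrt (expectation (\<lambda>\<omega>. (norm (X (0, 1) \<omega> - (a *\<^sub>R qone + u)))\<^sup>2)) + 1"
  have E0: "0 \<le> expectation (\<lambda>\<omega>. (norm (X (0, 1) \<omega> - (a *\<^sub>R qone + u)))\<^sup>2)" by (intro integral_nonneg_AE) simp
  then have s: "0 < s" unfolding s_def by (intro add_nonneg_pos) auto
  have "expectation (\<lambda>\<omega>. (norm (X (0, 1) \<omega> - (a *\<^sub>R qone + u)))\<^sup>2)
      = (sqrt (expectation (\<lambda>\<omega>. (norm (X (0, 1) \<omega> - (a *\<^sub>R qone + u)))\<^sup>2)))\<^sup>2"
    using E0 by simp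
  also have "\<dots> \<le> s\<^sup>2" unfolding s_def using E0 by (intro power_mono) auto
  finally have op: "AE \<omega> in M. \<forall>\<^sub>F n in sequentially. op_bound n (Y.W \<omega>) ((2 * s + 1) * sqrt n)"
    using s by (intro Y.AE_op_bound c(2-4)) auto
  obtain K where K: "0 \<le> K" "AE \<omega> in M. \<forall>\<^sub>F k in sequentially. card {i. i < k\<^sup>2 \<and> d i \<omega> < - K} \<le> 1 / 2 * real (k\<^sup>2)"
    using AE_bad_fraction[of "1 / 2"] by auto
  have sqf: "filterlim (\<lambda>k. k\<^sup>2) sequentially sequentially"
    by (intro filterlim_subseq) (auto simp: strict_mono_def power_strict_mono)
  define B where "B = 2 * s + 1 + C"
  define Good where "Good \<omega> k \<longleftrightarrow> real (k\<^sup>2) \<le> 2 * card ({i. - K \<le> d i \<omega>} \<inter> {..<k\<^sup>2}) \<and>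
    (\<forall>v. (\<forall>i<k\<^sup>2. v i = 0 \<or> i \<in> {i. - K \<le> d i \<omega>}) \<longrightarrow>
      ip (k\<^sup>2) v (mv (k\<^sup>2) (hm (\<lambda>_. u)) v) + a * (norm (\<Sum>i<k\<^sup>2. v i))\<^sup>2 \<le> (B * real k + K + a) * ip (k\<^sup>2) v v)" for \<omega> k
  have "AE \<omega> in M. \<forall>\<^sub>F k in sequentially. Good \<omega> k"
    using op K(2) bdd AE_space
  proof eventually_elim
    case (elim \<omega>)
    note om = elim(4)
    have eq: "H \<omega> = pmat (\<lambda>i j. Y.W \<omega> i j + hm (\<lambda>_. u) i j) (\<lambda>i. d i \<omega>) a"
    proof (intro ext)
      fix i j
      have "hm (\<lambda>e. X e \<omega> - a *\<^sub>R qone) = (\<lambda>i j. Y.W \<omega> i j + hm (\<lambda>_. u) i j)"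
        by (intro ext) (simp add: hm_add[symmetric] algebra_simps)
      then show "H \<omega> i j = pmat (\<lambda>i j. Y.W \<omega> i j + hm (\<lambda>_. u) i j) (\<lambda>i. d i \<omega>) a i j"
        using H_eq_pmat[OF om, of i j a] by simp
    qed
    show ?case
      using eventually_compose_filterlim[OF elim(1) sqf] elim(2) eventually_compose_filterlim[OF elim(3) sqf] eventually_gt_at_top[of 0]
    proof eventually_elim
      case (elim k)
      define n where "n = k\<^sup>2"
      have n: "0 < n" "sqrt (real n) = real k" using elim(4) by (simp_all add: n_def)
      have "{i. - K \<le> d i \<omega>} \<inter> {..<n} = {..<n} - {i. i < n \<and> d i \<omega> < - K}" by auto
      then have "card ({i. - K \<le> d i \<omega>} \<inter> {..<n}) = n - card {i. i < n \<and> d i \<omega> < - K}"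
        by (simp add: card_Diff_subset subset_iff)
      then have "real n \<le> 2 * card ({i. - K \<le> d i \<omega>} \<inter> {..<n})"
        using elim(2) unfolding n_def[symmetric] by linarith
      moreover have "ip n v (mv n (hm (\<lambda>_. u)) v) + a * (norm (\<Sum>i<n. v i))\<^sup>2 \<le> (B * real k + K + a) * ip n v v"
        if v: "\<forall>i<n. v i = 0 \<or> i \<in> {i. - K \<le> d i \<omega>}" for v
      proof -
        have "lam n \<omega> * sqrt n * ip n v v \<le> C * sqrt n * ip n v v"
          using elim(3) unfolding n_def[symmetric] by (intro mult_right_mono) auto
        then have "ip n v (mv n (H \<omega>) v) \<le> C * real k * ip n v v"
          using lam_ge[OF om n(1), of v] n(2) by simp
        moreover have "ip n v (mv n (H \<omega>) v) = ip n v (mv n (Y.W \<omega>) v) + ip n v (mv n (hm (\<lambda>_. u)) v)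
            + (\<Sum>i<n. (d i \<omega> - a) * (norm (v i))\<^sup>2) + a * (norm (\<Sum>i<n. v i))\<^sup>2"
          unfolding eq ip_pmat mv_add_mat by (simp add: ip_add_right)
        moreover have "- ((2 * s + 1) * real k * ip n v v) \<le> ip n v (mv n (Y.W \<omega>) v)"
          using op_bound_ip[OF elim(1)[folded n_def], of v] unfolding n(2) by linarith
        moreover have "(\<Sum>i<n. (- K - a) * (norm (v i))\<^sup>2) \<le> (\<Sum>i<n. (d i \<omega> - a) * (norm (v i))\<^sup>2)"
        proof (intro sum_mono)
          fix i assume "i \<in> {..<n}"
          then have "v i = 0 \<or> - K \<le> d i \<omega>" using v by blast
          then show "(- K - a) * (norm (v i))\<^sup>2 \<le> (d i \<omega> - a) * (norm (v i))\<^sup>2"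
            by (elim disjE) (simp_all add: mult_right_mono)
        qed
        moreover have "(\<Sum>i<n. (- K - a) * (norm (v i))\<^sup>2) = (- K - a) * ip n v v"
          by (simp add: ip_self sum_distrib_left)
        moreover have "(B * real k + K + a) * ip n v v
            = (2 * s + 1) * real k * ip n v v + C * real k * ip n v v - (- K - a) * ip n v v"
          by (simp add: B_def algebra_simps)
        ultimately show ?thesis by linarith
      qed
      ultimately show ?case unfolding Good_def n_def[symmetric] by blast
    qed
  qed
  \<comment> \<open>An almost sure property of a probability space holds for at least one
    outcome.\<close>
  then have "\<exists>\<omega>. \<forall>\<^sub>F k in sequentially. Good \<omega> k"
    by (metis (mono_tags, lifting) AE_E3 AE_False eventually_mono)
  then show ?thesis unfolding Good_def by blast
qed

text \<open>The real and the imaginary part of the mean are tested separately: constant vectors do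
  not see the imaginary part, and vectors with zero sum do not see the real part. In both cases the
  form per unit mass is of order \<open>k\<^sup>2\<close>, against the permitted order
  \<open>k\<close>.\<close>

lemma mean_necessary: "\<exists>a\<le>0. expectation (X (0, 1)) = a *\<^sub>R qone"
proof -
  define a where "a = inner qone (expectation (X (0, 1)))"
  define u where "u = expectation (X (0, 1)) - a *\<^sub>R qone"
  have mean: "expectation (X (0, 1)) = a *\<^sub>R qone + u" by (simp add: u_def)
  have u: "inner qone u = 0" by (simp add: u_def a_def inner_diff_right power2_norm_eq_inner[symmetric])
  obtain G B K where good: "\<forall>\<^sub>F k in sequentially. real (k\<^sup>2) \<le> 2 * card (G \<inter> {..<k\<^sup>2}) \<and>
    (\<forall>v. (\<forall>i<k\<^sup>2. v i = 0 \<or> i \<in> G) \<longrightarrow>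
      ip (k\<^sup>2) v (mv (k\<^sup>2) (hm (\<lambda>_. u)) v) + a * (norm (\<Sum>i<k\<^sup>2. v i))\<^sup>2 \<le> (B * real k + K + a) * ip (k\<^sup>2) v v)"
    using exists_good_outcome[OF mean] by blast
  have "a \<le> 0"
  proof (rule ccontr)
    assume "\<not> a \<le> 0"
    then have "0 < a" by simp
    then have "\<forall>\<^sub>F k in sequentially. B * real k + K + a < a * (real k ^ 2 / 2)" by real_asymp
    then have "\<forall>\<^sub>F k in sequentially. False"
      using good eventually_gt_at_top[of 0]
    proof eventually_elim
      case (elim k)
      define v where "v i = (if i \<in> G then qone else 0)" for i :: nat
      define N where "N = card (G \<inter> {..<k\<^sup>2})"
      have N: "real k ^ 2 / 2 \<le> real N" using elim(2) by (simp add: N_def)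
      then have N0: "0 < real N" using elim(3) by (smt (verit) half_gt_zero of_nat_0_less_iff zero_less_power)
      have e: "inner qone (qmul u qone) = 0" using u by simp
      have "v j = (if j \<in> G then qone else 0)" if "0 \<le> j" "j < k\<^sup>2" for j by (simp add: v_def)
      note b = block_sums[where c = 0 and c' = "k\<^sup>2" and v = v and G = G and e = qone and u = u, OF le0 this e]
      have "(\<Sum>i<k\<^sup>2. v i) = real N *\<^sub>R qone" using b(1) by (simp add: N_def atLeast0LessThan)
      moreover have "ip (k\<^sup>2) v v = real N" using b(3) by (simp add: N_def atLeast0LessThan ip_self)
      moreover have "ip (k\<^sup>2) v (mv (k\<^sup>2) (hm (\<lambda>_. u)) v) = 0" unfolding ip_hm_const using b(2) by simp
      moreover have "\<forall>i<k\<^sup>2. v i = 0 \<or> i \<in> G" by (simp add: v_def)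
      ultimately have "a * (real N)\<^sup>2 \<le> (B * real k + K + a) * real N"
        using elim(2)[THEN conjunct2, rule_format, of v] by simp
      then have "a * real N \<le> B * real k + K + a" using N0 by (simp add: power2_eq_square)
      moreover have "a * (real k ^ 2 / 2) \<le> a * real N" using N \<open>0 < a\<close> by (intro mult_left_mono) auto
      ultimately show ?case using elim(1) by linarith
    qed
    then show False by simp
  qed
  moreover have "u = 0"
  proof (rule ccontr)
    assume u0: "u \<noteq> 0"
    then have "\<forall>\<^sub>F k in sequentially. B * real k + K + a < c * (real k ^ 2 / 8 - 1)" if "0 < c" for c
      using that by real_asymp
    from this[of "norm u"] have "\<forall>\<^sub>F k in sequentially. B * real k + K + a < norm u * (real k ^ 2 / 8 - 1)" using u0 by simp
    then have "\<forall>\<^sub>F k in sequentially. False"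
      using good eventually_gt_at_top[of 2]
    proof eventually_elim
      case (elim k)
      \<comment> \<open>At least half of the \<open>k\<^sup>2\<close> indices lie in
        \<open>G\<close>, and four blocks are needed. For \<open>k > 2\<close> the quotient is
        positive.\<close>
      define t where "t = k\<^sup>2 div 8"
      have "3\<^sup>2 \<le> k\<^sup>2" using elim(3) by (intro power_mono) auto
      then have t: "0 < t" "real k ^ 2 / 8 - 1 \<le> real t"
      proof -
        have "k\<^sup>2 < 8 * t + 8" unfolding t_def by presburger
        then have "real (k\<^sup>2) < real (8 * t + 8)" by (simp only: of_nat_less_iff)
        then show "real k ^ 2 / 8 - 1 \<le> real t" by simp
      qed (simp add: t_def div_greater_zero_iff)
      have "8 * t \<le> k\<^sup>2" by (simp add: t_def)
      moreover have "k\<^sup>2 \<le> 2 * card (G \<inter> {..<k\<^sup>2})" using elim(2) by linarith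
      ultimately have "4 * t \<le> card (G \<inter> {..<k\<^sup>2})" by linarith
      from rotating_vector[OF u u0 this] obtain v where v: "(\<Sum>i<k\<^sup>2. v i) = 0" "\<forall>i<k\<^sup>2. v i = 0 \<or> i \<in> G"
          "ip (k\<^sup>2) v v = 4 * real t" "ip (k\<^sup>2) v (mv (k\<^sup>2) (hm (\<lambda>_. u)) v) = 4 * norm u * (real t)\<^sup>2"
        by blast
      have "4 * norm u * (real t)\<^sup>2 \<le> (B * real k + K + a) * (4 * real t)"
        using elim(2)[THEN conjunct2, rule_format, of v] v by simp
      moreover have "4 * norm u * (real t)\<^sup>2 = (norm u * real t) * (4 * real t)" by (simp add: power2_eq_square)
      ultimately have "(norm u * real t) * (4 * real t) \<le> (B * real k + K + a) * (4 * real t)"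
        by (simp only:)
      then have "norm u * real t \<le> B * real k + K + a" using t by (simp add: mult_le_cancel_right)
      moreover have "norm u * (real k ^ 2 / 8 - 1) \<le> norm u * real t" using t by (intro mult_left_mono) auto
      ultimately show ?case using elim(1) by linarith
    qed
    then show False by simp
  qed
  ultimately show ?thesis using mean by auto
qed

end

text \<open>For the converse, convergence is first used only as boundedness, which gives the moment
  conditions. The other direction then identifies the limit as \<open>2 * \<sigma>\<close>, and
  uniqueness of limits gives the value of \<open>\<xi>\<close>.\<close>

lemma lam_tendsto_iff:
  "(AE \<omega> in M. (\<lambda>n. lam n \<omega>) \<longlonglongrightarrow> \<xi>) \<longleftrightarrow>
    integrable M (\<lambda>\<omega>. (max (d 0 \<omega>) 0)\<^sup>2) \<and>
    (integrable M (X (0, 1)) \<and> (\<exists>a\<le>0. expectation (X (0, 1)) = a *\<^sub>R qone)) \<and>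
    (\<exists>\<sigma>\<ge>0. integrable M (\<lambda>\<omega>. (norm (X (0, 1) \<omega> - expectation (X (0, 1))))\<^sup>2) \<and>
      expectation (\<lambda>\<omega>. (norm (X (0, 1) \<omega> - expectation (X (0, 1))))\<^sup>2) = \<sigma>\<^sup>2 \<and> \<xi> = 2 * \<sigma>) \<and>
    integrable M (\<lambda>\<omega>. norm (X (0, 1) \<omega>) ^ 4)" (is "?L = ?R")
proof
  assume ?R
  then obtain a \<sigma> where *: "integrable M (\<lambda>\<omega>. (max (d 0 \<omega>) 0)\<^sup>2)" "integrable M (X (0, 1))"
      "integrable M (\<lambda>\<omega>. norm (X (0, 1) \<omega>) ^ 4)" "a \<le> 0" "expectation (X (0, 1)) = a *\<^sub>R qone" "0 \<le> \<sigma>" "\<xi> = 2 * \<sigma>"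
      "expectation (\<lambda>\<omega>. (norm (X (0, 1) \<omega> - a *\<^sub>R qone))\<^sup>2) = \<sigma>\<^sup>2" by metis
  show ?L using AE_lam_tendsto[OF *(2,3,5,4,8,6,1)] *(7) by simp
next
  assume L: ?L
  define C where "C = \<bar>\<xi>\<bar> + 1"
  have C: "0 < C" "\<xi> < C" by (auto simp: C_def)
  have bdd: "AE \<omega> in M. \<forall>\<^sub>F n in sequentially. lam n \<omega> \<le> C"
    using L
  proof eventually_elim
    case (elim \<omega>)
    then have "\<forall>\<^sub>F n in sequentially. lam n \<omega> < C" using C(2) by (rule order_tendstoD)
    then show ?case by (auto elim: eventually_mono)
  qed
  note fourth = fourth_integrable[OF C(1) bdd] and diag = diag_integrable[OF C(1) bdd]
  have int1: "integrable M (X (0, 1))"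
  proof (rule Bochner_Integration.integrable_bound)
    show "integrable M (\<lambda>\<omega>. 1 + norm (X (0, 1) \<omega>) ^ 4)" using fourth by simp
    have "r \<le> 1 + r ^ 4" if "0 \<le> r" for r :: real
    proof (cases "r \<le> 1")
      case False
      then show ?thesis using power_increasing[of 1 4 r] by simp
    qed (simp add: add_increasing2)
    then show "AE \<omega> in M. norm (X (0, 1) \<omega>) \<le> norm (1 + norm (X (0, 1) \<omega>) ^ 4)" by (simp add: abs_of_nonneg)
  qed (rule X.X01_measurable)
  obtain a where a: "a \<le> 0" "expectation (X (0, 1)) = a *\<^sub>R qone"
    using mean_necessary[OF C(1) bdd int1 fourth] by blast
  define \<sigma> where "\<sigma> = sqrt (expectation (\<lambda>\<omega>. (norm (X (0, 1) \<omega> - a *\<^sub>R qone))\<^sup>2))"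
  have "0 \<le> expectation (\<lambda>\<omega>. (norm (X (0, 1) \<omega> - a *\<^sub>R qone))\<^sup>2)" by (intro integral_nonneg_AE) simp
  then have \<sigma>: "0 \<le> \<sigma>" "expectation (\<lambda>\<omega>. (norm (X (0, 1) \<omega> - a *\<^sub>R qone))\<^sup>2) = \<sigma>\<^sup>2" by (simp_all add: \<sigma>_def)
  have "AE \<omega> in M. (\<lambda>n. lam n \<omega>) \<longlonglongrightarrow> 2 * \<sigma>"
    by (rule AE_lam_tendsto[OF int1 fourth a(2,1) \<sigma>(2,1) diag])
  with L have "AE \<omega> in M. \<xi> = 2 * \<sigma>" by eventually_elim (rule LIMSEQ_unique)
  then have "\<xi> = 2 * \<sigma>" by simp
  moreover have "integrable M (\<lambda>\<omega>. (norm (X (0, 1) \<omega> - a *\<^sub>R qone))\<^sup>2)"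
  proof -
    note c = X.iid_centred[OF int1 fourth a(2)]
    interpret Y: iid_quat_array M "\<lambda>e \<omega>. X e \<omega> - a *\<^sub>R qone" by (rule c(1))
    show ?thesis by (rule Y.int2[OF c(2-4)])
  qed
  ultimately show ?R using diag int1 a \<sigma> fourth by auto
qed

end

lemma integrable_quaternion_iff:
  "integrable M (f :: _ \<Rightarrow> quaternion) \<longleftrightarrow> integrable M (\<lambda>\<omega>. re_part (f \<omega>)) \<and> integrable M (\<lambda>\<omega>. i_part (f \<omega>))
    \<and> integrable M (\<lambda>\<omega>. j_part (f \<omega>)) \<and> integrable M (\<lambda>\<omega>. k_part (f \<omega>))"
  "integrable M f \<Longrightarrow> integral\<^sup>L M f = quat_expectation M f"
proof -
  have p: "re_part q = inner q (1, 0, 0, 0)" "i_part q = inner q (0, 1, 0, 0)" "j_part q = inner q (0, 0, 1, 0)"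
    "k_part q = inner q (0, 0, 0, 1)"
    "q = re_part q *\<^sub>R (1, 0, 0, 0) + i_part q *\<^sub>R (0, 1, 0, 0) + j_part q *\<^sub>R (0, 0, 1, 0) + k_part q *\<^sub>R (0, 0, 0, 1)" for q
    by (cases q; simp add: quat_inner)+
  show "integrable M f \<longleftrightarrow> integrable M (\<lambda>\<omega>. re_part (f \<omega>)) \<and> integrable M (\<lambda>\<omega>. i_part (f \<omega>))
    \<and> integrable M (\<lambda>\<omega>. j_part (f \<omega>)) \<and> integrable M (\<lambda>\<omega>. k_part (f \<omega>))" (is "_ \<longleftrightarrow> ?R")
  proof
    assume "integrable M f"
    then show ?R unfolding p(1-4) by simp
  next
    assume R: ?R
    have "integrable M (\<lambda>\<omega>. re_part (f \<omega>) *\<^sub>R (1, 0, 0, 0 :: real) + i_part (f \<omega>) *\<^sub>R (0, 1, 0, 0)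
        + j_part (f \<omega>) *\<^sub>R (0, 0, 1, 0) + k_part (f \<omega>) *\<^sub>R (0, 0, 0, 1))"
      using R by (intro Bochner_Integration.integrable_add integrable_scaleR_left) auto
    then show "integrable M f"
      by (rule ssubst[of f, rotated]) (rule ext, rule p(5))
  qed
  assume f: "integrable M f"
  have "integral\<^sup>L M f = quat_expectation M f" if "\<And>b. inner (integral\<^sup>L M f) b = integral\<^sup>L M (\<lambda>\<omega>. inner (f \<omega>) b)"
    using p(5)[of "integral\<^sup>L M f"] unfolding p(1-4) that
    by (simp add: quat_expectation_def p(1-4)[symmetric])
  then show "integral\<^sup>L M f = quat_expectation M f" using f by simp
qed

text \<open>Existence of each expectation is expressed by \<open>integrable\<close>, because the
  Bochner integral of a function that is not integrable is 0 by convention. Measurability of the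
  entries is part of \<open>indep_vars\<close>, so \<open>distr\<close> is their law. The degenerate
  matrix for \<open>n = 0\<close> does not affect the limit.\<close>

theorem theorem2p1:
  fixes M :: "'w measure"
    and x :: "nat \<Rightarrow> nat \<Rightarrow> 'w \<Rightarrow> quaternion"
    and \<xi> :: real
  assumes "prob_space M"
    and self_dual: "\<And>j k \<omega>. 1 \<le> j \<Longrightarrow> 1 \<le> k \<Longrightarrow> \<omega> \<in> space M \<Longrightarrow>
           x k j \<omega> = quat_conj (x j k \<omega>)"
    and diag_real: "\<And>j \<omega>. 1 \<le> j \<Longrightarrow> \<omega> \<in> space M \<Longrightarrow> x j j \<omega> = (re_part (x j j \<omega>), 0, 0, 0)"
    and indep: "prob_space.indep_vars M (\<lambda>_. borel) (\<lambda>(j, k). x j k) {(j, k). 1 \<le> j \<and> j \<le> k}"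
    and diag_ident: "\<And>j. 1 \<le> j \<Longrightarrow> distr M borel (x j j) = distr M borel (x 1 1)"
    and offdiag_ident: "\<And>j k. 1 \<le> j \<Longrightarrow> j < k \<Longrightarrow> distr M borel (x j k) = distr M borel (x 1 2)"
  shows "(AE \<omega> in M.
            (\<lambda>n. largest_eigenvalue
                   (complex_of_real (1 / sqrt (real n)) \<cdot>\<^sub>m quat_block_mat (\<lambda>j k. x j k \<omega>) n))
            \<longlonglongrightarrow> \<xi>)
     \<longleftrightarrow>
         integrable M (\<lambda>\<omega>. (max (re_part (x 1 1 \<omega>)) 0)\<^sup>2)
       \<and> (integrable M (\<lambda>\<omega>. re_part (x 1 2 \<omega>)) \<and> integrable M (\<lambda>\<omega>. i_part (x 1 2 \<omega>))
          \<and> integrable M (\<lambda>\<omega>. j_part (x 1 2 \<omega>)) \<and> integrable M (\<lambda>\<omega>. k_part (x 1 2 \<omega>))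
          \<and> integral\<^sup>L M (\<lambda>\<omega>. re_part (x 1 2 \<omega>)) \<le> 0
          \<and> integral\<^sup>L M (\<lambda>\<omega>. i_part (x 1 2 \<omega>)) = 0
          \<and> integral\<^sup>L M (\<lambda>\<omega>. j_part (x 1 2 \<omega>)) = 0
          \<and> integral\<^sup>L M (\<lambda>\<omega>. k_part (x 1 2 \<omega>)) = 0)
       \<and> (\<exists>\<sigma>\<ge>0.
            integrable M (\<lambda>\<omega>. (quat_norm (x 1 2 \<omega> - quat_expectation M (x 1 2)))\<^sup>2)
          \<and> integral\<^sup>L M (\<lambda>\<omega>. (quat_norm (x 1 2 \<omega> - quat_expectation M (x 1 2)))\<^sup>2) = \<sigma>\<^sup>2
          \<and> \<xi> = 2 * \<sigma>)
       \<and> integrable M (\<lambda>\<omega>. quat_norm (x 1 2 \<omega>) ^ 4)"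
proof -
  interpret wigner M x
    using assms by (intro wigner.intro wigner_axioms.intro)
  have d0: "d 0 = (\<lambda>\<omega>. re_part (x 1 1 \<omega>))" by (simp add: d_def[abs_def])
  have mean: "(\<exists>a\<le>0. quat_expectation M (x 1 2) = a *\<^sub>R qone) \<longleftrightarrow>
      expectation (\<lambda>\<omega>. re_part (x 1 2 \<omega>)) \<le> 0 \<and> expectation (\<lambda>\<omega>. i_part (x 1 2 \<omega>)) = 0
      \<and> expectation (\<lambda>\<omega>. j_part (x 1 2 \<omega>)) = 0 \<and> expectation (\<lambda>\<omega>. k_part (x 1 2 \<omega>)) = 0"
    by (auto simp: quat_expectation_def qone_def)
  have E: "expectation (x 1 2) = quat_expectation M (x 1 2)" if "integrable M (x 1 2)"
    by (rule integrable_quaternion_iff(2)[OF that])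
  show ?thesis
    using lam_tendsto_iff[of \<xi>, unfolded X01 d0] unfolding lam_def[abs_def] quat_norm_eq
    using E mean integrable_quaternion_iff(1)[of M "x 1 2"] by (auto cong: conj_cong)
qed

end
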